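(* Let $f,g,h$ be linearly independent holomorphic modular forms of the same weight $k$ on $\mathrm{SL}(2,\mathbb{Z})$, and let $w(z)$, $u_{1;\lambda,\mu},u_{2;\lambda,\mu}$, $p_j$, and $m^{(k)}_{z_j},m^{(k)}_{\mathrm i},m^{(k)}_\rho,m^{(k)}_\infty$ be as defined in the context. Then the functions $(v_{1;\lambda,\mu}(w),v_{2;\lambda,\mu}(w))$ defined by $$v_{k;\lambda,\mu}(w(z))=u_{k;\lambda,\mu}(z)-2\ln|w'(z)|,\qquad z\in\mathbb{H},\ k=1,2,$$ form a two-parameter family of solutions of the $\mathrm{SU}(3)$ Toda system $$\begin{cases}\Delta v_1+2e^{v_1}-e^{v_2}=4\pi\frac{m_{\mathrm i}^{(1)}-1}{2}\delta_1+4\pi\frac{m_\rho^{(1)}-2}{3}\delta_0+4\pi\sum_{j=1}^m m_{z_j}^{(1)}\delta_{p_j}&\text{in }\mathbb{R}^2,\\[2pt] \Delta v_2+2e^{v_2}-e^{v_1}=4\pi\frac{m_{\mathrm i}^{(2)}-1}{2}\delta_1+4\pi\frac{m_\rho^{(2)}-2}{3}\delta_0+4\pi\sum_{j=1}^m m_{z_j}^{(2)}\delta_{p_j}&\text{in }\mathbb{R}^2,\\[2pt] v_k(w)=-2\big(m_\infty^{(k)}+1\big)\ln|w|+O(1)\ \text{ as }|w|\to\infty,\ k=1,2,\end{cases}$$ where $\lambda,\mu>0$ can be arbitrary.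
   Context: $\mathbb{H}$ is the upper half plane, $\mathrm i=\sqrt{-1}$, $\rho=(-1+\sqrt3\,\mathrm i)/2$, $\mathbb{R}^2=\mathbb{C}$ with complex coordinate $w=x_1+\mathrm i x_2$, $\Delta=\partial_{x_1}^2+\partial_{x_2}^2$ is the Laplacian, $\delta_p$ is the Dirac measure at $p$. (In subscripts/superscripts of $v,u,U,m$ the index $k\in\{1,2\}$ is unrelated to the weight.) Let $W_{f,g,h}=\det\begin{pmatrix} f&f'&f''\\ g&g'&g''\\ h&h'&h''\end{pmatrix}$ and $y_1=f/\sqrt[3]{W_{f,g,h}}$, $y_2=g/\sqrt[3]{W_{f,g,h}}$, $y_3=h/\sqrt[3]{W_{f,g,h}}$. These span the solutions of an equation $y'''+Q_2(z)y'+Q_3(z)y=0$ on $\mathbb{H}$ with $Q_2$ and $Q_3-\frac12Q_2'$ meromorphic modular forms of weight 4 and 6 on $\mathrm{SL}(2,\mathbb{Z})$. Let $\mathcal S=\{z_1,\dots,z_m,\mathrm i,\rho\}$ denote its set of singular points in $\mathbb{H}$ modulo $\mathrm{SL}(2,\mathbb{Z})$ ($z_1,\dots,z_m$ pairwise inequivalent and non-elliptic). For $z\in\mathcal S$ let $\kappa_z^{(1)}<\kappa_z^{(2)}<\kappa_z^{(3)}$ be the local exponents at $z$ (the roots of the indicial equation), and $m_z^{(j)}=\kappa_z^{(j+1)}-\kappa_z^{(j)}-1\in\mathbb{Z}_{\ge0}$, $j=1,2$. Let $\kappa_\infty^{(1)}<\kappa_\infty^{(2)}<\kappa_\infty^{(3)}$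 be the local exponents at the cusp $\infty$ in the variable $q=e^{2\pi \mathrm i z}$ (the roots of $\kappa^3+(2\pi \mathrm i)^{-2}Q_2(\infty)\kappa+(2\pi \mathrm i)^{-3}Q_3(\infty)=0$), and $m_\infty^{(j)}=\kappa_\infty^{(j+1)}-\kappa_\infty^{(j)}$, $j=1,2$. For $\lambda,\mu>0$ define, with $W(y_i,y_j)=y_i'y_j-y_j'y_i$, $$e^{-U_{1;\lambda,\mu}}=\tfrac14\big(\lambda^2\mu^{-1}|y_1|^2+\mu^2\lambda^{-1}|y_2|^2+\lambda^{-1}\mu^{-1}|y_3|^2\big),$$ $$e^{-U_{2;\lambda,\mu}}=\tfrac14\big(\lambda\mu|W(y_1,y_2)|^2+\lambda^{-2}\mu|W(y_2,y_3)|^2+\lambda\mu^{-2}|W(y_3,y_1)|^2\big),$$ $$(u_{1;\lambda,\mu},u_{2;\lambda,\mu})=(2U_{1;\lambda,\mu}-U_{2;\lambda,\mu},\;2U_{2;\lambda,\mu}-U_{1;\lambda,\mu}).$$ Let $w(z)=\frac{E_4(z)^3}{E_4(z)^3-E_6(z)^2}$, with $E_4,E_6$ the normalized Eisenstein series of weights 4 and 6; it is a surjective modular function $\mathbb{H}\to\mathbb{C}$ with $w(\mathrm i)=1$, $w(\rho)=0$, $w(\infty)=\infty$. Put $p_j=w(z_j)$. The functions $v_{k;\lambda,\mu}$ are well defined on $\mathbb{C}\setminus\{p_1,\dots,p_m,0,1\}$. *)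

theory Defs
  imports "HOL-Complex_Analysis.Complex_Analysis" "HOL-Library.Landau_Symbols"
begin

definition upper_half_plane :: "complex set" where
  "upper_half_plane = {z. Im z > 0}"

definition rho :: complex where
  "rho = (-1 + of_real (sqrt 3) * \<i>) / 2"

definition SL2Z_equiv :: "complex \<Rightarrow> complex \<Rightarrow> bool" where
  "SL2Z_equiv z z' \<longleftrightarrow> (\<exists>a b c d :: int. a * d - b * c = 1 \<and>
     z' = (of_int a * z + of_int b) / (of_int c * z + of_int d))"

text \<open>The last clause is holomorphy at the cusp, as a power series in
  \<open>q = exp (2 \<pi> \<i> z)\<close>. Values outside the upper half plane are irrelevant.\<close>

definition modular_form :: "int \<Rightarrow> (complex \<Rightarrow> complex) \<Rightarrow> bool" where
  "modular_form k f \<longleftrightarrow>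
     f holomorphic_on upper_half_plane \<and>
     (\<forall>a b c d :: int. a * d - b * c = 1 \<longrightarrow> (\<forall>z\<in>upper_half_plane.
        f ((of_int a * z + of_int b) / (of_int c * z + of_int d)) =
          (of_int c * z + of_int d) powi k * f z)) \<and>
     (\<exists>a :: nat \<Rightarrow> complex. \<forall>z\<in>upper_half_plane.
        (\<lambda>n. a n * exp (2 * of_real pi * \<i> * z) ^ n) sums f z)"

definition lin_indep3 :: "(complex \<Rightarrow> complex) \<Rightarrow> (complex \<Rightarrow> complex) \<Rightarrow> (complex \<Rightarrow> complex) \<Rightarrow> bool" where
  "lin_indep3 f g h \<longleftrightarrow> (\<forall>a b c :: complex.
     (\<forall>z\<in>upper_half_plane. a * f z + b * g z + c * h z = 0) \<longrightarrow> a = 0 \<and> b = 0 \<and> c = 0)"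

text \<open>Summation over coprime pairs, with the factor \<open>1/2\<close>, gives the Eisenstein series
  with constant term 1. The sum converges absolutely for \<open>k > 2\<close>.\<close>

definition eisenstein :: "nat \<Rightarrow> complex \<Rightarrow> complex" where
  "eisenstein k z =
     infsum (\<lambda>(c :: int, d :: int). 1 / (of_int c * z + of_int d) ^ k) {(c, d). coprime c d} / 2"

definition modular_w :: "complex \<Rightarrow> complex" where
  "modular_w z = eisenstein 4 z ^ 3 / (eisenstein 4 z ^ 3 - eisenstein 6 z ^ 2)"

definition wronskian2 :: "(complex \<Rightarrow> complex) \<Rightarrow> (complex \<Rightarrow> complex) \<Rightarrow> complex \<Rightarrow> complex" where
  "wronskian2 y1 y2 z = deriv y1 z * y2 z - deriv y2 z * y1 z"

definition wronskian3 :: "(complex \<Rightarrow> complex) \<Rightarrow> (complex \<Rightarrow> complex) \<Rightarrow> (complex \<Rightarrow> complex) \<Rightarrow> complex \<Rightarrow> complex" where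
  "wronskian3 f g h z = det (vector
     [vector [f z, deriv f z, (deriv ^^ 2) f z],
      vector [g z, deriv g z, (deriv ^^ 2) g z],
      vector [h z, deriv h z, (deriv ^^ 2) h z]] :: complex ^ 3 ^ 3)"

text \<open>A holomorphic cube root of \<open>F\<close> near \<open>z0\<close>. One exists iff the order of \<open>F\<close> at \<open>z0\<close> is
  divisible by 3, in particular if \<open>F z0 \<noteq> 0\<close>; it is unique near \<open>z0\<close> up to a constant cube
  root of unity.\<close>

definition cube_root_at :: "(complex \<Rightarrow> complex) \<Rightarrow> complex \<Rightarrow> complex \<Rightarrow> complex" where
  "cube_root_at F z0 =
     (SOME c. c analytic_on {z0} \<and> (\<forall>\<^sub>F z in nhds z0. c z ^ 3 = F z))"

text \<open>\<open>normalized f g h \<phi> z0\<close>, for \<open>\<phi>\<close> one of \<open>f, g, h\<close>, is a branch near \<open>z0\<close> of the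
  multivalued quotient of \<open>\<phi>\<close> by the cube root of the Wronskian \<open>W\<close>.
  The three branches at \<open>z0\<close> use the same cube root. All quantities below are insensitive to its choice. Removing singularities matters where \<open>W\<close>
  vanishes although the differential equation is regular: there the quotient extends
  holomorphically.\<close>

definition normalized :: "(complex \<Rightarrow> complex) \<Rightarrow> (complex \<Rightarrow> complex) \<Rightarrow> (complex \<Rightarrow> complex)
    \<Rightarrow> (complex \<Rightarrow> complex) \<Rightarrow> complex \<Rightarrow> complex \<Rightarrow> complex" where
  "normalized f g h \<phi> z0 = remove_sings (\<lambda>z. \<phi> z / cube_root_at (wronskian3 f g h) z0 z)"

text \<open>The coefficients of \<open>y''' + Q2 y' + Q3 y = 0\<close>. They are determined at every point with
  nonzero Wronskian, hence in a punctured neighbourhood of every point, which is all that the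
  notions below depend on.\<close>

definition ode_coeffs :: "(complex \<Rightarrow> complex) \<Rightarrow> (complex \<Rightarrow> complex) \<Rightarrow> (complex \<Rightarrow> complex)
    \<Rightarrow> complex \<Rightarrow> complex \<times> complex" where
  "ode_coeffs f g h z = (THE (a, b). \<forall>\<phi>\<in>{f, g, h}.
     (deriv ^^ 3) (normalized f g h \<phi> z) z + a * deriv (normalized f g h \<phi> z) z
       + b * normalized f g h \<phi> z z = 0)"

definition ode_Q2 where "ode_Q2 f g h z = fst (ode_coeffs f g h z)"

definition ode_Q3 where "ode_Q3 f g h z = snd (ode_coeffs f g h z)"

definition singular_point :: "(complex \<Rightarrow> complex) \<Rightarrow> (complex \<Rightarrow> complex) \<Rightarrow> (complex \<Rightarrow> complex)
    \<Rightarrow> complex \<Rightarrow> bool" where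
  "singular_point f g h z \<longleftrightarrow> is_pole (ode_Q2 f g h) z \<or> is_pole (ode_Q3 f g h) z"

text \<open>\<open>z 1, \<dots>, z n\<close> represent, without repetition, the non-elliptic singular points modulo
  the modular group.\<close>

definition singular_representatives :: "(complex \<Rightarrow> complex) \<Rightarrow> (complex \<Rightarrow> complex)
    \<Rightarrow> (complex \<Rightarrow> complex) \<Rightarrow> nat \<Rightarrow> (nat \<Rightarrow> complex) \<Rightarrow> bool" where
  "singular_representatives f g h n z \<longleftrightarrow>
     (\<forall>j\<in>{1..n}. z j \<in> upper_half_plane \<and> singular_point f g h (z j) \<and>
        \<not> SL2Z_equiv (z j) \<i> \<and> \<not> SL2Z_equiv (z j) rho) \<and>
     (\<forall>i\<in>{1..n}. \<forall>j\<in>{1..n}. i \<noteq> j \<longrightarrow> \<not> SL2Z_equiv (z i) (z j)) \<and>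
     (\<forall>\<zeta>\<in>upper_half_plane. singular_point f g h \<zeta> \<longrightarrow>
        SL2Z_equiv \<zeta> \<i> \<or> SL2Z_equiv \<zeta> rho \<or> (\<exists>j\<in>{1..n}. SL2Z_equiv \<zeta> (z j)))"

text \<open>The three real roots of a cubic in increasing order.\<close>

definition ordered_roots :: "(complex \<Rightarrow> complex) \<Rightarrow> real list" where
  "ordered_roots P = (THE \<kappa>. length \<kappa> = 3 \<and> sorted_wrt (<) \<kappa> \<and>
     {x. P x = 0} = complex_of_real ` set \<kappa>)"

definition local_exponents :: "(complex \<Rightarrow> complex) \<Rightarrow> (complex \<Rightarrow> complex) \<Rightarrow> (complex \<Rightarrow> complex)
    \<Rightarrow> complex \<Rightarrow> real list" where
  "local_exponents f g h z0 = ordered_roots (\<lambda>x. x * (x - 1) * (x - 2)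
     + Lim (at z0) (\<lambda>z. (z - z0) ^ 2 * ode_Q2 f g h z) * x
     + Lim (at z0) (\<lambda>z. (z - z0) ^ 3 * ode_Q3 f g h z))"

definition cusp_exponents :: "(complex \<Rightarrow> complex) \<Rightarrow> (complex \<Rightarrow> complex) \<Rightarrow> (complex \<Rightarrow> complex)
    \<Rightarrow> real list" where
  "cusp_exponents f g h = ordered_roots (\<lambda>x. x ^ 3
     + Lim (filtercomap Im at_top) (ode_Q2 f g h) / (2 * of_real pi * \<i>) ^ 2 * x
     + Lim (filtercomap Im at_top) (ode_Q3 f g h) / (2 * of_real pi * \<i>) ^ 3)"

text \<open>Lists are indexed from 0, so the exponent with upper index \<open>j\<close> is entry \<open>j - 1\<close>.
  Note that the shift by 1 is absent at the cusp.\<close>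

definition sing_m :: "(complex \<Rightarrow> complex) \<Rightarrow> (complex \<Rightarrow> complex) \<Rightarrow> (complex \<Rightarrow> complex)
    \<Rightarrow> complex \<Rightarrow> nat \<Rightarrow> real" where
  "sing_m f g h z j = local_exponents f g h z ! j - local_exponents f g h z ! (j - 1) - 1"

definition cusp_m :: "(complex \<Rightarrow> complex) \<Rightarrow> (complex \<Rightarrow> complex) \<Rightarrow> (complex \<Rightarrow> complex)
    \<Rightarrow> nat \<Rightarrow> real" where
  "cusp_m f g h j = cusp_exponents f g h ! j - cusp_exponents f g h ! (j - 1)"

definition toda_U1 :: "(complex \<Rightarrow> complex) \<Rightarrow> (complex \<Rightarrow> complex) \<Rightarrow> (complex \<Rightarrow> complex)
    \<Rightarrow> real \<Rightarrow> real \<Rightarrow> complex \<Rightarrow> real" where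
  "toda_U1 f g h l \<mu> z =
     (let y1 = normalized f g h f z; y2 = normalized f g h g z; y3 = normalized f g h h z
      in - ln (1/4 * (l^2 / \<mu> * (cmod (y1 z))^2 + \<mu>^2 / l * (cmod (y2 z))^2
                + 1 / (l * \<mu>) * (cmod (y3 z))^2)))"

definition toda_U2 :: "(complex \<Rightarrow> complex) \<Rightarrow> (complex \<Rightarrow> complex) \<Rightarrow> (complex \<Rightarrow> complex)
    \<Rightarrow> real \<Rightarrow> real \<Rightarrow> complex \<Rightarrow> real" where
  "toda_U2 f g h l \<mu> z =
     (let y1 = normalized f g h f z; y2 = normalized f g h g z; y3 = normalized f g h h z
      in - ln (1/4 * (l * \<mu> * (cmod (wronskian2 y1 y2 z))^2
                + \<mu> / l^2 * (cmod (wronskian2 y2 y3 z))^2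
                + l / \<mu>^2 * (cmod (wronskian2 y3 y1 z))^2)))"

text \<open>The index \<open>k\<close> ranges over \<open>{1, 2}\<close>.\<close>

definition toda_u :: "(complex \<Rightarrow> complex) \<Rightarrow> (complex \<Rightarrow> complex) \<Rightarrow> (complex \<Rightarrow> complex)
    \<Rightarrow> real \<Rightarrow> real \<Rightarrow> nat \<Rightarrow> complex \<Rightarrow> real" where
  "toda_u f g h l \<mu> k z =
     (if k = 1 then 2 * toda_U1 f g h l \<mu> z - toda_U2 f g h l \<mu> z
      else 2 * toda_U2 f g h l \<mu> z - toda_U1 f g h l \<mu> z)"

definition toda_v :: "(complex \<Rightarrow> complex) \<Rightarrow> (complex \<Rightarrow> complex) \<Rightarrow> (complex \<Rightarrow> complex)
    \<Rightarrow> real \<Rightarrow> real \<Rightarrow> nat \<Rightarrow> complex \<Rightarrow> real" where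
  "toda_v f g h l \<mu> k w = (THE t. \<forall>z\<in>upper_half_plane. modular_w z = w \<longrightarrow>
     t = toda_u f g h l \<mu> k z - 2 * ln (cmod (deriv modular_w z)))"

definition partial1 :: "(complex \<Rightarrow> real) \<Rightarrow> complex \<Rightarrow> real" where
  "partial1 \<phi> w = frechet_derivative \<phi> (at w) 1"

definition partial2 :: "(complex \<Rightarrow> real) \<Rightarrow> complex \<Rightarrow> real" where
  "partial2 \<phi> w = frechet_derivative \<phi> (at w) \<i>"

definition laplacian :: "(complex \<Rightarrow> real) \<Rightarrow> complex \<Rightarrow> real" where
  "laplacian \<phi> w = partial1 (partial1 \<phi>) w + partial2 (partial2 \<phi>) w"

primrec C_k :: "nat \<Rightarrow> (complex \<Rightarrow> real) \<Rightarrow> bool" where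
  "C_k 0 \<phi> \<longleftrightarrow> continuous_on UNIV \<phi>"
| "C_k (Suc n) \<phi> \<longleftrightarrow> (\<forall>w. \<phi> differentiable (at w)) \<and> C_k n (partial1 \<phi>) \<and> C_k n (partial2 \<phi>)"

definition test_function :: "(complex \<Rightarrow> real) \<Rightarrow> bool" where
  "test_function \<phi> \<longleftrightarrow> (\<forall>n. C_k n \<phi>) \<and> compact (closure {w. \<phi> w \<noteq> 0})"

definition locally_integrable :: "(complex \<Rightarrow> real) \<Rightarrow> bool" where
  "locally_integrable v \<longleftrightarrow> (\<forall>K. compact K \<longrightarrow> set_integrable lborel K v)"

text \<open>\<open>laplacian_plus_eq v N T\<close>: the equation \<open>\<Delta>v + N = T\<close> in the sense of distributions
  on the plane, for functions \<open>v\<close>, \<open>N\<close> and a distribution \<open>T\<close>.\<close>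

definition laplacian_plus_eq :: "(complex \<Rightarrow> real) \<Rightarrow> (complex \<Rightarrow> real)
    \<Rightarrow> ((complex \<Rightarrow> real) \<Rightarrow> real) \<Rightarrow> bool" where
  "laplacian_plus_eq v N T \<longleftrightarrow> locally_integrable v \<and> locally_integrable N \<and>
     (\<forall>\<phi>. test_function \<phi> \<longrightarrow>
        (\<integral>w. v w * laplacian \<phi> w \<partial>lborel) + (\<integral>w. N w * \<phi> w \<partial>lborel) = T \<phi>)"

definition dirac :: "complex \<Rightarrow> (complex \<Rightarrow> real) \<Rightarrow> real" where
  "dirac p \<phi> = \<phi> p"

end

theory Submission
 imports Defs
begin

text \<open>Write \<open>N\<close> for the weighted norm \<open>norm_sum\<close> of the triple \<open>(f, g, h)\<close>, \<open>M\<close> for the weighted norm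
\<open>wronskian_sum\<close> of the triple of its 2 by 2 Wronskians and \<open>W\<close> for its 3 by 3 Wronskian. With the
cube root of \<open>W\<close> divided out, the potentials satisfy \<open>exp v1 = 4 M / N^2\<close> and \<open>exp v2 = 4 N |W|^2 / M^2\<close>.
By Lagrange's identity the Laplacian of \<open>ln N\<close> is \<open>4 M / N^2\<close>. The Wronskians of the Wronskians are the
original functions times \<open>W\<close> up to sign, so the same formula gives \<open>4 N |W|^2 / M^2\<close> for \<open>ln M\<close>. As \<open>ln |W|^2\<close> is
harmonic, the Toda equations follow (\<open>toda_system_local\<close>).

A common factor of the three functions cancels in \<open>v1\<close> and \<open>v2\<close>, and a change of coordinate adds twice
the logarithm of its derivative (\<open>toda_u_covariant\<close>). The modular group multiplies \<open>f, g, h\<close> by a common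
factor, so the potentials formed with the coordinate \<open>w\<close> depend on \<open>w\<close> only (\<open>toda_chart\<close>,
\<open>toda_v_eq\<close>), provided that \<open>w\<close> is a bijection from the orbits to the plane (\<open>modular_w_surj\<close>,
\<open>modular_w_inj\<close>) that is locally biholomorphic except over 0 and 1 (\<open>deriv_modular_w_zero\<close>).

At each point, the cusp \<open>q = 0\<close> included, the span of the three functions has a basis with orders
\<open>n1 < n2 < n3\<close>. Then \<open>N\<close>, \<open>M\<close> and \<open>W\<close> behave like the powers of \<open>|x|\<close> with exponents \<open>2 n1\<close>,
\<open>2 (n1 + n2 - 1)\<close> and of \<open>x\<close> with exponent \<open>n1 + n2 + n3 - 3\<close>. Hence \<open>v1\<close> and \<open>v2\<close> have logarithmic terms with coefficients
\<open>2 (n2 - n1 - 1)\<close> and \<open>2 (n3 - n2 - 1)\<close> (\<open>toda_local_asymptotics\<close>). The exponents of the differential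
equation are the \<open>n\<close>'s up to a common shift (\<open>local_exponents_adapted\<close>, \<open>cusp_exponents_adapted\<close>), so
these are the numbers \<open>m\<close> of the theorem, at the cusp \<open>m - 1\<close>. Passing to the coordinate \<open>w\<close> of ramification \<open>e\<close> turns
\<open>m\<close> into \<open>(m - (e - 1)) / e\<close>, with \<open>e = 2\<close> at \<open>\<i>\<close> and \<open>e = 3\<close> at \<open>rho\<close>; at the cusp \<open>w\<close> has a simple
pole in \<open>q\<close>. The Dirac masses come from the logarithms, since an isolated point at which a solution extends
continuously carries no mass (\<open>laplacian_plus_eq_log_poles\<close>).

The facts about \<open>w\<close> rest on the Eisenstein series. A form of weight \<open>k < 2 sqrt 3 pi m\<close> that vanishes to
order \<open>m\<close> at the cusp is 0 (\<open>cusp_order_bound\<close>). So the brackets of \<open>E4\<close> and \<open>E6\<close> are constant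
multiples of \<open>disc\<close> or \<open>E4 * disc\<close> (\<open>bracket_relations\<close>), and comparing orders of zeros in these
identities shows that the discriminant has no zeros and that those of \<open>E4\<close> and \<open>E6\<close> are simple.\<close>

section \<open>Functions of class \<open>C\<^sup>2\<close> on the plane\<close>

lemma partial_eqI: assumes "(u has_derivative D) (at w)"
 shows "partial1 u w = D 1" "partial2 u w = D \<i>"
 using frechet_derivative_at[OF assms] by (auto simp: partial1_def partial2_def)

lemma has_derivative_cong_nhds: assumes "\<forall>\<^sub>F x in nhds w. u x = v x"
 shows "(u has_derivative D) (at w) \<longleftrightarrow> (v has_derivative D) (at w)" proof -
 have "\<forall>\<^sub>F x in at w. u x = v x" "u w = v w" "\<forall>\<^sub>F x in at w. v x = u x"
  using assms eventually_nhds_x_imp_x by (auto simp: eventually_at_filter elim: eventually_mono)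
 thus ?thesis using has_derivative_transform_eventually[of u D w UNIV v] has_derivative_transform_eventually[of v D w UNIV u]
  by auto
qed

lemma partial_cong: assumes "\<forall>\<^sub>F x in nhds w. u x = v x"
 shows "partial1 u w = partial1 v w" "partial2 u w = partial2 v w" proof -
 have "(u has_derivative D) (at w) \<longleftrightarrow> (v has_derivative D) (at w)" for D
  using has_derivative_cong_nhds[OF assms] .
 hence "frechet_derivative u (at w) = frechet_derivative v (at w)"
  unfolding frechet_derivative_def by simp
 thus "partial1 u w = partial1 v w" "partial2 u w = partial2 v w"
  by (simp_all add: partial1_def partial2_def)
qed

lemma differentiable_cong: assumes "\<forall>\<^sub>F x in nhds w. u x = v x"
 shows "u differentiable (at w) \<longleftrightarrow> v differentiable (at w)"
 unfolding differentiable_def using has_derivative_cong_nhds[OF assms] by simp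

lemma partial_mult: fixes u v :: "complex => real"
 assumes "u differentiable (at w)" "v differentiable (at w)"
 shows "partial1 (%w. u w * v w) w = u w * partial1 v w + partial1 u w * v w"
  "partial2 (%w. u w * v w) w = u w * partial2 v w + partial2 u w * v w" proof -
 have "((%w. u w * v w) has_derivative (%h. u w * frechet_derivative v (at w) h + frechet_derivative u (at w) h * v w)) (at w)"
  using assms by (intro has_derivative_mult) (auto simp: frechet_derivative_works)
 from partial_eqI[OF this]
 show "partial1 (%w. u w * v w) w = u w * partial1 v w + partial1 u w * v w"
  "partial2 (%w. u w * v w) w = u w * partial2 v w + partial2 u w * v w" by (simp_all add: partial1_def partial2_def)
qed

lemma partial_lincomb: fixes u v :: "complex => real" assumes "u differentiable (at w)" "v differentiable (at w)"
 shows "partial1 (%w. a * u w + b * v w) w = a * partial1 u w + b * partial1 v w"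
  "partial2 (%w. a * u w + b * v w) w = a * partial2 u w + b * partial2 v w" proof -
 have "((%w. a * u w + b * v w) has_derivative (%h. a * frechet_derivative u (at w) h + b * frechet_derivative v (at w) h)) (at w)"
  using assms by (intro derivative_intros) (auto simp: frechet_derivative_works)
 from partial_eqI[OF this]
 show "partial1 (%w. a * u w + b * v w) w = a * partial1 u w + b * partial1 v w"
  "partial2 (%w. a * u w + b * v w) w = a * partial2 u w + b * partial2 v w" by (simp_all add: partial1_def partial2_def)
qed

text \<open>Only the second derivatives that make up the Laplacian are required to be continuous.\<close>

definition C2_on :: "complex set => (complex => real) => bool" where
 "C2_on S u \<longleftrightarrow> (\<forall>w\<in>S. u differentiable (at w) & partial1 u differentiable (at w) &
   partial2 u differentiable (at w)) &
   continuous_on S (partial1 (partial1 u)) & continuous_on S (partial2 (partial2 u))"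

lemma C2_onD: assumes "C2_on S u" "w \<in> S"
 shows "u differentiable (at w)" "partial1 u differentiable (at w)" "partial2 u differentiable (at w)"
 using assms by (auto simp: C2_on_def)

lemma C2_on_continuous: assumes "C2_on S u"
 shows "continuous_on S u" "continuous_on S (partial1 u)" "continuous_on S (partial2 u)"
  "continuous_on S (partial1 (partial1 u))" "continuous_on S (partial2 (partial2 u))"
  "continuous_on S (laplacian u)" proof -
 show "continuous_on S u" "continuous_on S (partial1 u)" "continuous_on S (partial2 u)"
  using C2_onD[OF assms] by (auto intro!: differentiable_imp_continuous_on differentiable_at_imp_differentiable_on)
 show "continuous_on S (partial1 (partial1 u))" "continuous_on S (partial2 (partial2 u))" using assms by (auto simp: C2_on_def)
 thus "continuous_on S (laplacian u)" unfolding laplacian_def [abs_def] by (intro continuous_intros)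
qed

lemma C2_on_subset: "C2_on S u ==> T \<subseteq> S ==> C2_on T u" unfolding C2_on_def by (meson continuous_on_subset subsetD)

lemma C2_on_open_cong: assumes "open S" "!!x. x \<in> S ==> u x = v x" "C2_on S v"
 shows "C2_on S u" "!!w. w \<in> S ==> laplacian u w = laplacian v w" proof -
 have ev: "\<forall>\<^sub>F x in nhds w. P x" if "w \<in> S" "!!x. x \<in> S ==> P x" for w P
  using that assms(1) eventually_nhds by blast
 have p: "partial1 u x = partial1 v x" "partial2 u x = partial2 v x" if "x \<in> S" for x
  using partial_cong[OF ev[OF that assms(2)]] by auto
 have pp: "partial1 (partial1 u) x = partial1 (partial1 v) x" "partial2 (partial2 u) x = partial2 (partial2 v) x"
  if "x \<in> S" for x using partial_cong(1)[OF ev[OF that p(1)]] partial_cong(2)[OF ev[OF that p(2)]] by auto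
 have "u differentiable (at w)" "partial1 u differentiable (at w)" "partial2 u differentiable (at w)" if "w \<in> S" for w
  using C2_onD[OF assms(3) that] differentiable_cong[OF ev[OF that assms(2)]]
   differentiable_cong[OF ev[OF that p(1)]] differentiable_cong[OF ev[OF that p(2)]] by auto
 moreover have "continuous_on S (partial1 (partial1 u))" "continuous_on S (partial2 (partial2 u))"
  using assms(3) pp by (auto simp: C2_on_def cong: continuous_on_cong)
 ultimately show "C2_on S u" by (auto simp: C2_on_def)
 show "!!w. w \<in> S ==> laplacian u w = laplacian v w" using pp by (auto simp: laplacian_def)
qed

lemma C2_on_lincomb: assumes "open S" "C2_on S u" "C2_on S v"
 shows "C2_on S (%w. a * u w + b * v w)"
  "!!w. w \<in> S ==> laplacian (%w. a * u w + b * v w) w = a * laplacian u w + b * laplacian v w"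
proof -
 let ?s = "%w. a * u w + b * v w"
 have ev: "\<forall>\<^sub>F x in nhds w. P x" if "w \<in> S" "!!x. x \<in> S ==> P x" for w P
  using that assms(1) eventually_nhds by blast
 note D = C2_onD[OF assms(2)] C2_onD[OF assms(3)]
 have p: "partial1 ?s x = a * partial1 u x + b * partial1 v x"
   "partial2 ?s x = a * partial2 u x + b * partial2 v x" if "x \<in> S" for x using partial_lincomb[of u x v a b] D that by auto
 have pp: "partial1 (partial1 ?s) x = a * partial1 (partial1 u) x + b * partial1 (partial1 v) x"
   "partial2 (partial2 ?s) x = a * partial2 (partial2 u) x + b * partial2 (partial2 v) x" if "x \<in> S" for x
  using partial_cong(1)[OF ev[OF that p(1)]] partial_cong(2)[OF ev[OF that p(2)]]
   partial_lincomb(1)[of "partial1 u" x "partial1 v" a b] partial_lincomb(2)[of "partial2 u" x "partial2 v" a b] D that by auto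
 have "?s differentiable (at w)" "partial1 ?s differentiable (at w)" "partial2 ?s differentiable (at w)" if "w \<in> S" for w
  using D that differentiable_cong[OF ev[OF that p(1)]] differentiable_cong[OF ev[OF that p(2)]] by auto
 moreover have "continuous_on S (partial1 (partial1 ?s))" "continuous_on S (partial2 (partial2 ?s))"
  using assms(2,3) unfolding C2_on_def by (auto simp: pp cong: continuous_on_cong intro!: continuous_intros)
 ultimately show "C2_on S ?s" by (auto simp: C2_on_def)
 show "!!w. w \<in> S ==> laplacian ?s w = a * laplacian u w + b * laplacian v w"
  using pp by (auto simp: laplacian_def algebra_simps)
qed

lemma C2_on_mult: assumes "open S" "C2_on S u" "C2_on S v" shows "C2_on S (%w. u w * v w)"
  "!!w. w \<in> S ==> laplacian (%w. u w * v w) w = u w * laplacian v w + laplacian u w * v w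
    + 2 * (partial1 u w * partial1 v w + partial2 u w * partial2 v w)" proof -
 let ?s = "%w. u w * v w"
 have ev: "\<forall>\<^sub>F x in nhds w. P x" if "w \<in> S" "!!x. x \<in> S ==> P x" for w P
  using that assms(1) eventually_nhds by blast
 note D = C2_onD[OF assms(2)] C2_onD[OF assms(3)]
 have p: "partial1 ?s x = u x * partial1 v x + partial1 u x * v x"
   "partial2 ?s x = u x * partial2 v x + partial2 u x * v x" if "x \<in> S" for x using partial_mult[of u x v] D that by auto
 have pp: "partial1 (partial1 ?s) x = u x * partial1 (partial1 v) x + partial1 (partial1 u) x * v x + 2 * (partial1 u x * partial1 v x)"
   "partial2 (partial2 ?s) x = u x * partial2 (partial2 v) x + partial2 (partial2 u) x * v x + 2 * (partial2 u x * partial2 v x)" if "x \<in> S" for x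
 proof -
  have "partial1 (%x. 1 * (u x * partial1 v x) + 1 * (partial1 u x * v x)) x =
    1 * partial1 (%x. u x * partial1 v x) x + 1 * partial1 (%x. partial1 u x * v x) x"
   using D that by (intro partial_lincomb derivative_intros) auto
  moreover have "partial2 (%x. 1 * (u x * partial2 v x) + 1 * (partial2 u x * v x)) x =
    1 * partial2 (%x. u x * partial2 v x) x + 1 * partial2 (%x. partial2 u x * v x) x"
   using D that by (intro partial_lincomb derivative_intros) auto
  ultimately show "partial1 (partial1 ?s) x = u x * partial1 (partial1 v) x + partial1 (partial1 u) x * v x + 2 * (partial1 u x * partial1 v x)"
   "partial2 (partial2 ?s) x = u x * partial2 (partial2 v) x + partial2 (partial2 u) x * v x + 2 * (partial2 u x * partial2 v x)"
   using partial_cong(1)[OF ev[OF that p(1)]] partial_cong(2)[OF ev[OF that p(2)]]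
    partial_mult(1)[of u x "partial1 v"] partial_mult(1)[of "partial1 u" x "v"]
    partial_mult(2)[of u x "partial2 v"] partial_mult(2)[of "partial2 u" x "v"] D that
   by simp_all
 qed
 have d: "?s differentiable (at w)" "partial1 ?s differentiable (at w)" "partial2 ?s differentiable (at w)" if "w \<in> S" for w
  using D that differentiable_cong[OF ev[OF that p(1)]] differentiable_cong[OF ev[OF that p(2)]] by auto
 note C2_on_continuous[OF assms(2)] C2_on_continuous[OF assms(3)]
 hence "continuous_on S (partial1 (partial1 ?s))" "continuous_on S (partial2 (partial2 ?s))"
  using assms(2,3) unfolding C2_on_def by (auto simp: pp cong: continuous_on_cong intro!: continuous_intros)
 with d show "C2_on S ?s" by (auto simp: C2_on_def)
 show "!!w. w \<in> S ==> laplacian ?s w = u w * laplacian v w + laplacian u w * v w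
    + 2 * (partial1 u w * partial1 v w + partial2 u w * partial2 v w)" using pp by (auto simp: laplacian_def algebra_simps)
qed

section \<open>Green's identity\<close>

lemma test_function_C2: assumes "test_function u" shows "C2_on UNIV u" "EX R. \<forall>w. cmod w > R --> u w = 0" proof -
 have 3: "C_k 3 u" "compact (closure {w. u w ~= 0})" using assms by (auto simp: test_function_def)
 thus "C2_on UNIV u" by (auto simp: C2_on_def numeral_3_eq_3 differentiable_on_def intro!: differentiable_imp_continuous_on)
 have "bounded {w. u w ~= 0}" using 3(2) compact_imp_bounded bounded_subset closure_subset by blast
 then obtain R where "!!w. u w ~= 0 ==> cmod w <= R" by (auto simp: bounded_iff)
 thus "EX R. \<forall>w. cmod w > R --> u w = 0" by (metis linorder_not_less)
qed

lemma lborel_integral_translate: fixes F :: "complex => real" assumes "F \<in> borel_measurable borel"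
 shows "(\<integral>w. F (w + c) \<partial>lborel) = (\<integral>w. F w \<partial>lborel)" proof -
 have "(\<integral>w. F w \<partial>lborel) = (\<integral>w. F w \<partial>(distr lborel borel ((+) c)))" by (simp add: lborel_distr_plus)
 also have "... = (\<integral>w. F (c + w) \<partial>lborel)" by (rule integral_distr) (use assms in auto)
 finally show ?thesis by (simp only: add.commute)
qed

lemma integrable_continuous_support: fixes F :: "complex => real"
 assumes "continuous_on UNIV F" "!!w. cmod w > R ==> F w = 0" shows "integrable lborel F" proof -
 have "integrable lborel (%w. indicator (cball 0 R) w *\<^sub>R F w)"
  by (rule borel_integrable_compact) (auto intro: continuous_on_subset[OF assms(1)])
 moreover have "(%w. indicator (cball 0 R) w *\<^sub>R F w) = F" using assms(2) by (auto simp: fun_eq_iff indicator_def)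
 ultimately show ?thesis by simp
qed

text \<open>The difference quotients integrate to 0 by translation invariance, are bounded by the mean value
 theorem, and converge dominatedly to the derivative.\<close>

lemma integral_directional_derivative_eq_0: fixes F :: "complex => real"
 assumes diff: "!!w. F differentiable (at w)" and supp: "!!w. cmod w > R ==> F w = 0"
  and cont: "continuous_on UNIV (%w. frechet_derivative F (at w) e)"
 shows "(\<integral>w. frechet_derivative F (at w) e \<partial>lborel) = 0" "integrable lborel (%w. frechet_derivative F (at w) e)"
proof -
 let ?G = "%w. frechet_derivative F (at w) e"
 have Fc: "continuous_on UNIV F" using diff by (auto intro!: differentiable_imp_continuous_on simp: differentiable_on_def)
 have G0: "?G w = 0" if "cmod w > R" for w proof -
  have "open {w. cmod w > R}" by (intro open_Collect_less continuous_intros)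
  hence "\<forall>\<^sub>F x in nhds w. F x = 0" using supp that eventually_nhds by blast
  hence "(F has_derivative (%_. 0)) (at w)" using has_derivative_cong_nhds[of F "%_. 0" w "%_. 0"] by simp
  from frechet_derivative_at[OF this] show ?thesis by metis
 qed
 show "integrable lborel ?G" by (rule integrable_continuous_support[OF cont G0])
 have "bounded (?G ` cball 0 R)" by (intro compact_imp_bounded compact_continuous_image continuous_on_subset[OF cont]) auto
 then obtain C where C: "!!w. cmod w <= R ==> \<bar>?G w\<bar> <= C" unfolding bounded_iff by (metis imageI mem_cball_0 real_norm_def)
 define C' where "C' = max C 0"
 have C': "abs (?G w) <= C'" for w using C[of w] G0[of w] by (cases "cmod w <= R") (auto simp: C'_def)
 define s where "s = (%n w. (F (w + complex_of_real (inverse (real (Suc n))) * e) - F w) / inverse (real (Suc n)))"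
 have der: "((%t. F (w + of_real t * e)) has_real_derivative ?G (w + of_real t * e)) (at t)" for w t proof -
  let ?x = "w + complex_of_real t * e"
  have "(F has_derivative frechet_derivative F (at ?x)) (at ?x)" using diff by (simp add: frechet_derivative_works)
  moreover have "((%t. w + complex_of_real t * e) has_derivative (%h. of_real h * e)) (at t)"
   by (auto intro!: derivative_eq_intros)
  ultimately have *: "((%t. F (w + of_real t * e)) has_derivative (%h. frechet_derivative F (at ?x) (of_real h * e))) (at t)"
   by (rule has_derivative_compose[rotated])
  have "frechet_derivative F (at ?x) (of_real h * e) = ?G ?x * h" for h proof -
   have "linear (frechet_derivative F (at ?x))" using diff linear_frechet_derivative by blast
   hence "frechet_derivative F (at ?x) (h *\<^sub>R e) = h *\<^sub>R ?G ?x" by (rule linear_scale)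
   thus ?thesis by (simp add: scaleR_conv_of_real mult.commute)
  qed
  with * show ?thesis by (simp only: has_field_derivative_def)
 qed
 have s_le: "abs (s n w) <= C'" for n w proof -
  define h where "h = inverse (real (Suc n))"
  have h: "h > 0" by (simp add: h_def)
  have "EX z. 0 < z & z < h & F (w + of_real h * e) - F (w + of_real 0 * e) = (h - 0) * ?G (w + of_real z * e)"
   by (rule MVT2[OF h]) (rule der)
  then obtain z where "F (w + of_real h * e) - F w = h * ?G (w + of_real z * e)" by auto
  moreover have "s n w = (F (w + of_real h * e) - F w) / h" by (simp only: s_def h_def)
  ultimately have "s n w = ?G (w + of_real z * e)" using h by simp
  thus ?thesis using C' by simp
 qed
 have s0: "s n w = 0" if "cmod w > R + cmod e" for n w proof -
  define h where "h = inverse (real (Suc n))"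
  have h: "h > 0" "h <= 1" by (simp_all add: h_def inverse_le_1_iff)
  have "cmod (of_real h * e) <= cmod e" using mult_right_mono[OF h(2), of "cmod e"] h by (simp add: norm_mult)
  moreover have "cmod w - cmod (of_real h * e) <= cmod (w + of_real h * e)" using norm_diff_ineq by blast
  ultimately have "cmod (w + of_real h * e) > R" "cmod w > R" using that norm_ge_zero[of e] by linarith+
  moreover have "s n w = (F (w + of_real h * e) - F w) / h" by (simp only: s_def h_def)
  ultimately show ?thesis using supp by simp
 qed
 have Fb: "F \<in> borel_measurable borel" by (rule borel_measurable_continuous_onI[OF Fc])
 have Fi: "integrable lborel F" by (rule integrable_continuous_support[OF Fc supp])
 have "integrable lborel (%w. F (w + c))" for c proof (rule integrable_continuous_support)
  show "continuous_on UNIV (%w. F (w + c))" by (intro continuous_on_compose2[OF Fc] continuous_intros) auto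
  show "F (w + c) = 0" if "cmod w > R + cmod c" for w using norm_diff_ineq[of w c] that by (intro supp) linarith
 qed
 hence s_int: "(\<integral>w. s n w \<partial>lborel) = 0" for n
  unfolding s_def using Fi Fb by (simp only: integral_divide_zero lborel_integral_translate Bochner_Integration.integral_diff) simp
 have "(%n. \<integral>w. s n w \<partial>lborel) \<longlonglongrightarrow> (\<integral>w. ?G w \<partial>lborel)"
 proof (rule integral_dominated_convergence[where w="%w. C' * indicator (cball 0 (R + cmod e)) w"])
  show "?G \<in> borel_measurable lborel" using borel_measurable_continuous_onI[OF cont] by simp
  show "s i \<in> borel_measurable lborel" for i unfolding s_def using Fb by measurable
  show "integrable lborel (%w::complex. C' * indicator (cball 0 (R + cmod e)) w)"
   by (intro integrable_mult_right integrable_real_indicator) (use emeasure_lborel_cball_finite[of "0::complex" "R + cmod e"] in simp_all)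
  show "AE w in lborel. (%i. s i w) \<longlonglongrightarrow> ?G w" proof (rule AE_I2)
   fix w
   have *: "((%h. (F (w + of_real (0+h) * e) - F (w + of_real 0 * e)) / h) \<longlongrightarrow> ?G (w + of_real 0 * e)) (at 0)"
    using der[of w 0] by (simp add: DERIV_def)
   have "filterlim (%n. inverse (real (Suc n))) (at 0) sequentially"
    using LIMSEQ_inverse_real_of_nat by (auto simp: filterlim_at)
   from filterlim_compose[OF * this] have "(%n. (F (w + of_real (0+inverse (real (Suc n))) * e) - F (w + of_real 0 * e)) / inverse (real (Suc n))) \<longlonglongrightarrow> ?G (w + of_real 0 * e)"
    .
   thus "(%i. s i w) \<longlonglongrightarrow> ?G w" by (simp add: s_def del: of_nat_Suc)
  qed
  show "AE w in lborel. norm (s i w) <= C' * indicator (cball 0 (R + cmod e)) w" for i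
   using s_le s0 by (auto simp: indicator_def not_le)
 qed
 thus "(\<integral>w. ?G w \<partial>lborel) = 0" by (simp add: s_int LIMSEQ_const_iff)
qed

text \<open>The integrand is the divergence of \<open>v grad u - u grad v\<close>, and this field extends by 0
 outside \<open>S\<close>. So \<open>v\<close> may be singular off \<open>S\<close>.\<close>

lemma green_identity: fixes v u :: "complex => real" assumes S: "open S" and v: "C2_on S v" and phi: "C2_on UNIV u"
  and K: "compact K" "K \<subseteq> S" "!!w. w \<notin> K ==> u w = 0"
 shows "(\<integral>w. v w * laplacian u w - u w * laplacian v w \<partial>lborel) = 0"
  "integrable lborel (%w. v w * laplacian u w - u w * laplacian v w)" proof -
 obtain R where R: "!!w. w \<in> K ==> cmod w <= R" using compact_imp_bounded[OF K(1)] by (auto simp: bounded_iff)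
 have opK: "open (-K)" using compact_imp_closed[OF K(1)] by blast
 have evK: "\<forall>\<^sub>F x in nhds w. P x" if "w \<notin> K" "!!x. x \<notin> K ==> P x" for w P
  using that opK eventually_nhds by (metis ComplD ComplI)
 have evS: "\<forall>\<^sub>F x in nhds w. P x" if "w \<in> S" "!!x. x \<in> S ==> P x" for w P
  using that S eventually_nhds by blast
 have zero: "partial1 (%_. 0) w = 0" "partial2 (%_. 0) w = 0" for w using partial_eqI[of "%_. 0" "%_. 0" w] by auto
 have p0: "partial1 F w = 0" "partial2 F w = 0" if "w \<notin> K" "!!x. x \<notin> K ==> F x = 0" for F w
  using partial_cong[OF evK[OF that]] zero by auto
 have phi0: "u w = 0" "partial1 u w = 0" "partial2 u w = 0" "partial1 (partial1 u) w = 0" "partial2 (partial2 u) w = 0"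
  if "w \<notin> K" for w using that K(3) p0 by auto
 note Dv = C2_onD[OF v]
 have Dp: "u differentiable (at w)" "partial1 u differentiable (at w)" "partial2 u differentiable (at w)" for w
  using C2_onD[OF phi] by auto
 have main: "(\<integral>w. v w * p (p u) w - u w * p (p v) w \<partial>lborel) = 0 & integrable lborel (%w. v w * p (p u) w - u w * p (p v) w)"
  if p: "p = partial1 & e = 1 | p = partial2 & e = \<i>" for p e proof -
  define F where "F = (%w. if w \<in> S then v w * p u w + - 1 * (u w * p v w) else 0)"
  have pe: "p = (%F w. frechet_derivative F (at w) e)" using p by (auto simp: partial1_def partial2_def fun_eq_iff)
  have F0: "F w = 0" if "w \<notin> K" for w using that phi0 p by (auto simp: F_def)
  have dp: "p u differentiable (at w)" for w using p Dp by auto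
  have dv: "p v differentiable (at w)" if "w \<in> S" for w using p Dv that by auto
  have FS: "\<forall>\<^sub>F x in nhds w. F x = 1 * (v x * p u x) + - 1 * (u x * p v x)" if "w \<in> S" for w
   using that by (intro evS) (auto simp: F_def)
  have Fd: "F differentiable (at w)" for w proof (cases "w \<in> K")
   case True
   hence "w \<in> S" using K by auto
   thus ?thesis by (subst differentiable_cong[OF FS]) (auto intro!: derivative_intros Dv Dp dp dv)
  next
   case False
   have "\<forall>\<^sub>F x in nhds w. F x = 0" by (rule evK[OF False F0])
   thus ?thesis by (subst differentiable_cong) auto
  qed
  have pF: "p F w = v w * p (p u) w - u w * p (p v) w" for w proof (cases "w \<in> K")
   case True
   hence w: "w \<in> S" using K by auto
   have 1: "p (%x. 1 * (v x * p u x) + - 1 * (u x * p v x)) w =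
    1 * p (%x. v x * p u x) w + -1 * p (%x. u x * p v x) w"
    using p by (elim disjE conjE; hypsubst; intro partial_lincomb derivative_intros Dv w Dp)
   have 2: "p (%x. v x * p u x) w = v w * p (p u) w + p v w * p u w"
     "p (%x. u x * p v x) w = u w * p (p v) w + p u w * p v w"
    using p by (elim disjE conjE; hypsubst; intro partial_mult derivative_intros Dv w Dp)+
   have "p F w = p (%x. 1 * (v x * p u x) + - 1 * (u x * p v x)) w"
    using partial_cong[OF FS[OF w]] p by auto
   thus ?thesis unfolding 1 2 by simp
  next
   case False
   thus ?thesis using p0[OF False F0] phi0[OF False] p by auto
  qed
  have cv: "continuous_on S v" "continuous_on S (p (p v))" "continuous_on UNIV u" "continuous_on UNIV (p (p u))"
   using C2_on_continuous[OF v] C2_on_continuous[OF phi] p by auto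
  have "continuous_on (S \<union> -K) (p F)" proof (rule continuous_on_open_Un[OF S opK])
   show "continuous_on S (p F)" unfolding pF
    by (intro continuous_intros cv continuous_on_subset[OF cv(3)] continuous_on_subset[OF cv(4)]) auto
   have "continuous_on (-K) (p F) \<longleftrightarrow> continuous_on (-K) (%_. 0::real)"
    by (intro continuous_on_cong refl) (use p0 F0 p in auto)
   thus "continuous_on (-K) (p F)" by simp
  qed
  moreover have "S \<union> -K = UNIV" using K by auto
  ultimately have "continuous_on UNIV (%w. frechet_derivative F (at w) e)" by (simp add: pe)
  moreover have "F w = 0" if "cmod w > R" for w using F0 R that by force
  ultimately show ?thesis using integral_directional_derivative_eq_0[of F R e] Fd unfolding pF[symmetric] by (simp add: pe)
 qed
 have split: "v w * laplacian u w - u w * laplacian v w =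
   (v w * partial1 (partial1 u) w - u w * partial1 (partial1 v) w) + (v w * partial2 (partial2 u) w - u w * partial2 (partial2 v) w)" for w
  by (simp add: laplacian_def algebra_simps)
 note i = main[of partial1 1, simplified] main[of partial2 \<i>, simplified]
 show "(\<integral>w. v w * laplacian u w - u w * laplacian v w \<partial>lborel) = 0"
  unfolding split using i by (simp add: Bochner_Integration.integral_add)
 show "integrable lborel (%w. v w * laplacian u w - u w * laplacian v w)"
  unfolding split using i by (intro Bochner_Integration.integrable_add) blast+
qed

section \<open>The Laplacian of the logarithm of a norm\<close>

lemma has_derivative_cmod_square: assumes "(F has_field_derivative d) (at x)"
 shows "((%x. (cmod (F x))^2) has_derivative (%h. 2 * Re (cnj (F x) * d * h))) (at x)" proof -
 have F: "(F has_derivative (%h. d * h)) (at x)" using assms by (simp add: has_field_derivative_def)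
 have 1: "((%x. Re (F x)) has_derivative (%h. Re (d * h))) (at x)"
  by (rule bounded_linear.has_derivative[OF bounded_linear_Re F])
 have 2: "((%x. Im (F x)) has_derivative (%h. Im (d * h))) (at x)"
  by (rule bounded_linear.has_derivative[OF bounded_linear_Im F])
 have "((%x. Re (F x) * Re (F x) + Im (F x) * Im (F x)) has_derivative
   (%h. (Re (F x) * Re (d * h) + Re (d * h) * Re (F x)) + (Im (F x) * Im (d * h) + Im (d * h) * Im (F x)))) (at x)"
  by (intro has_derivative_add has_derivative_mult 1 2)
 thus ?thesis unfolding cmod_power2 unfolding power2_eq_square by (rule has_derivative_eq_rhs) (auto simp: algebra_simps)
qed

lemma lagrange_identity3: fixes a b :: "nat => complex" and c :: "nat => real"
 shows "(c 1 * (cmod (a 1))^2 + c 2 * (cmod (a 2))^2 + c 3 * (cmod (a 3))^2) *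
   (c 1 * (cmod (b 1))^2 + c 2 * (cmod (b 2))^2 + c 3 * (cmod (b 3))^2)
  - (cmod (c 1 * cnj (a 1) * b 1 + c 2 * cnj (a 2) * b 2 + c 3 * cnj (a 3) * b 3))^2
  = c 1 * c 2 * (cmod (b 1 * a 2 - b 2 * a 1))^2 + c 2 * c 3 * (cmod (b 2 * a 3 - b 3 * a 2))^2
   + c 3 * c 1 * (cmod (b 3 * a 1 - b 1 * a 3))^2" unfolding cmod_power2 by (simp add: power2_eq_square algebra_simps)

text \<open>With \<open>S\<close> the Hermitian product of the curve and its derivative and \<open>M\<close> the
 squared norm of the derivative, the Laplacian is \<open>4 (N M - |S|^2) / N^2\<close>; the numerator is a case
 of the Lagrange identity.\<close>

lemma laplacian_ln_sum_squares: fixes F :: "nat => complex => complex" and c :: "nat => real"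
 assumes U: "open U" and F: "!!i. i \<in> {1,2,3} ==> F i holomorphic_on U"
 defines "N \<equiv> %w. c 1 * (cmod (F 1 w))^2 + c 2 * (cmod (F 2 w))^2 + c 3 * (cmod (F 3 w))^2"
 assumes pos: "!!w. w \<in> U ==> N w > 0" shows "C2_on U (%w. ln (N w))"
  "!!w. w \<in> U ==> laplacian (%w. ln (N w)) w =
   4 * (c 1 * c 2 * (cmod (wronskian2 (F 1) (F 2) w))^2 + c 2 * c 3 * (cmod (wronskian2 (F 2) (F 3) w))^2
    + c 3 * c 1 * (cmod (wronskian2 (F 3) (F 1) w))^2) / (N w)^2" proof -
 let ?L = "%w. ln (N w)"
 define S where "S = (%w. c 1 * cnj (F 1 w) * deriv (F 1) w + c 2 * cnj (F 2 w) * deriv (F 2) w + c 3 * cnj (F 3 w) * deriv (F 3) w)"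
 define T where "T = (%w. c 1 * cnj (F 1 w) * deriv (deriv (F 1)) w + c 2 * cnj (F 2 w) * deriv (deriv (F 2)) w + c 3 * cnj (F 3 w) * deriv (deriv (F 3)) w)"
 define M where "M = (%w. c 1 * (cmod (deriv (F 1) w))^2 + c 2 * (cmod (deriv (F 2) w))^2 + c 3 * (cmod (deriv (F 3) w))^2)"
 have ev: "\<forall>\<^sub>F x in nhds w. P x" if "w \<in> U" "!!x. x \<in> U ==> P x" for w P
  using that U eventually_nhds by blast
 have F1: "(F i has_field_derivative deriv (F i) x) (at x)" if "i \<in> {1,2,3}" "x \<in> U" for i x
  using F U that holomorphic_derivI by blast
 have F': "deriv (F i) holomorphic_on U" if "i \<in> {1,2,3}" for i using F U that holomorphic_deriv by blast
 have F2: "(deriv (F i) has_field_derivative deriv (deriv (F i)) x) (at x)" if "i \<in> {1,2,3}" "x \<in> U" for i x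
  using F' U that holomorphic_derivI by blast
 have F'': "deriv (deriv (F i)) holomorphic_on U" if "i \<in> {1,2,3}" for i using F' U that holomorphic_deriv by blast
 have dN: "(N has_derivative (%h. 2 * Re (S x * h))) (at x)" if "x \<in> U" for x proof -
  have "(N has_derivative (%h. c 1 * (2 * Re (cnj (F 1 x) * deriv (F 1) x * h)) + c 2 * (2 * Re (cnj (F 2 x) * deriv (F 2) x * h))
    + c 3 * (2 * Re (cnj (F 3 x) * deriv (F 3) x * h)))) (at x)" unfolding N_def
   by (intro has_derivative_add has_derivative_mult_right has_derivative_cmod_square F1 that) auto
  thus ?thesis by (rule has_derivative_eq_rhs) (auto simp: S_def algebra_simps)
 qed
 have dS: "(S has_derivative (%h. of_real (M x) * cnj h + T x * h)) (at x)" if "x \<in> U" for x proof -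
  have 1: "((%x. cnj (F i x)) has_derivative (%h. cnj (deriv (F i) x * h))) (at x)" if "i \<in> {1,2,3}" for i
   using F1[OF that \<open>x \<in> U\<close>] unfolding has_field_derivative_def
   by (rule bounded_linear.has_derivative[OF bounded_linear_cnj])
  have 2: "(deriv (F i) has_derivative (%h. deriv (deriv (F i)) x * h)) (at x)" if "i \<in> {1,2,3}" for i
   using F2[OF that \<open>x \<in> U\<close>] unfolding has_field_derivative_def .
  have "(S has_derivative (%h.
    (c 1 * cnj (F 1 x) * (deriv (deriv (F 1)) x * h) + c 1 * cnj (deriv (F 1) x * h) * deriv (F 1) x)
   + (c 2 * cnj (F 2 x) * (deriv (deriv (F 2)) x * h) + c 2 * cnj (deriv (F 2) x * h) * deriv (F 2) x)
   + (c 3 * cnj (F 3 x) * (deriv (deriv (F 3)) x * h) + c 3 * cnj (deriv (F 3) x * h) * deriv (F 3) x))) (at x)"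
   unfolding S_def by (intro has_derivative_add has_derivative_mult has_derivative_mult_right 1 2) auto
  thus ?thesis
   by (rule has_derivative_eq_rhs) (auto simp: M_def T_def complex_norm_square algebra_simps simp del: of_real_power)
 qed
 have Npos: "N x > 0" if "x \<in> U" for x using pos that by auto
 have dL: "(?L has_derivative (%h. 2 * Re (S x * h) / N x)) (at x)" if "x \<in> U" for x
  by (rule has_derivative_eq_rhs[OF has_derivative_ln[OF Npos[OF that] dN[OF that]]]) (auto simp: field_simps)
 have p: "partial1 ?L x = 2 * Re (S x) / N x" "partial2 ?L x = - 2 * Im (S x) / N x" if "x \<in> U" for x
  using partial_eqI[OF dL[OF that]] by auto
 have dq: "((%x. 2 * Re (S x) / N x) has_derivative (%h. (2 * Re (of_real (M x) * cnj h + T x * h) * N x - 2 * Re (S x) * (2 * Re (S x * h))) / (N x * N x))) (at x)"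
  "((%x. -2 * Im (S x) / N x) has_derivative (%h. (-2 * Im (of_real (M x) * cnj h + T x * h) * N x - (- 2 * Im (S x)) * (2 * Re (S x * h))) / (N x * N x))) (at x)"
  if "x \<in> U" for x using Npos[OF that]
  by (intro has_derivative_divide' has_derivative_mult_right bounded_linear.has_derivative[OF bounded_linear_Re]
    bounded_linear.has_derivative[OF bounded_linear_Im] dS dN that; simp)+
 have pp: "partial1 (partial1 ?L) x = (2 * (M x + Re (T x)) * N x - 4 * (Re (S x))^2) / (N x)^2"
  "partial2 (partial2 ?L) x = (2 * (M x - Re (T x)) * N x - 4 * (Im (S x))^2) / (N x)^2" if "x \<in> U" for x
  using partial_cong(1)[OF ev[OF that p(1)]] partial_cong(2)[OF ev[OF that p(2)]]
   partial_eqI(1)[OF dq(1)[OF that]] partial_eqI(2)[OF dq(2)[OF that]] by (auto simp: power2_eq_square algebra_simps)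
 have "?L differentiable (at x)" "partial1 ?L differentiable (at x)" "partial2 ?L differentiable (at x)" if "x \<in> U" for x
  using dL[OF that] dq[OF that] differentiable_cong[OF ev[OF that p(1)]] differentiable_cong[OF ev[OF that p(2)]]
  by (auto simp: differentiable_def)
 moreover have "continuous_on U N" "continuous_on U M" "continuous_on U T" "continuous_on U S" unfolding N_def M_def T_def S_def
  by (intro continuous_intros continuous_on_cnj holomorphic_on_imp_continuous_on[OF F]
    holomorphic_on_imp_continuous_on[OF F'] holomorphic_on_imp_continuous_on[OF F'']; simp)+
 hence "continuous_on U (partial1 (partial1 ?L))" "continuous_on U (partial2 (partial2 ?L))"
  using Npos by (auto simp: pp cong: continuous_on_cong intro!: continuous_intros dest: Npos less_imp_neq)
 ultimately show "C2_on U ?L" by (auto simp: C2_on_def)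
 fix w assume w: "w \<in> U"
 have "laplacian ?L w = 4 * (N w * M w - (cmod (S w))^2) / (N w)^2"
  unfolding laplacian_def pp[OF w] cmod_power2 by (simp add: add_divide_distrib[symmetric] algebra_simps)
 also have "N w * M w - (cmod (S w))^2 = c 1 * c 2 * (cmod (wronskian2 (F 1) (F 2) w))^2 + c 2 * c 3 * (cmod (wronskian2 (F 2) (F 3) w))^2
    + c 3 * c 1 * (cmod (wronskian2 (F 3) (F 1) w))^2" unfolding N_def M_def S_def wronskian2_def by (rule lagrange_identity3)
 finally show "laplacian ?L w = 4 * (c 1 * c 2 * (cmod (wronskian2 (F 1) (F 2) w))^2 + c 2 * c 3 * (cmod (wronskian2 (F 2) (F 3) w))^2
    + c 3 * c 1 * (cmod (wronskian2 (F 3) (F 1) w))^2) / (N w)^2" .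
qed

section \<open>Local integrability and the fundamental solution\<close>

text \<open>Integration in polar coordinates. The minus sign makes the half-lines \<open>{x<..}\<close> pull
 back to discs, which have finite area.\<close>

lemma distr_minus_norm_square:
 "distr lborel borel (%w::complex. - (cmod w)\<^sup>2) = density lborel (%r. ennreal pi * indicator {..0} r)" (is "?M = ?N")
proof (rule measure_eqI_lessThan)
 show "sets ?M = sets borel" "sets ?N = sets borel" by auto
 have M: "emeasure ?M {x<..} = ennreal (pi * max 0 (-x))" for x proof -
  have "emeasure ?M {x<..} = emeasure lborel ((%w::complex. - (cmod w)\<^sup>2) -` {x<..})" by (subst emeasure_distr) auto
  also have "(%w::complex. - (cmod w)\<^sup>2) -` {x<..} = (if x < 0 then ball 0 (sqrt (-x)) else {})" proof (cases "x < 0")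
   case True
   have "cmod w < sqrt (- x) \<longleftrightarrow> x < - (cmod w)\<^sup>2" for w :: complex
    using True real_less_rsqrt[of "cmod w" "-x"] real_sqrt_less_iff[of "(cmod w)^2" "-x"] by auto
   with True show ?thesis by (auto simp: dist_norm)
  next
   case False
   thus ?thesis by (auto simp: not_less) (smt (verit) zero_le_power2)
  qed
  finally show ?thesis using emeasure_ball[of "sqrt (-x)" "0::complex"] by (auto simp: unit_ball_vol_2)
 qed
 show "emeasure ?M {x<..} < \<infinity>" for x unfolding M by simp
 show "emeasure ?M {x<..} = emeasure ?N {x<..}" for x proof -
  have "emeasure ?N {x<..} = (\<integral>\<^sup>+r. ennreal pi * indicator {..0} r * indicator {x<..} r \<partial>lborel)"
   by (subst emeasure_density) auto
  also have "... = (\<integral>\<^sup>+r. ennreal pi * indicator {x<..0} r \<partial>lborel)"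
   by (intro nn_integral_cong) (auto simp: indicator_def)
  also have "... = ennreal pi * emeasure lborel {x<..0}" by (subst nn_integral_cmult_indicator) auto
  also have "... = ennreal (pi * max 0 (-x))" by (cases "x <= 0") (auto simp: ennreal_mult[symmetric])
  finally show ?thesis unfolding M ..
 qed
qed

lemma nn_integral_radial: assumes [measurable]: "F \<in> borel_measurable borel"
 shows "(\<integral>\<^sup>+(w::complex). F ((cmod w)^2) \<partial>lborel) = ennreal pi * (\<integral>\<^sup>+r. F r * indicator {0..} r \<partial>lborel)"
proof -
 have "(\<integral>\<^sup>+(w::complex). F ((cmod w)^2) \<partial>lborel) = (\<integral>\<^sup>+r. F (- r) \<partial>(distr lborel borel (%w::complex. - (cmod w)\<^sup>2)))"
  by (subst nn_integral_distr) auto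
 also have "... = (\<integral>\<^sup>+r. ennreal pi * indicator {..0} r * F (- r) \<partial>lborel)"
  unfolding distr_minus_norm_square by (subst nn_integral_density) auto
 also have "... = (\<integral>\<^sup>+r. ennreal pi * (indicator {..0} (-r) * F r) \<partial>lborel)"
  by (subst nn_integral_real_affine[of _ "-1" 0]) (auto simp: mult.assoc)
 also have "... = ennreal pi * (\<integral>\<^sup>+r. F r * indicator {0..} r \<partial>lborel)"
  by (subst nn_integral_cmult) (auto intro!: arg_cong2[where f="(*)"] nn_integral_cong simp: mult.commute split: split_indicator)
 finally show ?thesis .
qed

text \<open>The integrand is the Laplacian of \<open>ln (1 + |w|^2) / 2\<close>, a smooth version of \<open>ln
 |w|\<close>. This is the mass that the fundamental solution inherits.\<close>

lemma integral_poisson_kernel: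
 "has_bochner_integral lborel (%w::complex. 2 / (1 + (cmod w)^2)^2) (2 * pi)" proof (rule has_bochner_integral_nn_integral)
 have "(\<integral>\<^sup>+(w::complex). ennreal (2 / (1 + (cmod w)^2)^2) \<partial>lborel) =
   ennreal pi * (\<integral>\<^sup>+r. ennreal (2 / (1 + r)^2) * indicator {0..} r \<partial>lborel)"
  by (rule nn_integral_radial[of "%r. ennreal (2 / (1 + r)^2)"]) auto
 also have "(\<integral>\<^sup>+r. ennreal (2 / (1 + r)^2) * indicator {0..} r \<partial>lborel) = ennreal (0 - (%r. - 2 / (1 + r)) 0)"
 proof (rule nn_integral_FTC_atLeast)
  show "((%r::real. - 2 / (1 + r)) has_real_derivative 2 / (1 + x)^2) (at x)" if "0 <= x" for x
   using that by (auto intro!: derivative_eq_intros simp: power2_eq_square field_simps)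
  show "((%r::real. - 2 / (1 + r)) \<longlongrightarrow> 0) at_top"
   by (intro tendsto_divide_0[OF tendsto_const] filterlim_at_top_imp_at_infinity filterlim_tendsto_add_at_top[OF tendsto_const] filterlim_ident)
 qed auto
 also have "ennreal pi * ennreal (0 - (%r. - 2 / (1 + r)) 0) = ennreal (2 * pi)"
  by (subst ennreal_mult[symmetric]) (auto simp: mult.commute)
 finally show "(\<integral>\<^sup>+(w::complex). ennreal (2 / (1 + (cmod w)^2)^2) \<partial>lborel) = ennreal (2 * pi)" .
qed auto

text \<open>In the variable \<open>r = |w - p|^2\<close> the area element is \<open>pi dr\<close>, and \<open>r
 powr (a / 2)\<close> is integrable at 0.\<close>

lemma integrable_powr_cball: assumes "a > -2"
 shows "set_integrable lborel (cball p 1) (%w::complex. cmod (w - p) powr a)" proof -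
 define b where "b = a / 2"
 have [measurable]: "cball (0::complex) 1 \<in> sets borel" "cball p 1 \<in> sets borel" by auto
 have b: "b > -1" using assms by (simp add: b_def)
 have fin: "(\<integral>\<^sup>+r. ennreal (r powr b * indicator {0<..<1} r) \<partial>lborel) < \<infinity>" proof -
  have "set_integrable lborel (einterval 0 1) (%r. r powr b)" proof (rule interval_integral_FTC_nonneg)
   show "((%r. r powr (b+1) / (b+1)) has_real_derivative x powr b) (at x)" if "0 < ereal x" for x
    using that b by (auto intro!: derivative_eq_intros)
   have "((%r::real. r powr (b+1) / (b+1)) \<longlongrightarrow> 0) (at_right 0)"
    using b tendsto_powr'[of "%r. r" 0 "at_right 0" "%_. b + 1" "b + 1"] eventually_at_right_less[of 0]
    by (auto intro!: tendsto_eq_intros simp: eventually_at_filter)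
   thus "((((%r. r powr (b+1) / (b+1)) \<circ> real_of_ereal)) \<longlongrightarrow> 0) (at_right 0)"
    by (simp add: zero_ereal_def ereal_tendsto_simps)
   have "((%r::real. r powr (b+1) / (b+1)) \<longlongrightarrow> 1 / (b+1)) (at_left 1)"
    using b by (auto intro!: tendsto_eq_intros)
   thus "((((%r. r powr (b+1) / (b+1)) \<circ> real_of_ereal)) \<longlongrightarrow> 1 / (b+1)) (at_left 1)"
    by (simp add: one_ereal_def ereal_tendsto_simps)
  qed (auto intro!: continuous_intros)
  hence "integrable lborel (%r::real. r powr b * indicator {0<..<1} r)"
   by (simp add: set_integrable_def zero_ereal_def one_ereal_def mult.commute)
  thus ?thesis unfolding integrable_iff_bounded by (auto simp: abs_mult)
 qed
 have "(\<integral>\<^sup>+(w::complex). ennreal (((cmod w)^2) powr b * indicator {0<..<1} ((cmod w)^2)) \<partial>lborel) < \<infinity>"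
 proof -
  have "(\<integral>\<^sup>+(w::complex). ennreal (((cmod w)^2) powr b * indicator {0<..<1} ((cmod w)^2)) \<partial>lborel)
   = ennreal pi * (\<integral>\<^sup>+r. ennreal (r powr b * indicator {0<..<1} r) * indicator {0..} r \<partial>lborel)"
   by (rule nn_integral_radial[of "%r. ennreal (r powr b * indicator {0<..<1} r)"]) auto
  also have "(\<integral>\<^sup>+r. ennreal (r powr b * indicator {0<..<1} r) * indicator {0..} r \<partial>lborel)
   = (\<integral>\<^sup>+r. ennreal (r powr b * indicator {0<..<1} r) \<partial>lborel)"
   by (intro nn_integral_cong) (auto simp: indicator_def)
  finally show ?thesis using fin by (simp add: ennreal_mult_less_top)
 qed
 hence "integrable lborel (%w::complex. ((cmod w)^2) powr b * indicator {0<..<1} ((cmod w)^2))"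
  unfolding integrable_iff_bounded by auto
 hence "integrable lborel (%w::complex. ((cmod w)^2) powr b * indicator {0<..<1} ((cmod w)^2) + indicator (cball 0 1) w)"
  using emeasure_lborel_cball_finite[of "0::complex" 1]
  by (intro Bochner_Integration.integrable_add integrable_real_indicator) auto
 hence "integrable (distr lborel borel ((+) (-p))) (%w::complex. ((cmod w)^2) powr b * indicator {0<..<1} ((cmod w)^2) + indicator (cball 0 1) w)"
  by (simp add: lborel_distr_plus)
 hence i: "integrable lborel (%w. ((cmod (w - p))^2) powr b * indicator {0<..<1} ((cmod (w - p))^2) + indicator (cball 0 1) (w - p))"
  by (subst (asm) integrable_distr_eq) auto
 show ?thesis unfolding set_integrable_def proof (rule Bochner_Integration.integrable_bound[OF i], goal_cases)
  case 1
  show ?case by measurable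
 next
  case 2
  show ?case proof (rule AE_I2)
   fix w
   let ?r = "cmod (w - p)"
   have "?r powr a * indicator (cball p 1) w <= ?r\<^sup>2 powr b * indicator {0<..<1} (?r^2) + indicator (cball 0 1) (w - p)"
   proof (cases "?r = 0 | ?r >= 1")
    case True
    thus ?thesis by (auto simp: indicator_def dist_norm norm_minus_commute)
   next
    case False
    hence "?r powr a = ?r\<^sup>2 powr b" by (simp add: b_def powr_powr flip: powr_numeral)
    moreover have "?r^2 < 1" "?r^2 > 0" using False by (auto simp: abs_square_less_1)
    ultimately show ?thesis by (auto simp: indicator_def)
   qed
   thus "norm (indicat_real (cball p 1) w *\<^sub>R cmod (w - p) powr a)
      <= norm (?r\<^sup>2 powr b * indicator {0<..<1} (?r^2) + indicator (cball 0 1) (w - p))" by (simp add: mult.commute)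
  qed
 qed
qed

lemma locally_integrable_isolated: fixes f :: "complex => real" assumes P: "finite P" and cont: "continuous_on (-P) f"
  and bd: "!!p. p \<in> P ==> EX C a. a > -2 & (\<forall>\<^sub>F w in at p. \<bar>f w\<bar> <= C * cmod (w - p) powr a)"
 shows "locally_integrable f" unfolding locally_integrable_def proof (intro allI impI)
 fix K :: "complex set" assume K: "compact K"
 have [measurable]: "f \<in> borel_measurable borel"
  by (rule borel_measurable_continuous_countable_exceptions[of P]) (use P cont in \<open>auto intro: countable_finite\<close>)
 have "\<exists>r>0. set_integrable lborel (ball p r) f" if "p \<in> P" for p proof -
  obtain C a where a: "a > -2" "\<forall>\<^sub>F w in at p. \<bar>f w\<bar> <= C * cmod (w - p) powr a" using bd[OF \<open>p \<in> P\<close>] by auto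
  then obtain r0 where r0: "r0 > 0" "!!w. w ~= p ==> dist w p < r0 ==> \<bar>f w\<bar> <= C * cmod (w - p) powr a"
   unfolding eventually_at by auto
  define r where "r = min r0 1"
  have r: "r > 0" "r <= r0" "r <= 1" using r0 by (auto simp: r_def)
  have "set_integrable lborel (ball p r) (%w. C * cmod (w - p) powr a)"
   by (rule set_integrable_subset[OF set_integrable_mult_right[OF integrable_powr_cball[OF a(1), of p]]]) (use r in auto)
  hence "set_integrable lborel (ball p r) (%w. if w = p then f p else C * cmod (w - p) powr a)" unfolding set_integrable_def
   by (subst integrable_discrete_difference[where X="{p}" and g="%w. indicator (ball p r) w *\<^sub>R (C * cmod (w - p) powr a)"]) auto
  hence "set_integrable lborel (ball p r) f" proof (rule set_integrable_bound)
   have [measurable]: "ball p r \<in> sets borel" by auto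
   show "set_borel_measurable lborel (ball p r) f" unfolding set_borel_measurable_def by measurable
   have "abs (f x) <= abs (C * cmod (x - p) powr a)" if "x ~= p" "dist x p < r" for x using r0(2)[of x] r that by linarith
   thus "AE x in lborel. x \<in> ball p r --> norm (f x) <= norm (if x = p then f p else C * cmod (x - p) powr a)"
    by (intro AE_I2) (auto simp: dist_commute)
  qed
  thus ?thesis using r by auto
 qed
 then obtain r where r: "!!p. p \<in> P ==> r p > 0 & set_integrable lborel (ball p (r p)) f" by metis
 have m: "K \<in> sets borel" "(\<Union>p\<in>P. ball p (r p)) \<in> sets borel"
  using borel_compact[OF K] borel_open[OF open_UN[of P "%p. ball p (r p)"]] by auto
 define K' where "K' = K - (\<Union>p\<in>P. ball p (r p))"
 have "compact K'" unfolding K'_def by (intro compact_diff K open_UN ballI open_ball)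
 moreover have "continuous_on K' f" by (rule continuous_on_subset[OF cont]) (use r in \<open>force simp: K'_def\<close>)
 ultimately have "set_integrable lborel K' f" unfolding set_integrable_def by (rule borel_integrable_compact)
 moreover have "set_integrable lborel (\<Union>p\<in>P. ball p (r p)) f" by (rule set_integrable_UN) (use P r in auto)
 ultimately have "set_integrable lborel (K' \<union> (\<Union>p\<in>P. ball p (r p))) f"
  by (rule set_integrable_Un) (simp_all add: K'_def m sets.Diff)
 thus "set_integrable lborel K f" by (rule set_integrable_subset) (use m in \<open>auto simp: K'_def\<close>)
qed

lemma locally_integrable_mult_test:
 assumes N: "locally_integrable N" and phi: "continuous_on UNIV u" "!!w. cmod w > R ==> u w = 0"
 shows "integrable lborel (%w. N w * u w)" proof -
 have "compact (u ` cball 0 R)" by (intro compact_continuous_image continuous_on_subset[OF phi(1)]) auto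
 then obtain B where B: "!!w. cmod w <= R ==> \<bar>u w\<bar> <= B"
  using compact_imp_bounded[of "u ` cball 0 R"] unfolding bounded_iff by (metis imageI mem_cball_0 real_norm_def)
 have "set_integrable lborel (cball 0 R) N" using N by (auto simp: locally_integrable_def)
 hence i: "integrable lborel (%w. B * (indicator (cball 0 R) w *\<^sub>R N w))"
  unfolding set_integrable_def by (rule integrable_mult_right)
 have m: "u \<in> borel_measurable lborel" using borel_measurable_continuous_onI[OF phi(1)] by simp
 have "(%w. indicator (cball 0 R) w *\<^sub>R N w) \<in> borel_measurable lborel"
  using \<open>set_integrable lborel (cball 0 R) N\<close> unfolding set_integrable_def by (rule borel_measurable_integrable)
 hence "(%w. (indicator (cball 0 R) w *\<^sub>R N w) * u w) \<in> borel_measurable lborel" using m by measurable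
 moreover have "(%w. (indicator (cball 0 R) w *\<^sub>R N w) * u w) = (%w. N w * u w)"
  using phi(2) by (auto simp: fun_eq_iff indicator_def)
 ultimately have "(%w. N w * u w) \<in> borel_measurable lborel" by simp
 with i show ?thesis proof (rule Bochner_Integration.integrable_bound)
  show "AE w in lborel. norm (N w * u w) <= norm (B * (indicator (cball 0 R) w *\<^sub>R N w))" proof (rule AE_I2)
   fix w
   show "norm (N w * u w) <= norm (B * (indicator (cball 0 R) w *\<^sub>R N w))"
   proof (cases "cmod w <= R")
    case True
    hence "abs (u w) <= abs B" using B[of w] by linarith
    thus ?thesis using True by (simp add: abs_mult mult.commute[of "abs (N w)"] mult_right_mono)
   qed (use phi(2)[of w] in auto)
  qed
 qed
qed

lemma lborel_integral_scale: fixes f :: "complex => real" assumes "c > 0" and [measurable]: "f \<in> borel_measurable borel"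
 shows "(\<integral>w. f w \<partial>lborel) = (\<integral>u. c^2 * f (p + c *\<^sub>R u) \<partial>lborel)" proof -
 have "(\<integral>w. f w \<partial>lborel) = (\<integral>w. f w \<partial>(density (distr lborel borel (%x. p + c *\<^sub>R x)) (%_. ennreal (c^2))))"
  using lborel_affine[of c p] assms by simp
 also have "... = (\<integral>w. c^2 * f w \<partial>(distr lborel borel (%x. p + c *\<^sub>R x)))"
  by (subst integral_density) auto
 also have "... = (\<integral>u. c^2 * f (p + c *\<^sub>R u) \<partial>lborel)"
  by (subst integral_distr) auto
 finally show ?thesis .
qed

lemma abs_ln_le: "x > 0 ==> \<bar>ln x\<bar> <= x + 1 / x" for x :: real proof -
 assume x: "x > 0"
 have "- ln x <= 1 / x - 1" using ln_le_minus_one[of "1/x"] x by (simp add: ln_div)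
 moreover have "ln x <= x - 1" "1 / x > 0" using ln_le_minus_one x by auto
 ultimately show ?thesis using x by linarith
qed

lemma ln_bound_near: fixes p :: complex
 shows "\<forall>\<^sub>F w in at p. \<bar>ln (cmod (w - p))\<bar> <= 2 * cmod (w - p) powr -1 & 1 <= cmod (w - p) powr -1"
 unfolding eventually_at proof (intro exI[of _ 1] conjI ballI impI)
 fix w assume "w ~= p & dist w p < 1"
 hence r: "0 < cmod (w - p)" "cmod (w - p) < 1" by (auto simp: dist_norm)
 hence "cmod (w - p) <= 1 / cmod (w - p)" using mult_le_one[of "cmod (w - p)" "cmod (w - p)"] by (simp add: le_divide_eq)
 thus "abs (ln (cmod (w - p))) <= 2 * cmod (w - p) powr -1" "1 <= cmod (w - p) powr -1"
  using abs_ln_le[OF r(1)] r by (simp_all add: powr_minus_divide)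
qed auto

lemma locally_integrable_ln: "locally_integrable (%w. ln (cmod (w - p)))" proof (rule locally_integrable_isolated[of "{p}"])
 show "continuous_on (- {p}) (%w. ln (cmod (w - p)))" by (intro continuous_intros) auto
 have "\<forall>\<^sub>F w in at p. \<bar>ln (cmod (w - p))\<bar> <= 2 * cmod (w - p) powr -1" using ln_bound_near by eventually_elim simp
 thus "EX C a. -2 < a & (\<forall>\<^sub>F w in at q. \<bar>ln (cmod (w - p))\<bar> <= C * cmod (w - q) powr a)" if "q \<in> {p}" for q
  using that by (intro exI[of _ 2] exI[of _ "-1"]) auto
qed auto

text \<open>The argument of the logarithm is the squared norm of the curve \<open>(w - p, e)\<close>, whose
 Wronskian is \<open>e\<close>. The case \<open>e = 0\<close> says that \<open>ln |w - p|\<close> is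
 harmonic.\<close>

lemma laplacian_ln_regularized: fixes e :: real assumes U: "open U" and pos: "!!w. w \<in> U ==> (cmod (w - p))^2 + e^2 > 0"
 shows "C2_on U (%w. ln ((cmod (w - p))^2 + e^2) / 2)"
  "!!w. w \<in> U ==> laplacian (%w. ln ((cmod (w - p))^2 + e^2) / 2) w = 2 * e^2 / ((cmod (w - p))^2 + e^2)^2" proof -
 define F where "F = (%i w. if i = (1::nat) then w - p else of_real e)"
 define c where "c = (%i. if i = (3::nat) then 0 else (1::real))"
 have eq: "c 1 * (cmod (F 1 w))^2 + c 2 * (cmod (F 2 w))^2 + c 3 * (cmod (F 3 w))^2 = (cmod (w - p))^2 + e^2" for w
  by (simp add: c_def F_def)
 have hol: "F i holomorphic_on U" for i by (cases "i = 1") (auto simp: F_def intro!: holomorphic_intros)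
 note * = laplacian_ln_sum_squares[of U F c, unfolded eq, OF U hol pos]
 have w2: "wronskian2 (F 1) (F 2) w = of_real e" for w by (simp add: wronskian2_def F_def[abs_def])
 have L: "(%w. ln ((cmod (w - p))^2 + e^2) / 2) = (%w. (1/2) * ln ((cmod (w - p))^2 + e^2) + 0 * ln ((cmod (w - p))^2 + e^2))" by auto
 show "C2_on U (%w. ln ((cmod (w - p))^2 + e^2) / 2)" unfolding L by (intro C2_on_lincomb * U)
 fix w assume w: "w \<in> U"
 have D: "laplacian (%w. ln ((cmod (w - p))^2 + e^2)) w = 4 * e^2 / ((cmod (w - p))^2 + e^2)^2"
  using w by (subst *(2)) (auto simp: w2 c_def simp del: One_nat_def)
 show "laplacian (%w. ln ((cmod (w - p))^2 + e^2) / 2) w = 2 * e^2 / ((cmod (w - p))^2 + e^2)^2"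
  unfolding L using C2_on_lincomb(2)[OF U *(1) *(1) w, where a = "1/2" and b = 0] D by simp
qed

lemma laplacian_zero_outside: assumes "!!w. cmod w > R ==> u w = 0" "cmod w > R"
 shows "u w = 0" "partial1 u w = 0" "partial2 u w = 0" "laplacian u w = 0" proof -
 have o: "open {w::complex. cmod w > R}" by (intro open_Collect_less continuous_intros)
 have zero: "partial1 (%_. 0) w = 0" "partial2 (%_. 0) w = 0" for w using partial_eqI[of "%_. 0" "%_. 0" w] by auto
 have p0: "partial1 F w = 0" "partial2 F w = 0" if "cmod w > R" "!!x. cmod x > R ==> F x = 0" for F w proof -
  have "\<forall>\<^sub>F x in nhds w. F x = 0" using that o eventually_nhds by blast
  from partial_cong[OF this] show "partial1 F w = 0" "partial2 F w = 0" by (simp_all add: zero)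
 qed
 show "u w = 0" using assms by auto
 show "partial1 u w = 0" "partial2 u w = 0" using p0 assms by auto
 have "partial1 (partial1 u) w = 0" "partial2 (partial2 u) w = 0"
  using assms p0(1)[of w "partial1 u"] p0(2)[of w "partial2 u"] p0[of _ u] by auto
 thus "laplacian u w = 0" by (simp add: laplacian_def)
qed

text \<open>Green's identity holds for the regularized logarithm \<open>L n\<close>. Its Laplacian \<open>k
 n\<close> is a fixed kernel of mass \<open>2 pi\<close>, rescaled to concentrate at \<open>p\<close>.\<close>

lemma integral_ln_laplacian: assumes phi: "C2_on UNIV f" "!!w. cmod w > R ==> f w = 0"
 shows "(\<integral>w. ln (cmod (w - p)) * laplacian f w \<partial>lborel) = 2 * pi * f p" proof -
 define e where "e = (%n. inverse (real (Suc n)))"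
 have e: "e n > 0" "e n <= 1" for n by (auto simp: e_def inverse_le_1_iff)
 have e0: "e \<longlonglongrightarrow> 0" unfolding e_def by (rule LIMSEQ_inverse_real_of_nat)
 define L where "L = (%n w. ln ((cmod (w - p))^2 + (e n)^2) / 2)"
 define k where "k = (%n w. 2 * (e n)^2 / ((cmod (w - p))^2 + (e n)^2)^2)"
 have pos: "(cmod (w - p))^2 + (e n)^2 > 0" for w n using e[of n] by (simp add: add_nonneg_pos)
 have C2: "C2_on UNIV (L n)" and lap: "laplacian (L n) w = k n w" for n w
  unfolding L_def k_def using pos by (auto intro: laplacian_ln_regularized)
 have c: "continuous_on UNIV f" "continuous_on UNIV (laplacian f)"
  using C2_on_continuous[OF phi(1)] by auto
 have cL: "continuous_on UNIV (L n)" "continuous_on UNIV (k n)" for n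
  unfolding L_def k_def using pos e[of n] by (auto intro!: continuous_intros)
 have lp0: "laplacian f w = 0" if "cmod w > R" for w using laplacian_zero_outside[OF phi(2) that] by auto
 have green: "(\<integral>w. L n w * laplacian f w \<partial>lborel) = (\<integral>w. f w * k n w \<partial>lborel)" for n
 proof -
  have "(\<integral>w. L n w * laplacian f w - f w * laplacian (L n) w \<partial>lborel) = 0"
   by (rule green_identity(1)[OF open_UNIV C2 phi(1), of "cball 0 R"]) (use phi(2) in auto)
  moreover have "integrable lborel (%w. L n w * laplacian f w)" "integrable lborel (%w. f w * k n w)"
   using c cL phi(2) lp0 by (auto intro!: integrable_continuous_support[of _ R] continuous_intros)
  ultimately show ?thesis unfolding lap by simp
 qed
 have "(%n. \<integral>w. f w * k n w \<partial>lborel) \<longlonglongrightarrow> (\<integral>u. f p * (2 / (1 + (cmod u)^2)^2) \<partial>lborel)"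
 proof -
  have [measurable]: "f \<in> borel_measurable borel" "k n \<in> borel_measurable borel" for n
   using c cL by (auto intro!: borel_measurable_continuous_onI)
  have sc: "(\<integral>w. f w * k n w \<partial>lborel) = (\<integral>u. f (p + e n *\<^sub>R u) * (2 / (1 + (cmod u)^2)^2) \<partial>lborel)" for n
  proof -
   have kk: "(e n)^2 * (f (p + e n *\<^sub>R u) * k n (p + e n *\<^sub>R u)) = f (p + e n *\<^sub>R u) * (2 / (1 + (cmod u)^2)^2)" for u
   proof -
    have "(cmod (e n *\<^sub>R u))^2 + (e n)^2 = (e n)^2 * (1 + (cmod u)^2)" by (simp add: power_mult_distrib algebra_simps)
    hence "(e n)^2 * k n (p + e n *\<^sub>R u) = 2 / (1 + (cmod u)^2)^2"
     using e[of n] by (simp add: k_def power_mult_distrib power2_eq_square)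
    thus ?thesis by (metis mult.left_commute)
   qed
   have "(\<integral>w. f w * k n w \<partial>lborel) = (\<integral>u. (e n)^2 * (f (p + e n *\<^sub>R u) * k n (p + e n *\<^sub>R u)) \<partial>lborel)"
    by (rule lborel_integral_scale) (use e in auto)
   also have "... = (\<integral>u. f (p + e n *\<^sub>R u) * (2 / (1 + (cmod u)^2)^2) \<partial>lborel)" by (simp only: kk)
   finally show ?thesis .
  qed
  have "compact (f ` cball 0 R)" by (intro compact_continuous_image continuous_on_subset[OF c(1)]) auto
  then obtain B where B: "!!w. cmod w <= R ==> \<bar>f w\<bar> <= B"
   using compact_imp_bounded[of "f ` cball 0 R"] unfolding bounded_iff by (metis imageI mem_cball_0 real_norm_def)
  have B': "abs (f w) <= abs B" for w using B[of w] phi(2)[of w] by (cases "cmod w <= R") auto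
  show ?thesis unfolding sc proof (rule integral_dominated_convergence[where w="%u. abs B * (2 / (1 + (cmod u)^2)^2)"])
   show "integrable lborel (%u::complex. abs B * (2 / (1 + (cmod u)^2)^2))"
    using integral_poisson_kernel by (intro integrable_mult_right) (auto simp: has_bochner_integral_iff)
   show "AE u in lborel. (%n. f (p + e n *\<^sub>R u) * (2 / (1 + (cmod u)^2)^2)) \<longlonglongrightarrow> f p * (2 / (1 + (cmod u)^2)^2)"
   proof (rule AE_I2)
    fix u :: complex
    have "(%n. p + e n *\<^sub>R u) \<longlonglongrightarrow> p + 0 *\<^sub>R u" by (intro tendsto_intros e0)
    hence "(%n. f (p + e n *\<^sub>R u)) \<longlonglongrightarrow> f p"
     using c(1) by (intro isCont_tendsto_compose[of p f]) (auto simp: continuous_on_eq_continuous_at)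
    thus "(%n. f (p + e n *\<^sub>R u) * (2 / (1 + (cmod u)^2)^2)) \<longlonglongrightarrow> f p * (2 / (1 + (cmod u)^2)^2)"
     by (intro tendsto_mult tendsto_const)
   qed
   show "AE u in lborel. norm (f (p + e n *\<^sub>R u) * (2 / (1 + (cmod u)^2)^2)) <= abs B * (2 / (1 + (cmod u)^2)^2)" for n
    using B' by (intro AE_I2) (auto simp: abs_mult intro!: divide_right_mono mult_right_mono)
  qed measurable
 qed
 also have "(\<integral>(u::complex). f p * (2 / (1 + (cmod u)^2)^2) \<partial>lborel) = 2 * pi * f p"
  using has_bochner_integral_mult_right[OF integral_poisson_kernel, of "f p"] by (simp add: has_bochner_integral_iff mult.commute)
 finally have lim1: "(%n. \<integral>w. L n w * laplacian f w \<partial>lborel) \<longlonglongrightarrow> 2 * pi * f p" unfolding green .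
 have lim2: "(%n. \<integral>w. L n w * laplacian f w \<partial>lborel) \<longlonglongrightarrow> (\<integral>w. ln (cmod (w - p)) * laplacian f w \<partial>lborel)"
 proof (rule integral_dominated_convergence[where w="%w. \<bar>ln (cmod (w - p)) * laplacian f w\<bar> + abs (ln ((cmod (w - p))^2 + 1) / 2 * laplacian f w)"])
  have i: "integrable lborel (%w. ln (cmod (w - p)) * laplacian f w)"
   by (rule locally_integrable_mult_test[OF locally_integrable_ln c(2) lp0])
  have i2: "integrable lborel (%w. ln ((cmod (w - p))^2 + 1) / 2 * laplacian f w)"
  proof (rule integrable_continuous_support[of _ R])
   show "continuous_on UNIV (%w. ln ((cmod (w - p))^2 + 1) / 2 * laplacian f w)"
    by (intro continuous_intros c) (auto simp: add_nonneg_eq_0_iff)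
  qed (simp add: lp0)
  show "integrable lborel (%w. \<bar>ln (cmod (w - p)) * laplacian f w\<bar> + abs (ln ((cmod (w - p))^2 + 1) / 2 * laplacian f w))"
   by (intro Bochner_Integration.integrable_add integrable_abs i i2)
  show "(%w. ln (cmod (w - p)) * laplacian f w) \<in> borel_measurable lborel" using i by (rule borel_measurable_integrable)
  show "(%w. L n w * laplacian f w) \<in> borel_measurable lborel" for n
   using borel_measurable_continuous_onI[OF cL(1)] borel_measurable_continuous_onI[OF c(2)] by measurable
  show "AE w in lborel. (%n. L n w * laplacian f w) \<longlonglongrightarrow> ln (cmod (w - p)) * laplacian f w"
  proof (rule AE_mp[OF AE_lborel_singleton[of p]], rule AE_I2, rule impI)
   fix w assume "w ~= p"
   hence w: "cmod (w - p) > 0" by simp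
   hence "(%n. L n w) \<longlonglongrightarrow> ln ((cmod (w - p))^2 + 0^2) / 2"
    unfolding L_def by (intro tendsto_intros e0) auto
   also have "ln ((cmod (w - p))^2 + 0^2) / 2 = ln (cmod (w - p))" using w by (simp add: ln_realpow)
   finally show "(%n. L n w * laplacian f w) \<longlonglongrightarrow> ln (cmod (w - p)) * laplacian f w"
    by (intro tendsto_mult tendsto_const)
  qed
  show "AE w in lborel. norm (L n w * laplacian f w) <= abs (ln (cmod (w - p)) * laplacian f w) + abs (ln ((cmod (w - p))^2 + 1) / 2 * laplacian f w)" for n
  proof (rule AE_mp[OF AE_lborel_singleton[of p]], rule AE_I2, rule impI)
   fix w assume "w ~= p"
   hence w: "cmod (w - p) > 0" by simp
   have "ln ((cmod (w - p))^2) / 2 <= L n w" unfolding L_def using w by (intro divide_right_mono ln_mono) auto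
   moreover have "ln ((cmod (w - p))^2) / 2 = ln (cmod (w - p))" using w by (simp add: ln_realpow)
   moreover have "L n w <= ln ((cmod (w - p))^2 + 1) / 2"
    unfolding L_def using pos e[of n] by (intro divide_right_mono ln_mono add_left_mono) (auto simp: power_le_one)
   ultimately have "abs (L n w) <= abs (ln (cmod (w - p))) + abs (ln ((cmod (w - p))^2 + 1) / 2)" by linarith
   hence "abs (L n w) * abs (laplacian f w) <= (abs (ln (cmod (w - p))) + abs (ln ((cmod (w - p))^2 + 1) / 2)) * abs (laplacian f w)"
    by (intro mult_right_mono) auto
   thus "norm (L n w * laplacian f w) <= abs (ln (cmod (w - p)) * laplacian f w) + abs (ln ((cmod (w - p))^2 + 1) / 2 * laplacian f w)"
    by (simp add: abs_mult algebra_simps)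
  qed
 qed
 show ?thesis by (rule LIMSEQ_unique[OF lim2 lim1])
qed

section \<open>Logarithmic poles and Dirac masses\<close>

lemma C2_on_compose:
 assumes psi: "C2_on UNIV v" and G: "!!r. (G has_real_derivative G' r) (at r)" "!!r. (G' has_real_derivative G'' r) (at r)"
  and cont: "continuous_on UNIV G''" shows "C2_on UNIV (%w. G (v w))"
  "partial1 (%w. G (v w)) w = G' (v w) * partial1 v w"
  "partial2 (%w. G (v w)) w = G' (v w) * partial2 v w"
  "laplacian (%w. G (v w)) w = G'' (v w) * ((partial1 v w)^2 + (partial2 v w)^2) + G' (v w) * laplacian v w" proof -
 have D: "v differentiable (at w)" "partial1 v differentiable (at w)" "partial2 v differentiable (at w)" for w
  using C2_onD[OF psi] by auto
 have ch: "((%w. g (v w)) has_derivative (%h. g' (v w) * frechet_derivative v (at w) h)) (at w)"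
  if g: "!!r. (g has_real_derivative g' r) (at r)" for g g' w proof -
  have "(v has_derivative frechet_derivative v (at w)) (at w)" using D by (simp add: frechet_derivative_works)
  moreover have "(g has_derivative (%h. g' (v w) * h)) (at (v w))" using g by (simp add: has_field_derivative_def)
  ultimately show ?thesis by (rule has_derivative_compose)
 qed
 have p: "partial1 (%w. g (v w)) w = g' (v w) * partial1 v w" "partial2 (%w. g (v w)) w = g' (v w) * partial2 v w"
  if "!!r. (g has_real_derivative g' r) (at r)" for g g' w
  using partial_eqI[OF ch[OF that]] by (auto simp: partial1_def partial2_def)
 have d: "(%w. g (v w)) differentiable (at w)" if "!!r. (g has_real_derivative g' r) (at r)" for g g' w
  using ch[OF that] unfolding differentiable_def by blast
 have p': "partial1 (%w. G (v w)) = (%w. G' (v w) * partial1 v w)" "partial2 (%w. G (v w)) = (%w. G' (v w) * partial2 v w)"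
  using p[OF G(1)] by auto
 have pp: "partial1 (partial1 (%w. G (v w))) w = G'' (v w) * (partial1 v w)^2 + G' (v w) * partial1 (partial1 v) w"
  "partial2 (partial2 (%w. G (v w))) w = G'' (v w) * (partial2 v w)^2 + G' (v w) * partial2 (partial2 v) w" for w unfolding p'
  by (subst partial_mult[OF d[OF G(2)]], use D p[OF G(2)] in \<open>auto simp: power2_eq_square\<close>)+
 have cont': "continuous_on UNIV (%w. G'' (v w))" "continuous_on UNIV (%w. G' (v w))" proof -
  show "continuous_on UNIV (%w. G'' (v w))" by (rule continuous_on_compose2[OF cont C2_on_continuous(1)[OF psi]]) auto
  show "continuous_on UNIV (%w. G' (v w))"
   using d[OF G(2)] by (auto intro!: differentiable_imp_continuous_on differentiable_at_imp_differentiable_on)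
 qed
 have "continuous_on UNIV (partial1 (partial1 (%w. G (v w))))" "continuous_on UNIV (partial2 (partial2 (%w. G (v w))))"
  unfolding pp by (intro continuous_intros cont' C2_on_continuous[OF psi])+
 thus "C2_on UNIV (%w. G (v w))" unfolding C2_on_def p' using d[OF G(1)] d[OF G(2)] D by auto
 show "partial1 (%w. G (v w)) w = G' (v w) * partial1 v w"
  "partial2 (%w. G (v w)) w = G' (v w) * partial2 v w" by (simp_all add: p')
 show "laplacian (%w. G (v w)) w = G'' (v w) * ((partial1 v w)^2 + (partial2 v w)^2) + G' (v w) * laplacian v w"
  unfolding laplacian_def pp by (simp add: algebra_simps)
qed

lemma has_real_derivative_pos_part_power: assumes "n >= 2"
 shows "((%x::real. (max 0 x) ^ n) has_real_derivative real n * (max 0 x) ^ (n - 1)) (at x)"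
proof (cases x "0::real" rule: linorder_cases)
 case less
 have "((%x::real. 0) has_real_derivative real n * (max 0 x) ^ (n - 1)) (at x)"
  using less assms by (auto simp: max_def power_0_left)
 thus ?thesis by (rule has_field_derivative_transform_within_open[of _ _ _ "{..<0}"]) (use less assms in auto)
next
 case equal
 have "((%x::real. (max 0 x) ^ n / x) \<longlongrightarrow> 0) (at 0)"
 proof (rule Lim_null_comparison[where g="%x. abs x ^ (n - 1)"])
  show "\<forall>\<^sub>F x in at 0. norm ((max 0 x) ^ n / x) <= abs (x::real) ^ (n - 1)"
   unfolding eventually_at using assms by (intro exI[of _ 1]) (auto simp: max_def power_eq_if[of _ n] abs_mult)
  have "((%x::real. abs x ^ (n - 1)) \<longlongrightarrow> abs 0 ^ (n - 1)) (at 0)" by (intro tendsto_intros)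
  moreover have "abs (0::real) ^ (n - 1) = 0" using assms by (simp add: power_0_left)
  ultimately show "((%x::real. abs x ^ (n - 1)) \<longlongrightarrow> 0) (at 0)" by (simp only:)
 qed
 thus ?thesis using equal assms by (simp add: DERIV_def power_0_left)
next
 case greater
 have "((%x::real. x ^ n) has_real_derivative real n * (max 0 x) ^ (n - 1)) (at x)"
  using greater by (auto intro!: derivative_eq_intros)
 thus ?thesis by (rule has_field_derivative_transform_within_open[of _ _ _ "{0<..}"]) (use greater in auto)
qed

lemma C2_on_norm_square: "C2_on UNIV (%w. (cmod w)^2)" proof -
 have d: "((%w. (cmod w)^2) has_derivative (%h. 2 * Re (cnj w * 1 * h))) (at w)" for w
  by (rule has_derivative_cmod_square[OF DERIV_ident])
 have p: "partial1 (%w. (cmod w)^2) = (%w. 2 * Re w)" "partial2 (%w. (cmod w)^2) = (%w. 2 * Im w)"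
  using partial_eqI[OF d] by (auto simp: fun_eq_iff)
 have dd: "((%w. 2 * Re w) has_derivative (%h. 2 * Re h)) (at w)" "((%w. 2 * Im w) has_derivative (%h. 2 * Im h)) (at w)" for w
  by (auto intro!: derivative_eq_intros)
 have "partial1 (%w. 2 * Re w) = (%w. 2)" "partial2 (%w. 2 * Im w) = (%w. 2)"
  using partial_eqI(1)[OF dd(1)] partial_eqI(2)[OF dd(2)] by (auto simp: fun_eq_iff)
 thus ?thesis unfolding C2_on_def p using d dd by (auto simp: differentiable_def)
qed

text \<open>With \<open>c x = max 0 x ^ 3\<close> the function \<open>1 - c (1 - c (2 - r))\<close> is twice
 continuously differentiable, equals 1 for \<open>r <= 1\<close> and 0 for \<open>r >= 2\<close>. Take \<open>r
 = |w|^2\<close>.\<close>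

lemma cutoff_exists:
 obtains t :: "complex => real" where "C2_on UNIV t" "!!w. cmod w <= 1 ==> t w = 1" "!!w. cmod w > 2 ==> t w = 0" proof -
 define c c' c'' where "c = (%x::real. (max 0 x) ^ 3)" and "c' = (%x::real. 3 * (max 0 x) ^ 2)" and "c'' = (%x::real. 6 * max 0 x)"
 note cs = c_def c'_def c''_def
 have c: "(c has_real_derivative c' x) (at x)" for x using has_real_derivative_pos_part_power[of 3 x] by (simp add: cs)
 have c': "(c' has_real_derivative c'' x) (at x)" for x
  using DERIV_cmult[OF has_real_derivative_pos_part_power[of 2 x], of 3] by (simp add: cs)
 define G G' G'' where "G = (%r. 1 - c (1 - c (2 - r)))" and "G' = (%r. - (c' (1 - c (2 - r)) * c' (2 - r)))"
  and "G'' = (%r. c' (1 - c (2 - r)) * c'' (2 - r) - c'' (1 - c (2 - r)) * c' (2 - r) * c' (2 - r))"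
 note Gs = G_def G'_def G''_def
 have G: "(G has_real_derivative G' r) (at r)" "(G' has_real_derivative G'' r) (at r)" for r
  unfolding Gs by (auto intro!: derivative_eq_intros DERIV_chain2[OF c] DERIV_chain2[OF c'] simp: algebra_simps)
 have cont: "continuous_on UNIV G''" unfolding Gs cs by (intro continuous_intros)
 show ?thesis proof (rule that[OF C2_on_compose(1)[OF C2_on_norm_square G cont]])
  fix w :: complex
  show "G ((cmod w)^2) = 1" if "cmod w <= 1" proof -
   have "(cmod w)^2 <= 1" using that by (simp add: power_le_one)
   hence "c (2 - (cmod w)^2) >= 1" by (simp add: cs)
   thus ?thesis by (simp add: Gs cs max_def)
  qed
  show "G ((cmod w)^2) = 0" if "cmod w > 2" proof -
   have "2 * 2 <= cmod w * cmod w" using that by (intro mult_mono) auto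
   thus ?thesis by (simp add: Gs cs max_def power2_eq_square)
  qed
 qed
qed

lemma C2_on_affine: assumes "C2_on UNIV t" shows "C2_on UNIV (%w. t (m *\<^sub>R (w - p)))"
  "partial1 (%w. t (m *\<^sub>R (w - p))) w = m * partial1 t (m *\<^sub>R (w - p))"
  "partial2 (%w. t (m *\<^sub>R (w - p))) w = m * partial2 t (m *\<^sub>R (w - p))"
  "laplacian (%w. t (m *\<^sub>R (w - p))) w = m^2 * laplacian t (m *\<^sub>R (w - p))" proof -
 let ?a = "%w. m *\<^sub>R (w - p)"
 have D: "((%w. F (?a w)) has_derivative (%h. m * frechet_derivative F (at (?a w)) h)) (at w)"
  if d: "!!w. F differentiable (at w)" for F :: "complex => real" and w proof -
  have a: "(?a has_derivative (%h. m *\<^sub>R h)) (at w)" by (auto intro!: derivative_eq_intros)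
  have "(F has_derivative frechet_derivative F (at (?a w))) (at (?a w))" using d by (simp flip: frechet_derivative_works)
  from has_derivative_compose[OF a this] show ?thesis using linear_cmul[OF linear_frechet_derivative[OF d]] by simp
 qed
 have p: "partial1 (%w. F (?a w)) w = m * partial1 F (?a w)" "partial2 (%w. F (?a w)) w = m * partial2 F (?a w)"
  "(%w. F (?a w)) differentiable (at w)" if d: "!!w. F differentiable (at w)" for F :: "complex => real" and w
  using partial_eqI[OF D[OF d]] D[OF d, of w] by (auto simp: partial1_def partial2_def differentiable_def)
 note C = C2_onD[OF assms UNIV_I] and cc = C2_on_continuous(4,5)[OF assms]
 have p1: "partial1 (%w. t (?a w)) = (%w. m * partial1 t (?a w))" "partial2 (%w. t (?a w)) = (%w. m * partial2 t (?a w))"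
  using p(1,2)[OF C(1)] by auto
 have p2: "partial1 (%w. m * partial1 t (?a w)) = (%w. m * (m * partial1 (partial1 t) (?a w)))"
  "partial2 (%w. m * partial2 t (?a w)) = (%w. m * (m * partial2 (partial2 t) (?a w)))"
  using partial_lincomb(1)[OF p(3)[OF C(2)] p(3)[OF C(2)], of m 0] partial_lincomb(2)[OF p(3)[OF C(3)] p(3)[OF C(3)], of m 0]
   p(1)[OF C(2)] p(2)[OF C(3)] by auto
 have "continuous_on UNIV (%w. m * (m * F (?a w)))" if "continuous_on UNIV F" for F :: "complex => real"
  by (intro continuous_intros continuous_on_compose2[OF that]) auto
 thus "C2_on UNIV (%w. t (?a w))" unfolding C2_on_def p1 p2 using cc p(3)[OF C(1)] p(3)[OF C(2)] p(3)[OF C(3)] by auto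
 show "partial1 (%w. t (?a w)) w = m * partial1 t (?a w)" "partial2 (%w. t (?a w)) w = m * partial2 t (?a w)" by (simp_all add: p1)
 show "laplacian (%w. t (?a w)) w = m^2 * laplacian t (?a w)"
  unfolding laplacian_def p1 p2 by (simp add: power2_eq_square algebra_simps)
qed

lemma C2_compact_support_bounded: assumes "C2_on UNIV u" "!!w. cmod w > R ==> u w = 0"
 obtains B where "B > 0" "!!w. \<bar>u w\<bar> <= B" "!!w. \<bar>partial1 u w\<bar> <= B" "!!w. \<bar>partial2 u w\<bar> <= B" "!!w. \<bar>laplacian u w\<bar> <= B"
proof -
 note z = laplacian_zero_outside[of R u, OF assms(2)] and cc = C2_on_continuous[OF assms(1)]
 have "\<exists>B>0. \<forall>w. \<bar>f w\<bar> <= B" if f: "continuous_on UNIV f" "!!w. cmod w > R ==> f w = 0" for f :: "complex => real"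
 proof -
  have "bounded (f ` cball 0 R)" by (intro compact_imp_bounded compact_continuous_image continuous_on_subset[OF f(1)]) auto
  then obtain B where B: "!!w. cmod w <= R ==> \<bar>f w\<bar> <= B" unfolding bounded_iff by (metis imageI mem_cball_0 real_norm_def)
  have "abs (f w) <= abs B + 1" for w using B[of w] f(2)[of w] by (cases "cmod w <= R") auto
  thus ?thesis by (intro exI[of _ "abs B + 1"]) auto
 qed
 from this[OF cc(1) z(1)] this[OF cc(2) z(2)] this[OF cc(3) z(3)] this[OF cc(6) z(4)]
 obtain B0 B1 B2 B3 where B: "B0 > 0" "!!w. \<bar>u w\<bar> <= B0" "!!w. \<bar>partial1 u w\<bar> <= B1" "!!w. \<bar>partial2 u w\<bar> <= B2" "!!w. \<bar>laplacian u w\<bar> <= B3" by metis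
 show ?thesis by (rule that[of "max (max B0 B1) (max B2 B3)"]) (use B in \<open>auto simp: le_max_iff_disj less_max_iff_disj\<close>)
qed

text \<open>Away from \<open>P\<close> this is Green's identity. Near \<open>p\<close> cut \<open>u\<close> off
 at scale \<open>1 / n\<close>. The Laplacian of the cut-off function is of size \<open>n^2\<close> on a disc of
 area of order \<open>1 / n^2\<close>, so its integral against \<open>s - s p\<close> tends to 0 by continuity
 of \<open>s\<close>. The induction is on the set \<open>Q\<close> of the points of \<open>P\<close> near which
 \<open>u\<close> need not vanish.\<close>

lemma removable_isolated_points: assumes P: "finite P" and s: "continuous_on UNIV s" "C2_on (-P) s"
  and N: "locally_integrable N" "!!w. w \<notin> P ==> laplacian s w = - N w"
  and phi: "C2_on UNIV u" "!!w. cmod w > R ==> u w = 0"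
 shows "(\<integral>w. s w * laplacian u w \<partial>lborel) + (\<integral>w. N w * u w \<partial>lborel) = 0" proof -
 define T where "T = (%u. (\<integral>w. s w * laplacian u w \<partial>lborel) + (\<integral>w. N w * u w \<partial>lborel))"
 have I: "integrable lborel (%w. f w * laplacian u w)" "integrable lborel (%w. N w * u w)"
  if "C2_on UNIV u" "!!w. cmod w > R ==> u w = 0" "continuous_on UNIV f" for f u R proof -
  show "integrable lborel (%w. f w * laplacian u w)" by (rule integrable_continuous_support[of _ R])
     (auto intro!: continuous_intros that(3) C2_on_continuous(6)[OF that(1)] simp: laplacian_zero_outside[OF that(2)])
  show "integrable lborel (%w. N w * u w)"
   by (rule locally_integrable_mult_test[OF N(1) C2_on_continuous(1)[OF that(1)] that(2)])
 qed
 have claim: "T u = 0"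
  if "finite Q" "Q \<subseteq> P" "C2_on UNIV u" "!!w. cmod w > R ==> u w = 0" "!!p. p \<in> P - Q ==> \<forall>\<^sub>F w in nhds p. u w = 0"
  for Q u using that proof (induction Q arbitrary: u rule: finite_induct)
  case empty
  hence "EX U. \<forall>p\<in>P. open (U p) & p \<in> U p & (\<forall>w\<in>U p. u w = 0)"
   unfolding eventually_nhds by (intro bchoice) auto
  then obtain U where U: "!!p. p \<in> P ==> open (U p) & p \<in> U p & (\<forall>w\<in>U p. u w = 0)" by blast
  define K where "K = cball 0 R - (\<Union>p\<in>P. U p)"
  have "compact K" unfolding K_def using U by (intro compact_diff open_UN) auto
  moreover have "K \<subseteq> - P" "!!w. w \<notin> K ==> u w = 0" using U empty(3) by (auto simp: K_def not_le)
  moreover have "open (-P)" using P by (simp add: finite_imp_closed open_Compl)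
  ultimately have "(\<integral>w. s w * laplacian u w - u w * laplacian s w \<partial>lborel) = 0"
   using s(2) empty(2) by (intro green_identity(1)[of "-P" s u K]) auto
  also have "(%w. s w * laplacian u w - u w * laplacian s w) = (%w. s w * laplacian u w + N w * u w)"
  proof
   fix w show "s w * laplacian u w - u w * laplacian s w = s w * laplacian u w + N w * u w"
    using N(2)[of w] U[of w] by (cases "w \<in> P") auto
  qed
  finally show ?case unfolding T_def using I[OF empty(2,3) s(1)] by simp
 next
  case (insert p Q)
  obtain t :: "complex => real" where t: "C2_on UNIV t" "!!w. cmod w <= 1 ==> t w = 1" "!!w. cmod w > 2 ==> t w = 0"
   using cutoff_exists by metis
  define X where "X = (%n w. t (real (Suc n) *\<^sub>R (w - p)))"
  have X: "C2_on UNIV (X n)" "partial1 (X n) w = real (Suc n) * partial1 t (real (Suc n) *\<^sub>R (w - p))"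
   "partial2 (X n) w = real (Suc n) * partial2 t (real (Suc n) *\<^sub>R (w - p))"
   "laplacian (X n) w = (real (Suc n))^2 * laplacian t (real (Suc n) *\<^sub>R (w - p))" for n w
   unfolding X_def by (rule C2_on_affine[OF t(1)])+
  define u' where "u' = (%n w. u w * X n w)"
  have phi': "C2_on UNIV (u' n)" for n unfolding u'_def by (intro C2_on_mult X insert) auto
  have phi'0: "u' n w = 0" if "cmod w > R" for n w using insert.prems(3)[OF that] by (simp add: u'_def)
  have T: "T u = T (u' n)" for n proof -
   let ?d = "%w. 1 * u w + (-1) * u' n w"
   note d = C2_on_lincomb[OF open_UNIV insert.prems(2) phi'[of n], where a = 1 and b = "-1"]
   have "T ?d = 0" proof (rule insert.IH[OF _ d(1)])
    show "Q \<subseteq> P" using insert by auto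
    show "?d w = 0" if "cmod w > R" for w using insert.prems(3)[OF that] phi'0[OF that] by simp
    show "\<forall>\<^sub>F w in nhds q. ?d w = 0" if q: "q \<in> P - Q" for q proof (cases "q = p")
     case True
     have "open {w. cmod (real (Suc n) *\<^sub>R (w - p)) < 1}" by (intro open_Collect_less continuous_intros)
     hence "\<forall>\<^sub>F w in nhds p. w \<in> {w. cmod (real (Suc n) *\<^sub>R (w - p)) < 1}" by (rule eventually_nhds_in_open) simp
     thus ?thesis unfolding True by eventually_elim (simp add: u'_def X_def t(2))
    next
     case False
     hence "\<forall>\<^sub>F w in nhds q. u w = 0" using insert.prems(4) q by auto
     thus ?thesis by eventually_elim (auto simp: u'_def)
    qed
   qed
   moreover have "integrable lborel (%w. s w * laplacian u w)" by (rule I(1)[OF insert.prems(2,3) s(1)])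
   moreover have "integrable lborel (%w. N w * u w)" by (rule I(2)[OF insert.prems(2,3) s(1)])
   moreover have "integrable lborel (%w. s w * laplacian (u' n) w)" by (rule I(1)[OF phi' phi'0 s(1)])
   moreover have "integrable lborel (%w. N w * u' n w)" by (rule I(2)[OF phi' phi'0 s(1)])
   ultimately have "0 = T u - T (u' n)" unfolding T_def d(2)[OF UNIV_I] by (simp add: right_diff_distrib)
   thus ?thesis by simp
  qed
  have pw: "(%n. X n w) \<longlonglongrightarrow> 0" if "w ~= p" for w
  proof (rule tendsto_eventually, use eventually_ge_at_top[of "nat \<lceil>2 / cmod (w - p)\<rceil>"] in eventually_elim)
   fix n assume "n >= nat \<lceil>2 / cmod (w - p)\<rceil>"
   hence "2 / cmod (w - p) < real (Suc n)" by linarith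
   thus "X n w = 0" unfolding X_def using that by (intro t(3)) (simp add: pos_divide_less_eq del: of_nat_Suc scaleR_left.add)
  qed
  obtain M where M: "M > 0" "!!w. \<bar>t w\<bar> <= M" "!!w. \<bar>partial1 t w\<bar> <= M" "!!w. \<bar>partial2 t w\<bar> <= M" "!!w. \<bar>laplacian t w\<bar> <= M"
   using C2_compact_support_bounded[of t 2, OF t(1,3)] by metis
  obtain B where B: "B > 0" "!!w. \<bar>u w\<bar> <= B" "!!w. \<bar>partial1 u w\<bar> <= B" "!!w. \<bar>partial2 u w\<bar> <= B" "!!w. \<bar>laplacian u w\<bar> <= B"
   using C2_compact_support_bounded[of u R, OF insert.prems(2,3)] by metis
  have l2: "(%n. \<integral>w. N w * u' n w \<partial>lborel) \<longlonglongrightarrow> (\<integral>(w::complex). 0 \<partial>lborel)"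
  proof (rule integral_dominated_convergence[where w="%w. M * abs (N w * u w)"])
   show "integrable lborel (%w. M * abs (N w * u w))" by (intro integrable_mult_right integrable_abs I(2)[OF insert.prems(2,3) s(1)])
   show "(%w. N w * u' n w) \<in> borel_measurable lborel" for n by (rule borel_measurable_integrable[OF I(2)[OF phi' phi'0 s(1)]])
   show "AE w in lborel. (%n. N w * u' n w) \<longlonglongrightarrow> 0"
    by (rule AE_mp[OF AE_lborel_singleton[of p]], rule AE_I2) (auto simp: u'_def intro!: tendsto_mult_right_zero pw)
   show "AE w in lborel. norm (N w * u' n w) <= M * abs (N w * u w)" for n proof (rule AE_I2)
    fix w
    have "norm (N w * u' n w) = abs (X n w) * abs (N w * u w)" by (simp add: u'_def abs_mult)
    also have "... <= M * abs (N w * u w)" unfolding X_def by (intro mult_right_mono M) auto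
    finally show "norm (N w * u' n w) <= M * abs (N w * u w)" .
   qed
  qed simp
  \<comment> \<open>the constant may be subtracted, as the Laplacian of a test function has integral 0\<close>
  define S where "S = (%w. s w - s p)"
  have S: "continuous_on UNIV S" unfolding S_def by (intro continuous_intros s)
  have iS: "integrable lborel (%w. S w * laplacian (u' n) w)" for n by (rule I(1)[OF phi' phi'0 S])
  have sS: "(\<integral>w. s w * laplacian (u' n) w \<partial>lborel) = (\<integral>w. S w * laplacian (u' n) w \<partial>lborel)" for n
  proof -
   have "C2_on UNIV (%_. 1::real)" by (auto simp: C2_on_def partial1_def[abs_def] partial2_def[abs_def])
   from green_identity(1)[OF open_UNIV this phi', of "cball 0 R" n] phi'0
   have "(\<integral>w. laplacian (u' n) w \<partial>lborel) = 0" by (simp add: laplacian_def partial1_def[abs_def] partial2_def[abs_def])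
   thus ?thesis unfolding S_def left_diff_distrib
    using I(1)[OF phi' phi'0 s(1)] I(1)[OF phi' phi'0 continuous_on_const] by (subst Bochner_Integration.integral_diff) auto
  qed
  have bound: "abs (laplacian (u' n) w) <= 6 * B * M * (real (Suc n))^2 * indicator (cball p (2 / real (Suc n))) w" for n w
  proof (cases "w \<in> cball p (2 / real (Suc n))")
   case False
   have "u' n x = 0" if "x \<in> - cball p (2 / real (Suc n))" for x proof -
    have "cmod (real (Suc n) *\<^sub>R (x - p)) > 2"
     using that by (simp add: dist_norm norm_minus_commute not_le pos_divide_less_eq mult.commute del: of_nat_Suc scaleR_left.add)
    thus ?thesis by (simp add: u'_def X_def t(3))
   qed
   moreover have "C2_on (- cball p (2 / real (Suc n))) (%_. 0)" by (auto simp: C2_on_def partial1_def[abs_def] partial2_def[abs_def])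
   ultimately have "laplacian (u' n) w = laplacian (%_. 0) w"
    using False by (intro C2_on_open_cong(2)[OF open_Compl[OF closed_cball]]) auto
   thus ?thesis using B M by (simp add: laplacian_def partial1_def[abs_def] partial2_def[abs_def])
  next
   case True
   define m where "m = real (Suc n)"
   have "1 <= m" by (simp add: m_def)
   hence m: "1 <= m" "m <= m^2" "1 <= m^2" by (simp_all add: self_le_power)
   define v where "v = m *\<^sub>R (w - p)"
   have tri: "abs (a + b + 2 * (c + d)) <= abs a + abs b + 2 * (abs c + abs d)" for a b c d :: real by (smt (verit))
   have L: "laplacian (u' n) w = u w * (m^2 * laplacian t v) + laplacian u w * t v
     + 2 * (partial1 u w * (m * partial1 t v) + partial2 u w * (m * partial2 t v))"
    unfolding u'_def C2_on_mult(2)[OF open_UNIV insert.prems(2) X(1) UNIV_I] X(2-4) by (simp only: X_def v_def m_def)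
   have "abs (laplacian (u' n) w) <= abs (u w * (m^2 * laplacian t v)) + abs (laplacian u w * t v)
     + 2 * (abs (partial1 u w * (m * partial1 t v)) + abs (partial2 u w * (m * partial2 t v)))" unfolding L by (rule tri)
   also have "... = abs (u w) * (m^2 * abs (laplacian t v)) + abs (laplacian u w) * abs (t v)
     + 2 * (abs (partial1 u w) * (m * abs (partial1 t v)) + abs (partial2 u w) * (m * abs (partial2 t v)))"
    using m by (simp add: abs_mult)
   also have "... <= B * (m^2 * M) + B * M + 2 * (B * (m * M) + B * (m * M))"
    using B M m by (intro add_mono mult_mono mult_left_mono) auto
   also have "... <= B * (m^2 * M) + B * (m^2 * M) + 2 * (B * (m^2 * M) + B * (m^2 * M))"
    using B M m by (intro add_mono mult_left_mono mult_right_mono order_refl) (auto simp: mult_le_cancel_right1)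
   finally show ?thesis using True by (simp add: m_def)
  qed
  have l1: "(%n. \<integral>w. S w * laplacian (u' n) w \<partial>lborel) \<longlonglongrightarrow> 0" proof (rule LIMSEQ_I)
   fix e :: real assume e: "e > 0"
   \<comment> \<open>the disc below has area \<open>4 pi / m^2\<close>, so this choice bounds the integral by \<open>e / 2\<close>\<close>
   define j where "j = e / (6 * B * M * (8 * pi))"
   have j: "j > 0" using e B M by (simp add: j_def)
   have "isCont S p" using S by (auto simp: continuous_on_eq_continuous_at)
   then obtain r where r: "r > 0" "!!w. dist w p < r ==> \<bar>S w\<bar> < j"
    using j unfolding continuous_at_eps_delta by (auto simp: S_def dist_real_def)
   obtain n0 where n0: "real n0 > 2 / r" using reals_Archimedean2 by blast
   have "\<bar>\<integral>w. S w * laplacian (u' n) w \<partial>lborel\<bar> < e" if "n >= n0" for n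
   proof -
    define m where "m = real (Suc n)"
    have m0: "m > 0" "2 / r < m" using n0 that by (auto simp: m_def)
    hence m: "m > 0" "2 / m < r" using r by (auto simp: field_simps)
    let ?D = "cball p (2 / m)"
    have fin: "integrable lborel (%w. j * (6 * B * M * m^2) * indicator ?D w)"
     using emeasure_lborel_cball_finite[of p "2 / m"] by (intro integrable_mult_right integrable_real_indicator) auto
    have "abs (S w * laplacian (u' n) w) <= j * (6 * B * M * m^2) * indicator ?D w" for w proof (cases "w \<in> ?D")
     case True
     hence "abs (S w) <= j" using r(2)[of w] m by (auto simp: dist_commute)
     with bound[of n w] True show ?thesis unfolding abs_mult using j by (auto simp: m_def intro!: mult_mono)
    qed (use bound[of n w] in \<open>auto simp: m_def\<close>)
    hence "\<bar>\<integral>w. S w * laplacian (u' n) w \<partial>lborel\<bar> <= (\<integral>w. j * (6 * B * M * m^2) * indicator ?D w \<partial>lborel)"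
     by (intro order_trans[OF integral_abs_bound] integral_mono integrable_abs iS fin)
    also have "... = j * (6 * B * M * m^2) * (pi * (2 / m)^2)"
     using content_cball[of "2 / m" p] m by (simp add: unit_ball_vol_2)
    also have "... = e / 2" using m B M by (simp add: j_def power_divide)
    finally show ?thesis using e by simp
   qed
   thus "EX no. \<forall>n\<ge>no. norm ((\<integral>w. S w * laplacian (u' n) w \<partial>lborel) - 0) < e" by auto
  qed
  have "(%n. T (u' n)) \<longlonglongrightarrow> 0" unfolding T_def sS using tendsto_add[OF l1 l2] by simp
  thus "T u = 0" unfolding T[symmetric] by (simp add: LIMSEQ_const_iff)
 qed
 show ?thesis using claim[of P u] P phi unfolding T_def by auto
qed

text \<open>Once the logarithms are subtracted, the rest extends continuously over \<open>P\<close> and has no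
 mass there.\<close>

lemma laplacian_plus_eq_log_poles:
 assumes P: "finite P" and v: "C2_on (-P) v" and N: "locally_integrable N" "!!w. w \<notin> P ==> laplacian v w = - N w"
  and lim: "!!p. p \<in> P ==> EX L. ((%w. v w - j p * ln (cmod (w - p))) \<longlongrightarrow> L) (at p)"
 shows "laplacian_plus_eq v N (%u. 2 * pi * (\<Sum>p\<in>P. j p * u p))" proof -
 have oP: "open (-P)" using P by (simp add: finite_imp_closed open_Compl)
 define l where "l = (%w. \<Sum>p\<in>P. j p * ln (cmod (w - p)))"
 define s0 where "s0 = (%w. v w - l w)"
 have lnp: "C2_on (- {p}) (%w. ln (cmod (w - p)))" "w ~= p ==> laplacian (%w. ln (cmod (w - p))) w = 0" for p w proof -
  have op: "open (- {p})" by auto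
  have L: "ln (cmod (w - p)) = ln ((cmod (w - p))^2 + 0^2) / 2" if "w \<in> - {p}" for w using that by (simp add: ln_realpow)
  note r = laplacian_ln_regularized[OF op, of p 0]
  show "C2_on (- {p}) (%w. ln (cmod (w - p)))" by (rule C2_on_open_cong(1)[OF op L r(1)]) auto
  show "laplacian (%w. ln (cmod (w - p))) w = 0" if "w ~= p"
   using C2_on_open_cong(2)[OF op L r(1), of w] r(2)[of w] that by simp
 qed
 have l: "C2_on (-P) (%w. \<Sum>p\<in>Q. j p * ln (cmod (w - p)))" "!!w. w \<in> -P ==> laplacian (%w. \<Sum>p\<in>Q. j p * ln (cmod (w - p))) w = 0"
  if "finite Q" "Q \<subseteq> P" for Q proof -
  have "C2_on (-P) (%w. \<Sum>p\<in>Q. j p * ln (cmod (w - p))) & (\<forall>w\<in>-P. laplacian (%w. \<Sum>p\<in>Q. j p * ln (cmod (w - p))) w = 0)"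
   using that proof (induction Q rule: finite_induct)
   case empty
   thus ?case by (auto simp: C2_on_def laplacian_def partial1_def[abs_def] partial2_def[abs_def])
  next
   case (insert p Q)
   have c: "C2_on (-P) (%w. ln (cmod (w - p)))" by (rule C2_on_subset[OF lnp(1)]) (use insert in auto)
   have eq: "(%w. \<Sum>p\<in>insert p Q. j p * ln (cmod (w - p))) = (%w. j p * ln (cmod (w - p)) + 1 * (\<Sum>p\<in>Q. j p * ln (cmod (w - p))))"
    using insert by auto
   have "p \<in> P" "Q \<subseteq> P" using insert by auto
   moreover have "laplacian (%w. ln (cmod (w - p))) w = 0" if "w \<notin> P" for w
    using \<open>p \<in> P\<close> that by (intro lnp(2)) auto
   ultimately show ?case
    using insert.IH C2_on_lincomb[OF oP c, where v="%w. \<Sum>p\<in>Q. j p * ln (cmod (w - p))" and a="j p" and b=1]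
    unfolding eq by auto
  qed
  thus "C2_on (-P) (%w. \<Sum>p\<in>Q. j p * ln (cmod (w - p)))" "!!w. w \<in> -P ==> laplacian (%w. \<Sum>p\<in>Q. j p * ln (cmod (w - p))) w = 0" by auto
 qed
 have lP: "C2_on (-P) l" "!!w. w \<in> -P ==> laplacian l w = 0" using l[OF P] by (auto simp: l_def)
 have s0eq: "s0 = (%w. 1 * v w + - 1 * l w)" by (auto simp: s0_def)
 have s0: "C2_on (-P) s0" "!!w. w \<in> -P ==> laplacian s0 w = - N w"
  unfolding s0eq using C2_on_lincomb[OF oP v lP(1), where a=1 and b="-1"] N(2) lP(2) by auto
 have lims0: "EX L. (s0 \<longlongrightarrow> L) (at p)" if p: "p \<in> P" for p proof -
  obtain L where L: "((%w. v w - j p * ln (cmod (w - p))) \<longlongrightarrow> L) (at p)" using lim[OF p] by auto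
  have "((%w. \<Sum>q\<in>P-{p}. j q * ln (cmod (w - q))) \<longlongrightarrow> (\<Sum>q\<in>P-{p}. j q * ln (cmod (p - q)))) (at p)"
   by (intro tendsto_intros) auto
  from tendsto_diff[OF L this]
  have "((%w. v w - j p * ln (cmod (w - p)) - (\<Sum>q\<in>P-{p}. j q * ln (cmod (w - q)))) \<longlongrightarrow> L - (\<Sum>q\<in>P-{p}. j q * ln (cmod (p - q)))) (at p)" .
  moreover have "(%w. v w - j p * ln (cmod (w - p)) - (\<Sum>q\<in>P-{p}. j q * ln (cmod (w - q)))) = s0"
   using P p by (auto simp: s0_def l_def fun_eq_iff sum.remove[of P p])
  ultimately show ?thesis by auto
 qed
 define s where "s = (%w. if w \<in> P then Lim (at w) s0 else s0 w)"
 have ss0: "s w = s0 w" if "w \<in> -P" for w using that by (simp add: s_def)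
 have s: "C2_on (-P) s" "!!w. w \<notin> P ==> laplacian s w = - N w" using C2_on_open_cong[OF oP ss0 s0(1)] s0(2) by auto
 have "isCont s w" for w proof (cases "w \<in> P")
  case False
  have "continuous_on (-P) s" by (rule C2_on_continuous[OF s(1)])
  thus ?thesis using False oP by (simp add: continuous_on_eq_continuous_at)
 next
  case True
  then obtain L where L: "(s0 \<longlongrightarrow> L) (at w)" using lims0 by auto
  hence "s w = L" using True by (simp add: s_def tendsto_Lim)
  moreover have "\<forall>\<^sub>F x in at w. x \<notin> P - {w}" proof -
   have "open (- (P - {w}))" using P by (intro open_Compl finite_imp_closed) auto
   from eventually_at_in_open'[OF this, of w] show ?thesis by (auto elim: eventually_mono)
  qed
  hence "\<forall>\<^sub>F x in at w. s0 x = s x" unfolding eventually_at_filter by (auto elim!: eventually_mono simp: s_def)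
  ultimately show ?thesis using L by (simp add: isCont_def Lim_transform_eventually)
 qed
 hence sc: "continuous_on UNIV s" by (simp add: continuous_on_eq_continuous_at)
 have vloc: "locally_integrable v" proof (rule locally_integrable_isolated[OF P C2_on_continuous(1)[OF v]])
  fix p assume p: "p \<in> P"
  then obtain L where L: "((%w. v w - j p * ln (cmod (w - p))) \<longlongrightarrow> L) (at p)" using lim by auto
  hence "\<forall>\<^sub>F w in at p. dist (v w - j p * ln (cmod (w - p))) L < 1" by (rule tendstoD) simp
  hence "\<forall>\<^sub>F w in at p. \<bar>v w\<bar> <= (abs L + 1 + 2 * abs (j p)) * cmod (w - p) powr -1"
   using ln_bound_near[of p] proof eventually_elim
   case (elim w)
   have "abs (v w) <= abs L + 1 + abs (j p) * abs (ln (cmod (w - p)))"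
    using elim(1) abs_mult[of "j p" "ln (cmod (w - p))"] by (simp add: dist_real_def)
   also have "... <= (abs L + 1) * cmod (w - p) powr -1 + abs (j p) * (2 * cmod (w - p) powr -1)"
    using elim(2) mult_left_mono[of 1 "cmod (w - p) powr -1" "abs L + 1"] by (intro add_mono mult_left_mono) auto
   finally show ?case by (simp only: distrib_right mult.assoc mult.left_commute[of 2])
  qed
  thus "EX C a. - 2 < a & (\<forall>\<^sub>F w in at p. \<bar>v w\<bar> <= C * cmod (w - p) powr a)"
   by (intro exI[of _ "abs L + 1 + 2 * abs (j p)"] exI[of _ "-1"]) auto
 qed
 have "(\<integral>w. v w * laplacian u w \<partial>lborel) + (\<integral>w. N w * u w \<partial>lborel) = 2 * pi * (\<Sum>p\<in>P. j p * u p)" if "test_function u" for u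
 proof -
  obtain R where R: "!!w. cmod w > R ==> u w = 0" using test_function_C2(2)[OF \<open>test_function u\<close>] by auto
  note phi = test_function_C2(1)[OF \<open>test_function u\<close>]
  have c: "continuous_on UNIV (laplacian u)" by (rule C2_on_continuous[OF phi])
  have z: "laplacian u w = 0" if "cmod w > R" for w using laplacian_zero_outside[of R u w] R that by auto
  have i1: "integrable lborel (%w. s w * laplacian u w)"
   by (rule integrable_continuous_support[of _ R]) (auto intro!: continuous_intros sc c simp: z)
  have i2: "integrable lborel (%w. ln (cmod (w - p)) * laplacian u w)" for p
   by (rule locally_integrable_mult_test[OF locally_integrable_ln c z])
  have "(\<integral>w. v w * laplacian u w \<partial>lborel) = (\<integral>w. s w * laplacian u w + (\<Sum>p\<in>P. j p * (ln (cmod (w - p)) * laplacian u w)) \<partial>lborel)"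
  proof (rule integral_discrete_difference[of P])
   show "v w * laplacian u w = s w * laplacian u w + (\<Sum>p\<in>P. j p * (ln (cmod (w - p)) * laplacian u w))" if "w \<notin> P" for w
    using that by (simp add: s_def s0_def l_def sum_distrib_left sum_distrib_right algebra_simps)
  qed (use P in \<open>auto intro: countable_finite\<close>)
  also have "... = (\<integral>w. s w * laplacian u w \<partial>lborel) + (\<Sum>p\<in>P. j p * (\<integral>w. ln (cmod (w - p)) * laplacian u w \<partial>lborel))"
   using i1 i2 by (subst Bochner_Integration.integral_add) (auto simp: Bochner_Integration.integral_sum)
  also have "(\<Sum>p\<in>P. j p * (\<integral>w. ln (cmod (w - p)) * laplacian u w \<partial>lborel)) = 2 * pi * (\<Sum>p\<in>P. j p * u p)"
  proof -
   have "(\<integral>w. ln (cmod (w - p)) * laplacian u w \<partial>lborel) = 2 * pi * u p" for p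
    by (rule integral_ln_laplacian[OF phi, of R]) (use R in auto)
   thus ?thesis unfolding sum_distrib_left by (intro sum.cong) (auto simp: mult_ac)
  qed
  finally show ?thesis using removable_isolated_points[of P s N u R, OF P sc s(1) N(1) s(2) phi R] by simp
 qed
 thus ?thesis using vloc N(1) by (simp add: laplacian_plus_eq_def)
qed

section \<open>The modular group and expansions at the cusp\<close>

abbreviation HH :: "complex set" where "HH \<equiv> upper_half_plane"

lemma open_HH: "open HH" unfolding upper_half_plane_def by (simp add: open_halfspace_Im_gt)

lemma convex_HH: "convex HH" unfolding upper_half_plane_def by (simp add: convex_halfspace_Im_gt)

lemma connected_HH: "connected HH" using convex_HH convex_connected by blast

definition cocycle :: "int => int => complex => complex" where
 "cocycle c d z = of_int c * z + of_int d"

definition mob :: "int => int => int => int => complex => complex" where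
 "mob a b c d z = (of_int a * z + of_int b) / cocycle c d z"

lemma unimodular_not_both_zero: "a * d - b * c = (1::int) ==> (c, d) ~= (0, 0)" by auto

lemma cocycle_nonzero: assumes "z \<in> HH" "(c, d) ~= (0, 0)" shows "cocycle c d z ~= 0" proof
 assume 0: "cocycle c d z = 0"
 have "Im (cocycle c d z) = of_int c * Im z" by (simp add: cocycle_def)
 with 0 assms have "c = 0" by (simp add: upper_half_plane_def)
 with 0 assms show False by (simp add: cocycle_def)
qed

lemma Im_mob: assumes "a * d - b * c = 1" "z \<in> HH" shows "Im (mob a b c d z) = Im z / (cmod (cocycle c d z))^2" proof -
 have nz: "cocycle c d z ~= 0" using assms cocycle_nonzero unimodular_not_both_zero by blast
 have det: "real_of_int a * real_of_int d - real_of_int b * real_of_int c = 1"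
  using assms(1) by (metis of_int_1 of_int_diff of_int_mult)
 have "mob a b c d z = (of_int a * z + of_int b) * cnj (cocycle c d z) / (cmod (cocycle c d z))^2"
  using nz by (simp add: mob_def complex_norm_square del: of_real_power)
 hence "Im (mob a b c d z) = Im ((of_int a * z + of_int b) * cnj (cocycle c d z)) / (cmod (cocycle c d z))^2"
  by (simp add: Im_divide_of_real del: of_real_power)
 also have "Im ((of_int a * z + of_int b) * cnj (cocycle c d z)) = (real_of_int a * real_of_int d - real_of_int b * real_of_int c) * Im z"
  by (simp add: cocycle_def algebra_simps)
 finally show ?thesis using det by simp
qed

lemma mob_in_HH: "a * d - b * c = 1 ==> z \<in> HH ==> mob a b c d z \<in> HH"
 using Im_mob cocycle_nonzero[of z c d] unimodular_not_both_zero[of a d b c] by (auto simp: upper_half_plane_def)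

lemma cocycle_mob: assumes "a * d - b * c = 1" "z \<in> HH"
 shows "cocycle m n (mob a b c d z) = cocycle (m * a + n * c) (m * b + n * d) z / cocycle c d z" proof -
 have "cocycle c d z ~= 0" using assms cocycle_nonzero unimodular_not_both_zero by blast
 thus ?thesis by (simp add: mob_def cocycle_def[of m] cocycle_def[of "m * a + n * c"] field_simps) (simp add: cocycle_def algebra_simps)
qed

lemma mob_mob: assumes "a * d - b * c = 1" "a' * d' - b' * c' = 1" "z \<in> HH"
 shows "mob a' b' c' d' (mob a b c d z) = mob (a' * a + b' * c) (a' * b + b' * d) (c' * a + d' * c) (c' * b + d' * d) z" proof -
 have nz: "cocycle c d z ~= 0" using assms cocycle_nonzero unimodular_not_both_zero by blast
 have mobc: "mob p q r s x = cocycle p q x / cocycle r s x" for p q r s x by (simp add: mob_def cocycle_def)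
 show ?thesis unfolding mobc[of a'] mobc[of "a' * a + b' * c"] cocycle_mob[OF assms(1,3)] using nz by simp
qed

lemma mob_one [simp]: "mob 1 0 0 1 z = z" by (simp add: mob_def cocycle_def)

lemma SL2Z_equiv_alt: "SL2Z_equiv z z' \<longleftrightarrow> (EX a b c d. a * d - b * c = 1 & z' = mob a b c d z)"
 by (simp add: SL2Z_equiv_def mob_def cocycle_def)

lemma mob_inverse: assumes "a * d - b * c = 1" "z \<in> HH" shows "mob d (-b) (-c) a (mob a b c d z) = z" proof -
 have "d * a - (-b) * (-c) = 1" using assms(1) by (simp add: mult.commute)
 from mob_mob[OF assms(1) this assms(2)] assms(1) show ?thesis by (simp add: algebra_simps)
qed

lemma SL2Z_equiv_sym: "z \<in> HH ==> SL2Z_equiv z z' ==> SL2Z_equiv z' z" unfolding SL2Z_equiv_alt proof clarify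
 fix a b c d assume z: "z \<in> HH" and det: "a * d - b * c = (1::int)"
 show "EX a' b' c' d'. a' * d' - b' * c' = 1 & z = mob a' b' c' d' (mob a b c d z)"
  using mob_inverse[OF det z] det by (intro exI[of _ d] exI[of _ "-b"] exI[of _ "-c"] exI[of _ a]) (auto simp: algebra_simps)
qed

lemma SL2Z_equiv_trans: "z \<in> HH ==> SL2Z_equiv z z' ==> SL2Z_equiv z' z'' ==> SL2Z_equiv z z''"
 unfolding SL2Z_equiv_alt proof clarify
 fix a b c d a' b' c' d' :: int assume z: "z \<in> HH" and det: "a * d - b * c = 1" "a' * d' - b' * c' = 1"
 have "(a' * a + b' * c) * (c' * b + d' * d) - (a' * b + b' * d) * (c' * a + d' * c) = (a * d - b * c) * (a' * d' - b' * c')"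
  by (simp add: algebra_simps)
 thus "EX A B C D. A * D - B * C = 1 & mob a' b' c' d' (mob a b c d z) = mob A B C D z"
  using mob_mob[OF det z] det by (intro exI[of _ "a' * a + b' * c"] exI[of _ "a' * b + b' * d"] exI[of _ "c' * a + d' * c"] exI[of _ "c' * b + d' * d"]) simp
qed

lemma SL2Z_equiv_HH: "z \<in> HH ==> SL2Z_equiv z z' ==> z' \<in> HH" unfolding SL2Z_equiv_alt using mob_in_HH by blast

lemma SL2Z_equiv_translate: "SL2Z_equiv z (z + of_int n)"
 unfolding SL2Z_equiv_alt by (intro exI[of _ 1] exI[of _ n] exI[of _ 0]) (simp add: mob_def cocycle_def)

definition nome :: "complex => complex" where "nome z = exp (2 * of_real pi * \<i> * z)"

lemma norm_nome: "cmod (nome z) = exp (- 2 * pi * Im z)" by (simp add: nome_def norm_exp_eq_Re)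

lemma nome_nonzero [simp]: "nome z ~= 0" by (simp add: nome_def)

lemma nome_in_ball: "z \<in> HH ==> nome z \<in> ball 0 1" by (simp add: norm_nome upper_half_plane_def)

lemma nome_eq_iff: "nome z = nome z' \<longleftrightarrow> (\<exists>n::int. z' = z + of_int n)" proof -
 have "nome z = nome z' \<longleftrightarrow> (\<exists>n::int. 2 * of_real pi * \<i> * z = 2 * of_real pi * \<i> * z' + (of_int (2 * n) * pi) * \<i>)"
  unfolding nome_def by (rule exp_eq)
 also have "... \<longleftrightarrow> (\<exists>n::int. z = z' + of_int n)" proof (intro ex_cong1)
  fix n :: int
  have "2 * of_real pi * \<i> * z = 2 * of_real pi * \<i> * z' + (of_int (2 * n) * pi) * \<i> \<longleftrightarrow>
    (2 * of_real pi * \<i>) * z = (2 * of_real pi * \<i>) * (z' + of_int n)" by (simp add: algebra_simps)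
  thus "2 * of_real pi * \<i> * z = 2 * of_real pi * \<i> * z' + (of_int (2 * n) * pi) * \<i> \<longleftrightarrow> z = z' + of_int n"
   by simp
 qed
 also have "... \<longleftrightarrow> (\<exists>n::int. z' = z + of_int n)"
  by (metis add.commute add_diff_cancel_left' diff_add_cancel minus_diff_eq of_int_minus uminus_add_conv_diff)
 finally show ?thesis .
qed

lemma nome_surj: assumes "q ~= 0" "cmod q < 1"
 obtains z where "z \<in> HH" "nome z = q" proof
 let ?z = "Ln q / (2 * of_real pi * \<i>)"
 show "nome ?z = q" using assms by (simp add: nome_def)
 hence "exp (- 2 * pi * Im ?z) < exp 0" using norm_nome[of ?z] assms by simp
 thus "?z \<in> HH" unfolding exp_less_cancel_iff by (simp add: upper_half_plane_def zero_less_mult_iff mult_less_0_iff)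
qed

lemma nome_has_field_derivative: "(nome has_field_derivative 2 * of_real pi * \<i> * nome z) (at z)"
 unfolding nome_def [abs_def] by (auto intro!: derivative_eq_intros)

lemma deriv_nome: "deriv nome z = 2 * of_real pi * \<i> * nome z" by (rule DERIV_imp_deriv[OF nome_has_field_derivative])

lemma nome_holomorphic: "nome holomorphic_on S"
 using nome_has_field_derivative by (meson holomorphic_on_open holomorphic_on_subset open_UNIV subset_UNIV)

text \<open>Convergence as the imaginary part tends to infinity, uniformly in the real part.\<close>

abbreviation to_cusp :: "complex filter" where "to_cusp \<equiv> filtercomap Im at_top"

lemma eventually_to_cusp: "eventually P to_cusp \<longleftrightarrow> (EX Y. \<forall>z. Im z > Y --> P z)" proof
 assume "eventually P to_cusp"
 then obtain Q where Q: "eventually Q at_top" "!!z. Q (Im z) ==> P z" by (auto simp: eventually_filtercomap)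
 thus "EX Y. \<forall>z. Im z > Y --> P z" unfolding eventually_at_top_dense by auto
next
 assume "EX Y. \<forall>z. Im z > Y --> P z"
 then obtain Y where "\<forall>z. Im z > Y --> P z" by auto
 thus "eventually P to_cusp" unfolding eventually_filtercomap by (intro exI[of _ "%y. y > Y"]) (auto simp: eventually_gt_at_top)
qed

lemma to_cusp_neq_bot: "to_cusp ~= bot" proof
 assume "to_cusp = bot"
 hence "eventually (%_. False) to_cusp" by simp
 then obtain Y where "\<forall>z. Im z > Y --> False" unfolding eventually_to_cusp by auto
 hence "~ Im (Complex 0 (Y + 1)) > Y" by blast
 thus False by simp
qed

lemma eventually_to_cusp_HH: "\<forall>\<^sub>F z in to_cusp. z \<in> HH"
 unfolding eventually_to_cusp by (intro exI[of _ 0]) (auto simp: upper_half_plane_def)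

lemma nome_at_0: "filterlim nome (at 0) to_cusp" proof -
 have "(nome \<longlongrightarrow> 0) to_cusp" proof (rule tendstoI)
  fix e :: real assume e: "e > 0"
  have "cmod (nome z) < e" if "Im z > - ln e / (2 * pi)" for z proof -
   have "- 2 * pi * Im z < ln e" using that by (simp add: field_simps)
   hence "exp (- 2 * pi * Im z) < exp (ln e)" by simp
   thus ?thesis using e by (simp add: norm_nome)
  qed
  thus "\<forall>\<^sub>F z in to_cusp. dist (nome z) 0 < e"
   unfolding eventually_to_cusp by (intro exI[of _ "- ln e / (2 * pi)"]) simp
 qed
 thus ?thesis by (simp add: filterlim_at)
qed

definition q_expansion :: "(complex => complex) => (complex => complex) => bool" where
 "q_expansion F G \<longleftrightarrow> G holomorphic_on ball 0 1 & (\<forall>z\<in>HH. F z = G (nome z))"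

lemma q_expansion_tendsto: assumes "q_expansion F G" shows "(F \<longlongrightarrow> G 0) to_cusp" proof -
 have "continuous_on (ball 0 1) G" using assms by (auto simp: q_expansion_def holomorphic_on_imp_continuous_on)
 hence "(G \<longlongrightarrow> G 0) (at 0)" by (auto simp: continuous_on_eq_continuous_at isCont_def)
 hence "((%z. G (nome z)) \<longlongrightarrow> G 0) to_cusp" by (rule filterlim_compose[OF _ nome_at_0])
 thus ?thesis
  by (rule Lim_transform_eventually) (use assms in \<open>auto intro: eventually_mono[OF eventually_to_cusp_HH] simp: q_expansion_def\<close>)
qed

lemma modular_form_alt:
 "modular_form k f \<longleftrightarrow> f holomorphic_on HH &
   (\<forall>a b c d. a * d - b * c = 1 --> (\<forall>z\<in>HH. f (mob a b c d z) = cocycle c d z powi k * f z)) &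
   (EX G. q_expansion f G)" proof -
 have "(\<exists>a :: nat => complex. \<forall>z\<in>HH. (%n. a n * nome z ^ n) sums f z) \<longleftrightarrow> (EX G. q_expansion f G)"
 proof
  assume "\<exists>a :: nat => complex. \<forall>z\<in>HH. (%n. a n * nome z ^ n) sums f z"
  then obtain a where a: "!!z. z \<in> HH ==> (%n. a n * nome z ^ n) sums f z" by auto
  define G where "G = (%q. \<Sum>n. a n * q ^ n)"
  have "(%n. a n * (q - 0) ^ n) sums G q" if q: "q \<in> ball 0 1" for q proof (cases "q = 0")
   case True
   thus ?thesis unfolding G_def by (simp add: powser_sums_zero powser_zero)
  next
   case False
   then obtain z where "z \<in> HH" "nome z = q" using nome_surj[of q] q by auto
   with a[of z] show ?thesis unfolding G_def by (auto simp: sums_iff)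
  qed
  hence "G holomorphic_on ball 0 1" by (rule power_series_holomorphic)
  moreover have "f z = G (nome z)" if "z \<in> HH" for z using a[OF that] by (simp add: G_def sums_iff)
  ultimately show "EX G. q_expansion f G" by (auto simp: q_expansion_def)
 next
  assume "EX G. q_expansion f G"
  then obtain G where G: "G holomorphic_on ball 0 1" "!!z. z \<in> HH ==> f z = G (nome z)" by (auto simp: q_expansion_def)
  have "(%n. (deriv ^^ n) G 0 / fact n * nome z ^ n) sums f z" if "z \<in> HH" for z
   using holomorphic_power_series[OF G(1) nome_in_ball[OF that]] G(2)[OF that] by simp
  thus "\<exists>a :: nat => complex. \<forall>z\<in>HH. (%n. a n * nome z ^ n) sums f z"
   by (intro exI[of _ "%n. (deriv ^^ n) G 0 / fact n"] ballI)
 qed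
 thus ?thesis unfolding modular_form_def mob_def cocycle_def nome_def by simp
qed

text \<open>By periodicity \<open>F\<close> factors through the nome, and the limit at the cusp removes the
 singularity at 0.\<close>

lemma q_expansion_exists:
 assumes F: "F holomorphic_on HH" and per: "!!z. z \<in> HH ==> F (z + 1) = F z" and lim: "(F \<longlongrightarrow> L) to_cusp"
 obtains G where "q_expansion F G" "G 0 = L" proof -
 have per_nat: "F (z + of_nat n) = F z" if "z \<in> HH" for z n proof (induction n)
  case (Suc n)
  have "z + of_nat n \<in> HH" using that by (simp add: upper_half_plane_def)
  from per[OF this] Suc show ?case by (simp add: algebra_simps)
 qed simp
 have per_int: "F (z + of_int n) = F z" if "z \<in> HH" for z n proof (cases "n >= 0")
  case True
  thus ?thesis using per_nat[OF that, of "nat n"] by simp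
 next
  case False
  have "z + of_int n \<in> HH" using that by (simp add: upper_half_plane_def)
  from per_nat[OF this, of "nat (-n)"] False show ?thesis by simp
 qed
 have ex: "\<exists>z\<in>HH. nome z = q" if "q \<in> ball 0 1 - {0}" for q using that nome_surj[of q] by auto
 define lg where "lg = (%q. SOME z. z \<in> HH & nome z = q)"
 have lg: "lg q \<in> HH" "nome (lg q) = q" if "q \<in> ball 0 1 - {0}" for q
  using someI_ex[of "%z. z \<in> HH & nome z = q"] ex[OF that] by (auto simp: lg_def)
 define G0 where "G0 = (%q. F (lg q))"
 have G0: "G0 (nome z) = F z" if "z \<in> HH" for z proof -
  have "nome z \<in> ball 0 1 - {0}" using nome_in_ball[OF that] by simp
  from lg[OF this] obtain n :: int where "lg (nome z) = z + of_int n" using nome_eq_iff[of z "lg (nome z)"] by auto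
  thus ?thesis using per_int[OF that] by (simp add: G0_def)
 qed
 have hol: "G0 holomorphic_on ball 0 1 - {0}" proof -
  have "G0 field_differentiable at q" if q: "q \<in> ball 0 1 - {0}" for q proof -
   define z0 where "z0 = lg q"
   define lc where "lc = (%p. z0 + Ln (p / q) / (2 * of_real pi * \<i>))"
   have z0: "z0 \<in> HH" "nome z0 = q" using lg[OF q] by (auto simp: z0_def)
   have "lc analytic_on {q}" unfolding lc_def using q by (intro analytic_intros) (auto simp: complex_nonpos_Reals_iff)
   hence d: "lc field_differentiable at q" by (simp add: analytic_on_imp_differentiable_at)
   hence "isCont lc q" by (rule field_differentiable_imp_continuous_at)
   moreover have "lc q = z0" using q by (simp add: lc_def)
   ultimately have evH: "\<forall>\<^sub>F p in nhds q. lc p \<in> HH"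
    using z0 open_HH continuous_at_open[of q lc] eventually_nhds[of "%p. lc p \<in> HH" q] by auto
   have evn: "\<forall>\<^sub>F p in nhds q. p ~= 0" using q by (intro t1_space_nhds) auto
   have eq: "\<forall>\<^sub>F p in nhds q. F (lc p) = G0 p" using evH evn proof eventually_elim
    case (elim p)
    have "nome (lc p) = nome z0 * exp (Ln (p / q))" by (simp add: nome_def lc_def exp_add[symmetric] algebra_simps)
    also have "... = p" using q elim z0 by (subst exp_Ln) auto
    finally show ?case using G0[OF elim(1)] by simp
   qed
   have "F field_differentiable at (lc q)"
    using F z0 \<open>lc q = z0\<close> open_HH by (auto simp: holomorphic_on_open field_differentiable_def)
   with d have "(F \<circ> lc) field_differentiable at q" by (rule field_differentiable_compose)
   then obtain D where "((F \<circ> lc) has_field_derivative D) (at q)" by (auto simp: field_differentiable_def)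
   hence "(G0 has_field_derivative D) (at q)" using DERIV_cong_ev[of q q "F \<circ> lc" G0 D D] eq by (simp add: o_def)
   thus ?thesis by (auto simp: field_differentiable_def)
  qed
  thus ?thesis by (auto simp: holomorphic_on_def intro: field_differentiable_at_within)
 qed
 have lim0: "(G0 \<longlongrightarrow> L) (at 0)" proof (rule tendstoI)
  fix e :: real assume "e > 0"
  hence "\<forall>\<^sub>F z in to_cusp. dist (F z) L < e" using lim tendstoD by blast
  then obtain Y where Y: "!!z. Im z > Y ==> dist (F z) L < e" unfolding eventually_to_cusp by auto
  show "\<forall>\<^sub>F q in at 0. dist (G0 q) L < e" unfolding eventually_at
  proof (intro exI[of _ "min 1 (exp (- 2 * pi * Y))"] conjI ballI impI)
   fix q :: complex assume "q ~= 0 & dist q 0 < min 1 (exp (- 2 * pi * Y))"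
   hence q: "q \<in> ball 0 1 - {0}" "cmod q < exp (- 2 * pi * Y)" by auto
   hence "exp (- 2 * pi * Im (lg q)) < exp (- 2 * pi * Y)" using lg(2)[OF q(1)] norm_nome[of "lg q"] by simp
   hence "Im (lg q) > Y" by simp
   thus "dist (G0 q) L < e" using Y by (simp add: G0_def)
  qed auto
 qed
 define G where "G = (%q. if q = 0 then L else G0 q)"
 have "G holomorphic_on ball 0 1" proof (rule no_isolated_singularity'[of "{0}"])
  show "G holomorphic_on ball 0 1 - {0}" by (rule holomorphic_transform[OF hol]) (auto simp: G_def)
  show "(G \<longlongrightarrow> G z) (at z within ball 0 1)" if "z \<in> {0}" for z proof -
   have "(G \<longlongrightarrow> L) (at 0)" by (rule Lim_transform_eventually[OF lim0]) (auto simp: G_def eventually_at_filter)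
   thus ?thesis using that by (auto simp: G_def intro: tendsto_within_subset)
  qed
 qed auto
 hence "q_expansion F G" unfolding q_expansion_def using G0 by (auto simp: G_def)
 thus ?thesis by (rule that) (simp add: G_def)
qed

section \<open>Eisenstein series\<close>

lemma summable_on_inverse_square_int: "(%n::int. 1 / (1 + (of_int n)^2) :: real) summable_on UNIV" proof -
 have nat: "(%n::nat. 1 / (1 + (of_nat n)^2) :: real) summable_on UNIV" proof -
  have "summable (%n::nat. 1 / (1 + (of_nat n)^2) :: real)" proof (rule summable_comparison_test')
   show "summable (%n::nat. inverse (of_nat n ^ 2) :: real)" by (rule inverse_power_summable) auto
   show "norm (1 / (1 + (of_nat n)^2) :: real) <= inverse (of_nat n ^ 2)" if "n >= 1" for n :: nat
    using that by (auto simp: inverse_eq_divide intro!: divide_left_mono mult_pos_pos add_pos_nonneg)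
  qed
  thus ?thesis by (subst summable_on_UNIV_nonneg_real_iff) auto
 qed
 have "(%n::int. 1 / (1 + (of_int n)^2) :: real) summable_on (range int)" by (subst summable_on_reindex) (auto simp: o_def nat)
 moreover have "(%n::int. 1 / (1 + (of_int n)^2) :: real) summable_on (range (%n. - int n))"
  by (subst summable_on_reindex) (auto simp: o_def nat inj_on_def)
 ultimately have "(%n::int. 1 / (1 + (of_int n)^2) :: real) summable_on (range int \<union> range (%n. - int n))"
  by (rule summable_on_union)
 also have "range int \<union> range (%n. - int n) = UNIV" proof -
  have "x \<in> range int \<union> range (%n. - int n)" for x by (cases x rule: int_cases2) auto
  thus ?thesis by auto
 qed
 finally show ?thesis .
qed

text \<open>A summable majorant of the Eisenstein series that is a product over the two indices.\<close>

definition lattice_weight :: "int \<times> int => real" where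
 "lattice_weight = (%(c, d). 1 / (1 + (of_int c)^2) * (1 / (1 + (of_int d)^2)))"

lemma lattice_weight_summable: "lattice_weight summable_on S" proof -
 let ?f = "%n::int. 1 / (1 + (of_int n)^2) :: real"
 have "(%x. norm (lattice_weight x)) summable_on (UNIV \<times> UNIV)"
  unfolding Infinite_Sum.abs_summable_on_Sigma_iff proof (intro conjI ballI)
  fix c :: int
  have "(%d. ?f c * ?f d) summable_on UNIV" by (intro summable_on_cmult_right summable_on_inverse_square_int)
  thus "(%d. norm (lattice_weight (c, d))) summable_on UNIV" by (simp add: lattice_weight_def abs_mult)
 next
  have "(\<Sum>\<^sub>\<infinity>d. norm (lattice_weight (c, d))) = ?f c * (\<Sum>\<^sub>\<infinity>d. ?f d)" for c
   by (simp add: lattice_weight_def abs_mult flip: infsum_cmult_right')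
  moreover have "(%c. norm (?f c * (\<Sum>\<^sub>\<infinity>d. ?f d))) summable_on UNIV"
   using summable_on_cmult_left[OF summable_on_inverse_square_int, of "\<bar>\<Sum>\<^sub>\<infinity>d. ?f d\<bar>"] by (simp add: abs_mult)
  ultimately show "(%c. norm (\<Sum>\<^sub>\<infinity>d. norm (lattice_weight (c, d)))) summable_on UNIV" by simp
 qed
 hence "lattice_weight summable_on UNIV" by (simp add: abs_summable_summable)
 thus ?thesis using summable_on_subset_banach by blast
qed

lemma lattice_weight_le: assumes "(c, d) ~= (0, 0)"
 shows "1 / ((of_int c)^2 + (of_int d)^2)^2 <= 3 * lattice_weight (c, d)" proof -
 define s :: real where "s = (of_int c)^2 + (of_int d)^2"
 have "c^2 + d^2 > 0" using assms by (simp add: sum_power2_gt_zero_iff)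
 hence "c^2 + d^2 >= 1" by linarith
 hence "real_of_int (c^2 + d^2) >= 1" by (simp only: of_int_1_le_iff)
 hence s: "s >= 1" by (simp add: s_def)
 have "(1 + (of_int c)^2) * (1 + (of_int d)^2) = 1 + s + (of_int c)^2 * (of_int d)^2" by (simp add: s_def algebra_simps)
 also have "real_of_int c ^ 2 * of_int d ^ 2 <= s * s" unfolding s_def by (intro mult_mono) auto
 also have "1 + s + s * s <= 3 * s^2" proof -
  have "s * 1 <= s * s" using s by (intro mult_left_mono) auto
  thus ?thesis using s unfolding power2_eq_square by linarith
 qed
 finally have "(1 + (of_int c)^2) * (1 + (of_int d)^2) <= 3 * s^2" by simp
 moreover have "(1 + (real_of_int c)^2) * (1 + (of_int d)^2) > 0" by (intro mult_pos_pos add_pos_nonneg) auto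
 ultimately have "1 / s^2 <= 3 * (1 / ((1 + (of_int c)^2) * (1 + (of_int d)^2)))" using s by (simp add: field_simps)
 thus ?thesis by (simp add: lattice_weight_def s_def)
qed

text \<open>Both \<open>c\<close> and \<open>d\<close> are controlled by \<open>|c z + d|\<close>: the imaginary
 part bounds \<open>c\<close>, then the triangle inequality bounds \<open>d\<close>. The bound is uniform on
 compact sets.\<close>

lemma cocycle_lower_bound: assumes y: "y > 0" and z: "Im z >= y" "cmod z <= R"
 shows "(of_int c)^2 + (of_int d)^2 <= (1 / y^2 + (1 + R / y)^2) * (cmod (cocycle c d z))^2" proof -
 define t where "t = cmod (cocycle c d z)"
 have R: "R >= 0" using z(2) norm_ge_zero order_trans by blast
 have "abs (Im (cocycle c d z)) <= t" unfolding t_def by (rule abs_Im_le_cmod)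
 hence "abs (of_int c) * Im z <= t" using y z by (simp add: cocycle_def abs_mult)
 moreover have "abs (real_of_int c) * y <= abs (of_int c) * Im z" using z by (intro mult_left_mono) auto
 ultimately have c: "abs (real_of_int c) <= t / y" using y by (simp add: field_simps)
 have "cmod (of_int d) <= cmod (cocycle c d z) + cmod (of_int c * z)"
  using norm_triangle_ineq4[of "cocycle c d z" "of_int c * z"] by (simp add: cocycle_def)
 hence "abs (real_of_int d) <= t + abs (of_int c) * cmod z" by (simp add: t_def norm_mult)
 also have "abs (of_int c) * cmod z <= t / y * R" using c z y by (intro mult_mono) (auto simp: t_def)
 finally have d: "abs (real_of_int d) <= (1 + R / y) * t" by (simp add: algebra_simps)
 have "(of_int c)^2 <= (t / y)^2" using c by (metis abs_ge_zero power2_abs power_mono)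
 moreover have "(of_int d)^2 <= ((1 + R / y) * t)^2" using d by (metis abs_ge_zero power2_abs power_mono)
 moreover have "(1 / y^2 + (1 + R / y)^2) * t^2 = (t / y)^2 + ((1 + R / y) * t)^2"
  unfolding power_mult_distrib[of "1 + R / y"] power_divide[of t] distrib_right[of "1 / y^2"] by simp
 ultimately show ?thesis unfolding t_def[symmetric] by linarith
qed

lemma cocycle_power_bound: assumes y: "y > 0" and k: "k >= 4"
 shows "EX C. \<forall>z c d. Im z >= y --> cmod z <= R --> (c, d) ~= (0, 0) -->
   cmod (1 / (cocycle c d z) ^ k) <= C * lattice_weight (c, d)" proof -
 define M where "M = 1 / y^2 + (1 + R / y)^2"
 have M: "M > 0" using y by (simp add: M_def add_pos_nonneg)
 show ?thesis proof (intro exI[of _ "(M + 1) ^ (k - 4) * (M^2 * 3)"] allI impI)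
  fix z c d assume z: "Im z >= y" "cmod z <= R" and cd: "(c::int, d::int) ~= (0, 0)"
  define t where "t = cmod (cocycle c d z)"
  define s :: real where "s = (of_int c)^2 + (of_int d)^2"
  have "c^2 + d^2 > 0" using cd by (simp add: sum_power2_gt_zero_iff)
  hence "c^2 + d^2 >= 1" by linarith
  hence "real_of_int (c^2 + d^2) >= 1" by (simp only: of_int_1_le_iff)
  hence s: "s >= 1" by (simp add: s_def)
  have st: "s <= M * t^2" using cocycle_lower_bound[OF y z] by (simp add: s_def M_def t_def)
  have "t ~= 0" using st s M by auto
  hence t: "t > 0" by (simp add: t_def)
  have "1 <= (M + 1) * t" proof (rule ccontr)
   assume "~ 1 <= (M + 1) * t"
   hence lt: "(M + 1) * t < 1" by simp
   have "t * 1 <= (M + 1) * t" using M t by (simp add: algebra_simps)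
   hence "t < 1" using lt by linarith
   have "M * t^2 = (M * t) * t" by (simp add: power2_eq_square)
   also have "... <= (M * t) * 1" using \<open>t < 1\<close> M t by (intro mult_left_mono) auto
   also have "... < 1" using lt M t by (simp add: algebra_simps)
   finally show False using st s by linarith
  qed
  hence it: "1 / t <= M + 1" using t by (simp add: field_simps)
  have "s^2 <= (M * t^2)^2" using st s by (intro power_mono) auto
  hence "1 / t ^ 4 <= M^2 * (1 / s^2)" using t s by (simp add: field_simps power2_eq_square eval_nat_numeral)
  also have "... <= M^2 * (3 * lattice_weight (c, d))"
   using lattice_weight_le[OF cd] by (intro mult_left_mono) (auto simp: s_def)
  finally have 4: "1 / t ^ 4 <= M^2 * 3 * lattice_weight (c, d)" by simp
  have "cmod (1 / (cocycle c d z) ^ k) = 1 / t ^ k" by (simp add: t_def norm_divide norm_power)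
  also have "... = (1 / t) ^ (k - 4) * (1 / t ^ 4)" using k by (simp add: power_divide flip: power_add)
  also have "... <= (M + 1) ^ (k - 4) * (M^2 * 3 * lattice_weight (c, d))" using 4 it t M by (intro mult_mono power_mono) auto
  finally show "cmod (1 / (cocycle c d z) ^ k) <= (M + 1) ^ (k - 4) * (M^2 * 3) * lattice_weight (c, d)" by simp
 qed
qed

definition coprime_pairs :: "(int \<times> int) set" where "coprime_pairs = {(c, d). coprime c d}"

lemma coprime_pairs_nonzero: "(c, d) \<in> coprime_pairs ==> (c, d) ~= (0, 0)" by (auto simp: coprime_pairs_def)

lemma eisenstein_alt: "eisenstein k z = (\<Sum>\<^sub>\<infinity>(c, d)\<in>coprime_pairs. 1 / cocycle c d z ^ k) / 2"
 by (simp add: eisenstein_def coprime_pairs_def cocycle_def case_prod_unfold)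

lemma eisenstein_abs_summable: assumes "k >= 4" "z \<in> HH" "S \<subseteq> coprime_pairs"
 shows "(%x. norm (case x of (c, d) => 1 / cocycle c d z ^ k)) summable_on S" proof -
 have "Im z > 0" using assms by (simp add: upper_half_plane_def)
 from cocycle_power_bound[OF this assms(1), of "cmod z"] obtain C where
  C0: "\<forall>w c d. Im w >= Im z --> cmod w <= cmod z --> (c, d) ~= (0, 0) -->
    cmod (1 / (cocycle c d w) ^ k) <= C * lattice_weight (c, d)" ..
 have C: "cmod (1 / (cocycle c d z) ^ k) <= C * lattice_weight (c, d)" if "(c, d) ~= (0, 0)" for c d using C0 that by simp
 show ?thesis proof (rule Infinite_Sum.abs_summable_on_comparison_test'[where g="%x. C * lattice_weight x"])
  show "(%x. C * lattice_weight x) summable_on S" by (intro summable_on_cmult_right lattice_weight_summable)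
  show "norm (case x of (c, d) => 1 / cocycle c d z ^ k) <= C * lattice_weight x" if "x \<in> S" for x proof -
   obtain c d where x: "x = (c, d)" by (cases x)
   with that assms(3) coprime_pairs_nonzero have "(c, d) ~= (0, 0)" by blast
   from C[OF this] x show ?thesis by simp
  qed
 qed
qed

lemma eisenstein_holomorphic: assumes "k >= 4" shows "eisenstein k holomorphic_on HH" proof -
 have "eisenstein k field_differentiable at z" if z: "z \<in> HH" for z proof -
  obtain r where r: "r > 0" "cball z r \<subseteq> HH" using open_HH z open_contains_cball by blast
  define y where "y = Im z - r"
  have zr: "z - of_real r * \<i> \<in> cball z r" using r by (simp add: dist_norm norm_mult)
  hence "z - of_real r * \<i> \<in> HH" using r by blast
  hence y: "y > 0" by (simp add: y_def upper_half_plane_def)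
  from cocycle_power_bound[OF y assms, of "cmod z + r"] obtain C where
   C: "\<forall>w c d. Im w >= y --> cmod w <= cmod z + r --> (c, d) ~= (0, 0) -->
    cmod (1 / (cocycle c d w) ^ k) <= C * lattice_weight (c, d)" ..
  have ul: "uniform_limit (cball z r) (%X w. \<Sum>x\<in>X. (%(c, d). 1 / cocycle c d w ^ k) x)
    (%w. \<Sum>\<^sub>\<infinity>x\<in>coprime_pairs. (%(c, d). 1 / cocycle c d w ^ k) x) (finite_subsets_at_top coprime_pairs)"
  proof (rule Weierstrass_m_test_general[where M="%x. C * lattice_weight x"])
   show "(%x. C * lattice_weight x) summable_on coprime_pairs" by (intro summable_on_cmult_right lattice_weight_summable)
   fix x w assume x: "x \<in> coprime_pairs" and w: "w \<in> cball z r"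
   obtain c d where xcd: "x = (c, d)" by (cases x)
   have "cmod (z - w) <= r" using w by (simp add: dist_norm)
   hence "Im w >= y" "cmod w <= cmod z + r"
    using abs_Im_le_cmod[of "z - w"] norm_triangle_ineq2[of w z] by (auto simp: y_def norm_minus_commute)
   thus "norm (case x of (c, d) => 1 / cocycle c d w ^ k) <= C * lattice_weight x"
    using C[rule_format, of w c d] coprime_pairs_nonzero[of c d] x xcd by auto
  qed
  have ev: "\<forall>\<^sub>F X in finite_subsets_at_top coprime_pairs. continuous_on (cball z r) (%w. \<Sum>x\<in>X. (%(c, d). 1 / cocycle c d w ^ k) x)
    & (%w. \<Sum>x\<in>X. (%(c, d). 1 / cocycle c d w ^ k) x) holomorphic_on ball z r"
  proof (rule eventually_finite_subsets_at_top_weakI)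
   fix X assume X: "finite X" "X \<subseteq> coprime_pairs"
   have hol: "(%w. \<Sum>x\<in>X. (%(c, d). 1 / cocycle c d w ^ k) x) holomorphic_on HH" proof (intro holomorphic_on_sum)
    fix x assume "x \<in> X"
    obtain c d where xcd: "x = (c, d)" by (cases x)
    have "(c, d) ~= (0, 0)" using \<open>x \<in> X\<close> X xcd coprime_pairs_nonzero by blast
    hence nz: "cocycle c d w ~= 0" if "w \<in> HH" for w using cocycle_nonzero that by blast
    have "(%w. cocycle c d w) holomorphic_on HH" unfolding cocycle_def by (intro holomorphic_intros)
    hence "(%w. 1 / cocycle c d w ^ k) holomorphic_on HH" using nz by (intro holomorphic_intros) auto
    thus "(%w. case x of (c, d) => 1 / cocycle c d w ^ k) holomorphic_on HH" by (simp add: xcd)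
   qed
   show "continuous_on (cball z r) (%w. \<Sum>x\<in>X. (%(c, d). 1 / cocycle c d w ^ k) x)
    & (%w. \<Sum>x\<in>X. (%(c, d). 1 / cocycle c d w ^ k) x) holomorphic_on ball z r"
    using holomorphic_on_subset[OF hol r(2)] holomorphic_on_subset[OF hol, of "ball z r"] r(2) ball_subset_cball[of z r]
    by (auto intro: holomorphic_on_imp_continuous_on)
  qed
  have "(%w. \<Sum>\<^sub>\<infinity>x\<in>coprime_pairs. (%(c, d). 1 / cocycle c d w ^ k) x) holomorphic_on ball z r"
   by (rule holomorphic_uniform_limit[OF ev ul]) auto
  hence "(%w. (\<Sum>\<^sub>\<infinity>x\<in>coprime_pairs. (%(c, d). 1 / cocycle c d w ^ k) x) / 2) holomorphic_on ball z r"
   by (intro holomorphic_intros) auto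
  hence "eisenstein k holomorphic_on ball z r" by (rule holomorphic_transform) (simp add: eisenstein_alt case_prod_unfold)
  thus ?thesis using r by (simp add: holomorphic_on_imp_differentiable_at)
 qed
 thus ?thesis by (auto simp: holomorphic_on_def intro: field_differentiable_at_within)
qed

lemma coprime_unimodular: fixes a b c d m n :: int assumes "a * d - b * c = 1" "coprime m n"
 shows "coprime (m * a + n * c) (m * b + n * d)" proof (rule coprimeI)
 fix p assume p: "p dvd m * a + n * c" "p dvd m * b + n * d"
 have "p dvd d * (m * a + n * c) - c * (m * b + n * d)" using p by (intro dvd_diff dvd_mult)
 also have "d * (m * a + n * c) - c * (m * b + n * d) = m * (a * d - b * c)" by (simp add: algebra_simps)
 finally have 1: "p dvd m" using assms by simp
 have "p dvd a * (m * b + n * d) - b * (m * a + n * c)" using p by (intro dvd_diff dvd_mult)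
 also have "a * (m * b + n * d) - b * (m * a + n * c) = n * (a * d - b * c)" by (simp add: algebra_simps)
 finally have "p dvd n" using assms by simp
 thus "is_unit p" using coprime_common_divisor[OF assms(2) 1] by blast
qed

text \<open>The matrix permutes the coprime pairs.\<close>

lemma eisenstein_modular: assumes det: "a * d - b * c = 1" and z: "z \<in> HH"
 shows "eisenstein k (mob a b c d z) = cocycle c d z ^ k * eisenstein k z" proof -
 let ?h = "%(m, n). (m * a + n * c, m * b + n * d)"
 have bij: "bij_betw ?h coprime_pairs coprime_pairs" proof (rule bij_betwI[where g="%(m, n). (m * d - n * c, n * a - m * b)"])
  show "?h \<in> coprime_pairs \<rightarrow> coprime_pairs" using coprime_unimodular[OF det] by (auto simp: coprime_pairs_def)
  have det': "d * a - (-b) * (-c) = 1" using det by (simp add: algebra_simps)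
  show "(%(m, n). (m * d - n * c, n * a - m * b)) \<in> coprime_pairs \<rightarrow> coprime_pairs"
   using coprime_unimodular[OF det'] by (auto simp: coprime_pairs_def algebra_simps)
  have 1: "(m * a + n * c) * d - (m * b + n * d) * c = m * (a * d - b * c)" "(m * b + n * d) * a - (m * a + n * c) * b = n * (a * d - b * c)"
   "(m * d - n * c) * a + (n * a - m * b) * c = m * (a * d - b * c)" "(m * d - n * c) * b + (n * a - m * b) * d = n * (a * d - b * c)" for m n
   by (simp_all add: algebra_simps)
  show "(%(m, n). (m * d - n * c, n * a - m * b)) (?h x) = x" for x using det 1 by (cases x) simp
  show "?h ((%(m, n). (m * d - n * c, n * a - m * b)) x) = x" for x using det 1 by (cases x) simp
 qed
 have nz: "cocycle c d z ~= 0" using cocycle_nonzero[OF z unimodular_not_both_zero[OF det]] .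
 have "(\<Sum>\<^sub>\<infinity>x\<in>coprime_pairs. (%(m, n). 1 / cocycle m n (mob a b c d z) ^ k) x) =
   (\<Sum>\<^sub>\<infinity>x\<in>coprime_pairs. cocycle c d z ^ k * (%(m, n). 1 / cocycle m n z ^ k) (?h x))"
  by (rule infsum_cong) (auto simp: cocycle_mob[OF det z] power_divide)
 also have "... = cocycle c d z ^ k * (\<Sum>\<^sub>\<infinity>x\<in>coprime_pairs. (%(m, n). 1 / cocycle m n z ^ k) (?h x))"
  by (rule infsum_cmult_right')
 also have "(\<Sum>\<^sub>\<infinity>x\<in>coprime_pairs. (%(m, n). 1 / cocycle m n z ^ k) (?h x)) = (\<Sum>\<^sub>\<infinity>x\<in>coprime_pairs. (%(m, n). 1 / cocycle m n z ^ k) x)"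
  by (rule infsum_reindex_bij_betw[OF bij])
 finally show ?thesis by (simp add: eisenstein_alt)
qed

text \<open>The pairs \<open>(0, 1)\<close> and \<open>(0, -1)\<close> give the constant term 1; for all others
 \<open>|c z + d|\<close> is large with \<open>Im z\<close>. This yields the limit at the cusp and with it the
 expansion in \<open>q\<close>, without computing coefficients.\<close>

lemma eisenstein_estimate: assumes k: "k >= 4" "even k" and z: "Im z >= 1" "abs (Re z) <= 1 / 2"
 shows "cmod (eisenstein k z - 1) <= 4 * (\<Sum>\<^sub>\<infinity>x\<in>coprime_pairs. lattice_weight x) / (Im z)^2" proof -
 have zH: "z \<in> HH" using z by (simp add: upper_half_plane_def)
 define y where "y = Im z"
 have y: "y >= 1" using z by (simp add: y_def)
 let ?f = "%(c, d). 1 / cocycle c d z ^ k"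
 \<comment> \<open>the pairs with \<open>c = 0\<close>\<close>
 define A where "A = {(0::int, 1::int), (0, -1)}"
 have A: "A \<subseteq> coprime_pairs" "finite A" by (auto simp: A_def coprime_pairs_def)
 have split: "coprime_pairs = A \<union> (coprime_pairs - A)" using A by auto
 have s: "?f summable_on (coprime_pairs - A)"
  using eisenstein_abs_summable[OF k(1) zH, of "coprime_pairs - A"] by (simp add: abs_summable_summable)
 have "infsum ?f coprime_pairs = infsum ?f A + infsum ?f (coprime_pairs - A)"
  by (subst split, rule infsum_Un_disjoint) (use A s in auto)
 also have "infsum ?f A = 2" using k(2) by (simp add: A_def cocycle_def)
 finally have eq: "eisenstein k z - 1 = infsum ?f (coprime_pairs - A) / 2"
  unfolding eisenstein_alt by (simp add: add_divide_distrib)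
 have bound: "norm (?f x) <= 8 / y^2 * lattice_weight x" if x: "x \<in> coprime_pairs - A" for x proof -
  obtain c d where xcd: "x = (c, d)" by (cases x)
  have c0: "c ~= 0" proof
   assume "c = 0"
   hence "abs d = 1" using x xcd by (auto simp: coprime_pairs_def)
   thus False using x xcd \<open>c = 0\<close> by (auto simp: A_def abs_if split: if_splits)
  qed
  hence "c^2 > 0" by simp
  hence "c^2 >= 1" by linarith
  hence "real_of_int (c^2) >= 1" by (simp only: of_int_1_le_iff)
  hence c2: "(real_of_int c)^2 >= 1" by simp
  define C D where "C = real_of_int c" and "D = real_of_int d"
  have C2: "C^2 >= 1" using c2 by (simp add: C_def)
  define t where "t = cmod (cocycle c d z)"
  have t2: "t^2 = (C * Re z + D)^2 + (C * y)^2" by (simp add: t_def cmod_power2 cocycle_def C_def D_def y_def)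
  have cx: "(C * Re z)^2 <= C^2 / 4" proof -
   have "(Re z)^2 <= (1/2)^2" using z(2) by (metis abs_ge_zero power2_abs power_mono)
   hence "C^2 * (Re z)^2 <= C^2 * (1/4)" by (intro mult_left_mono) (auto simp: power2_eq_square)
   thus ?thesis by (simp add: power_mult_distrib)
  qed
  have "0 <= (2 * (C * Re z) + D)^2" by simp
  hence sq: "(C * Re z + D)^2 >= D^2 / 2 - (C * Re z)^2" by (simp add: power2_eq_square algebra_simps)
  have y2: "y^2 >= 1" using y by simp
  have cy: "C^2 * 1 <= C^2 * y^2" using y2 by (intro mult_left_mono) auto
  have t2': "t^2 >= (D^2 + C^2 * y^2) / 2" proof -
   have aux: "u >= d / 2 - q ==> q <= c / 4 ==> c * 1 <= p ==> 1 <= c ==> (d + p) / 2 <= u + p" for u d q c p :: real by argo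
   show ?thesis unfolding t2 power_mult_distrib[of C y] by (rule aux[OF sq cx cy C2])
  qed
  have a1: "D^2 + C^2 * y^2 >= 1 + D^2" using cy C2 by linarith
  have a2: "D^2 + C^2 * y^2 >= (1 + C^2) * y^2 / 2" proof -
   have "1 * y^2 <= C^2 * y^2" using C2 by (intro mult_right_mono) auto
   thus ?thesis using zero_le_power2[of D] unfolding distrib_right add_divide_distrib by linarith
  qed
  have "(1 + D^2) * ((1 + C^2) * y^2 / 2) <= (D^2 + C^2 * y^2) * (D^2 + C^2 * y^2)" using a1 a2 by (intro mult_mono) auto
  also have "... <= (2 * t^2) * (2 * t^2)" using t2' by (intro mult_mono) auto
  finally have t4: "(1 + D^2) * (1 + C^2) * y^2 <= 8 * t ^ 4" by (simp add: power2_eq_square eval_nat_numeral)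
  have pos: "(1 + D^2) * (1 + C^2) > 0" by (intro mult_pos_pos add_pos_nonneg) auto
  have t1: "t >= 1" proof -
   have "t^2 >= (C * y)^2" unfolding t2 by simp
   hence "t^2 >= 1" using cy C2 unfolding power_mult_distrib by linarith
   thus ?thesis by (metis abs_le_square_iff abs_norm_cancel abs_one one_power2 t_def)
  qed
  have "norm (?f x) = 1 / t ^ k" by (simp add: xcd t_def norm_divide norm_power)
  also have "... <= 1 / t ^ 4" using t1 k(1) by (intro divide_left_mono power_increasing) auto
  also have "... <= 8 / (y^2 * ((1 + D^2) * (1 + C^2)))" proof -
   have X: "y^2 * ((1 + D^2) * (1 + C^2)) > 0" using pos y by (intro mult_pos_pos[OF _ pos]) auto
   have "y^2 * ((1 + D^2) * (1 + C^2)) <= 8 * t ^ 4" using t4 by (simp only: mult.commute)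
   hence "8 / (8 * t ^ 4) <= 8 / (y^2 * ((1 + D^2) * (1 + C^2)))"
    by (rule divide_left_mono[OF _ _ mult_pos_pos[OF _ X]]) (use t1 in auto)
   thus ?thesis by simp
  qed
  also have "... = 8 / y^2 * lattice_weight x" by (simp add: xcd lattice_weight_def C_def D_def)
  finally show ?thesis .
 qed
 have sw: "(%x. 8 / y^2 * lattice_weight x) summable_on S" for S by (intro summable_on_cmult_right lattice_weight_summable)
 have "norm (infsum ?f (coprime_pairs - A)) <= infsum (%x. 8 / y^2 * lattice_weight x) (coprime_pairs - A)"
  by (rule norm_infsum_le[OF has_sum_infsum[OF s] has_sum_infsum[OF sw] bound])
 also have "... <= infsum (%x. 8 / y^2 * lattice_weight x) coprime_pairs"
  by (rule infsum_mono_neutral[OF sw sw]) (auto simp: lattice_weight_def)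
 also have "... = 8 / y^2 * infsum lattice_weight coprime_pairs" by (rule infsum_cmult_right')
 finally show ?thesis unfolding eq by (simp add: norm_divide y_def)
qed

lemma eisenstein_q_expansion: assumes k: "k >= 4" "even k"
 obtains G where "q_expansion (eisenstein k) G" "G 0 = 1" proof (rule q_expansion_exists)
 show "eisenstein k holomorphic_on HH" by (rule eisenstein_holomorphic[OF k(1)])
 have per: "eisenstein k (z + of_int n) = eisenstein k z" if "z \<in> HH" for z n
  using eisenstein_modular[of 1 1 n 0 z k] that by (simp add: mob_def cocycle_def)
 show "eisenstein k (z + 1) = eisenstein k z" if "z \<in> HH" for z using per[OF that, of 1] by simp
 define C where "C = 4 * (\<Sum>\<^sub>\<infinity>x\<in>coprime_pairs. lattice_weight x)"
 have bd: "cmod (eisenstein k z - 1) <= C / (Im z)^2" if "Im z >= 1" for z proof -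
  define n where "n = - round (Re z)"
  have "abs (Re (z + of_int n)) <= 1 / 2" using of_int_round_abs_le[of "Re z"] by (simp add: n_def abs_minus_commute)
  moreover have "Im (z + of_int n) = Im z" by simp
  ultimately have "cmod (eisenstein k (z + of_int n) - 1) <= C / (Im (z + of_int n))^2"
   unfolding C_def using that by (intro eisenstein_estimate k) auto
  thus ?thesis using per[of z n] that by (simp add: upper_half_plane_def)
 qed
 have C: "C >= 0" unfolding C_def by (intro mult_nonneg_nonneg infsum_nonneg) (auto simp: lattice_weight_def)
 show "(eisenstein k \<longlongrightarrow> 1) to_cusp" proof (rule tendstoI)
  fix e :: real assume e: "e > 0"
  show "\<forall>\<^sub>F z in to_cusp. dist (eisenstein k z) 1 < e" unfolding eventually_to_cusp
  proof (intro exI[of _ "max 1 (C / e)"] allI impI)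
   fix z assume "Im z > max 1 (C / e)"
   hence z: "Im z > 1" "Im z > C / e" by auto
   have "C / (Im z)^2 <= C / Im z" using z C by (intro divide_left_mono) (auto simp: power2_eq_square)
   also have "... < e" using z e by (simp add: field_simps)
   finally show "dist (eisenstein k z) 1 < e" using bd[of z] z by (simp add: dist_norm)
  qed
 qed
qed (use that in auto)

lemma modular_form_eisenstein: assumes "k >= 4" "even k" shows "modular_form (int k) (eisenstein k)" proof -
 obtain G where "q_expansion (eisenstein k) G" using eisenstein_q_expansion[OF assms] by blast
 thus ?thesis unfolding modular_form_alt
  using eisenstein_holomorphic[OF assms(1)] eisenstein_modular by (auto simp: power_int_of_nat)
qed

section \<open>Vanishing of forms of low weight\<close>

text \<open>Take a coprime pair \<open>(c, d)\<close> with least \<open>|c z + d|\<close> as the lower row of a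
 matrix, and translate. The upper row \<open>(a, b)\<close> is coprime too, so minimality gives \<open>|z'| >=
 1\<close> for the image \<open>z'\<close>.\<close>

lemma fundamental_domain: assumes z: "z \<in> HH"
 obtains z' where "SL2Z_equiv z z'" "z' \<in> HH" "abs (Re z') <= 1 / 2" "Im z' >= sqrt 3 / 2" proof -
 have y: "Im z > 0" using z by (simp add: upper_half_plane_def)
 define M where "M = 1 / (Im z)^2 + (1 + cmod z / Im z)^2"
 define T where "T = {(c, d) \<in> coprime_pairs. cmod (cocycle c d z) <= 1}"
 have "T \<subseteq> {- \<lceil>M\<rceil>..\<lceil>M\<rceil>} \<times> {- \<lceil>M\<rceil>..\<lceil>M\<rceil>}" proof
  fix x assume "x \<in> T"
  then obtain c d where x: "x = (c, d)" "cmod (cocycle c d z) <= 1" by (auto simp: T_def)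
  have M0: "M >= 0" by (simp add: M_def)
  have "(of_int c)^2 + (of_int d)^2 <= M * (cmod (cocycle c d z))^2" unfolding M_def by (rule cocycle_lower_bound[OF y]) auto
  also have "... <= M * 1" using x M0 by (intro mult_left_mono) (auto simp: power_le_one)
  finally have "real_of_int (c^2 + d^2) <= M" by simp
  hence "c^2 + d^2 <= \<lceil>M\<rceil>" by linarith
  moreover have "abs e <= e^2" for e :: int
   using self_le_power[of "abs e" 2] by (cases "e = 0") auto
  from this[of c] this[of d] have "abs c <= c^2" "abs d <= d^2" by auto
  ultimately have "abs c <= \<lceil>M\<rceil>" "abs d <= \<lceil>M\<rceil>" using zero_le_power2[of c] zero_le_power2[of d] by linarith+
  thus "x \<in> {- \<lceil>M\<rceil>..\<lceil>M\<rceil>} \<times> {- \<lceil>M\<rceil>..\<lceil>M\<rceil>}" using x by auto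
 qed
 hence fin: "finite T" by (rule finite_subset) auto
 have T01: "(0, 1) \<in> T" by (auto simp: T_def coprime_pairs_def cocycle_def)
 define x where "x = arg_min_on (%(c, d). cmod (cocycle c d z)) T"
 have xT: "x \<in> T" unfolding x_def by (rule arg_min_if_finite) (use fin T01 in auto)
 obtain c d where cd: "x = (c, d)" by (cases x)
 have min: "cmod (cocycle c d z) <= cmod (cocycle c' d' z)" if "coprime c' d'" for c' d' proof (cases "(c', d') \<in> T")
  case True
  have "~ (%(c, d). cmod (cocycle c d z)) (c', d') < (%(c, d). cmod (cocycle c d z)) x"
   unfolding x_def using arg_min_if_finite(2)[OF fin, of "%(c, d). cmod (cocycle c d z)"] True by blast
  thus ?thesis using cd by simp
 next
  case False
  hence "cmod (cocycle c' d' z) > 1" using that by (auto simp: T_def coprime_pairs_def)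
  moreover have "cmod (cocycle c d z) <= 1" using xT cd by (auto simp: T_def)
  ultimately show ?thesis by linarith
 qed
 have "coprime c d" using xT cd by (auto simp: T_def coprime_pairs_def)
 then obtain u v where uv: "u * c + v * d = 1" using bezout_int[of c d] by (auto simp: coprime_iff_gcd_eq_1)
 \<comment> \<open>the translation that brings the real part into \<open>[-1/2, 1/2]\<close>\<close>
 define n where "n = - round (Re (mob v (-u) c d z))"
 define a where "a = v + n * c"
 define b where "b = -u + n * d"
 have det0: "v * d - (-u) * c = 1" using uv by (simp add: algebra_simps)
 have det: "a * d - b * c = 1" using uv by (simp add: a_def b_def algebra_simps)
 have nz: "cocycle c d z ~= 0" using cocycle_nonzero[OF z unimodular_not_both_zero[OF det]] .
 define z' where "z' = mob a b c d z"
 have eq: "z' = mob v (-u) c d z + of_int n" proof -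
  have "of_int a * z + of_int b = (of_int v * z + of_int (-u)) + of_int n * cocycle c d z"
   by (simp add: a_def b_def cocycle_def algebra_simps)
  thus ?thesis using nz by (simp add: z'_def mob_def add_divide_distrib)
 qed
 have z': "z' \<in> HH" unfolding z'_def by (rule mob_in_HH[OF det z])
 have re: "abs (Re z') <= 1 / 2" using of_int_round_abs_le[of "Re (mob v (-u) c d z)"] by (simp add: eq n_def abs_minus_commute)
 have "coprime a b" proof (rule coprimeI)
  fix p assume "p dvd a" "p dvd b"
  hence "p dvd a * d - b * c" by simp
  thus "is_unit p" using det by simp
 qed
 hence "cmod (cocycle c d z) <= cmod (cocycle a b z)" by (rule min)
 moreover have "z' = cocycle a b z / cocycle c d z" by (simp add: z'_def mob_def cocycle_def)
 ultimately have "cmod z' >= 1" using nz by (simp add: norm_divide)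
 hence "1 <= (Re z')^2 + (Im z')^2" by (metis cmod_power2 one_le_power)
 moreover have "(Re z')^2 <= (1/2)^2" using re by (metis abs_ge_zero power2_abs power_mono)
 ultimately have "(Im z')^2 >= 3 / 4" by (simp add: power2_eq_square)
 hence "(Im z')^2 >= (sqrt 3 / 2)^2" by (simp add: power_divide)
 moreover have "Im z' >= 0" using z' by (simp add: upper_half_plane_def)
 ultimately have "Im z' >= sqrt 3 / 2" by (rule power2_le_imp_le)
 moreover have "SL2Z_equiv z z'" unfolding SL2Z_equiv_alt z'_def using det by blast
 ultimately show ?thesis using that z' re by blast
qed

text \<open>The part of the fundamental domain below height \<open>Y\<close>, enlarged to a compact
 rectangle.\<close>

definition fund_box :: "real => complex set" where
 "fund_box Y = cbox (Complex (- 1 / 2) (sqrt 3 / 2)) (Complex (1 / 2) Y)"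

lemma compact_fund_box: "compact (fund_box Y)" by (simp add: fund_box_def)

lemma fund_box_HH: "fund_box Y \<subseteq> HH" proof
 fix z assume "z \<in> fund_box Y"
 hence "Im z >= sqrt 3 / 2" by (simp add: fund_box_def in_cbox_complex_iff)
 moreover have "sqrt 3 / 2 > (0::real)" by simp
 ultimately have "Im z > 0" by linarith
 thus "z \<in> HH" by (simp add: upper_half_plane_def)
qed

lemma modular_formD: assumes "modular_form k F"
 shows "F holomorphic_on HH" "!!a b c d z. a * d - b * c = 1 ==> z \<in> HH ==> F (mob a b c d z) = cocycle c d z powi k * F z"
  "EX G. q_expansion F G" using assms unfolding modular_form_alt by auto

lemma petersson_norm_invariant: assumes "modular_form k F" "a * d - b * c = 1" "z \<in> HH"
 shows "cmod (F (mob a b c d z)) * (Im (mob a b c d z)) powr (of_int k / 2) = cmod (F z) * (Im z) powr (of_int k / 2)" proof -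
 define t where "t = cmod (cocycle c d z)"
 have t: "t > 0" using cocycle_nonzero[OF assms(3) unimodular_not_both_zero[OF assms(2)]] by (simp add: t_def)
 have y: "Im z > 0" using assms by (simp add: upper_half_plane_def)
 have "cmod (F (mob a b c d z)) = t powr (of_int k) * cmod (F z)"
  unfolding modular_formD(2)[OF assms] norm_mult norm_power_int using t by (simp add: t_def powr_real_of_int' )
 moreover have "(Im (mob a b c d z)) powr (of_int k / 2) = (Im z) powr (of_int k / 2) / t powr (of_int k)" proof -
  have "t^2 = t powr 2" using t by simp
  hence "(t^2) powr (of_int k / 2) = t powr (of_int k)" by (simp add: powr_powr)
  thus ?thesis unfolding Im_mob[OF assms(2,3)] t_def[symmetric] using t y by (simp add: powr_divide)
 qed
 ultimately show ?thesis using t by simp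
qed

lemma powr_exp_decay: fixes C :: real assumes "c >= 1" "e > 0"
 shows "\<exists>Y\<ge>1. \<forall>y\<ge>Y. C * (y powr a * exp (- c * y)) < e" proof -
 define n where "n = nat \<lceil>a\<rceil>"
 have "((%y. abs C * (y ^ n / exp y)) \<longlongrightarrow> abs C * 0) at_top" by (intro tendsto_intros tendsto_power_div_exp_0)
 hence "\<forall>\<^sub>F y in at_top. dist (abs C * (y ^ n / exp y)) 0 < e" using assms by (intro tendstoD) auto
 then obtain Y where Y0: "\<forall>y\<ge>Y. dist (abs C * (y ^ n / exp y)) 0 < e" unfolding eventually_at_top_linorder ..
 have Y: "abs C * (y ^ n / exp y) < e" if "y >= Y" for y using order_le_less_trans[OF abs_ge_self Y0[rule_format, OF that, unfolded dist_real_def diff_0_right]] .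
 show ?thesis proof (intro exI[of _ "max 1 Y"] conjI allI impI)
  fix y assume "y >= max 1 Y"
  hence y: "y >= 1" "y >= Y" by auto
  have "y powr a <= y powr (real n)" using y real_nat_ceiling_ge[of a] by (intro powr_mono) (auto simp: n_def)
  also have "... = y ^ n" using y by (simp add: powr_realpow)
  finally have 1: "y powr a <= y ^ n" .
  have "1 * y <= c * y" using assms y by (intro mult_right_mono) auto
  hence 2: "exp (- c * y) <= exp (- y)" by simp
  have "C * (y powr a * exp (- c * y)) <= abs C * (y ^ n * exp (- y))"
   using 1 2 y by (intro mult_mono) auto
  also have "... = abs C * (y ^ n / exp y)" by (simp add: exp_minus divide_inverse)
  also have "... < e" using Y y by blast
  finally show "C * (y powr a * exp (- c * y)) < e" .
 qed auto
qed

text \<open>The invariant function \<open>\<Phi>\<close> tends to 0 at the cusp, so it has a maximum at some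
 \<open>z0\<close> with \<open>y0 = Im z0 >= sqrt 3 / 2\<close>. The maximum principle for \<open>G\<close> on a
 slightly larger disc, the image of a lower horizontal line, contradicts the monotonicity of \<open>t powr (- k
 / 2) * exp (2 pi m t)\<close> near \<open>y0\<close>.\<close>

theorem cusp_order_bound:
 assumes F: "modular_form k F" and k: "k >= 0" and m: "m >= 1" and km: "of_int k < 2 * sqrt 3 * pi * real m"
  and G: "G holomorphic_on ball 0 1" "!!z. z \<in> HH ==> F z = nome z ^ m * G (nome z)"
  and z: "z \<in> HH" shows "F z = 0" proof (rule ccontr)
 assume "F z ~= 0"
 define \<Phi> where "\<Phi> = (%z. cmod (F z) * (Im z) powr (of_int k / 2))"
 have inv: "\<Phi> z = \<Phi> z'" if "z \<in> HH" "SL2Z_equiv z z'" for z z'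
  using that petersson_norm_invariant[OF F] unfolding SL2Z_equiv_alt \<Phi>_def by auto
 obtain z1 where z1: "SL2Z_equiv z z1" "z1 \<in> HH" "abs (Re z1) <= 1 / 2" "Im z1 >= sqrt 3 / 2"
  using fundamental_domain[OF z] by blast
 have "\<Phi> z > 0" using \<open>F z ~= 0\<close> z by (simp add: \<Phi>_def upper_half_plane_def)
 hence pos: "\<Phi> z1 > 0" using inv[OF z z1(1)] by simp
 have s3: "sqrt 3 / 2 >= (1 / 2 :: real)" by simp
 have "cball 0 (exp (- pi)) \<subseteq> ball (0::complex) 1" by (intro subsetI) (simp, erule order_le_less_trans, simp)
 hence "compact (G ` cball 0 (exp (- pi)))"
  by (intro compact_continuous_image continuous_on_subset[OF holomorphic_on_imp_continuous_on[OF G(1)]]) auto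
 then obtain C where C: "!!q. cmod q <= exp (- pi) ==> cmod (G q) <= C"
  using compact_imp_bounded[of "G ` cball 0 (exp (- pi))"] unfolding bounded_iff by (metis imageI mem_cball_0)
 have norm_F: "cmod (F z) = exp (- 2 * pi * m * Im z) * cmod (G (nome z))" if "z \<in> HH" for z
  unfolding G(2)[OF that] norm_mult norm_power norm_nome by (simp add: exp_of_nat_mult[symmetric] algebra_simps)
 have "2 * pi * m >= 1" proof -
  have "1 <= 2 * pi * 1" using pi_ge_two by simp
  also have "... <= 2 * pi * m" using m by (intro mult_left_mono) auto
  finally show ?thesis .
 qed
 from powr_exp_decay[OF this pos, of C "of_int k / 2"] obtain Y where
  Y: "Y >= 1" "\<forall>y\<ge>Y. C * (y powr (of_int k / 2) * exp (- (2 * pi * m) * y)) < \<Phi> z1" by auto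
 have small: "\<Phi> z < \<Phi> z1" if "Im z >= Y" for z proof -
  have zH: "z \<in> HH" using that Y by (simp add: upper_half_plane_def)
  have "pi * 1 <= 2 * pi * Im z" using that Y pi_gt_zero by (simp add: mult_ge1_I mult.assoc)
  hence "cmod (G (nome z)) <= C" by (intro C) (simp add: norm_nome)
  hence "\<Phi> z <= exp (- 2 * pi * m * Im z) * C * (Im z) powr (of_int k / 2)"
   unfolding \<Phi>_def norm_F[OF zH] by (intro mult_right_mono mult_left_mono) auto
  also have "... = C * (Im z powr (of_int k / 2) * exp (- (2 * pi * m) * Im z))" by (simp add: algebra_simps)
  also have "... < \<Phi> z1" using Y(2) that by blast
  finally show ?thesis .
 qed
 define K where "K = fund_box Y"
 note K_def = K_def[unfolded fund_box_def]
 have KH: "K \<subseteq> HH" using fund_box_HH[of Y] by (simp add: K_def fund_box_def)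
 have contF: "continuous_on HH F" using modular_formD(1)[OF F] by (rule holomorphic_on_imp_continuous_on)
 have "continuous_on K \<Phi>"
  unfolding \<Phi>_def using KH by (intro continuous_intros continuous_on_subset[OF contF]) (auto simp: upper_half_plane_def)
 moreover have z1K: "z1 \<in> K" proof -
  have "Im z1 < Y" using small[of z1] by force
  thus ?thesis using z1 by (auto simp: K_def in_cbox_complex_iff)
 qed
 ultimately obtain z0 where z0: "z0 \<in> K" "!!z. z \<in> K ==> \<Phi> z <= \<Phi> z0"
  using continuous_attains_sup[of K \<Phi>] by (auto simp: K_def)
 have z0H: "z0 \<in> HH" using z0 KH by auto
 have M: "\<Phi> z0 > 0" using z0(2)[OF z1K] pos by linarith
 have max: "\<Phi> z <= \<Phi> z0" if zz: "z \<in> HH" for z proof -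
  obtain z' where z': "SL2Z_equiv z z'" "z' \<in> HH" "abs (Re z') <= 1 / 2" "Im z' >= sqrt 3 / 2"
   using fundamental_domain[OF zz] by blast
  have "\<Phi> z' <= \<Phi> z0" proof (cases "Im z' >= Y")
   case True
   thus ?thesis using small[of z'] z0(2)[OF z1K] by linarith
  next
   case False
   thus ?thesis using z' by (intro z0(2)) (auto simp: K_def in_cbox_complex_iff)
  qed
  thus ?thesis using inv[OF zz z'(1)] by simp
 qed
 define y0 where "y0 = Im z0"
 have y0: "y0 >= sqrt 3 / 2" using z0(1) by (simp add: y0_def K_def in_cbox_complex_iff)
 \<comment> \<open>the critical point of \<open>t powr (- k / 2) * exp (2 pi m t)\<close>, which increases beyond it\<close>
 define \<kappa> where "\<kappa> = real_of_int k / (4 * pi * m)"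
 have mpos: "real m > 0" using m by simp
 have "\<kappa> < sqrt 3 / 2" using km mpos by (simp add: \<kappa>_def field_simps)
 hence ky: "\<kappa> < y0" using y0 by linarith
 have k0: "\<kappa> >= 0" using k by (simp add: \<kappa>_def)
 define y where "y = (\<kappa> + y0) / 2"
 have y: "y > 0" "y < y0" "y > \<kappa>" using ky k0 y0 s3 by (auto simp: y_def)
 define r where "r = exp (- 2 * pi * y)"
 have r: "r > 0" "r < 1" using y by (auto simp: r_def)
 define B where "B = \<Phi> z0 * y powr (- (of_int k / 2)) * exp (2 * pi * m * y)"
 have "cmod (G (nome z0)) <= B" proof (rule maximum_modulus_frontier[of G "cball 0 r"])
  show "G holomorphic_on interior (cball 0 r)" by (rule holomorphic_on_subset[OF G(1)]) (use r in auto)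
  show "continuous_on (closure (cball 0 r)) G"
   by (rule continuous_on_subset[OF holomorphic_on_imp_continuous_on[OF G(1)]]) (use r in auto)
  have "exp (- 2 * pi * y0) < exp (- 2 * pi * y)" using y by simp
  thus "nome z0 \<in> cball 0 r" by (simp add: norm_nome y0_def r_def)
  show "cmod (G q) <= B" if "q \<in> frontier (cball 0 r)" for q proof -
   have q: "cmod q = r" using that r by (simp add: frontier_cball sphere_def)
   hence "q ~= 0" "cmod q < 1" using r by auto
   then obtain z where z: "z \<in> HH" "nome z = q" by (rule nome_surj)
   have Im: "Im z = y" using q z norm_nome[of z] by (simp add: r_def)
   have "cmod (F z) * y powr (of_int k / 2) <= \<Phi> z0" using max[OF z(1)] Im by (simp add: \<Phi>_def)
   hence "cmod (F z) <= \<Phi> z0 * y powr (- (of_int k / 2))" using y by (simp add: powr_minus field_simps)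
   moreover have "cmod (F z) = exp (- 2 * pi * m * y) * cmod (G q)" using norm_F[OF z(1)] z Im by simp
   ultimately have "exp (- 2 * pi * m * y) * cmod (G q) <= \<Phi> z0 * y powr (- (of_int k / 2))" by simp
   hence "exp (2 * pi * m * y) * (exp (- 2 * pi * m * y) * cmod (G q)) <= exp (2 * pi * m * y) * (\<Phi> z0 * y powr (- (of_int k / 2)))"
    by (intro mult_left_mono) auto
   moreover have "exp (2 * pi * m * y) * (exp (- 2 * pi * m * y) * cmod (G q)) = cmod (G q)"
    by (simp add: mult.assoc[symmetric] flip: exp_add)
   ultimately have "cmod (G q) <= exp (2 * pi * m * y) * (\<Phi> z0 * y powr (- (of_int k / 2)))" by (simp only:)
   thus ?thesis by (simp only: B_def mult_ac)
  qed
 qed (use r in auto)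
 moreover have "cmod (G (nome z0)) = \<Phi> z0 * y0 powr (- (of_int k / 2)) * exp (2 * pi * m * y0)" proof -
  have y0p: "y0 > 0" using y by linarith
  have "\<Phi> z0 = exp (- 2 * pi * m * y0) * cmod (G (nome z0)) * y0 powr (of_int k / 2)"
   unfolding \<Phi>_def norm_F[OF z0H] y0_def ..
  thus ?thesis using y0p by (simp add: powr_minus exp_minus field_simps)
 qed
 ultimately have "y0 powr (- (of_int k / 2)) * exp (2 * pi * m * y0) <= y powr (- (of_int k / 2)) * exp (2 * pi * m * y)"
  using M by (simp add: B_def mult.assoc)
 moreover have "t powr (- (of_int k / 2)) * exp (2 * pi * m * t) = exp (- (of_int k / 2) * ln t + 2 * pi * m * t)" if "t > 0" for t :: real
  using that unfolding exp_add by (simp add: powr_def)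
 ultimately have "exp (- (of_int k / 2) * ln y0 + 2 * pi * m * y0) <= exp (- (of_int k / 2) * ln y + 2 * pi * m * y)"
  using y by (simp only: order.strict_trans[OF y(1,2)])
 hence le: "- (of_int k / 2) * ln y0 + 2 * pi * m * y0 <= - (of_int k / 2) * ln y + 2 * pi * m * y" by simp
 have "ln y0 - ln y = ln (y0 / y)" using y by (simp add: ln_div)
 also have "... <= y0 / y - 1" using y by (intro ln_le_minus_one) auto
 also have "... = (y0 - y) / y" using y by (simp add: field_simps)
 finally have "of_int k / 2 * (ln y0 - ln y) <= of_int k / 2 * ((y0 - y) / y)" using k by (intro mult_left_mono) auto
 also have "... < 2 * pi * m * (y0 - y)" proof -
  have "real_of_int k < 4 * pi * m * y" using y(3) mpos by (simp add: \<kappa>_def field_simps)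
  hence "of_int k / (2 * y) < 2 * pi * m" using y by (simp add: field_simps)
  hence "of_int k / (2 * y) * (y0 - y) < 2 * pi * m * (y0 - y)" using y by (intro mult_strict_right_mono) auto
  thus ?thesis by (simp add: field_simps)
 qed
 finally show False using le by (simp add: algebra_simps diff_divide_distrib)
qed

section \<open>Rankin-Cohen brackets\<close>

lemma mob_has_field_derivative: assumes "a * d - b * c = 1" "z \<in> HH"
 shows "(mob a b c d has_field_derivative 1 / (cocycle c d z)^2) (at z)" proof -
 have nz: "cocycle c d z ~= 0" using cocycle_nonzero[OF assms(2) unimodular_not_both_zero[OF assms(1)]] .
 have det: "(of_int a :: complex) * of_int d - of_int b * of_int c = 1"
  using assms(1) by (metis of_int_1 of_int_diff of_int_mult)
 have "(mob a b c d has_field_derivative (of_int a * cocycle c d z - (of_int a * z + of_int b) * of_int c) / (cocycle c d z * cocycle c d z)) (at z)"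
  unfolding mob_def[abs_def] cocycle_def[abs_def] using nz[unfolded cocycle_def] by (auto intro!: derivative_eq_intros)
 also have "of_int a * cocycle c d z - (of_int a * z + of_int b) * of_int c = (of_int a :: complex) * of_int d - of_int b * of_int c"
  by (simp add: cocycle_def algebra_simps)
 finally show ?thesis using det by (simp add: power2_eq_square)
qed

lemma cocycle_has_field_derivative [derivative_intros]:
 "(cocycle c d has_field_derivative of_int c) (at z)" unfolding cocycle_def[abs_def] by (auto intro!: derivative_eq_intros)

lemma deriv_transform: assumes F: "F holomorphic_on HH" and det: "a * d - b * c = 1" and z: "z \<in> HH"
  and eq: "!!z. z \<in> HH ==> F (mob a b c d z) = R z" and R: "(R has_field_derivative R') (at z)"
 shows "deriv F (mob a b c d z) = (cocycle c d z)^2 * R'" proof -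
 have nz: "cocycle c d z ~= 0" using cocycle_nonzero[OF z unimodular_not_both_zero[OF det]] .
 have "(F has_field_derivative deriv F (mob a b c d z)) (at (mob a b c d z))"
  by (rule holomorphic_derivI[OF F open_HH mob_in_HH[OF det z]])
 hence "((%z. F (mob a b c d z)) has_field_derivative deriv F (mob a b c d z) * (1 / (cocycle c d z)^2)) (at z)"
  by (rule DERIV_chain2[OF _ mob_has_field_derivative[OF det z]])
 moreover have "((%z. F (mob a b c d z)) has_field_derivative R') (at z)"
  by (rule has_field_derivative_transform_within_open[OF R open_HH z]) (simp add: eq)
 ultimately have "deriv F (mob a b c d z) * (1 / (cocycle c d z)^2) = R'" by (rule DERIV_unique)
 thus ?thesis using nz by (simp add: field_simps)
qed

lemma modular_form_nat:
 "modular_form (int k) f \<longleftrightarrow> f holomorphic_on HH &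
   (\<forall>a b c d. a * d - b * c = 1 --> (\<forall>z\<in>HH. f (mob a b c d z) = cocycle c d z ^ k * f z)) &
   (EX G. q_expansion f G)" unfolding modular_form_alt by (simp add: power_int_of_nat)

lemma modular_deriv: assumes F: "modular_form (int k) F" and det: "a * d - b * c = 1" and z: "z \<in> HH"
 shows "deriv F (mob a b c d z) = cocycle c d z ^ (k + 2) * deriv F z + of_nat k * of_int c * cocycle c d z ^ (k + 1) * F z"
  "deriv (deriv F) (mob a b c d z) = cocycle c d z ^ (k + 4) * deriv (deriv F) z
   + 2 * (of_nat k + 1) * of_int c * cocycle c d z ^ (k + 3) * deriv F z
   + of_nat k * (of_nat k + 1) * (of_int c)^2 * cocycle c d z ^ (k + 2) * F z" proof -
 have hol: "F holomorphic_on HH" and tr: "!!z. z \<in> HH ==> F (mob a b c d z) = cocycle c d z ^ k * F z"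
  using F det unfolding modular_form_nat by auto
 have hol': "deriv F holomorphic_on HH" using hol open_HH by (rule holomorphic_deriv)
 have d1: "(F has_field_derivative deriv F z) (at z)" "(deriv F has_field_derivative deriv (deriv F) z) (at z)" if "z \<in> HH" for z
  using holomorphic_derivI[OF hol open_HH that] holomorphic_derivI[OF hol' open_HH that] by auto
 have tr': "deriv F (mob a b c d z) = cocycle c d z ^ (k + 2) * deriv F z + of_nat k * of_int c * cocycle c d z ^ (k + 1) * F z"
  if z: "z \<in> HH" for z proof -
  have "((%z. cocycle c d z ^ k * F z) has_field_derivative of_nat k * (of_int c * cocycle c d z ^ (k - 1)) * F z + deriv F z * cocycle c d z ^ k) (at z)"
   using d1[OF z] by (auto intro!: derivative_eq_intros)
  from deriv_transform[OF hol det z tr this]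
  have "deriv F (mob a b c d z) = (cocycle c d z)^2 * (of_nat k * (of_int c * cocycle c d z ^ (k - 1)) * F z + deriv F z * cocycle c d z ^ k)" .
  also have "... = cocycle c d z ^ (k + 2) * deriv F z + of_nat k * of_int c * cocycle c d z ^ (k + 1) * F z"
   by (cases k) (simp_all add: algebra_simps power2_eq_square)
  finally show ?thesis .
 qed
 show "deriv F (mob a b c d z) = cocycle c d z ^ (k + 2) * deriv F z + of_nat k * of_int c * cocycle c d z ^ (k + 1) * F z"
  by (rule tr'[OF z])
 have "((%z. cocycle c d z ^ (k + 2) * deriv F z + of_nat k * of_int c * cocycle c d z ^ (k + 1) * F z) has_field_derivative
   (of_nat (k + 2) * (of_int c * cocycle c d z ^ (k + 1)) * deriv F z + deriv (deriv F) z * cocycle c d z ^ (k + 2))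
   + of_nat k * of_int c * (of_nat (k + 1) * (of_int c * cocycle c d z ^ k) * F z + deriv F z * cocycle c d z ^ (k + 1))) (at z)"
 proof -
  have dp: "((%z. cocycle c d z ^ m') has_field_derivative of_nat m' * (of_int c * cocycle c d z ^ m)) (at z)" if "m' = Suc m" for m m'
   unfolding that by (rule DERIV_cong[OF DERIV_power_Suc[OF cocycle_has_field_derivative]]) simp
  have dp2: "((%z. cocycle c d z ^ (k + 2)) has_field_derivative of_nat (k + 2) * (of_int c * cocycle c d z ^ (k + 1))) (at z)"
   and dp1: "((%z. cocycle c d z ^ (k + 1)) has_field_derivative of_nat (k + 1) * (of_int c * cocycle c d z ^ k)) (at z)"
   by (intro dp; simp)+
  show ?thesis
   by (rule DERIV_cong[OF DERIV_add[OF DERIV_mult[OF dp2 d1(2)[OF z]] DERIV_mult[OF DERIV_cmult[OF dp1, of "of_nat k * of_int c"] d1(1)[OF z]]]])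
     (simp add: algebra_simps)
 qed
 from deriv_transform[OF hol' det z tr' this]
 show "deriv (deriv F) (mob a b c d z) = cocycle c d z ^ (k + 4) * deriv (deriv F) z
   + 2 * (of_nat k + 1) * of_int c * cocycle c d z ^ (k + 3) * deriv F z
   + of_nat k * (of_nat k + 1) * (of_int c)^2 * cocycle c d z ^ (k + 2) * F z"
  by (simp add: algebra_simps power2_eq_square power_add eval_nat_numeral)
qed

lemma q_expansion_deriv: assumes "q_expansion F G"
 shows "q_expansion (deriv F) (%q. 2 * of_real pi * \<i> * q * deriv G q)" unfolding q_expansion_def proof (intro conjI ballI)
 have G: "G holomorphic_on ball 0 1" "!!z. z \<in> HH ==> F z = G (nome z)" using assms by (auto simp: q_expansion_def)
 show "(%q. 2 * of_real pi * \<i> * q * deriv G q) holomorphic_on ball 0 1"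
  by (intro holomorphic_intros holomorphic_deriv G) auto
 fix z assume z: "z \<in> HH"
 have "(G has_field_derivative deriv G (nome z)) (at (nome z))" by (rule holomorphic_derivI[OF G(1) _ nome_in_ball[OF z]]) auto
 hence "((%z. G (nome z)) has_field_derivative deriv G (nome z) * (2 * of_real pi * \<i> * nome z)) (at z)"
  by (rule DERIV_chain2[OF _ nome_has_field_derivative])
 hence "(F has_field_derivative deriv G (nome z) * (2 * of_real pi * \<i> * nome z)) (at z)"
  by (rule has_field_derivative_transform_within_open[OF _ open_HH z]) (simp add: G)
 thus "deriv F z = 2 * of_real pi * \<i> * nome z * deriv G (nome z)" by (simp add: DERIV_imp_deriv)
qed

lemma q_expansion_mult: "q_expansion F G ==> q_expansion F' G' ==> q_expansion (%z. F z * F' z) (%q. G q * G' q)"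
 unfolding q_expansion_def by (auto intro: holomorphic_intros)
lemma q_expansion_add: "q_expansion F G ==> q_expansion F' G' ==> q_expansion (%z. F z + F' z) (%q. G q + G' q)"
 unfolding q_expansion_def by (auto intro: holomorphic_intros)
lemma q_expansion_diff: "q_expansion F G ==> q_expansion F' G' ==> q_expansion (%z. F z - F' z) (%q. G q - G' q)"
 unfolding q_expansion_def by (auto intro: holomorphic_intros)
lemma q_expansion_const: "q_expansion (%z. c) (%q. c)" unfolding q_expansion_def by auto
lemma q_expansion_power: "q_expansion F G ==> q_expansion (%z. F z ^ n) (%q. G q ^ n)"
 unfolding q_expansion_def by (auto intro: holomorphic_intros)
lemmas q_expansion_intros = q_expansion_mult q_expansion_add q_expansion_diff q_expansion_const q_expansion_power q_expansion_deriv

definition cusp_form :: "nat => (complex => complex) => bool" where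
 "cusp_form k F \<longleftrightarrow> modular_form (int k) F & (EX G. q_expansion F G & G 0 = 0)"

text \<open>The first Rankin-Cohen bracket, and below a multiple of the second bracket of a form with itself.
 The terms of \<open>modular_deriv\<close> that break modularity cancel in them.\<close>

definition bracket1 :: "nat => (complex => complex) => nat => (complex => complex) => complex => complex" where
 "bracket1 k F l H z = of_nat k * F z * deriv H z - of_nat l * H z * deriv F z"

definition bracket2 :: "nat => (complex => complex) => complex => complex" where
 "bracket2 k F z = of_nat k * F z * deriv (deriv F) z - (of_nat k + 1) * (deriv F z)^2"

lemma cusp_form_bracket1: assumes F: "modular_form (int k) F" and H: "modular_form (int l) H"
 shows "cusp_form (k + l + 2) (bracket1 k F l H)" proof -
 have hol: "F holomorphic_on HH" "H holomorphic_on HH" using F H unfolding modular_form_nat by auto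
 obtain G G' where G: "q_expansion F G" "q_expansion H G'" using F H unfolding modular_form_nat by auto
 have q: "q_expansion (bracket1 k F l H) (%q. of_nat k * G q * (2 * of_real pi * \<i> * q * deriv G' q) - of_nat l * G' q * (2 * of_real pi * \<i> * q * deriv G q))"
  unfolding bracket1_def[abs_def] by (intro q_expansion_intros G)
 have h: "bracket1 k F l H holomorphic_on HH"
  unfolding bracket1_def[abs_def] by (intro holomorphic_intros hol holomorphic_deriv open_HH)
 have "bracket1 k F l H (mob a b c d z) = cocycle c d z ^ (k + l + 2) * bracket1 k F l H z" if "a * d - b * c = 1" "z \<in> HH" for a b c d z
 proof -
  have "F (mob a b c d z) = cocycle c d z ^ k * F z" "H (mob a b c d z) = cocycle c d z ^ l * H z"
   using F H that unfolding modular_form_nat by auto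
  thus ?thesis unfolding bracket1_def modular_deriv(1)[OF F that] modular_deriv(1)[OF H that]
   by (simp add: algebra_simps power_add power2_eq_square)
 qed
 hence "modular_form (int (k + l + 2)) (bracket1 k F l H)" unfolding modular_form_nat using h q by auto
 thus ?thesis unfolding cusp_form_def using q by (intro conjI exI[of _ "%q. of_nat k * G q * (2 * of_real pi * \<i> * q * deriv G' q) - of_nat l * G' q * (2 * of_real pi * \<i> * q * deriv G q)"]) auto
qed

lemma cusp_form_bracket2: assumes F: "modular_form (int k) F" shows "cusp_form (2 * k + 4) (bracket2 k F)" proof -
 have hol: "F holomorphic_on HH" using F unfolding modular_form_nat by auto
 obtain G where G: "q_expansion F G" using F unfolding modular_form_nat by auto
 define G' where "G' = (%q. 2 * of_real pi * \<i> * q * deriv G q)"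
 have G': "q_expansion (deriv F) G'" unfolding G'_def by (rule q_expansion_deriv[OF G])
 define B where "B = (%q. of_nat k * G q * (2 * of_real pi * \<i> * q * deriv G' q) - (of_nat k + 1) * (G' q)^2)"
 have q: "q_expansion (bracket2 k F) B" unfolding bracket2_def[abs_def] B_def by (intro q_expansion_intros G G')
 have h: "bracket2 k F holomorphic_on HH"
  unfolding bracket2_def[abs_def] by (intro holomorphic_intros hol holomorphic_deriv open_HH)
 have "bracket2 k F (mob a b c d z) = cocycle c d z ^ (2 * k + 4) * bracket2 k F z" if "a * d - b * c = 1" "z \<in> HH" for a b c d z
 proof -
  define j where "j = cocycle c d z"
  define jk where "jk = j ^ k"
  have p: "j ^ (k + 1) = jk * j" "j ^ (k + 2) = jk * j^2" "j ^ (k + 3) = jk * j ^ 3" "j ^ (k + 4) = jk * j ^ 4" "j ^ (2 * k + 4) = jk^2 * j ^ 4"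
   unfolding jk_def by (simp_all only: power_add power_even_eq power_one_right)
  have "F (mob a b c d z) = jk * F z" using F that unfolding modular_form_nat jk_def j_def by auto
  thus ?thesis unfolding bracket2_def modular_deriv[OF F that] unfolding j_def[symmetric] p by algebra
 qed
 hence "modular_form (int (2 * k + 4)) (bracket2 k F)" unfolding modular_form_nat using h q by auto
 thus ?thesis unfolding cusp_form_def using q by (intro conjI exI[of _ B]) (auto simp: B_def G'_def)
qed

lemma holomorphic_divide_zero: assumes "G holomorphic_on ball 0 1" "G 0 = (0::complex)"
 obtains A where "A holomorphic_on ball 0 1" "!!q. G q = q * A q" "A 0 = deriv G 0" proof
 show "(%z. if z = 0 then deriv G 0 else (G z - G 0) / (z - 0)) holomorphic_on ball 0 1"
  by (rule pole_lemma_open[OF assms(1)]) auto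
qed (use assms(2) in auto)

text \<open>The constant of \<open>cusp_order_bound\<close> exceeds 10, so weights up to \<open>10 m\<close> are
 covered. The weights needed are at most 16.\<close>

lemma pi_sqrt3_bound: "2 * sqrt 3 * pi > (10 :: real)" proof -
 have "sqrt 3 > (1.7 :: real)" by (rule real_less_rsqrt) (simp add: power2_eq_square)
 moreover have "pi > 3" using pi_gt3 .
 ultimately have "1.7 * 3 < sqrt 3 * pi" by (intro mult_strict_mono) auto
 hence "10 < 2 * (sqrt 3 * pi)" by linarith
 thus ?thesis by (simp only: mult.assoc)
qed

lemma cusp_form_quotient: assumes "cusp_form k F"
 obtains A where "A holomorphic_on ball 0 1" "q_expansion F (%q. q * A q)" proof -
 obtain G where G: "q_expansion F G" "G 0 = 0" using assms by (auto simp: cusp_form_def)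
 then obtain A where "A holomorphic_on ball 0 1" "!!q. G q = q * A q"
  using holomorphic_divide_zero[of G] unfolding q_expansion_def by metis
 moreover from this have "G = (%q. q * A q)" by auto
 ultimately show ?thesis using that G by metis
qed

lemma cusp_form_low_weight_zero: assumes F: "cusp_form k F" and k: "k <= 10" and z: "z \<in> HH" shows "F z = 0" proof -
 obtain A where A: "A holomorphic_on ball 0 1" "q_expansion F (%q. q * A q)" by (rule cusp_form_quotient[OF F])
 have "real k < 2 * sqrt 3 * pi" using k pi_sqrt3_bound by linarith
 thus ?thesis using F A by (intro cusp_order_bound[of "int k" F 1 A z]) (auto simp: cusp_form_def q_expansion_def z)
qed

lemma cusp_form_order_two_zero: assumes F: "modular_form (int k) F" and k: "k <= 20" and z: "z \<in> HH"
  and G: "q_expansion F (%q. q * G q)" "G holomorphic_on ball 0 1" "G 0 = 0" shows "F z = 0" proof -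
 obtain A where A: "A holomorphic_on ball 0 1" "!!q. G q = q * A q" "A 0 = deriv G 0"
  using holomorphic_divide_zero[of G] G by auto
 have "real k < 2 * sqrt 3 * pi * 2" using k pi_sqrt3_bound by linarith
 thus ?thesis using F G A by (intro cusp_order_bound[of "int k" F 2 A z]) (auto simp: q_expansion_def z power2_eq_square)
qed

lemma cusp_form_simple_zero: assumes F: "cusp_form k F" and k: "k <= 20" and nz: "z0 \<in> HH" "F z0 ~= 0"
 obtains A where "A holomorphic_on ball 0 1" "q_expansion F (%q. q * A q)" "A 0 ~= 0" proof -
 obtain A where A: "A holomorphic_on ball 0 1" "q_expansion F (%q. q * A q)" by (rule cusp_form_quotient[OF F])
 have "A 0 ~= 0" using cusp_form_order_two_zero[OF _ k nz(1) A(2,1)] nz(2) F by (auto simp: cusp_form_def)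
 with that A show ?thesis by blast
qed

lemma modular_form_lincomb: assumes "modular_form (int k) F" "modular_form (int k) H"
 shows "modular_form (int k) (%z. F z - c * H z)" proof -
 obtain G G' where "q_expansion F G" "q_expansion H G'" using assms unfolding modular_form_nat by auto
 hence "q_expansion (%z. F z - c * H z) (%q. G q - c * G' q)" by (intro q_expansion_intros)
 thus ?thesis using assms unfolding modular_form_nat by (auto intro!: holomorphic_intros simp: algebra_simps)
qed

text \<open>The combination that cancels the leading coefficients vanishes to order two at the cusp.\<close>

lemma cusp_forms_proportional:
 assumes F: "cusp_form k F" and H: "cusp_form k H" and k: "k <= 20" and nz: "z0 \<in> HH" "H z0 ~= 0"
 obtains c where "!!z. z \<in> HH ==> F z = c * H z" proof -
 obtain B where B: "B holomorphic_on ball 0 1" "q_expansion H (%q. q * B q)" "B 0 ~= 0"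
  using cusp_form_simple_zero[OF H k nz] by blast
 obtain A where A: "A holomorphic_on ball 0 1" "q_expansion F (%q. q * A q)" by (rule cusp_form_quotient[OF F])
 define c where "c = A 0 / B 0"
 have "q_expansion (%z. F z - c * H z) (%q. q * A q - c * (q * B q))" by (intro q_expansion_intros A B)
 also have "(%q. q * A q - c * (q * B q)) = (%q. q * (A q - c * B q))" by (auto simp: algebra_simps)
 finally have q: "q_expansion (%z. F z - c * H z) (%q. q * (A q - c * B q))" .
 have "F z - c * H z = 0" if "z \<in> HH" for z proof (rule cusp_form_order_two_zero[OF _ k that q])
  show "modular_form (int k) (%z. F z - c * H z)" using F H by (intro modular_form_lincomb) (auto simp: cusp_form_def)
  show "(%q. A q - c * B q) holomorphic_on ball 0 1" by (intro holomorphic_intros A B)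
  show "A 0 - c * B 0 = 0" using B by (simp add: c_def)
 qed
 thus ?thesis using that[of c] by simp
qed

section \<open>Zeros of the Eisenstein series and of the discriminant\<close>

lemma zero_factor:
 assumes F: "F holomorphic_on HH" and z0: "z0 \<in> HH" "F z0 = 0" and nc: "z1 \<in> HH" "F z1 ~= 0"
 obtains u r n where "n > 0" "r > 0" "ball z0 r \<subseteq> HH" "u holomorphic_on ball z0 r"
  "!!w. w \<in> ball z0 r ==> F w = (w - z0) ^ n * u w" "u z0 ~= 0" "!!w. w \<in> ball z0 r ==> u w ~= 0" proof -
 have "~ F constant_on HH" using z0 nc unfolding constant_on_def by metis
 from holomorphic_factor_zero_nonconstant[OF F open_HH connected_HH z0(1) z0(2) this]
 obtain u r n where "0 < n" "0 < r" "ball z0 r \<subseteq> HH" "u holomorphic_on ball z0 r"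
  "!!w. w \<in> ball z0 r ==> F w = (w - z0) ^ n * u w" "!!w. w \<in> ball z0 r ==> u w ~= 0" by metis
 thus ?thesis using that[of n r u] by auto
qed

lemma euler_operator_factor:
 assumes u: "u holomorphic_on ball z0 r" and F: "!!w. w \<in> ball z0 r ==> F w = (w - z0) ^ n * u w" and w: "w \<in> ball z0 r"
 shows "(w - z0) * deriv F w = (w - z0) ^ n * (of_nat n * u w + (w - z0) * deriv u w)" proof -
 have "(u has_field_derivative deriv u w) (at w)" by (rule holomorphic_derivI[OF u _ w]) auto
 hence "((%w. (w - z0) ^ n * u w) has_field_derivative of_nat n * (w - z0) ^ (n - 1) * u w + deriv u w * (w - z0) ^ n) (at w)"
  by (auto intro!: derivative_eq_intros)
 hence "(F has_field_derivative of_nat n * (w - z0) ^ (n - 1) * u w + deriv u w * (w - z0) ^ n) (at w)"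
  by (rule has_field_derivative_transform_within_open[OF _ open_ball w]) (simp add: F)
 hence eq: "deriv F w = of_nat n * (w - z0) ^ (n - 1) * u w + deriv u w * (w - z0) ^ n" by (rule DERIV_imp_deriv)
 show ?thesis unfolding eq by (cases n) (simp_all add: algebra_simps)
qed

text \<open>If \<open>F\<close> has a zero of order \<open>n > 0\<close> the bracket has order exactly \<open>2
 n - 2\<close>: its leading coefficient is \<open>- n (n + k) (u z0)^2\<close>. Multiplication by \<open>(w -
 z0)^2\<close> avoids negative exponents.\<close>

lemma bracket2_order:
 assumes u: "u holomorphic_on ball z0 r" and F: "!!w. w \<in> ball z0 r ==> F w = (w - z0) ^ n * u w"
  and r: "r > 0" and nz: "u z0 ~= 0" and n: "n > 0"
 obtains K where "K holomorphic_on ball z0 r" "K z0 ~= 0"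
  "!!w. w \<in> ball z0 r ==> (w - z0)^2 * bracket2 k F w = (w - z0) ^ (2 * n) * K w" proof -
 define A where "A = (%w. of_nat n * u w + (w - z0) * deriv u w)"
 have A: "A holomorphic_on ball z0 r" unfolding A_def by (intro holomorphic_intros u holomorphic_deriv) auto
 have 1: "(w - z0) * deriv F w = (w - z0) ^ n * A w" if "w \<in> ball z0 r" for w
  unfolding A_def by (rule euler_operator_factor[OF u F that])
 define A2 where "A2 = (%w. (of_nat n - 1) * A w + (w - z0) * deriv A w)"
 have A2: "A2 holomorphic_on ball z0 r" unfolding A2_def by (intro holomorphic_intros A holomorphic_deriv) auto
 have holF: "F holomorphic_on ball z0 r" by (rule holomorphic_transform[of "%w. (w - z0) ^ n * u w"]) (auto intro!: holomorphic_intros u simp: F)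
 have 2: "(w - z0)^2 * deriv (deriv F) w = (w - z0) ^ n * A2 w" if w: "w \<in> ball z0 r" for w proof -
  have "(deriv F has_field_derivative deriv (deriv F) w) (at w)"
   by (rule holomorphic_derivI[OF holomorphic_deriv[OF holF] _ w]) auto
  hence "((%w. (w - z0) * deriv F w) has_field_derivative deriv F w + (w - z0) * deriv (deriv F) w) (at w)"
   by (auto intro!: derivative_eq_intros)
  hence "deriv (%w. (w - z0) * deriv F w) w = deriv F w + (w - z0) * deriv (deriv F) w" by (rule DERIV_imp_deriv)
  with euler_operator_factor[OF A 1 w]
  have "(w - z0) * (deriv F w + (w - z0) * deriv (deriv F) w) = (w - z0) ^ n * (of_nat n * A w + (w - z0) * deriv A w)" by simp
  thus ?thesis using 1[OF w] by (simp add: A2_def power2_eq_square algebra_simps)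
 qed
 define K where "K = (%w. of_nat k * u w * A2 w - (of_nat k + 1) * (A w)^2)"
 show ?thesis proof
  show "K holomorphic_on ball z0 r" unfolding K_def by (intro holomorphic_intros u A A2)
  define N :: complex where "N = of_nat (n * n + k * n)"
  have "K z0 = - N * (u z0)^2" by (simp add: N_def K_def A2_def A_def power2_eq_square algebra_simps)
  moreover have "N ~= 0" using n unfolding N_def of_nat_eq_0_iff by simp
  ultimately show "K z0 ~= 0" using nz by simp
  fix w assume w: "w \<in> ball z0 r"
  have "(w - z0)^2 * bracket2 k F w = of_nat k * F w * ((w - z0)^2 * deriv (deriv F) w) - (of_nat k + 1) * ((w - z0) * deriv F w)^2"
   unfolding bracket2_def power_mult_distrib by algebra
  also have "... = (w - z0) ^ (2 * n) * K w"
   unfolding 1[OF w] 2[OF w] F[OF w] K_def power_even_eq by algebra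
  finally show "(w - z0)^2 * bracket2 k F w = (w - z0) ^ (2 * n) * K w" .
 qed
qed

text \<open>Comparison of orders: the factor \<open>0 ^ n\<close> makes \<open>X z0\<close> vanish if \<open>n >
 0\<close>, and yields \<open>X z0 = Y z0\<close> if \<open>n = 0\<close>.\<close>

lemma power_factor_eq: fixes z0 :: complex
 assumes r: "r > 0" and X: "continuous_on (ball z0 r) X" and Y: "continuous_on (ball z0 r) Y"
  and eq: "!!w. w \<in> ball z0 r ==> (w - z0) ^ m * X w = (w - z0) ^ (m + n) * Y w" shows "X z0 = 0 ^ n * Y z0" proof -
 have lim: "((%w. X w - (w - z0) ^ n * Y w) \<longlongrightarrow> X z0 - (z0 - z0) ^ n * Y z0) (at z0)"
  using X Y r by (intro tendsto_intros) (auto simp: continuous_on_eq_continuous_at isCont_def)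
 have "\<forall>\<^sub>F w in at z0. w \<in> ball z0 r - {z0}" using eventually_at_in_open[of "ball z0 r" z0] r by auto
 hence "\<forall>\<^sub>F w in at z0. X w - (w - z0) ^ n * Y w = 0"
  by eventually_elim (use eq in \<open>auto simp: power_add\<close>)
 hence "((%w. X w - (w - z0) ^ n * Y w) \<longlongrightarrow> 0) (at z0)" by (rule tendsto_eventually)
 hence "X z0 - (z0 - z0) ^ n * Y z0 = 0" using lim tendsto_unique[OF _ lim] by auto
 thus ?thesis by simp
qed

lemma i_in_HH: "\<i> \<in> HH" by (simp add: upper_half_plane_def)
lemma rho_in_HH: "rho \<in> HH" by (simp add: upper_half_plane_def rho_def)

text \<open>The point \<open>\<i>\<close> is fixed by \<open>z \<mapsto> - 1 / z\<close>, whose factor there is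
 \<open>\<i>\<close>.\<close>

lemma modular_form_zero_i: assumes "modular_form (int k) F" "\<i> ^ k ~= 1" shows "F \<i> = 0" proof -
 have "F (mob 0 (-1) 1 0 \<i>) = cocycle 1 0 \<i> ^ k * F \<i>" using assms(1) i_in_HH unfolding modular_form_nat by simp
 hence "F \<i> = \<i> ^ k * F \<i>" by (simp add: mob_def cocycle_def)
 thus ?thesis using assms(2) by (metis mult_cancel_right1 mult_cancel_right2)
qed

lemma rho_relation: "rho * rho + rho + 1 = 0" proof -
 have "(complex_of_real (sqrt 3))^2 = 3" by (metis of_real_numeral of_real_power real_sqrt_pow2 zero_le_numeral)
 thus ?thesis by (simp add: rho_def field_simps power2_eq_square)
qed

text \<open>The point \<open>rho\<close> is fixed by an element with factor \<open>rho + 1\<close>.\<close>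

lemma modular_form_zero_rho: assumes "modular_form (int k) F" "(rho + 1) ^ k ~= 1" shows "F rho = 0" proof -
 have 1: "F (mob 0 (-1) 1 1 rho) = cocycle 1 1 rho ^ k * F rho" using assms(1) rho_in_HH unfolding modular_form_nat by simp
 have "(rho + 1) * rho = -1" using rho_relation by (simp add: algebra_simps eq_neg_iff_add_eq_0)
 hence "-1 / (rho + 1) = rho" by (metis divide_eq_eq mult.commute mult_zero_left neg_equal_0_iff_equal one_neq_zero)
 hence "mob 0 (-1) 1 1 rho = rho" by (simp add: mob_def cocycle_def)
 with 1 have "F rho = (rho + 1) ^ k * F rho" by (simp add: cocycle_def)
 thus ?thesis using assms(2) by (metis mult_cancel_right1 mult_cancel_right2)
qed

abbreviation E4 where "E4 \<equiv> eisenstein 4"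
abbreviation E6 where "E6 \<equiv> eisenstein 6"
definition disc where "disc z = E4 z ^ 3 - E6 z ^ 2"

lemma E4: "modular_form (int 4) E4" and E6: "modular_form (int 6) E6"
 using modular_form_eisenstein[of 4] modular_form_eisenstein[of 6] by auto

lemma E_hol: "E4 holomorphic_on HH" "E6 holomorphic_on HH" using E4 E6 unfolding modular_form_nat by auto

lemma disc_hol: "disc holomorphic_on HH" unfolding disc_def[abs_def] by (intro holomorphic_intros E_hol)

lemma E6_i: "E6 \<i> = 0" by (rule modular_form_zero_i[OF E6]) (simp add: eval_nat_numeral)

lemma E4_rho: "E4 rho = 0" proof (rule modular_form_zero_rho[OF E4])
 have "(rho + 1) ^ 2 = rho" using rho_relation by (simp add: power2_eq_square algebra_simps eq_neg_iff_add_eq_0[symmetric])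
 moreover have "(rho + 1) ^ 4 = ((rho + 1) ^ 2) ^ 2" by (simp flip: power_mult)
 ultimately have eq: "(rho + 1) ^ 4 = rho^2" by simp
 have "rho^2 = - 1 - rho" using rho_relation by (simp add: power2_eq_square algebra_simps eq_neg_iff_add_eq_0[symmetric])
 hence "Im (rho^2) = - Im rho" by simp
 moreover have "Im rho > 0" using rho_in_HH by (simp add: upper_half_plane_def)
 ultimately show "(rho + 1) ^ 4 ~= 1" unfolding eq by (metis less_irrefl neg_equal_0_iff_equal one_complex.sel(2))
qed

lemma cusp_limit_nonzero: fixes F :: "complex => complex" assumes "(F \<longlongrightarrow> L) to_cusp" "L ~= 0"
 obtains z where "z \<in> HH" "F z ~= 0" proof -
 have "\<forall>\<^sub>F z in to_cusp. F z ~= 0" by (rule tendsto_imp_eventually_ne[OF assms(1,2)])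
 hence "\<forall>\<^sub>F z in to_cusp. z \<in> HH & F z ~= 0" using eventually_to_cusp_HH by eventually_elim auto
 then obtain z where "z \<in> HH & F z ~= 0" using to_cusp_neq_bot eventually_happens by blast
 thus ?thesis using that by blast
qed

lemma E_cusp: "(E4 \<longlongrightarrow> 1) to_cusp" "(E6 \<longlongrightarrow> 1) to_cusp" proof -
 obtain G where "q_expansion E4 G" "G 0 = 1" using eisenstein_q_expansion[of 4] by auto
 thus "(E4 \<longlongrightarrow> 1) to_cusp" using q_expansion_tendsto by metis
 obtain G where "q_expansion E6 G" "G 0 = 1" using eisenstein_q_expansion[of 6] by auto
 thus "(E6 \<longlongrightarrow> 1) to_cusp" using q_expansion_tendsto by metis
qed

lemma bracket2_nonzero:
 assumes F: "F holomorphic_on HH" and z0: "z0 \<in> HH" "F z0 = 0" and nc: "z1 \<in> HH" "F z1 ~= 0"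
 shows "\<exists>z\<in>HH. bracket2 k F z ~= 0" proof (rule ccontr)
 assume "~ ?thesis"
 hence zero: "bracket2 k F z = 0" if "z \<in> HH" for z using that by auto
 obtain u r n where u: "n > 0" "r > 0" "ball z0 r \<subseteq> HH" "u holomorphic_on ball z0 r"
  "!!w. w \<in> ball z0 r ==> F w = (w - z0) ^ n * u w" "u z0 ~= 0" using zero_factor[OF F z0 nc] by metis
 obtain K where K: "K holomorphic_on ball z0 r" "K z0 ~= 0"
  "!!w. w \<in> ball z0 r ==> (w - z0)^2 * bracket2 k F w = (w - z0) ^ (2 * n) * K w"
  using bracket2_order[OF u(4,5,2,6,1), where k=k] by metis
 have "K z0 = 0 ^ 1 * (%_. 0) z0" proof (rule power_factor_eq[where X=K and Y="%_. 0" and m="2 * n" and n=1, OF u(2)])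
  show "(w - z0) ^ (2 * n) * K w = (w - z0) ^ (2 * n + 1) * 0" if "w \<in> ball z0 r" for w
   using K(3)[OF that] zero[of w] u(3) that by auto
 qed (use holomorphic_on_imp_continuous_on[OF K(1)] in auto)
 thus False using K(2) by simp
qed

text \<open>Otherwise \<open>r = E6 / E4\<close> would satisfy \<open>r^2 = E4\<close> and be a form of weight
 2. Such a form vanishes at \<open>\<i>\<close>, but its bracket is a cusp form of weight 8, hence 0, whereas a
 bracket of a form with a zero is not 0.\<close>

lemma disc_not_identically_zero: "\<exists>z\<in>HH. disc z ~= 0" proof (rule ccontr)
 assume "~ ?thesis"
 hence rel: "E6 z ^ 2 = E4 z ^ 3" if "z \<in> HH" for z using that by (auto simp: disc_def)
 \<comment> \<open>as \<open>E6^2 = E4^3\<close>, the quotient extends by 0 over the zeros of \<open>E4\<close>\<close>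
 define r where "r = (%z. if E4 z = 0 then 0 else E6 z / E4 z)"
 have r2: "r z ^ 2 = E4 z" "r z * E4 z = E6 z" if "z \<in> HH" for z
  using rel[OF that] by (auto simp: r_def power_divide eval_nat_numeral)
 have contE: "continuous_on HH E4" using E_hol(1) by (rule holomorphic_on_imp_continuous_on)
 obtain zz where zz: "zz \<in> HH" "E4 zz ~= 0" using cusp_limit_nonzero[OF E_cusp(1)] by auto
 have "r field_differentiable at z" if z: "z \<in> HH" for z proof (cases "E4 z = 0")
  case False
  have "\<forall>\<^sub>F w in nhds z. w \<in> HH & E4 w ~= 0" proof -
   have "open {w\<in>HH. E4 w ~= 0}"
    using continuous_open_preimage[OF contE open_HH open_Compl[OF closed_singleton[of 0]]] by (simp add: vimage_def Int_def)
   thus ?thesis using eventually_nhds_in_open[of "{w\<in>HH. E4 w ~= 0}" z] z False by simp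
  qed
  hence "\<forall>\<^sub>F w in nhds z. E6 w / E4 w = r w" by eventually_elim (auto simp: r_def)
  moreover have "(%w. E6 w / E4 w) field_differentiable at z"
   using E_hol z open_HH False by (intro field_differentiable_divide) (auto intro: holomorphic_on_imp_differentiable_at)
  ultimately show ?thesis unfolding field_differentiable_def using DERIV_cong_ev[of z z "%w. E6 w / E4 w" r] by blast
 next
  case True
  obtain u t n where u: "n > 0" "t > 0" "ball z t \<subseteq> HH"
   "!!w. w \<in> ball z t ==> E4 w = (w - z) ^ n * u w" "!!w. w \<in> ball z t ==> u w ~= 0"
   using zero_factor[OF E_hol(1) z True zz] by metis
  have nz: "E4 w ~= 0" if "w \<in> ball z t - {z}" for w using that u(4,5)[of w] by auto
  have "r holomorphic_on ball z t" proof (rule no_isolated_singularity'[of "{z}"])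
   have "(%w. E6 w / E4 w) holomorphic_on ball z t - {z}"
    using nz u(3) by (intro holomorphic_on_divide holomorphic_on_subset[OF E_hol(1)] holomorphic_on_subset[OF E_hol(2)]) auto
   thus "r holomorphic_on ball z t - {z}" by (rule holomorphic_transform) (use nz in \<open>auto simp: r_def\<close>)
   have "(E4 \<longlongrightarrow> 0) (at z)" using contE z True open_HH by (metis continuous_on_eq_continuous_at isCont_def)
   hence "((%w. sqrt (cmod (E4 w))) \<longlongrightarrow> sqrt (cmod 0)) (at z)" by (intro tendsto_intros)
   hence "((%w. sqrt (cmod (E4 w))) \<longlongrightarrow> 0) (at z)" by simp
   moreover have "\<forall>\<^sub>F w in at z. w \<in> HH" using eventually_at_in_open'[OF open_HH z] .
   hence "\<forall>\<^sub>F w in at z. sqrt (cmod (E4 w)) = cmod (r w)"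
    by eventually_elim (simp add: r2(1)[symmetric] norm_power)
   ultimately have "((%w. cmod (r w)) \<longlongrightarrow> 0) (at z)" by (rule Lim_transform_eventually)
   hence "(r \<longlongrightarrow> 0) (at z)" by (rule tendsto_norm_zero_cancel)
   moreover have "r z = 0" using True by (simp add: r_def)
   ultimately show "(r \<longlongrightarrow> r x) (at x within ball z t)" if "x \<in> {z}" for x
    using that by (auto intro: tendsto_within_subset)
  qed auto
  thus ?thesis using u(2) by (simp add: holomorphic_on_imp_differentiable_at)
 qed
 hence r_hol: "r holomorphic_on HH" by (auto simp: holomorphic_on_def intro: field_differentiable_at_within)
 have r_mod: "r (mob a b c d z) = cocycle c d z ^ 2 * r z" if "a * d - b * c = 1" "z \<in> HH" for a b c d z proof -
  have "E4 (mob a b c d z) = cocycle c d z ^ 4 * E4 z" "E6 (mob a b c d z) = cocycle c d z ^ 6 * E6 z"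
   using E4 E6 that unfolding modular_form_nat by auto
  moreover have "cocycle c d z ~= 0" using cocycle_nonzero[OF that(2) unimodular_not_both_zero[OF that(1)]] .
  ultimately show ?thesis by (simp add: r_def field_simps eval_nat_numeral)
 qed
 have r_lim: "(r \<longlongrightarrow> 1) to_cusp" proof -
  have "((%z. E6 z / E4 z) \<longlongrightarrow> 1 / 1) to_cusp" by (intro tendsto_divide E_cusp) auto
  moreover have "\<forall>\<^sub>F z in to_cusp. E4 z ~= 0" using tendsto_imp_eventually_ne[OF E_cusp(1)] by auto
  hence "\<forall>\<^sub>F z in to_cusp. E6 z / E4 z = r z" by eventually_elim (auto simp: r_def)
  ultimately show ?thesis using Lim_transform_eventually by fastforce
 qed
 have "r (z + 1) = r z" if "z \<in> HH" for z using r_mod[of 1 1 1 0 z] that by (simp add: mob_def cocycle_def)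
 from q_expansion_exists[OF r_hol this r_lim] obtain G where "q_expansion r G" by blast
 hence r: "modular_form (int 2) r" unfolding modular_form_nat using r_hol r_mod by auto
 have ri: "r \<i> = 0" by (rule modular_form_zero_i[OF r]) simp
 have "bracket2 2 r z = 0" if "z \<in> HH" for z using cusp_form_low_weight_zero[OF cusp_form_bracket2[OF r] _ that] by simp
 moreover obtain z1 where "z1 \<in> HH" "r z1 ~= 0" using cusp_limit_nonzero[OF r_lim] by auto
 ultimately show False using bracket2_nonzero[OF r_hol i_in_HH ri, of z1 2] by auto
qed

lemma cusp_form_mult: assumes "modular_form (int k) F" "cusp_form l H" shows "cusp_form (k + l) (%z. F z * H z)" proof -
 obtain G where G: "q_expansion F G" using assms unfolding modular_form_nat by auto
 obtain G' where G': "q_expansion H G'" "G' 0 = 0" using assms unfolding cusp_form_def by auto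
 have q: "q_expansion (%z. F z * H z) (%q. G q * G' q)" by (intro q_expansion_intros G G')
 hence "modular_form (int (k + l)) (%z. F z * H z)"
  using assms unfolding modular_form_nat cusp_form_def by (auto intro!: holomorphic_intros simp: power_add)
 thus ?thesis unfolding cusp_form_def using q G' by (intro conjI exI[of _ "%q. G q * G' q"]) auto
qed

lemma cusp_form_disc: "cusp_form 12 disc" proof -
 obtain G where G: "q_expansion E4 G" "G 0 = 1" using eisenstein_q_expansion[of 4] by auto
 obtain G' where G': "q_expansion E6 G'" "G' 0 = 1" using eisenstein_q_expansion[of 6] by auto
 have q: "q_expansion disc (%q. G q ^ 3 - G' q ^ 2)" unfolding disc_def[abs_def] by (intro q_expansion_intros G G')
 have "disc (mob a b c d z) = cocycle c d z ^ 12 * disc z" if "a * d - b * c = 1" "z \<in> HH" for a b c d z proof -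
  have "E4 (mob a b c d z) = cocycle c d z ^ 4 * E4 z" "E6 (mob a b c d z) = cocycle c d z ^ 6 * E6 z"
   using E4 E6 that unfolding modular_form_nat by auto
  thus ?thesis unfolding disc_def by (simp add: power_mult_distrib algebra_simps flip: power_mult)
 qed
 hence "modular_form (int 12) disc" unfolding modular_form_nat using disc_hol q by auto
 thus ?thesis unfolding cusp_form_def using q G G' by (intro conjI exI[of _ "%q. G q ^ 3 - G' q ^ 2"]) auto
qed

text \<open>Both sides are cusp forms of weight 12 or 16, hence proportional. The constants \<open>c1\<close>,
 \<open>c2\<close> are not 0 because \<open>E4\<close> and \<open>E6\<close> have zeros.\<close>

lemma bracket_relations:
 obtains c1 c2 c3 where
  "!!z. z \<in> HH ==> bracket2 4 E4 z = c1 * disc z"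
  "!!z. z \<in> HH ==> bracket2 6 E6 z = c2 * (E4 z * disc z)"
  "!!z. z \<in> HH ==> bracket1 4 E4 6 E6 z = c3 * disc z" "c1 ~= 0" "c2 ~= 0" proof -
 obtain zd where zd: "zd \<in> HH" "disc zd ~= 0" using disc_not_identically_zero by auto
 obtain z4 where z4: "z4 \<in> HH" "E4 z4 ~= 0" using cusp_limit_nonzero[OF E_cusp(1)] by auto
 obtain z6 where z6: "z6 \<in> HH" "E6 z6 ~= 0" using cusp_limit_nonzero[OF E_cusp(2)] by auto
 have b4: "cusp_form 12 (bracket2 4 E4)" using cusp_form_bracket2[OF E4] by simp
 have b6: "cusp_form 16 (bracket2 6 E6)" using cusp_form_bracket2[OF E6] by simp
 have b46: "cusp_form 12 (bracket1 4 E4 6 E6)" using cusp_form_bracket1[OF E4 E6] by simp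
 have ed: "cusp_form 16 (%z. E4 z * disc z)" using cusp_form_mult[OF E4 cusp_form_disc] by simp
 obtain A where A: "A holomorphic_on ball 0 1" "q_expansion disc (%q. q * A q)" "A 0 ~= 0"
  using cusp_form_simple_zero[OF cusp_form_disc _ zd] by auto
 have "(A \<longlongrightarrow> A 0) (at 0)"
  using holomorphic_on_imp_continuous_on[OF A(1)] by (simp add: continuous_on_eq_continuous_at isCont_def)
 hence "((%z. E4 z * A (nome z)) \<longlongrightarrow> 1 * A 0) to_cusp"
  by (intro tendsto_mult E_cusp filterlim_compose[OF _ nome_at_0])
 then obtain ze where ze: "ze \<in> HH" "E4 ze * A (nome ze) ~= 0" using A(3) by (elim cusp_limit_nonzero) auto
 hence nz: "E4 ze * disc ze ~= 0" using A(2) by (simp add: q_expansion_def)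
 obtain c1 where c1: "!!z. z \<in> HH ==> bracket2 4 E4 z = c1 * disc z"
  using cusp_forms_proportional[OF b4 cusp_form_disc _ zd] by auto
 obtain c2 where c2: "!!z. z \<in> HH ==> bracket2 6 E6 z = c2 * (E4 z * disc z)"
  using cusp_forms_proportional[OF b6 ed _ ze(1) nz] by auto
 obtain c3 where c3: "!!z. z \<in> HH ==> bracket1 4 E4 6 E6 z = c3 * disc z"
  using cusp_forms_proportional[OF b46 cusp_form_disc _ zd] by auto
 have "c1 ~= 0" using bracket2_nonzero[OF E_hol(1) rho_in_HH E4_rho z4, of 4] c1 by auto
 moreover have "c2 ~= 0" using bracket2_nonzero[OF E_hol(2) i_in_HH E6_i z6, of 6] c2 by auto
 ultimately show ?thesis using that c1 c2 c3 by blast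
qed

text \<open>The third bracket relation gives a first order equation \<open>E4 * disc' = (3 * E4' - c3 / 2 * E6)
 * disc\<close>. At a zero of \<open>disc\<close> of order \<open>n\<close> its left side has lower order unless
 \<open>E4\<close> vanishes.\<close>

lemma disc_zero_is_common_zero: assumes z0: "z0 \<in> HH" "disc z0 = 0" shows "E4 z0 = 0" "E6 z0 = 0" proof -
 obtain c1 c2 c3 where c3: "!!z. z \<in> HH ==> bracket1 4 E4 6 E6 z = c3 * disc z" using bracket_relations by metis
 obtain zd where zd: "zd \<in> HH" "disc zd ~= 0" using disc_not_identically_zero by auto
 obtain v r n where v: "n > 0" "r > 0" "ball z0 r \<subseteq> HH" "v holomorphic_on ball z0 r"
  "!!w. w \<in> ball z0 r ==> disc w = (w - z0) ^ n * v w" "v z0 ~= 0" using zero_factor[OF disc_hol z0 zd] by metis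
 have rel: "E4 z * deriv disc z = (3 * deriv E4 z - c3 / 2 * E6 z) * disc z" if z: "z \<in> HH" for z proof -
  have "(E4 has_field_derivative deriv E4 z) (at z)" "(E6 has_field_derivative deriv E6 z) (at z)"
   using E_hol open_HH z by (auto intro: holomorphic_derivI)
  hence "(disc has_field_derivative 3 * E4 z ^ 2 * deriv E4 z - 2 * E6 z * deriv E6 z) (at z)"
   unfolding disc_def[abs_def] by (auto intro!: derivative_eq_intros)
  hence d: "deriv disc z = 3 * E4 z ^ 2 * deriv E4 z - 2 * E6 z * deriv E6 z" by (rule DERIV_imp_deriv)
  have b: "4 * E4 z * deriv E6 z - 6 * E6 z * deriv E4 z = c3 * disc z" using c3[OF z] by (simp add: bracket1_def)
  have "2 * (E4 z * deriv disc z) = 6 * deriv E4 z * (disc z + E6 z ^ 2) - E6 z * (4 * E4 z * deriv E6 z)"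
   unfolding d by (simp add: disc_def algebra_simps eval_nat_numeral)
  also have "4 * E4 z * deriv E6 z = c3 * disc z + 6 * E6 z * deriv E4 z" using b by (simp add: algebra_simps)
  finally have "2 * (E4 z * deriv disc z) = 2 * ((3 * deriv E4 z - c3 / 2 * E6 z) * disc z)"
   by (simp add: algebra_simps power2_eq_square)
  thus ?thesis by simp
 qed
 have cE: "continuous_on (ball z0 r) E4" "continuous_on (ball z0 r) E6" "continuous_on (ball z0 r) (deriv E4)"
   "continuous_on (ball z0 r) v" "continuous_on (ball z0 r) (deriv v)"
  using E_hol holomorphic_deriv[OF E_hol(1) open_HH] v(3,4) holomorphic_deriv[OF v(4)]
  by (auto intro!: holomorphic_on_imp_continuous_on intro: holomorphic_on_subset)
 have "(%w. E4 w * (of_nat n * v w + (w - z0) * deriv v w)) z0 = 0 ^ 1 * (%w. (3 * deriv E4 w - c3 / 2 * E6 w) * v w) z0"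
 proof (rule power_factor_eq[OF v(2), where m=n and n=1 and X="%w. E4 w * (of_nat n * v w + (w - z0) * deriv v w)" and Y="%w. (3 * deriv E4 w - c3 / 2 * E6 w) * v w"])
  show "(w - z0) ^ n * (E4 w * (of_nat n * v w + (w - z0) * deriv v w)) = (w - z0) ^ (n + 1) * ((3 * deriv E4 w - c3 / 2 * E6 w) * v w)" if w: "w \<in> ball z0 r" for w
  proof -
   have wH: "w \<in> HH" using w v(3) by auto
   have "(w - z0) ^ n * (E4 w * (of_nat n * v w + (w - z0) * deriv v w)) = E4 w * ((w - z0) * deriv disc w)"
    using euler_operator_factor[OF v(4,5) w] by (metis mult.left_commute)
   also have "... = (w - z0) * (E4 w * deriv disc w)" by (simp add: mult_ac)
   also have "... = (w - z0) ^ (n + 1) * ((3 * deriv E4 w - c3 / 2 * E6 w) * v w)"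
    unfolding rel[OF wH] unfolding v(5)[OF w] by (simp add: mult_ac)
   finally show ?thesis .
  qed
 qed (intro continuous_intros cE)+
 thus "E4 z0 = 0" using v by simp
 thus "E6 z0 = 0" using z0 by (simp add: disc_def)
qed

text \<open>At a zero, \<open>E4\<close> and \<open>E6\<close> have orders \<open>a, b > 0\<close>. The first
 two bracket relations give \<open>2 b - 2 = a + (2 a - 2)\<close>, so \<open>2 b = 3 a\<close>. Then
 \<open>disc = E4^3 - E6^2\<close> has order at least \<open>3 a\<close>, but by the first relation it has order
 \<open>2 a - 2\<close>.\<close>

theorem disc_nonzero: assumes z0: "z0 \<in> HH" shows "disc z0 ~= 0" proof
 assume "disc z0 = 0"
 hence E0: "E4 z0 = 0" "E6 z0 = 0" using disc_zero_is_common_zero z0 by auto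
 obtain c1 c2 where c1: "!!z. z \<in> HH ==> bracket2 4 E4 z = c1 * disc z"
  and c2: "!!z. z \<in> HH ==> bracket2 6 E6 z = c2 * (E4 z * disc z)" and nz: "c1 ~= 0" "c2 ~= 0"
  using bracket_relations by metis
 obtain z4 where z4: "z4 \<in> HH" "E4 z4 ~= 0" using cusp_limit_nonzero[OF E_cusp(1)] by auto
 obtain z6 where z6: "z6 \<in> HH" "E6 z6 ~= 0" using cusp_limit_nonzero[OF E_cusp(2)] by auto
 obtain u r1 a where u: "a > 0" "r1 > 0" "ball z0 r1 \<subseteq> HH" "u holomorphic_on ball z0 r1"
  "!!w. w \<in> ball z0 r1 ==> E4 w = (w - z0) ^ a * u w" "u z0 ~= 0" using zero_factor[OF E_hol(1) z0 E0(1) z4] by metis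
 obtain v r2 b where v: "b > 0" "r2 > 0" "ball z0 r2 \<subseteq> HH" "v holomorphic_on ball z0 r2"
  "!!w. w \<in> ball z0 r2 ==> E6 w = (w - z0) ^ b * v w" "v z0 ~= 0" using zero_factor[OF E_hol(2) z0 E0(2) z6] by metis
 obtain K4 where K4: "K4 holomorphic_on ball z0 r1" "K4 z0 ~= 0"
  "!!w. w \<in> ball z0 r1 ==> (w - z0)^2 * bracket2 4 E4 w = (w - z0) ^ (2 * a) * K4 w"
  using bracket2_order[OF u(4,5,2,6,1), where k=4] by metis
 obtain K6 where K6: "K6 holomorphic_on ball z0 r2" "K6 z0 ~= 0"
  "!!w. w \<in> ball z0 r2 ==> (w - z0)^2 * bracket2 6 E6 w = (w - z0) ^ (2 * b) * K6 w"
  using bracket2_order[OF v(4,5,2,6,1), where k=6] by metis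
 define r where "r = min r1 r2"
 have r: "r > 0" using u v by (simp add: r_def)
 have cont: "continuous_on (ball z0 r) u" "continuous_on (ball z0 r) v" "continuous_on (ball z0 r) K4" "continuous_on (ball z0 r) K6"
  using u(4) v(4) K4(1) K6(1) by (auto simp: r_def intro!: holomorphic_on_imp_continuous_on intro: holomorphic_on_subset)
 have sub: "w \<in> ball z0 r1" "w \<in> ball z0 r2" "w \<in> HH" if "w \<in> ball z0 r" for w
  using that u(3) by (auto simp: r_def)
 define X where "X = (%w. c1 * K6 w)"
 define Y where "Y = (%w. c2 * (u w * K4 w))"
 have XY: "(w - z0) ^ (2 * b) * X w = (w - z0) ^ (3 * a) * Y w" if w: "w \<in> ball z0 r" for w proof -
  note s = sub[OF w]
  have "(w - z0) ^ (2 * b) * X w = c1 * ((w - z0)^2 * bracket2 6 E6 w)" unfolding K6(3)[OF s(2)] X_def by (simp add: mult_ac)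
  also have "... = c2 * (E4 w * ((w - z0)^2 * bracket2 4 E4 w))" unfolding c1[OF s(3)] c2[OF s(3)] by (simp add: mult_ac)
  also have "... = c2 * ((w - z0) ^ a * u w * ((w - z0) ^ (2 * a) * K4 w))" unfolding K4(3)[OF s(1)] u(5)[OF s(1)] ..
  also have "... = (w - z0) ^ (3 * a) * Y w" unfolding Y_def by (simp add: mult_ac power_add[symmetric])
  finally show ?thesis .
 qed
 have XYc: "continuous_on (ball z0 r) X" "continuous_on (ball z0 r) Y" unfolding X_def Y_def by (intro continuous_intros cont)+
 have XYn: "X z0 ~= 0" "Y z0 ~= 0" using nz K4 K6 u by (auto simp: X_def Y_def)
 have ab: "2 * b = 3 * a" proof (rule ccontr)
  assume "2 * b ~= 3 * a"
  then consider n where "3 * a = 2 * b + n" "n > 0" | n where "2 * b = 3 * a + n" "n > 0"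
   by (metis less_imp_add_positive linorder_neqE_nat)
  thus False proof cases
   case 1
   have "X z0 = 0 ^ n * Y z0" by (rule power_factor_eq[OF r XYc, where m="2 * b"]) (use XY 1 in simp)
   thus False using XYn 1 by simp
  next
   case 2
   have "Y z0 = 0 ^ n * X z0" by (rule power_factor_eq[OF r XYc(2,1), where m="3 * a"]) (use XY 2 in simp)
   thus False using XYn 2 by simp
  qed
 qed
 have "K4 z0 = 0 ^ (a + 2) * (%w. c1 * (u w ^ 3 - v w ^ 2)) z0"
 proof (rule power_factor_eq[OF r, where m="2 * a" and n="a + 2" and X=K4 and Y="%w. c1 * (u w ^ 3 - v w ^ 2)"])
  show "continuous_on (ball z0 r) (%w. c1 * (u w ^ 3 - v w ^ 2))" by (intro continuous_intros cont)
  fix w assume w: "w \<in> ball z0 r"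
  note s = sub[OF w]
  have "(w - z0) ^ (2 * a) * K4 w = (w - z0)^2 * (c1 * disc w)" unfolding K4(3)[OF s(1), symmetric] c1[OF s(3)] ..
  also have "disc w = (w - z0) ^ (3 * a) * (u w ^ 3 - v w ^ 2)" proof -
   have "((w - z0) ^ a) ^ 3 = (w - z0) ^ (3 * a)" "((w - z0) ^ b) ^ 2 = (w - z0) ^ (2 * b)"
    by (simp_all only: power_mult[symmetric] mult.commute)
   moreover note ab
   ultimately have "((w - z0) ^ a) ^ 3 = (w - z0) ^ (3 * a)" "((w - z0) ^ b) ^ 2 = (w - z0) ^ (3 * a)" by simp_all
   thus ?thesis unfolding disc_def u(5)[OF s(1)] v(5)[OF s(2)] by (simp add: power_mult_distrib algebra_simps)
  qed
  also have "(w - z0)^2 * (c1 * ((w - z0) ^ (3 * a) * (u w ^ 3 - v w ^ 2))) = (w - z0) ^ (2 * a + (a + 2)) * (c1 * (u w ^ 3 - v w ^ 2))"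
  proof -
   have "(w - z0) ^ (2 * a + (a + 2)) = (w - z0)^2 * (w - z0) ^ (3 * a)" by (simp add: power_add[symmetric])
   thus ?thesis by (simp only: mult_ac)
  qed
  finally show "(w - z0) ^ (2 * a) * K4 w = (w - z0) ^ (2 * a + (a + 2)) * (c1 * (u w ^ 3 - v w ^ 2))" .
 qed (rule cont)
 thus False using K4(2) by simp
qed

lemma E4_simple_zero: "z \<in> HH ==> E4 z = 0 ==> deriv E4 z ~= 0" proof
 assume z: "z \<in> HH" "E4 z = 0" "deriv E4 z = 0"
 obtain c1 where "!!z. z \<in> HH ==> bracket2 4 E4 z = c1 * disc z" "c1 ~= 0" using bracket_relations by metis
 hence "bracket2 4 E4 z ~= 0" using disc_nonzero z by auto
 thus False using z by (simp add: bracket2_def)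
qed

lemma E6_simple_zero: "z \<in> HH ==> E6 z = 0 ==> deriv E6 z ~= 0" proof
 assume z: "z \<in> HH" "E6 z = 0" "deriv E6 z = 0"
 obtain c2 where c: "!!z. z \<in> HH ==> bracket2 6 E6 z = c2 * (E4 z * disc z)" "c2 ~= 0" using bracket_relations by metis
 have "disc z = E4 z ^ 3" using z by (simp add: disc_def)
 hence "E4 z ~= 0" using disc_nonzero[OF z(1)] by auto
 hence "bracket2 6 E6 z ~= 0" using c disc_nonzero z by auto
 thus False using z by (simp add: bracket2_def)
qed

section \<open>The modular function\<close>

lemma modular_w_alt: "modular_w z = E4 z ^ 3 / disc z" by (simp add: modular_w_def disc_def)

lemma modular_w_minus_1: "z \<in> HH ==> modular_w z - 1 = E6 z ^ 2 / disc z"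
 using disc_nonzero[of z] by (simp add: modular_w_alt field_simps) (simp add: disc_def)

lemma modular_w_hol: "modular_w holomorphic_on HH"
 unfolding modular_w_alt[abs_def] using disc_nonzero by (intro holomorphic_intros E_hol disc_hol) auto

lemma modular_w_i: "modular_w \<i> = 1" using modular_w_minus_1[OF i_in_HH] E6_i by simp
lemma modular_w_rho: "modular_w rho = 0" by (simp add: modular_w_alt E4_rho)

lemma modular_w_mob: "a * d - b * c = 1 ==> z \<in> HH ==> modular_w (mob a b c d z) = modular_w z" proof -
 assume *: "a * d - b * c = 1" "z \<in> HH"
 have "E4 (mob a b c d z) = cocycle c d z ^ 4 * E4 z" "E6 (mob a b c d z) = cocycle c d z ^ 6 * E6 z"
  using E4 E6 * unfolding modular_form_nat by auto
 moreover have "cocycle c d z ~= 0" using cocycle_nonzero[OF *(2) unimodular_not_both_zero[OF *(1)]] .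
 moreover have "disc (mob a b c d z) = cocycle c d z ^ 12 * disc z"
  using cusp_form_disc * unfolding cusp_form_def modular_form_nat by auto
 ultimately show ?thesis by (simp add: modular_w_alt power_mult_distrib flip: power_mult)
qed

lemma modular_w_invariant: "z \<in> HH ==> SL2Z_equiv z z' ==> modular_w z' = modular_w z"
 unfolding SL2Z_equiv_alt using modular_w_mob by auto

text \<open>The derivative is a nonzero multiple of \<open>E4^2 E6 / disc\<close>, by the third bracket
 relation.\<close>

lemma deriv_modular_w_zero: assumes z: "z \<in> HH" and 0: "deriv modular_w z = 0"
 shows "modular_w z = 0 | modular_w z = 1" proof -
 obtain c3 where c3: "!!z. z \<in> HH ==> bracket1 4 E4 6 E6 z = c3 * disc z" using bracket_relations by metis
 have "c3 ~= 0" proof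
  assume "c3 = 0"
  hence "E4 \<i> * deriv E6 \<i> = 0" using c3[OF i_in_HH] by (simp add: bracket1_def E6_i)
  moreover have "deriv E6 \<i> ~= 0" using E6_simple_zero[OF i_in_HH E6_i] .
  moreover have "E4 \<i> ~= 0" using disc_nonzero[OF i_in_HH] by (auto simp: disc_def E6_i)
  ultimately show False by simp
 qed
 have nz: "disc z ~= 0" using disc_nonzero[OF z] .
 have d: "(E4 has_field_derivative deriv E4 z) (at z)" "(E6 has_field_derivative deriv E6 z) (at z)"
  using E_hol open_HH z by (auto intro: holomorphic_derivI)
 hence dd: "(disc has_field_derivative 3 * E4 z ^ 2 * deriv E4 z - 2 * E6 z * deriv E6 z) (at z)"
  unfolding disc_def[abs_def] by (auto intro!: derivative_eq_intros)
 have "(modular_w has_field_derivative (3 * E4 z ^ 2 * deriv E4 z * disc z - E4 z ^ 3 * (3 * E4 z ^ 2 * deriv E4 z - 2 * E6 z * deriv E6 z)) / (disc z * disc z)) (at z)"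
  unfolding modular_w_alt[abs_def] using d(1) dd nz by (auto intro!: derivative_eq_intros)
 hence "deriv modular_w z = (3 * E4 z ^ 2 * deriv E4 z * disc z - E4 z ^ 3 * (3 * E4 z ^ 2 * deriv E4 z - 2 * E6 z * deriv E6 z)) / (disc z * disc z)"
  by (rule DERIV_imp_deriv)
 also have "3 * E4 z ^ 2 * deriv E4 z * disc z - E4 z ^ 3 * (3 * E4 z ^ 2 * deriv E4 z - 2 * E6 z * deriv E6 z)
   = E4 z ^ 2 * E6 z * (bracket1 4 E4 6 E6 z / 2)" by (simp add: disc_def bracket1_def field_simps eval_nat_numeral)
 finally have "E4 z = 0 | E6 z = 0" using 0 nz \<open>c3 ~= 0\<close> c3[OF z] by simp
 thus ?thesis using modular_w_minus_1[OF z] by (auto simp: modular_w_alt)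
qed

text \<open>The discriminant has a simple zero at the cusp and \<open>E4\<close> tends to 1.\<close>

lemma modular_w_cusp:
 obtains H where "H holomorphic_on ball 0 1" "H 0 ~= 0" "!!z. z \<in> HH ==> modular_w z = H (nome z) / nome z" proof -
 obtain G where G: "q_expansion E4 G" "G 0 = 1" using eisenstein_q_expansion[of 4] by auto
 obtain A where A: "A holomorphic_on ball 0 1" "q_expansion disc (%q. q * A q)" "A 0 ~= 0"
  using cusp_form_simple_zero[OF cusp_form_disc _ i_in_HH disc_nonzero[OF i_in_HH]] by auto
 have nz: "A q ~= 0" if "q \<in> ball 0 1" for q proof (cases "q = 0")
  case False
  then obtain z where z: "z \<in> HH" "nome z = q" using nome_surj[of q] \<open>q \<in> ball 0 1\<close> by auto
  hence "disc z = q * A q" using A(2) by (auto simp: q_expansion_def)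
  thus ?thesis using disc_nonzero[OF z(1)] by auto
 qed (use A in simp)
 show ?thesis proof
  show "(%q. G q ^ 3 / A q) holomorphic_on ball 0 1" using G nz by (auto simp: q_expansion_def intro!: holomorphic_intros A)
  show "G 0 ^ 3 / A 0 ~= 0" using G A by simp
  show "modular_w z = (G (nome z) ^ 3 / A (nome z)) / nome z" if "z \<in> HH" for z
   using G A that by (simp add: modular_w_alt q_expansion_def)
 qed
qed

lemma modular_w_at_cusp: "filterlim modular_w at_infinity to_cusp" proof -
 obtain H where H: "H holomorphic_on ball 0 1" "H 0 ~= 0" "!!z. z \<in> HH ==> modular_w z = H (nome z) / nome z"
  using modular_w_cusp by metis
 have "(H \<longlongrightarrow> H 0) (at 0)"
  using holomorphic_on_imp_continuous_on[OF H(1)] by (simp add: continuous_on_eq_continuous_at isCont_def)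
 hence "((%z. H (nome z)) \<longlongrightarrow> H 0) to_cusp" by (rule filterlim_compose[OF _ nome_at_0])
 from filterlim_divide_at_infinity[OF this nome_at_0 H(2)]
 have *: "filterlim (%z. H (nome z) / nome z) at_infinity to_cusp" .
 have ev: "\<forall>\<^sub>F z in to_cusp. modular_w z = H (nome z) / nome z" using eventually_to_cusp_HH by eventually_elim (rule H(3))
 show ?thesis using filterlim_cong[OF refl refl ev] * by simp
qed

lemma modular_w_large:
 obtains Y where "!!z. Im z > Y ==> cmod (modular_w z) > R" proof -
 have "\<forall>\<^sub>F x in at_infinity. cmod x > R" unfolding eventually_at_infinity by (intro exI[of _ "R + 1"]) auto
 from filterlim_iff[THEN iffD1, OF modular_w_at_cusp, rule_format, OF this]
 have "\<forall>\<^sub>F z in to_cusp. cmod (modular_w z) > R" .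
 then obtain Y where "\<forall>z. Im z > Y --> cmod (modular_w z) > R" unfolding eventually_to_cusp ..
 thus ?thesis using that[of Y] by simp
qed

lemma bounded_preimage_in_fund_box:
 obtains Y where "!!z. z \<in> HH ==> cmod (modular_w z) <= R ==> \<exists>z'\<in>fund_box Y. SL2Z_equiv z z'" proof -
 obtain Y where Y: "!!z. Im z > Y ==> cmod (modular_w z) > R" using modular_w_large[of R] by metis
 show ?thesis proof (rule that[of Y])
  fix z assume z: "z \<in> HH" "cmod (modular_w z) <= R"
  obtain z' where z': "SL2Z_equiv z z'" "z' \<in> HH" "abs (Re z') <= 1 / 2" "Im z' >= sqrt 3 / 2"
   using fundamental_domain[OF z(1)] by metis
  have "Im z' <= Y" using Y[of z'] modular_w_invariant[OF z(1) z'(1)] z(2) by force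
  hence "z' \<in> fund_box Y" using z' by (auto simp: fund_box_def in_cbox_complex_iff)
  thus "\<exists>z'\<in>fund_box Y. SL2Z_equiv z z'" using z' by auto
 qed
qed

lemma modular_w_not_constant: "~ modular_w constant_on HH" proof
 assume "modular_w constant_on HH"
 then obtain c where "!!z. z \<in> HH ==> modular_w z = c" unfolding constant_on_def by metis
 from this[OF i_in_HH] this[OF rho_in_HH] show False by (simp add: modular_w_i modular_w_rho)
qed

lemma modular_w_open: "open U ==> U \<subseteq> HH ==> open (modular_w ` U)"
 using open_mapping_thm[OF modular_w_hol open_HH connected_HH _ _ modular_w_not_constant] by auto

lemma isCont_modular_w: "z \<in> HH ==> isCont modular_w z"
 using holomorphic_on_imp_continuous_on[OF modular_w_hol] open_HH by (simp add: continuous_on_eq_continuous_at)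

text \<open>The image is open, and closed because bounded values are attained in a compact set.\<close>

theorem modular_w_surj: "modular_w ` HH = UNIV" proof -
 have "closed (modular_w ` HH)" unfolding closed_sequential_limits proof (intro allI impI, elim conjE)
  fix x l assume x: "\<forall>n. x n \<in> modular_w ` HH" and lim: "x \<longlonglongrightarrow> l"
  have "Bseq x" using lim by (intro convergent_imp_Bseq) (auto simp: convergent_def)
  then obtain R where R: "!!n. cmod (x n) <= R" by (auto simp: Bseq_def)
  obtain Y where Y: "!!z. z \<in> HH ==> cmod (modular_w z) <= R ==> \<exists>z'\<in>fund_box Y. SL2Z_equiv z z'"
   using bounded_preimage_in_fund_box[of R] by metis
  have "\<exists>z\<in>fund_box Y. modular_w z = x n" for n proof -
   obtain z where z: "z \<in> HH" "modular_w z = x n" using x by (auto simp: image_iff) metis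
   then obtain z' where "z' \<in> fund_box Y" "SL2Z_equiv z z'" using Y[of z] R[of n] by auto
   thus ?thesis using modular_w_invariant[OF z(1)] z(2) by auto
  qed
  then obtain z where z: "!!n. z n \<in> fund_box Y" "!!n. modular_w (z n) = x n" by metis
  obtain a r where a: "a \<in> fund_box Y" "strict_mono r" "(z \<circ> r) \<longlonglongrightarrow> a"
   using compact_fund_box[of Y] z(1) unfolding compact_def by metis
  have aH: "a \<in> HH" using a fund_box_HH by auto
  have "(%n. modular_w ((z \<circ> r) n)) \<longlonglongrightarrow> modular_w a"
   by (rule isCont_tendsto_compose[OF isCont_modular_w[OF aH] a(3)])
  moreover have "(%n. modular_w ((z \<circ> r) n)) = x \<circ> r" by (auto simp: z)
  moreover have "(x \<circ> r) \<longlonglongrightarrow> l" using lim a(2) by (rule LIMSEQ_subseq_LIMSEQ)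
  ultimately have "modular_w a = l" using LIMSEQ_unique by auto
  thus "l \<in> modular_w ` HH" using aH by auto
 qed
 moreover have "open (modular_w ` HH)" using modular_w_open[OF open_HH] by auto
 moreover have "modular_w ` HH ~= {}" using i_in_HH by auto
 ultimately show ?thesis using clopen[of "modular_w ` HH"] by simp
qed

text \<open>Matrices that move points of a compact set into a compact set have bounded integer entries, so one
 matrix occurs infinitely often.\<close>

lemma SL2Z_equiv_limit:
 assumes z: "z \<in> HH" "!!n. x n \<in> HH" "x \<longlonglongrightarrow> z" and z': "z' \<in> HH" "x' \<longlonglongrightarrow> z'"
  and eq: "!!n. SL2Z_equiv (x n) (x' n)" shows "SL2Z_equiv z z'" proof -
 have xH': "x' n \<in> HH" for n using SL2Z_equiv_HH[OF z(2) eq] .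
 have "\<forall>n. EX g. (%(a, b, c, d). a * d - b * c = (1::int) & x' n = mob a b c d (x n)) g"
  using eq unfolding SL2Z_equiv_alt by auto
 from choice[OF this] obtain g where g0: "\<forall>n. (%(a, b, c, d). a * d - b * c = (1::int) & x' n = mob a b c d (x n)) (g n)" ..
 have g: "case g n of (a, b, c, d) => a * d - b * c = (1::int) & x' n = mob a b c d (x n)" for n using g0 by (rule spec)
 have yz: "Im z > 0" "Im z' > 0" using z z' by (auto simp: upper_half_plane_def)
 define y where "y = min (Im z) (Im z') / 2"
 have y: "y > 0" "y < Im z" "y < Im z'" using yz by (auto simp: y_def)
 define R where "R = cmod z + cmod z' + 1"
 have R: "cmod z < R" "cmod z' < R" using norm_ge_zero[of z] norm_ge_zero[of z'] unfolding R_def by linarith+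
 have "\<forall>\<^sub>F n in sequentially. Im (x n) > y & Im (x' n) > y & cmod (x n) < R & cmod (x' n) < R"
  using order_tendstoD(1)[OF tendsto_Im[OF z(3)] y(2)] order_tendstoD(1)[OF tendsto_Im[OF z'(2)] y(3)]
   order_tendstoD(2)[OF tendsto_norm[OF z(3)] R(1)] order_tendstoD(2)[OF tendsto_norm[OF z'(2)] R(2)] by eventually_elim auto
 then obtain N where N: "!!n. n >= N ==> Im (x n) > y & Im (x' n) > y & cmod (x n) < R & cmod (x' n) < R"
  unfolding eventually_sequentially by auto
 define M where "M = 1 / y^2 + (1 + R / y)^2"
 have R0: "R > 0" using R(1) norm_ge_zero[of z] by linarith
 have M: "M >= 0" by (simp add: M_def)
 define B where "B = \<lceil>M * (R / y) + M * (R^2 * (R / y))\<rceil>"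
 have small: "abs p <= B" if "(real_of_int p)^2 <= M * (R / y) + M * (R^2 * (R / y))" for p proof -
  have "real_of_int (p^2) <= M * (R / y) + M * (R^2 * (R / y))" using that by simp
  hence "p^2 <= B" unfolding B_def by linarith
  moreover have "abs p <= p^2" using self_le_power[of "abs p" 2] by (cases "p = 0") auto
  ultimately show ?thesis by linarith
 qed
 have fin: "g n \<in> {-B..B} \<times> {-B..B} \<times> {-B..B} \<times> {-B..B}" if n: "n >= N" for n
 proof -
  obtain a b c d where gn: "g n = (a, b, c, d)" by (cases "g n")
  with g[of n] have det: "a * d - b * c = 1" and x': "x' n = mob a b c d (x n)" by auto
  have nz: "cocycle c d (x n) ~= 0" using cocycle_nonzero[OF z(2) unimodular_not_both_zero[OF det]] .
  note Nn = N[OF n]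
  define t where "t = (cmod (cocycle c d (x n)))^2"
  have t: "t > 0" using nz by (simp add: t_def)
  have "Im (x' n) = Im (x n) / t" unfolding x' t_def by (rule Im_mob[OF det z(2)])
  hence "t = Im (x n) / Im (x' n)" using t Nn y by (simp add: field_simps)
  also have "... <= R / y" using Nn y abs_Im_le_cmod[of "x n"] by (intro frac_le) auto
  finally have tR: "t <= R / y" .
  have "(of_int c)^2 + (of_int d)^2 <= M * t" unfolding M_def t_def using Nn y by (intro cocycle_lower_bound) auto
  also have "... <= M * (R / y)" using tR M by (rule mult_left_mono)
  finally have cd: "(real_of_int c)^2 + (of_int d)^2 <= M * (R / y)" .
  have "cocycle a b (x n) = x' n * cocycle c d (x n)" using nz unfolding x' by (simp add: mob_def cocycle_def)
  hence ab': "(cmod (cocycle a b (x n)))^2 = (cmod (x' n))^2 * t" by (simp add: norm_mult power_mult_distrib t_def)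
  have "(of_int a)^2 + (of_int b)^2 <= M * (cmod (cocycle a b (x n)))^2"
   unfolding M_def using Nn y by (intro cocycle_lower_bound) auto
  also have "... <= M * (R^2 * (R / y))" unfolding ab' using Nn tR M t by (intro mult_left_mono mult_mono power_mono) auto
  finally have ab: "(real_of_int a)^2 + (of_int b)^2 <= M * (R^2 * (R / y))" .
  have nn: "M * (R / y) >= 0" "M * (R^2 * (R / y)) >= 0" using M R0 y by (auto intro!: mult_nonneg_nonneg divide_nonneg_pos)
  have "abs a <= B" "abs b <= B" "abs c <= B" "abs d <= B"
   using ab cd nn zero_le_power2[of "real_of_int a"] zero_le_power2[of "real_of_int b"] zero_le_power2[of "real_of_int c"] zero_le_power2[of "real_of_int d"]
   by (intro small; linarith)+
  thus ?thesis by (auto simp: gn)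
 qed
 have "finite (g ` {N..})" by (rule finite_subset[OF image_subsetI[OF fin]]) auto
 then obtain n0 where n0: "infinite {n\<in>{N..}. g n = g n0}" using pigeonhole_infinite[of "{N..}" g] infinite_Ici by metis
 from infinite_enumerate[OF n0] obtain r :: "nat => nat"
  where r0: "strict_mono r & (\<forall>n. r n \<in> {n\<in>{N..}. g n = g n0})" ..
 hence r: "strict_mono r" "r n \<in> {n\<in>{N..}. g n = g n0}" for n by simp_all
 obtain a b c d where gn: "g n0 = (a, b, c, d)" by (cases "g n0")
 with g[of n0] have det: "a * d - b * c = 1" by auto
 have xr: "x' (r n) = mob a b c d (x (r n))" for n using g[of "r n"] r(2)[of n] gn by auto
 have "(%n. mob a b c d ((x \<circ> r) n)) \<longlonglongrightarrow> mob a b c d z"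
  using DERIV_isCont[OF mob_has_field_derivative[OF det z(1)]] LIMSEQ_subseq_LIMSEQ[OF z(3) r(1)]
  by (rule isCont_tendsto_compose)
 moreover have "(%n. mob a b c d ((x \<circ> r) n)) = x' \<circ> r" by (auto simp: xr)
 moreover have "(x' \<circ> r) \<longlonglongrightarrow> z'" by (rule LIMSEQ_subseq_LIMSEQ[OF z'(2) r(1)])
 ultimately have "z' = mob a b c d z" using LIMSEQ_unique by auto
 thus ?thesis unfolding SL2Z_equiv_alt using det by blast
qed

lemma SL2Z_separation: assumes z: "z \<in> HH" "z' \<in> HH" "~ SL2Z_equiv z z'"
 obtains r where "r > 0" "ball z r \<subseteq> HH" "ball z' r \<subseteq> HH"
  "!!u v. u \<in> ball z r ==> v \<in> ball z' r ==> ~ SL2Z_equiv u v" proof -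
 define E where "E = {p \<in> HH \<times> HH. SL2Z_equiv (fst p) (snd p)}"
 have "(z, z') \<notin> closure E" proof
  assume "(z, z') \<in> closure E"
  then obtain x where x: "!!n. x n \<in> E" "x \<longlonglongrightarrow> (z, z')" unfolding closure_sequential by blast
  have "SL2Z_equiv z z'" by (rule SL2Z_equiv_limit[of z "%n. fst (x n)" z' "%n. snd (x n)"])
    (use x(1) z tendsto_fst[OF x(2)] tendsto_snd[OF x(2)] in \<open>auto simp: E_def mem_Times_iff\<close>)
  thus False using z by blast
 qed
 moreover have "open (HH \<times> HH - closure E)" by (intro open_Diff open_Times open_HH closed_closure)
 ultimately obtain A B where AB: "open A" "open B" "(z, z') \<in> A \<times> B" "A \<times> B \<subseteq> HH \<times> HH - closure E"
  using z by (elim open_prod_elim[where x = "(z, z')"]) auto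
 obtain r1 r2 where r: "r1 > 0" "ball z r1 \<subseteq> A" "r2 > 0" "ball z' r2 \<subseteq> B" using AB(1-3) unfolding open_contains_ball by blast
 have *: "(u, v) \<in> HH \<times> HH - E" if "u \<in> ball z (min r1 r2)" "v \<in> ball z' (min r1 r2)" for u v proof -
  have "u \<in> A" "v \<in> B" using that r by auto
  hence "(u, v) \<in> HH \<times> HH - closure E" using AB(4) by blast
  thus ?thesis using closure_subset[of E] by blast
 qed
 have c: "z \<in> ball z (min r1 r2)" "z' \<in> ball z' (min r1 r2)" using r by auto
 show ?thesis proof (rule that[of "min r1 r2"])
  show "ball z (min r1 r2) \<subseteq> HH" using *[OF _ c(2)] by blast
  show "ball z' (min r1 r2) \<subseteq> HH" using *[OF c(1)] by blast
  show "~ SL2Z_equiv u v" if "u \<in> ball z (min r1 r2)" "v \<in> ball z' (min r1 r2)" for u v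
   using *[OF that] by (auto simp: E_def)
 qed (use r in auto)
qed

text \<open>A large value is not attained in the compact \<open>fund_box Y\<close>, so its preimage in the
 fundamental domain lies above it.\<close>

lemma modular_w_large_imp_near_cusp:
 obtains R where "!!z. z \<in> HH ==> cmod (modular_w z) > R ==> EX z'. SL2Z_equiv z z' & z' \<in> HH & Im z' > Y" proof -
 have "bounded (modular_w ` fund_box Y)" by (intro compact_imp_bounded compact_continuous_image compact_fund_box
    continuous_on_subset[OF holomorphic_on_imp_continuous_on[OF modular_w_hol] fund_box_HH])
 then obtain R where R: "!!z. z \<in> fund_box Y ==> cmod (modular_w z) <= R" by (auto simp: bounded_iff)
 show ?thesis proof (rule that[of R])
  fix z assume z: "z \<in> HH" "cmod (modular_w z) > R"
  obtain u where u: "SL2Z_equiv z u" "u \<in> HH" "abs (Re u) <= 1 / 2" "Im u >= sqrt 3 / 2"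
   using fundamental_domain[OF z(1)] by metis
  have "u \<notin> fund_box Y" using R[of u] z(2) modular_w_invariant[OF z(1) u(1)] by auto
  hence "Im u > Y" using u by (auto simp: fund_box_def in_cbox_complex_iff)
  thus "EX z'. SL2Z_equiv z z' & z' \<in> HH & Im z' > Y" using u by auto
 qed
qed

text \<open>Near the cusp \<open>1 / w\<close> is an injective function of the nome, and points with equal nome
 differ by a translation.\<close>

lemma modular_w_inj_near_cusp:
 obtains R where "!!z z'. z \<in> HH ==> z' \<in> HH ==> modular_w z = modular_w z' ==> cmod (modular_w z) > R ==> SL2Z_equiv z z'"
proof -
 obtain H where H: "H holomorphic_on ball 0 1" "H 0 ~= 0" "!!z. z \<in> HH ==> modular_w z = H (nome z) / nome z"
  using modular_w_cusp by metis
 have "isCont H 0" using holomorphic_on_imp_continuous_on[OF H(1)] by (simp add: continuous_on_eq_continuous_at)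
 hence "\<forall>\<^sub>F q in nhds 0. H q ~= 0"
  using H(2) tendsto_imp_eventually_ne[of H "H 0" "nhds 0" 0] by (simp add: isCont_def tendsto_at_iff_tendsto_nhds)
 then obtain s where s: "s > 0" "!!q. dist q 0 < s ==> H q ~= 0" unfolding eventually_nhds_metric by auto
 define t where "t = min s 1"
 have t: "t > 0" "t <= s" "t <= 1" using s by (auto simp: t_def)
 \<comment> \<open>\<open>1 / w\<close> as a function of the nome\<close>
 define k where "k = (%q. q / H q)"
 have kh: "k holomorphic_on ball 0 t" unfolding k_def
  using s t by (intro holomorphic_intros holomorphic_on_subset[OF H(1)]) auto
 have "(H has_field_derivative deriv H 0) (at 0)" by (rule holomorphic_derivI[OF H(1)]) auto
 hence "(k has_field_derivative 1 / H 0) (at 0)"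
  unfolding k_def using H(2) by (auto intro!: derivative_eq_intros simp: field_simps)
 hence dk: "deriv k 0 ~= 0" using H(2) by (simp add: DERIV_imp_deriv)
 have 0: "(0::complex) \<in> ball 0 t" using t by simp
 obtain r where r: "r > 0" "ball (0::complex) r \<subseteq> ball 0 t" "inj_on k (ball 0 r)"
  by (rule has_complex_derivative_locally_injective[OF kh 0 open_ball dk])
 have "\<forall>\<^sub>F q in at 0. q \<in> ball 0 r" by (rule eventually_at_in_open') (use r in auto)
 from filterlim_iff[THEN iffD1, OF nome_at_0, rule_format, OF this]
 obtain Y where Y: "\<forall>z. Im z > Y --> nome z \<in> ball 0 r" unfolding eventually_to_cusp ..
 obtain R where R: "!!z. z \<in> HH ==> cmod (modular_w z) > R ==> EX z'. SL2Z_equiv z z' & z' \<in> HH & Im z' > Y"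
  using modular_w_large_imp_near_cusp[of Y] by metis
 show ?thesis proof (rule that[of R])
  fix z z' assume z: "z \<in> HH" "z' \<in> HH" and eq: "modular_w z = modular_w z'" and R': "cmod (modular_w z) > R"
  obtain u where u: "SL2Z_equiv z u" "u \<in> HH" "nome u \<in> ball 0 r" using R[of z] Y z R' by auto
  obtain u' where u': "SL2Z_equiv z' u'" "u' \<in> HH" "nome u' \<in> ball 0 r" using R[of z'] Y z R' eq by auto
  have "modular_w u = modular_w u'" using eq modular_w_invariant[OF z(1) u(1)] modular_w_invariant[OF z(2) u'(1)] by simp
  hence "H (nome u) / nome u = H (nome u') / nome u'" using H(3) u u' by simp
  hence "inverse (H (nome u) / nome u) = inverse (H (nome u') / nome u')" by simp
  hence "k (nome u) = k (nome u')" by (simp add: k_def)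
  hence "nome u = nome u'" using r(3) u u' by (auto dest: inj_onD)
  hence "SL2Z_equiv u u'" using nome_eq_iff SL2Z_equiv_translate by metis
  thus "SL2Z_equiv z z'" using SL2Z_equiv_trans[OF z(1) u(1)] SL2Z_equiv_trans[OF z(1) _ SL2Z_equiv_sym[OF z(2) u'(1)]] by blast
 qed
qed

text \<open>Let \<open>A\<close> be the set of values other than 0 and 1 that are attained on two orbits. It is
 open by the open mapping theorem, and closed because a limit of inequivalent pairs is inequivalent:
 \<open>w\<close> is injective near points with value other than 0 and 1. As large values lie outside
 \<open>A\<close> and the plane without 0 and 1 is connected, \<open>A\<close> is empty. A coincidence with
 value 0 or 1 would spread to values in \<open>A\<close>.\<close>

theorem modular_w_inj: assumes "z \<in> HH" "z' \<in> HH" "modular_w z = modular_w z'" shows "SL2Z_equiv z z'"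
proof (rule ccontr)
 assume neq: "~ SL2Z_equiv z z'"
 define S where "S = UNIV - {0, 1 :: complex}"
 define A where "A = {c \<in> S. \<exists>z\<in>HH. \<exists>z'\<in>HH. ~ SL2Z_equiv z z' & modular_w z = c & modular_w z' = c}"
 have openS: "open S" unfolding S_def by (intro open_Diff) auto
 have connS: "connected S" unfolding S_def by (rule connected_open_delete_finite) auto
 have spread: "EX V. open V & modular_w z \<in> V & V \<inter> S \<subseteq> A"
  if z: "z \<in> HH" "z' \<in> HH" "~ SL2Z_equiv z z'" "modular_w z = modular_w z'" for z z' proof -
  obtain r where r: "r > 0" "ball z r \<subseteq> HH" "ball z' r \<subseteq> HH"
   "!!u v. u \<in> ball z r ==> v \<in> ball z' r ==> ~ SL2Z_equiv u v" using SL2Z_separation[OF z(1-3)] by metis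
  \<comment> \<open>every value in \<open>V\<close> is attained near \<open>z\<close> and near \<open>z'\<close>, at inequivalent points\<close>
  define V where "V = modular_w ` ball z r \<inter> modular_w ` ball z' r"
  have "open V" unfolding V_def using modular_w_open r by (intro open_Int) auto
  moreover have "modular_w z \<in> modular_w ` ball z r" "modular_w z' \<in> modular_w ` ball z' r" using r(1) by auto
  hence "modular_w z \<in> V" unfolding V_def Int_iff using z(4) by simp
  moreover have "V \<inter> S \<subseteq> A" proof
   fix c assume c: "c \<in> V \<inter> S"
   then obtain u v where "u \<in> ball z r" "v \<in> ball z' r" "modular_w u = c" "modular_w v = c" unfolding V_def by auto
   thus "c \<in> A" using c r(2-4) unfolding A_def by blast
  qed
  ultimately show ?thesis by blast
 qed
 have openA: "open A" proof (subst open_subopen, rule ballI)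
  fix c assume "c \<in> A"
  then obtain z z' where "c \<in> S" "z \<in> HH" "z' \<in> HH" "~ SL2Z_equiv z z'" "modular_w z = c" "modular_w z' = c" by (auto simp: A_def)
  then obtain V where "open V" "c \<in> V" "V \<inter> S \<subseteq> A" using spread[of z z'] by auto
  thus "EX T. open T & c \<in> T & T \<subseteq> A" using openS \<open>c \<in> S\<close> by (intro exI[of _ "V \<inter> S"]) auto
 qed
 have closedA: "c \<in> A" if c: "c \<in> S" "!!n. x n \<in> A" "x \<longlonglongrightarrow> c" for c x proof -
  have "Bseq x" using c(3) by (intro convergent_imp_Bseq) (auto simp: convergent_def)
  then obtain R where R: "!!n. cmod (x n) <= R" by (auto simp: Bseq_def)
  obtain Y where Y: "!!z. z \<in> HH ==> cmod (modular_w z) <= R ==> \<exists>z'\<in>fund_box Y. SL2Z_equiv z z'"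
   using bounded_preimage_in_fund_box[of R] by metis
  have "EX p. fst p \<in> fund_box Y & snd p \<in> fund_box Y & ~ SL2Z_equiv (fst p) (snd p) & modular_w (fst p) = x n & modular_w (snd p) = x n" for n
  proof -
   obtain z z' where z: "z \<in> HH" "z' \<in> HH" "~ SL2Z_equiv z z'" "modular_w z = x n" "modular_w z' = x n" using c(2)[of n] by (auto simp: A_def)
   obtain u where u: "u \<in> fund_box Y" "SL2Z_equiv z u" using Y[of z] z R[of n] by auto
   obtain u' where u': "u' \<in> fund_box Y" "SL2Z_equiv z' u'" using Y[of z'] z R[of n] by auto
   have "~ SL2Z_equiv u u'"
    using SL2Z_equiv_trans[OF z(1) u(2)] SL2Z_equiv_trans[OF z(1) _ SL2Z_equiv_sym[OF z(2) u'(2)]] z(3) by blast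
   thus ?thesis using u u' z modular_w_invariant[OF z(1) u(2)] modular_w_invariant[OF z(2) u'(2)] by (intro exI[of _ "(u, u')"]) auto
  qed
  hence "\<forall>n. EX p. fst p \<in> fund_box Y & snd p \<in> fund_box Y & ~ SL2Z_equiv (fst p) (snd p) & modular_w (fst p) = x n & modular_w (snd p) = x n" by blast
  from choice[OF this] obtain p where p: "\<forall>n. fst (p n) \<in> fund_box Y & snd (p n) \<in> fund_box Y & ~ SL2Z_equiv (fst (p n)) (snd (p n)) & modular_w (fst (p n)) = x n & modular_w (snd (p n)) = x n" ..
  have "compact (fund_box Y \<times> fund_box Y)" by (intro compact_Times compact_fund_box)
  moreover have "\<forall>n. p n \<in> fund_box Y \<times> fund_box Y" using p by (auto simp: mem_Times_iff)
  ultimately obtain l r where l: "l \<in> fund_box Y \<times> fund_box Y" "strict_mono r" "(p \<circ> r) \<longlonglongrightarrow> l"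
   unfolding compact_def by metis
  define u where "u = (%n. fst (p (r n)))"
  define v where "v = (%n. snd (p (r n)))"
  have ul: "u \<longlonglongrightarrow> fst l" "v \<longlonglongrightarrow> snd l" using tendsto_fst[OF l(3)] tendsto_snd[OF l(3)] by (auto simp: u_def v_def)
  have lH: "fst l \<in> HH" "snd l \<in> HH" using l(1) fund_box_HH by (auto simp: mem_Times_iff)
  have uH: "u n \<in> HH" "v n \<in> HH" for n using p fund_box_HH unfolding u_def v_def by blast+
  have uv: "~ SL2Z_equiv (u n) (v n)" "modular_w (u n) = modular_w (v n)" for n using p by (auto simp: u_def v_def)
  have xr: "(%n. x (r n)) \<longlonglongrightarrow> c" using LIMSEQ_subseq_LIMSEQ[OF c(3) l(2)] by (simp add: o_def)
  have "(%n. modular_w (u n)) \<longlonglongrightarrow> modular_w (fst l)" "(%n. modular_w (v n)) \<longlonglongrightarrow> modular_w (snd l)"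
   using isCont_modular_w lH ul by (auto intro: isCont_tendsto_compose)
  moreover have "(%n. modular_w (u n)) = (%n. x (r n))" "(%n. modular_w (v n)) = (%n. x (r n))" using p by (auto simp: u_def v_def)
  ultimately have wl: "modular_w (fst l) = c" "modular_w (snd l) = c" using xr LIMSEQ_unique by auto
  have "~ SL2Z_equiv (fst l) (snd l)" proof
   assume "SL2Z_equiv (fst l) (snd l)"
   then obtain a b e d where det: "a * d - b * e = 1" and sl: "snd l = mob a b e d (fst l)" unfolding SL2Z_equiv_alt by auto
   have dn: "deriv modular_w (snd l) ~= 0" using deriv_modular_w_zero[OF lH(2)] wl c(1) by (auto simp: S_def)
   obtain s where s: "s > 0" "ball (snd l) s \<subseteq> HH" "inj_on modular_w (ball (snd l) s)"
    by (rule has_complex_derivative_locally_injective[OF modular_w_hol lH(2) open_HH dn])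
   have "(%n. mob a b e d (u n)) \<longlonglongrightarrow> snd l"
    unfolding sl using DERIV_isCont[OF mob_has_field_derivative[OF det lH(1)]] ul(1) by (rule isCont_tendsto_compose)
   from topological_tendstoD[OF this, of "ball (snd l) s"] have "\<forall>\<^sub>F n in sequentially. mob a b e d (u n) \<in> ball (snd l) s" using s by auto
   moreover have "\<forall>\<^sub>F n in sequentially. v n \<in> ball (snd l) s" using topological_tendstoD[OF ul(2), of "ball (snd l) s"] s by auto
   ultimately have "\<forall>\<^sub>F n in sequentially. mob a b e d (u n) \<in> ball (snd l) s & v n \<in> ball (snd l) s" by eventually_elim auto
   then obtain n where n: "mob a b e d (u n) \<in> ball (snd l) s" "v n \<in> ball (snd l) s"
    using eventually_happens'[OF sequentially_bot] by blast
   have "modular_w (mob a b e d (u n)) = modular_w (v n)" using modular_w_mob[OF det uH(1)] uv(2) by simp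
   hence "mob a b e d (u n) = v n" using inj_onD[OF s(3)] n by blast
   thus False using uv(1)[of n] det unfolding SL2Z_equiv_alt by metis
  qed
  thus ?thesis using lH wl c(1) unfolding A_def by blast
 qed
 have "c \<in> A" if "c \<in> closure A" "c \<in> S" for c using that closedA unfolding closure_sequential by blast
 hence "S - A = S - closure A" using closure_subset[of A] by blast
 hence openSA: "open (S - A)" using openS by (simp add: open_Diff)
 obtain R where R: "!!z z'. z \<in> HH ==> z' \<in> HH ==> modular_w z = modular_w z' ==> cmod (modular_w z) > R ==> SL2Z_equiv z z'"
  using modular_w_inj_near_cusp by metis
 define cR where "cR = complex_of_real (max R 1 + 1)"
 have "cmod cR = max R 1 + 1" by (simp add: cR_def)
 hence "cmod cR > R" "cmod cR > 1" by auto
 hence "cR \<in> S - A" using R unfolding A_def S_def by auto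
 moreover have "A \<inter> S = {} | (S - A) \<inter> S = {}" by (rule connectedD[OF connS openA openSA]) (auto simp: A_def)
 moreover have "A \<subseteq> S" by (auto simp: A_def)
 ultimately have "A = {}" by auto
 moreover obtain V where V: "open V" "modular_w z \<in> V" "V \<inter> S \<subseteq> A" using spread[OF assms(1,2) neq assms(3)] by auto
 ultimately have "V \<subseteq> {0, 1}" by (auto simp: S_def)
 hence "finite V" by (rule finite_subset) auto
 thus False using V(1,2) not_open_singleton finite_imp_not_open by auto
qed

lemma simple_zero_factor: assumes "n > 0" "r > 0" and u: "u holomorphic_on ball z0 r"
  and F: "!!w. w \<in> ball z0 r ==> F w = (w - z0) ^ n * u w" and d: "deriv F z0 ~= 0" shows "n = 1" proof (rule ccontr)
 assume "n ~= 1"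
 hence n: "n >= 2" using assms(1) by simp
 have z0: "z0 \<in> ball z0 r" using assms by simp
 have "(u has_field_derivative deriv u z0) (at z0)" by (rule holomorphic_derivI[OF u _ z0]) auto
 hence "((%w. (w - z0) ^ n * u w) has_field_derivative 0) (at z0)"
  using n by (auto intro!: derivative_eq_intros simp: power_0_left)
 hence "(F has_field_derivative 0) (at z0)"
  by (rule has_field_derivative_transform_within_open[OF _ open_ball z0]) (simp add: F)
 thus False using d by (simp add: DERIV_imp_deriv)
qed

text \<open>The ramification is 2 because \<open>w - 1 = E6^2 / disc\<close> and the zero of \<open>E6\<close>
 is simple.\<close>

lemma modular_w_factor_i:
 obtains r g where "r > 0" "ball \<i> r \<subseteq> HH" "g holomorphic_on ball \<i> r" "g \<i> ~= 0"
  "!!z. z \<in> ball \<i> r ==> modular_w z - 1 = (z - \<i>) ^ 2 * g z" proof -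
 obtain z6 where z6: "z6 \<in> HH" "E6 z6 ~= 0" using cusp_limit_nonzero[OF E_cusp(2)] by auto
 obtain u r n where u: "n > 0" "r > 0" "ball \<i> r \<subseteq> HH" "u holomorphic_on ball \<i> r"
  "!!w. w \<in> ball \<i> r ==> E6 w = (w - \<i>) ^ n * u w" "u \<i> ~= 0"
  using zero_factor[OF E_hol(2) i_in_HH E6_i z6] by metis
 have n: "n = 1" using simple_zero_factor[OF u(1,2,4,5)] E6_simple_zero[OF i_in_HH E6_i] by blast
 show ?thesis proof (rule that[of r "%z. (u z)^2 / disc z"])
  show "(%z. (u z)^2 / disc z) holomorphic_on ball \<i> r"
   using u(3) disc_nonzero by (intro holomorphic_intros u holomorphic_on_subset[OF disc_hol u(3)]) auto
  show "(u \<i>)^2 / disc \<i> ~= 0" using u(6) disc_nonzero[OF i_in_HH] by simp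
  fix z assume z: "z \<in> ball \<i> r"
  hence "modular_w z - 1 = E6 z ^ 2 / disc z" using u(3) modular_w_minus_1 by blast
  thus "modular_w z - 1 = (z - \<i>) ^ 2 * ((u z)^2 / disc z)" unfolding u(5)[OF z] n by (simp add: power_mult_distrib)
 qed (use u in auto)
qed

text \<open>The ramification is 3 because \<open>w = E4^3 / disc\<close> and the zero of \<open>E4\<close> is
 simple.\<close>

lemma modular_w_factor_rho:
 obtains r g where "r > 0" "ball rho r \<subseteq> HH" "g holomorphic_on ball rho r" "g rho ~= 0"
  "!!z. z \<in> ball rho r ==> modular_w z - 0 = (z - rho) ^ 3 * g z" proof -
 obtain z4 where z4: "z4 \<in> HH" "E4 z4 ~= 0" using cusp_limit_nonzero[OF E_cusp(1)] by auto
 obtain u r n where u: "n > 0" "r > 0" "ball rho r \<subseteq> HH" "u holomorphic_on ball rho r"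
  "!!w. w \<in> ball rho r ==> E4 w = (w - rho) ^ n * u w" "u rho ~= 0"
  using zero_factor[OF E_hol(1) rho_in_HH E4_rho z4] by metis
 have n: "n = 1" using simple_zero_factor[OF u(1,2,4,5)] E4_simple_zero[OF rho_in_HH E4_rho] by blast
 show ?thesis proof (rule that[of r "%z. (u z) ^ 3 / disc z"])
  show "(%z. (u z) ^ 3 / disc z) holomorphic_on ball rho r"
   using u(3) disc_nonzero by (intro holomorphic_intros u holomorphic_on_subset[OF disc_hol u(3)]) auto
  show "(u rho) ^ 3 / disc rho ~= 0" using u(6) disc_nonzero[OF rho_in_HH] by simp
  fix z assume z: "z \<in> ball rho r"
  show "modular_w z - 0 = (z - rho) ^ 3 * ((u z) ^ 3 / disc z)"
   unfolding modular_w_alt u(5)[OF z] n by (simp add: power_mult_distrib)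
 qed (use u in auto)
qed

lemma modular_w_factor_regular: assumes z0: "z0 \<in> HH" "deriv modular_w z0 ~= 0"
 obtains r g where "r > 0" "ball z0 r \<subseteq> HH" "g holomorphic_on ball z0 r" "g z0 ~= 0"
  "!!z. z \<in> ball z0 r ==> modular_w z - modular_w z0 = (z - z0) ^ 1 * g z" proof -
 obtain r where r: "r > 0" "ball z0 r \<subseteq> HH" using open_HH z0 open_contains_ball by blast
 show ?thesis proof (rule that[of r "%z. if z = z0 then deriv modular_w z0 else (modular_w z - modular_w z0) / (z - z0)"])
  show "(%z. if z = z0 then deriv modular_w z0 else (modular_w z - modular_w z0) / (z - z0)) holomorphic_on ball z0 r"
   by (rule pole_lemma_open[OF holomorphic_on_subset[OF modular_w_hol r(2)]]) auto
 qed (use r z0 in auto)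
qed

section \<open>Wronskians under scaling and change of variable\<close>

lemma eventually_analytic: "f analytic_on {z} ==> \<forall>\<^sub>F x in nhds z. f analytic_on {x}"
 unfolding analytic_at eventually_nhds by blast

lemma analytic_eventually_nonzero: "f analytic_on {z} ==> f z ~= 0 ==> \<forall>\<^sub>F x in nhds z. f x ~= 0"
 using analytic_at_imp_isCont[of f z] tendsto_imp_eventually_ne[of f "f z" "nhds z" 0]
 by (simp add: isCont_def tendsto_at_iff_tendsto_nhds)

lemma deriv_germ: assumes "\<forall>\<^sub>F y in nhds x. f y = g y"
 shows "\<forall>\<^sub>F y in nhds x. deriv f y = deriv g y" "deriv f x = deriv g x" proof -
 have "\<forall>\<^sub>F y in nhds x. \<forall>\<^sub>F u in nhds y. f u = g u" using assms by (simp add: eventually_eventually)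
 thus "\<forall>\<^sub>F y in nhds x. deriv f y = deriv g y" by eventually_elim (rule deriv_cong_ev, auto)
 thus "deriv f x = deriv g x" by (rule eventually_nhds_x_imp_x)
qed

lemma wronskian2_germ:
 assumes "\<forall>\<^sub>F y in nhds x. f y = f' y" "\<forall>\<^sub>F y in nhds x. g y = g' y"
 shows "wronskian2 f g x = wronskian2 f' g' x"
 using deriv_germ(2)[OF assms(1)] deriv_germ(2)[OF assms(2)] assms[THEN eventually_nhds_x_imp_x] by (simp add: wronskian2_def)

lemma wronskian3_eq:
 "wronskian3 f g h x = f x * deriv g x * deriv (deriv h) x + deriv f x * deriv (deriv g) x * h x + deriv (deriv f) x * g x * deriv h x
   - f x * deriv (deriv g) x * deriv h x - deriv f x * g x * deriv (deriv h) x - deriv (deriv f) x * deriv g x * h x"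
 by (simp add: wronskian3_def det_3 numeral_2_eq_2)

lemma wronskian3_germ:
 assumes "\<forall>\<^sub>F y in nhds x. f y = f' y" "\<forall>\<^sub>F y in nhds x. g y = g' y" "\<forall>\<^sub>F y in nhds x. h y = h' y"
 shows "wronskian3 f g h x = wronskian3 f' g' h' x"
 using deriv_germ(2)[OF assms(1)] deriv_germ(2)[OF assms(2)] deriv_germ(2)[OF assms(3)] assms[THEN eventually_nhds_x_imp_x]
  deriv_germ(2)[OF deriv_germ(1)[OF assms(1)]] deriv_germ(2)[OF deriv_germ(1)[OF assms(2)]] deriv_germ(2)[OF deriv_germ(1)[OF assms(3)]]
 by (simp add: wronskian3_eq)

lemma analytic_has_derivative: "f analytic_on {x} ==> (f has_field_derivative deriv f x) (at x)" by (rule analytic_derivI)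

lemma deriv_mult_analytic: assumes "s analytic_on {x}" "P analytic_on {x}"
 shows "deriv (%y. s y * P y) x = deriv s x * P x + s x * deriv P x"
  "deriv (deriv (%y. s y * P y)) x = deriv (deriv s) x * P x + 2 * deriv s x * deriv P x + s x * deriv (deriv P) x" proof -
 have 1: "deriv (%y. s y * P y) x = deriv s x * P x + s x * deriv P x" if "s analytic_on {x}" "P analytic_on {x}" for s P x
  using DERIV_mult[OF analytic_has_derivative[OF that(1)] analytic_has_derivative[OF that(2)]]
  by (simp add: DERIV_imp_deriv algebra_simps)
 thus "deriv (%y. s y * P y) x = deriv s x * P x + s x * deriv P x" using assms by blast
 have "\<forall>\<^sub>F y in nhds x. deriv (%y. s y * P y) y = deriv s y * P y + s y * deriv P y"
  using eventually_analytic[OF assms(1)] eventually_analytic[OF assms(2)] by eventually_elim (rule 1)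
 from deriv_germ(2)[OF this]
 have "deriv (deriv (%y. s y * P y)) x = deriv (%y. deriv s y * P y + s y * deriv P y) x" .
 also have "... = deriv (%y. deriv s y * P y) x + deriv (%y. s y * deriv P y) x"
  using assms by (intro deriv_add) (auto intro!: analytic_on_imp_differentiable_at analytic_intros)
 also have "deriv (%y. deriv s y * P y) x = deriv (deriv s) x * P x + deriv s x * deriv P x"
  using assms by (intro 1 analytic_deriv)
 also have "deriv (%y. s y * deriv P y) x = deriv s x * deriv P x + s x * deriv (deriv P) x"
  using assms by (intro 1 analytic_deriv)
 finally show "deriv (deriv (%y. s y * P y)) x = deriv (deriv s) x * P x + 2 * deriv s x * deriv P x + s x * deriv (deriv P) x"
  by (simp add: algebra_simps)
qed

lemma wronskian2_scale: assumes "s analytic_on {x}" "P analytic_on {x}" "Q analytic_on {x}"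
 shows "wronskian2 (%y. s y * P y) (%y. s y * Q y) x = s x ^ 2 * wronskian2 P Q x"
 unfolding wronskian2_def deriv_mult_analytic[OF assms(1,2)] deriv_mult_analytic[OF assms(1,3)] by algebra

lemma wronskian3_scale: assumes "s analytic_on {x}" "P analytic_on {x}" "Q analytic_on {x}" "R analytic_on {x}"
 shows "wronskian3 (%y. s y * P y) (%y. s y * Q y) (%y. s y * R y) x = s x ^ 3 * wronskian3 P Q R x"
 unfolding wronskian3_eq deriv_mult_analytic[OF assms(1,2)] deriv_mult_analytic[OF assms(1,3)] deriv_mult_analytic[OF assms(1,4)] by algebra

lemma analytic_compose_at: "v analytic_on {x} ==> F analytic_on {v x} ==> (%y. F (v y)) analytic_on {x}"
 using analytic_on_compose[of v "{x}" F] by (simp add: o_def)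

lemma eventually_compose: assumes "v analytic_on {x}" "\<forall>\<^sub>F u in nhds (v x). P u"
 shows "\<forall>\<^sub>F y in nhds x. P (v y)" proof -
 have "filterlim v (nhds (v x)) (nhds x)"
  using analytic_at_imp_isCont[OF assms(1)] by (simp add: isCont_def tendsto_at_iff_tendsto_nhds)
 with assms(2) show ?thesis by (rule eventually_compose_filterlim)
qed

lemma deriv_compose_analytic: assumes "v analytic_on {x}" "F analytic_on {v x}"
 shows "deriv (%y. F (v y)) x = deriv F (v x) * deriv v x"
  "deriv (deriv (%y. F (v y))) x = deriv (deriv F) (v x) * (deriv v x)^2 + deriv F (v x) * deriv (deriv v) x" proof -
 have 1: "deriv (%y. F (v y)) x = deriv F (v x) * deriv v x" if "v analytic_on {x}" "F analytic_on {v x}" for v F x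
  using DERIV_chain2[OF analytic_has_derivative[OF that(2)] analytic_has_derivative[OF that(1)]] by (rule DERIV_imp_deriv)
 thus "deriv (%y. F (v y)) x = deriv F (v x) * deriv v x" using assms by blast
 have "\<forall>\<^sub>F y in nhds x. deriv (%y. F (v y)) y = deriv F (v y) * deriv v y"
  using eventually_analytic[OF assms(1)] eventually_compose[OF assms(1) eventually_analytic[OF assms(2)]]
  by eventually_elim (rule 1)
 from deriv_germ(2)[OF this]
 have "deriv (deriv (%y. F (v y))) x = deriv (%y. deriv F (v y) * deriv v y) x" .
 also have "... = deriv (%y. deriv F (v y)) x * deriv v x + deriv F (v x) * deriv (deriv v) x"
  by (rule deriv_mult_analytic(1)[OF analytic_compose_at[OF assms(1) analytic_deriv[OF assms(2)]] analytic_deriv[OF assms(1)]])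
 also have "deriv (%y. deriv F (v y)) x = deriv (deriv F) (v x) * deriv v x"
  by (rule 1[OF assms(1) analytic_deriv[OF assms(2)]])
 finally show "deriv (deriv (%y. F (v y))) x = deriv (deriv F) (v x) * (deriv v x)^2 + deriv F (v x) * deriv (deriv v) x"
  by (simp add: algebra_simps power2_eq_square)
qed

lemma wronskian2_compose: assumes "v analytic_on {x}" "F analytic_on {v x}" "G analytic_on {v x}"
 shows "wronskian2 (%y. F (v y)) (%y. G (v y)) x = deriv v x * wronskian2 F G (v x)"
 unfolding wronskian2_def deriv_compose_analytic[OF assms(1,2)] deriv_compose_analytic[OF assms(1,3)] by algebra

lemma wronskian3_compose:
 assumes "v analytic_on {x}" "F analytic_on {v x}" "G analytic_on {v x}" "H analytic_on {v x}"
 shows "wronskian3 (%y. F (v y)) (%y. G (v y)) (%y. H (v y)) x = deriv v x ^ 3 * wronskian3 F G H (v x)"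
 unfolding wronskian3_eq deriv_compose_analytic[OF assms(1,2)] deriv_compose_analytic[OF assms(1,3)] deriv_compose_analytic[OF assms(1,4)] by algebra

lemma wronskian3_analytic: "F analytic_on {x} ==> G analytic_on {x} ==> H analytic_on {x} ==> wronskian3 F G H analytic_on {x}"
 unfolding wronskian3_eq[abs_def] by (intro analytic_intros)

section \<open>Normalized functions and covariance of the potentials\<close>

lemma analytic_cube_root: assumes "T analytic_on {z}" "T z ~= 0"
 obtains c where "c analytic_on {z}" "\<forall>\<^sub>F x in nhds z. c x ^ 3 = T x" "c z ~= 0" proof -
 define c where "c = (%x. exp (Ln (T z) / 3) * exp (Ln (T x / T z) / 3))"
 have "c analytic_on {z}" unfolding c_def using assms by (intro analytic_intros) (auto simp: complex_nonpos_Reals_iff)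
 moreover have "\<forall>\<^sub>F x in nhds z. T x ~= 0" by (rule analytic_eventually_nonzero[OF assms(1) assms(2)])
 hence "\<forall>\<^sub>F x in nhds z. c x ^ 3 = T x" proof eventually_elim
  case (elim x)
  have "c x ^ 3 = exp (Ln (T z)) * exp (Ln (T x / T z))" by (simp add: c_def power_mult_distrib flip: exp_of_nat_mult)
  thus ?case using elim assms(2) by simp
 qed
 moreover have "c z ~= 0" by (simp add: c_def)
 ultimately show ?thesis using that by blast
qed

lemma analytic_zero_dichotomy: assumes "F analytic_on {z}"
 shows "(\<forall>\<^sub>F x in nhds z. F x = 0) | (\<forall>\<^sub>F x in at z. F x ~= 0)" proof -
 obtain r where r: "r > 0" "F holomorphic_on ball z r" using assms by (auto simp: analytic_on_def)
 have nh: "\<forall>\<^sub>F x in nhds z. x \<in> ball z r" using r by (intro eventually_nhds_in_open) auto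
 show ?thesis proof (cases "\<exists>b\<in>ball z r. F b ~= 0")
  case False
  have "\<forall>\<^sub>F x in nhds z. F x = 0" using nh by eventually_elim (use False in auto)
  thus ?thesis by simp
 next
  case True
  then obtain b where b: "b \<in> ball z r" "F b ~= 0" by auto
  show ?thesis proof (cases "F z = 0")
   case True
   obtain s where s: "0 < s" "ball z s \<subseteq> ball z r" "!!x. x \<in> ball z s - {z} ==> F x ~= 0"
    using isolated_zeros[OF r(2) open_ball connected_ball _ True b] r(1) by auto
   have "\<forall>\<^sub>F x in at z. x \<in> ball z s - {z}" by (rule eventually_at_in_open) (use s in auto)
   hence "\<forall>\<^sub>F x in at z. F x ~= 0" by eventually_elim (rule s(3))
   thus ?thesis by simp
  next
   case False
   hence "\<forall>\<^sub>F x in at z. F x ~= 0"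
    using analytic_at_imp_isCont[OF assms] by (intro tendsto_imp_eventually_ne[of F "F z"]) (auto simp: isCont_def)
   thus ?thesis by simp
  qed
 qed
qed

text \<open>The product of the three factors \<open>c - k d\<close>, with \<open>k\<close> a cube root of unity,
 is 0, and a product of nonzero analytic germs is not 0. So normalized functions do not depend on the chosen
 cube root, up to a constant of modulus 1.\<close>

lemma cube_roots_agree:
 assumes "c analytic_on {z}" "d analytic_on {z}" "\<forall>\<^sub>F x in nhds z. c x ^ 3 = d x ^ 3"
 obtains j where "j ^ 3 = 1" "\<forall>\<^sub>F x in nhds z. c x = j * d x" proof -
 have rr: "rho * rho + rho + 1 = 0" proof -
  have "(complex_of_real (sqrt 3))^2 = 3" by (metis of_real_numeral of_real_power real_sqrt_pow2 zero_le_numeral)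
  thus ?thesis by (simp add: rho_def field_simps power2_eq_square)
 qed
 have r3: "rho ^ 3 = 1" proof -
  have "rho ^ 3 - 1 = (rho - 1) * (rho * rho + rho + 1)" by (simp add: algebra_simps eval_nat_numeral)
  thus ?thesis using rr by simp
 qed
 have fac: "a ^ 3 - b ^ 3 = (a - 1 * b) * ((a - rho * b) * (a - rho^2 * b))" for a b :: complex using rr by algebra
 have an: "(%x. c x - k * d x) analytic_on {z}" for k by (intro analytic_intros assms)
 have "\<exists>k\<in>{1, rho, rho^2}. \<forall>\<^sub>F x in nhds z. c x - k * d x = 0" proof (rule ccontr)
  assume "~ ?thesis"
  hence "\<forall>\<^sub>F x in at z. c x - k * d x ~= 0" if "k \<in> {1, rho, rho^2}" for k
   using analytic_zero_dichotomy[OF an] that by blast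
  from this[of 1] this[of rho] this[of "rho^2"]
  have "\<forall>\<^sub>F x in at z. c x - 1 * d x ~= 0" "\<forall>\<^sub>F x in at z. c x - rho * d x ~= 0" "\<forall>\<^sub>F x in at z. c x - rho^2 * d x ~= 0" by auto
  moreover have "\<forall>\<^sub>F x in at z. c x ^ 3 = d x ^ 3" using assms(3) by (auto simp: eventually_at_filter elim: eventually_mono)
  ultimately have "\<forall>\<^sub>F x in at z. False" proof eventually_elim
   case (elim x)
   thus ?case using fac[of "c x" "d x"] by simp
  qed
  thus False by simp
 qed
 then obtain k where k: "k \<in> {1, rho, rho^2}" "\<forall>\<^sub>F x in nhds z. c x - k * d x = 0" by blast
 have "(rho^2) ^ 3 = 1" using r3 by algebra
 hence "k ^ 3 = 1" using k(1) r3 by auto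
 moreover have "\<forall>\<^sub>F x in nhds z. c x = k * d x" using k(2) by eventually_elim simp
 ultimately show ?thesis using that by blast
qed

text \<open>The weights are those of the potentials. The product of two weights of \<open>norm_sum\<close> is a
 weight of \<open>wronskian_sum\<close> and conversely, which makes the Toda system close up.\<close>

definition norm_sum :: "real => real => (complex => complex) => (complex => complex) => (complex => complex) => complex => real" where
 "norm_sum l m f g h z = l^2 / m * (cmod (f z))^2 + m^2 / l * (cmod (g z))^2 + 1 / (l * m) * (cmod (h z))^2"

definition wronskian_sum :: "real => real => (complex => complex) => (complex => complex) => (complex => complex) => complex => real" where
 "wronskian_sum l m f g h z = l * m * (cmod (wronskian2 f g z))^2 + m / l^2 * (cmod (wronskian2 g h z))^2 + l / m^2 * (cmod (wronskian2 h f z))^2"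

text \<open>The potentials of the quotients of \<open>f, g, h\<close> by the cube root of their Wronskian,
 written without the cube root.\<close>

definition toda_local :: "real => real => nat => (complex => complex) => (complex => complex) => (complex => complex) => complex => real" where
 "toda_local l m k f g h z = (if k = 1 then ln (4 * wronskian_sum l m f g h z / (norm_sum l m f g h z)^2)
   else ln (4 * norm_sum l m f g h z * (cmod (wronskian3 f g h z))^2 / (wronskian_sum l m f g h z)^2))"

lemma norm_sum_pos: assumes "l > 0" "m > 0" "f z ~= 0 | g z ~= 0 | h z ~= 0" shows "norm_sum l m f g h z > 0" proof -
 have "0 <= l^2 / m * (cmod (f z))^2" "0 <= m^2 / l * (cmod (g z))^2" "0 <= 1 / (l * m) * (cmod (h z))^2" using assms by auto
 moreover have "0 < l^2 / m * (cmod (f z))^2 | 0 < m^2 / l * (cmod (g z))^2 | 0 < 1 / (l * m) * (cmod (h z))^2"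
  using assms by (auto intro!: mult_pos_pos)
 ultimately show ?thesis unfolding norm_sum_def by linarith
qed

lemma wronskian_sum_pos:
 assumes "l > 0" "m > 0" "wronskian2 f g z ~= 0 | wronskian2 g h z ~= 0 | wronskian2 h f z ~= 0"
 shows "wronskian_sum l m f g h z > 0" proof -
 have "0 <= l * m * (cmod (wronskian2 f g z))^2" "0 <= m / l^2 * (cmod (wronskian2 g h z))^2" "0 <= l / m^2 * (cmod (wronskian2 h f z))^2"
  using assms by auto
 moreover have "0 < l * m * (cmod (wronskian2 f g z))^2 | 0 < m / l^2 * (cmod (wronskian2 g h z))^2 | 0 < l / m^2 * (cmod (wronskian2 h f z))^2"
  using assms by (auto intro!: mult_pos_pos)
 ultimately show ?thesis unfolding wronskian_sum_def by linarith
qed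

lemma wronskian3_nonzero_imp: assumes "wronskian3 f g h z ~= 0"
 shows "f z ~= 0 | g z ~= 0 | h z ~= 0" "wronskian2 f g z ~= 0 | wronskian2 g h z ~= 0 | wronskian2 h f z ~= 0"
proof -
 show "f z ~= 0 | g z ~= 0 | h z ~= 0" using assms by (auto simp: wronskian3_eq)
 have "wronskian3 f g h z = - (deriv (deriv h) z * wronskian2 f g z + deriv (deriv f) z * wronskian2 g h z + deriv (deriv g) z * wronskian2 h f z)"
  unfolding wronskian3_eq wronskian2_def by algebra
 thus "wronskian2 f g z ~= 0 | wronskian2 g h z ~= 0 | wronskian2 h f z ~= 0" using assms by auto
qed

text \<open>The Wronskian of \<open>f, g, h\<close> is \<open>(s d)^3\<close> with \<open>d^3\<close> the
 product of \<open>v'^3\<close> and the Wronskian of \<open>F1, F2, F3\<close>. So the chosen cube root is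
 \<open>s d\<close> up to a root of unity, and \<open>s\<close> cancels in the normalized functions. At a zero
 of \<open>s\<close> this relies on the removal of singularities.\<close>

lemma toda_u_covariant: assumes psi: "v analytic_on {z}" "deriv v z ~= 0"
  and s: "s analytic_on {z}" "\<forall>\<^sub>F x in at z. s x ~= 0"
  and F: "F1 analytic_on {v z}" "F2 analytic_on {v z}" "F3 analytic_on {v z}" and W: "wronskian3 F1 F2 F3 (v z) ~= 0"
  and f: "\<forall>\<^sub>F x in nhds z. f x = s x * F1 (v x)" "\<forall>\<^sub>F x in nhds z. g x = s x * F2 (v x)" "\<forall>\<^sub>F x in nhds z. h x = s x * F3 (v x)"
  and l: "l > 0" "m > 0" shows "toda_u f g h l m k z = toda_local l m k F1 F2 F3 (v z) + 2 * ln (cmod (deriv v z))" proof -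
 define T where "T = (%x. deriv v x ^ 3 * wronskian3 F1 F2 F3 (v x))"
 have "T analytic_on {z}" unfolding T_def
  by (intro analytic_on_mult analytic_on_power analytic_deriv psi(1) analytic_compose_at[OF psi(1) wronskian3_analytic[OF F]])
 moreover have Tz: "T z ~= 0" using psi W by (simp add: T_def)
 ultimately obtain d where d: "d analytic_on {z}" "\<forall>\<^sub>F x in nhds z. d x ^ 3 = T x" "d z ~= 0"
  using analytic_cube_root[of T z] by metis
 have Wf: "\<forall>\<^sub>F x in nhds z. wronskian3 f g h x = s x ^ 3 * T x" proof -
  have "\<forall>\<^sub>F y in nhds z. \<forall>\<^sub>F x in nhds y. f x = s x * F1 (v x)" "\<forall>\<^sub>F y in nhds z. \<forall>\<^sub>F x in nhds y. g x = s x * F2 (v x)" "\<forall>\<^sub>F y in nhds z. \<forall>\<^sub>F x in nhds y. h x = s x * F3 (v x)"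
   using f by (simp_all add: eventually_eventually)
  with eventually_analytic[OF s(1)] eventually_analytic[OF psi(1)] eventually_compose[OF psi(1) eventually_analytic[OF F(1)]]
   eventually_compose[OF psi(1) eventually_analytic[OF F(2)]] eventually_compose[OF psi(1) eventually_analytic[OF F(3)]]
  show ?thesis proof eventually_elim
   case (elim x)
   have "wronskian3 f g h x = wronskian3 (%x. s x * F1 (v x)) (%x. s x * F2 (v x)) (%x. s x * F3 (v x)) x"
    by (rule wronskian3_germ) (use elim in auto)
   also have "... = s x ^ 3 * wronskian3 (%x. F1 (v x)) (%x. F2 (v x)) (%x. F3 (v x)) x"
    by (rule wronskian3_scale[OF elim(1) analytic_compose_at[OF elim(2,3)] analytic_compose_at[OF elim(2,4)] analytic_compose_at[OF elim(2,5)]])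
   also have "wronskian3 (%x. F1 (v x)) (%x. F2 (v x)) (%x. F3 (v x)) x = T x"
    unfolding T_def by (rule wronskian3_compose[OF elim(2-5)])
   finally show ?case .
  qed
 qed
 define c where "c = cube_root_at (wronskian3 f g h) z"
 have "EX c. c analytic_on {z} & (\<forall>\<^sub>F x in nhds z. c x ^ 3 = wronskian3 f g h x)"
 proof (intro exI[of _ "%x. s x * d x"] conjI)
  show "(%x. s x * d x) analytic_on {z}" by (intro analytic_intros s d)
  show "\<forall>\<^sub>F x in nhds z. (s x * d x) ^ 3 = wronskian3 f g h x"
   using Wf d(2) by eventually_elim (simp add: power_mult_distrib)
 qed
 from someI_ex[OF this] have c: "c analytic_on {z}" "\<forall>\<^sub>F x in nhds z. c x ^ 3 = wronskian3 f g h x"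
  unfolding c_def cube_root_at_def by auto
 have "\<forall>\<^sub>F x in nhds z. c x ^ 3 = (s x * d x) ^ 3"
  using c(2) Wf d(2) by eventually_elim (simp add: power_mult_distrib)
 moreover have "(%x. s x * d x) analytic_on {z}" by (intro analytic_intros s d)
 ultimately obtain j where j: "j ^ 3 = 1" "\<forall>\<^sub>F x in nhds z. c x = j * (s x * d x)"
  using cube_roots_agree[OF c(1)] by metis
 have "cmod j ^ 3 = 1" using j(1) by (metis norm_one norm_power)
 hence nj: "cmod j = 1" using power_eq_imp_eq_base[of "cmod j" 3 1] by simp
 hence j0: "j ~= 0" by auto
 define e where "e = (%x. 1 / (j * d x))"
 have e: "e analytic_on {z}" unfolding e_def using d j0 by (intro analytic_intros) auto
 have dnz: "\<forall>\<^sub>F x in nhds z. d x ~= 0" by (rule analytic_eventually_nonzero[OF d(1) d(3)])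
 have norm: "\<forall>\<^sub>F x in nhds z. normalized f g h u z x = e x * F (v x)"
  if F: "F analytic_on {v z}" and u: "\<forall>\<^sub>F x in nhds z. u x = s x * F (v x)" for u F
 proof -
  have Y: "(%x. e x * F (v x)) analytic_on {z}" by (intro analytic_on_mult e analytic_compose_at[OF psi(1) F])
  have "\<forall>\<^sub>F x in nhds z. x ~= z --> u x / c x = e x * F (v x)"
   using u j(2) dnz s(2)[unfolded eventually_at_filter]
   by eventually_elim (use j0 in \<open>auto simp: e_def field_simps\<close>)
  hence at: "\<forall>\<^sub>F y in nhds z. \<forall>\<^sub>F x in nhds y. x ~= z --> u x / c x = e x * F (v x)" by (simp add: eventually_eventually)
  have "\<forall>\<^sub>F y in nhds z. \<forall>\<^sub>F x in at y. u x / c x = e x * F (v x)" using at proof eventually_elim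
   case (elim y)
   have "\<forall>\<^sub>F x in at y. x ~= z" proof (cases "y = z")
    case True
    thus ?thesis by (simp add: eventually_at_filter)
   next
    case False
    hence "\<forall>\<^sub>F x in nhds y. x ~= z" by (intro t1_space_nhds) auto
    thus ?thesis by (simp add: eventually_at_filter eventually_mono)
   qed
   moreover have "\<forall>\<^sub>F x in at y. x ~= z --> u x / c x = e x * F (v x)"
    using elim unfolding eventually_at_filter by (auto elim: eventually_mono)
   ultimately show ?case by eventually_elim auto
  qed
  thus ?thesis using eventually_analytic[OF Y] proof eventually_elim
   case (elim y)
   have "remove_sings (%x. u x / c x) y = remove_sings (%x. e x * F (v x)) y" by (rule remove_sings_cong) (use elim in auto)
   thus ?case using elim by (simp add: normalized_def c_def)
  qed
 qed
 note y1 = norm[OF F(1) f(1)] and y2 = norm[OF F(2) f(2)] and y3 = norm[OF F(3) f(3)]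
 define t where "t = cmod (d z)"
 have t: "t > 0" using d(3) by (simp add: t_def)
 have ne: "cmod (e z) = 1 / t" using nj by (simp add: e_def norm_divide norm_mult t_def)
 define p where "p = cmod (deriv v z)"
 have p: "p > 0" using psi by (simp add: p_def)
 have t3: "t ^ 3 = p ^ 3 * cmod (wronskian3 F1 F2 F3 (v z))"
  using eventually_nhds_x_imp_x[OF d(2)] by (simp add: t_def p_def T_def norm_mult norm_power flip: norm_power)
 have wr: "cmod (wronskian2 (normalized f g h u1 z) (normalized f g h u2 z) z) = p / t^2 * cmod (wronskian2 G1 G2 (v z))"
  if "\<forall>\<^sub>F x in nhds z. normalized f g h u1 z x = e x * G1 (v x)" "\<forall>\<^sub>F x in nhds z. normalized f g h u2 z x = e x * G2 (v x)"
   "G1 analytic_on {v z}" "G2 analytic_on {v z}" for u1 u2 G1 G2 proof -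
  have "wronskian2 (normalized f g h u1 z) (normalized f g h u2 z) z = wronskian2 (%x. e x * G1 (v x)) (%x. e x * G2 (v x)) z"
   by (rule wronskian2_germ[OF that(1,2)])
  also have "... = e z ^ 2 * wronskian2 (%x. G1 (v x)) (%x. G2 (v x)) z"
   by (rule wronskian2_scale[OF e analytic_compose_at[OF psi(1) that(3)] analytic_compose_at[OF psi(1) that(4)]])
  also have "wronskian2 (%x. G1 (v x)) (%x. G2 (v x)) z = deriv v z * wronskian2 G1 G2 (v z)"
   by (rule wronskian2_compose[OF psi(1) that(3,4)])
  finally show ?thesis by (simp add: norm_mult norm_power ne p_def power_divide)
 qed
 define A where "A = norm_sum l m F1 F2 F3 (v z)"
 define B where "B = wronskian_sum l m F1 F2 F3 (v z)"
 have A: "A > 0" unfolding A_def by (intro norm_sum_pos l wronskian3_nonzero_imp(1)[OF W])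
 have B: "B > 0" unfolding B_def by (intro wronskian_sum_pos l wronskian3_nonzero_imp(2)[OF W])
 have U1: "toda_U1 f g h l m z = - ln (1/4 * (A / t^2))" unfolding toda_U1_def Let_def A_def norm_sum_def
   eventually_nhds_x_imp_x[OF y1] eventually_nhds_x_imp_x[OF y2] eventually_nhds_x_imp_x[OF y3] norm_mult ne
  by (simp add: power_mult_distrib power_divide add_divide_distrib)
 have U2: "toda_U2 f g h l m z = - ln (1/4 * (p^2 * B / t ^ 4))" unfolding toda_U2_def Let_def B_def wronskian_sum_def
   wr[OF y1 y2 F(1,2)] wr[OF y2 y3 F(2,3)] wr[OF y3 y1 F(3,1)]
  by (simp add: power_mult_distrib power_divide add_divide_distrib distrib_left mult_ac flip: power_mult)
 have lnU1: "ln (1/4 * (A / t^2)) = - ln 4 + ln A - 2 * ln t" using A t by (simp add: ln_mult ln_div ln_realpow)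
 have lnU2: "ln (1/4 * (p^2 * B / t ^ 4)) = - ln 4 + 2 * ln p + ln B - 4 * ln t"
  using B t p by (simp add: ln_mult ln_div ln_realpow)
 define w where "w = cmod (wronskian3 F1 F2 F3 (v z))"
 have w: "w > 0" using W by (simp add: w_def)
 have "ln (t ^ 3) = ln (p ^ 3 * w)" using t3 by (simp add: w_def)
 hence lnt: "3 * ln t = 3 * ln p + ln w" using t p w by (simp add: ln_mult ln_realpow)
 have E1: "ln (4 * B / A^2) = ln 4 + ln B - 2 * ln A" using A B by (simp add: ln_mult ln_div ln_realpow)
 have E2: "ln (4 * A * w^2 / B^2) = ln 4 + ln A + 2 * ln w - 2 * ln B" using A B w by (simp add: ln_mult ln_div ln_realpow)
 show ?thesis
  unfolding toda_u_def toda_local_def U1 U2 lnU1 lnU2 A_def[symmetric] B_def[symmetric] w_def[symmetric] p_def[symmetric] E1 E2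
  using lnt by (auto simp: algebra_simps)
qed

section \<open>Orders and adapted bases\<close>

text \<open>The cofactor \<open>u\<close> is kept explicit, since leading coefficients are computed from
 it.\<close>

abbreviation germ_factor :: "complex => nat => (complex => complex) => (complex => complex) => bool" where
 "germ_factor p n F u \<equiv> \<forall>\<^sub>F x in nhds p. F x = (x - p) ^ n * u x"

definition germ_order :: "complex => (complex => complex) => nat => bool" where
 "germ_order p F n \<longleftrightarrow> (EX u. u analytic_on {p} & u p ~= 0 & germ_factor p n F u)"

definition germ_indep :: "complex => (complex => complex) => (complex => complex) => (complex => complex) => bool" where
 "germ_indep p f g h \<longleftrightarrow> (\<forall>a b c. (\<forall>\<^sub>F x in nhds p. a * f x + b * g x + c * h x = 0) --> a = 0 & b = 0 & c = 0)"

definition in_span :: "(complex => complex) => (complex => complex) => (complex => complex) => (complex => complex) => bool" where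
 "in_span f g h b \<longleftrightarrow> (EX a j c. b = (%x. a * f x + j * g x + c * h x))"

text \<open>Three functions with increasing orders that span the same space as \<open>f, g, h\<close>.\<close>

definition adapted_basis :: "complex => (complex => complex) => (complex => complex) => (complex => complex) => nat => nat => nat
  => (complex => complex) => (complex => complex) => (complex => complex) => bool" where
 "adapted_basis p f g h n1 n2 n3 b1 b2 b3 \<longleftrightarrow> n1 < n2 & n2 < n3 &
   germ_order p b1 n1 & germ_order p b2 n2 & germ_order p b3 n3 &
   in_span f g h b1 & in_span f g h b2 & in_span f g h b3 &
   in_span b1 b2 b3 f & in_span b1 b2 b3 g & in_span b1 b2 b3 h"

lemma germ_order_exists: assumes F: "F analytic_on {p}" and nz: "~ (\<forall>\<^sub>F x in nhds p. F x = 0)"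
 obtains n where "germ_order p F n" proof (cases "F p = 0")
 case False
 hence "germ_order p F 0" unfolding germ_order_def using F by (intro exI[of _ F]) auto
 thus ?thesis by (rule that)
next
 case True
 obtain r where r: "r > 0" "F holomorphic_on ball p r" using F by (auto simp: analytic_on_def)
 have "~ F constant_on ball p r" proof
  assume "F constant_on ball p r"
  hence "F x = 0" if "x \<in> ball p r" for x using True r(1) that unfolding constant_on_def by (metis centre_in_ball)
  moreover have "\<forall>\<^sub>F x in nhds p. x \<in> ball p r" using r by (intro eventually_nhds_in_open) auto
  ultimately show False using nz eventually_mono[of "%x. x \<in> ball p r" "nhds p" "%x. F x = 0"] by blast
 qed
 moreover have "p \<in> ball p r" using r(1) by simp
 ultimately obtain u s n where u: "0 < n" "0 < s" "ball p s \<subseteq> ball p r" "u holomorphic_on ball p s"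
  "!!w. w \<in> ball p s ==> F w = (w - p) ^ n * u w" "!!w. w \<in> ball p s ==> u w ~= 0"
  using holomorphic_factor_zero_nonconstant[OF r(2) open_ball connected_ball _ True] by metis
 have "\<forall>\<^sub>F x in nhds p. x \<in> ball p s" using u by (intro eventually_nhds_in_open) auto
 hence "germ_factor p n F u" by eventually_elim (rule u(5))
 moreover have "u analytic_on {p}" unfolding analytic_at using u by (intro exI[of _ "ball p s"]) auto
 ultimately have "germ_order p F n" unfolding germ_order_def using u by auto
 thus ?thesis by (rule that)
qed

text \<open>The multiple is chosen to cancel the leading coefficient.\<close>

lemma germ_reduce: assumes F: "germ_order p F m" and G: "germ_order p G n" and mn: "m <= n"
 obtains b where "!!k. germ_order p (%x. G x - b * F x) k ==> m < k" proof -
 obtain u where u: "u analytic_on {p}" "u p ~= 0" "germ_factor p m F u"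
  using F unfolding germ_order_def by auto
 obtain v where v: "v analytic_on {p}" "v p ~= 0" "germ_factor p n G v"
  using G unfolding germ_order_def by auto
 define v' where "v' = (%x. (x - p) ^ (n - m) * v x)"
 have v': "v' analytic_on {p}" unfolding v'_def by (intro analytic_intros v)
 have Gv: "germ_factor p m G v'" using v(3) by eventually_elim (use mn in \<open>simp add: v'_def power_add[symmetric]\<close>)
 define b where "b = v' p / u p"
 have "m < k" if k0: "germ_order p (%x. G x - b * F x) k" for k proof (rule ccontr)
  assume k: "~ m < k"
  obtain w where w: "w analytic_on {p}" "w p ~= 0" "\<forall>\<^sub>F x in nhds p. G x - b * F x = (x - p) ^ k * w x"
   using k0 unfolding germ_order_def by auto
  have "\<forall>\<^sub>F x in nhds p. x ~= p --> w x = (x - p) ^ (m - k) * (v' x - b * u x)"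
   using w(3) u(3) Gv proof eventually_elim
   case (elim x)
   have "(x - p) ^ k * w x = (x - p) ^ k * ((x - p) ^ (m - k) * (v' x - b * u x))"
    using elim k by (simp add: algebra_simps power_add[symmetric])
   thus ?case by auto
  qed
  hence "\<forall>\<^sub>F x in at p. w x = (x - p) ^ (m - k) * (v' x - b * u x)" by (simp add: eventually_at_filter)
  moreover have "(w \<longlongrightarrow> w p) (at p)" using analytic_at_imp_isCont[OF w(1)] by (simp add: isCont_def)
  ultimately have "((%x. (x - p) ^ (m - k) * (v' x - b * u x)) \<longlongrightarrow> w p) (at p)"
   by (rule Lim_transform_eventually[rotated])
  moreover have "((%x. (x - p) ^ (m - k) * (v' x - b * u x)) \<longlongrightarrow> (p - p) ^ (m - k) * (v' p - b * u p)) (at p)"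
   using analytic_at_imp_isCont[OF v'] analytic_at_imp_isCont[OF u(1)] by (intro tendsto_intros) (auto simp: isCont_def)
  ultimately have "w p = (p - p) ^ (m - k) * (v' p - b * u p)" by (intro LIM_unique)
  thus False using w(2) u(2) by (simp add: b_def)
 qed
 thus ?thesis by (rule that)
qed

lemma in_span_perm:
 "in_span f g h b \<longleftrightarrow> in_span g f h b" "in_span f g h b \<longleftrightarrow> in_span f h g b" proof -
 have "in_span g f h b" if "in_span f g h b" for f g h b proof -
  obtain a j c where "b = (%x. a * f x + j * g x + c * h x)" using \<open>in_span f g h b\<close> unfolding in_span_def by auto
  thus ?thesis unfolding in_span_def by (intro exI[of _ j] exI[of _ a] exI[of _ c]) (auto simp: algebra_simps)
 qed
 thus "in_span f g h b \<longleftrightarrow> in_span g f h b" by blast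
 have "in_span f h g b" if "in_span f g h b" for f g h b proof -
  obtain a j c where "b = (%x. a * f x + j * g x + c * h x)" using \<open>in_span f g h b\<close> unfolding in_span_def by auto
  thus ?thesis unfolding in_span_def by (intro exI[of _ a] exI[of _ c] exI[of _ j]) (auto simp: algebra_simps)
 qed
 thus "in_span f g h b \<longleftrightarrow> in_span f h g b" by blast
qed

lemma adapted_basis_perm:
 "adapted_basis p f g h n1 n2 n3 b1 b2 b3 \<longleftrightarrow> adapted_basis p g f h n1 n2 n3 b1 b2 b3"
 "adapted_basis p f g h n1 n2 n3 b1 b2 b3 \<longleftrightarrow> adapted_basis p f h g n1 n2 n3 b1 b2 b3"
 unfolding adapted_basis_def using in_span_perm[of f g h] by auto

lemma germ_indep_perm:
 "germ_indep p f g h \<longleftrightarrow> germ_indep p g f h" "germ_indep p f g h \<longleftrightarrow> germ_indep p f h g"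
proof -
 have "germ_indep p g f h" if "germ_indep p f g h" for f g h unfolding germ_indep_def proof safe
  fix a b c assume "\<forall>\<^sub>F x in nhds p. a * g x + b * f x + c * h x = 0"
  hence "\<forall>\<^sub>F x in nhds p. b * f x + a * g x + c * h x = 0" by eventually_elim algebra
  from that[unfolded germ_indep_def, rule_format, OF this]
  show "a = 0" "b = 0" "c = 0" by simp_all
 qed
 thus "germ_indep p f g h \<longleftrightarrow> germ_indep p g f h" by blast
 have "germ_indep p f h g" if "germ_indep p f g h" for f g h unfolding germ_indep_def proof safe
  fix a b c assume "\<forall>\<^sub>F x in nhds p. a * f x + b * h x + c * g x = 0"
  hence "\<forall>\<^sub>F x in nhds p. a * f x + c * g x + b * h x = 0" by eventually_elim algebra
  from that[unfolded germ_indep_def, rule_format, OF this]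
  show "a = 0" "b = 0" "c = 0" by simp_all
 qed
 thus "germ_indep p f g h \<longleftrightarrow> germ_indep p f h g" by blast
qed

lemma in_span_analytic:
 "in_span f g h b ==> f analytic_on {p} ==> g analytic_on {p} ==> h analytic_on {p} ==> b analytic_on {p}"
 unfolding in_span_def by (elim exE, hypsubst) (intro analytic_intros)

lemma germ_indep_order:
 assumes an: "f analytic_on {p}" "g analytic_on {p}" "h analytic_on {p}" and ind: "germ_indep p f g h"
  and nz: "a ~= 0 | b ~= 0 | c ~= 0" obtains n where "germ_order p (%x. a * f x + b * g x + c * h x) n" proof -
 have "(%x. a * f x + b * g x + c * h x) analytic_on {p}" by (intro analytic_intros an)
 moreover have "~ (\<forall>\<^sub>F x in nhds p. a * f x + b * g x + c * h x = 0)" using ind nz unfolding germ_indep_def by blast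
 ultimately obtain n where "germ_order p (%x. a * f x + b * g x + c * h x) n" by (rule germ_order_exists)
 thus ?thesis by (rule that)
qed

text \<open>Gaussian elimination: take a function of least order, reduce the two others by it, then reduce the
 one of larger order by the other.\<close>

lemma adapted_basis_exists:
 assumes an: "f analytic_on {p}" "g analytic_on {p}" "h analytic_on {p}" and ind: "germ_indep p f g h"
 obtains n1 n2 n3 b1 b2 b3 where "adapted_basis p f g h n1 n2 n3 b1 b2 b3" proof -
 let ?Q = "%f g h. EX n1 n2 n3 b1 b2 b3. adapted_basis p f g h n1 n2 n3 b1 b2 b3"
 let ?A = "%f. f analytic_on {p}"
 have step: "?Q f g h" if an: "?A f" "?A g" "?A h" and ind: "germ_indep p f g h"
   and ord: "germ_order p f m" "germ_order p (%x. g x - j * f x) n" "m < n" "germ_order p (%x. h x - c * f x) k" "n <= k"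
  for f g h m n k j c proof -
  obtain d where d: "!!k. germ_order p (%x. (h x - c * f x) - d * (g x - j * f x)) k ==> n < k"
   using germ_reduce[OF ord(2,4,5)] by blast
  define b3 where "b3 = (%x. (d * j - c) * f x + (- d) * g x + 1 * h x)"
  have b3': "b3 = (%x. (h x - c * f x) - d * (g x - j * f x))" unfolding b3_def by (auto simp: algebra_simps)
  obtain l where l: "germ_order p b3 l" using germ_indep_order[OF an ind, of "d * j - c" "- d" 1] unfolding b3_def by auto
  have "n < l" using d[of l] l b3' by simp
  define b2 where "b2 = (%x. g x - j * f x)"
  have "in_span f g h f" unfolding in_span_def by (intro exI[of _ 1] exI[of _ 0]) auto
  moreover have "in_span f g h b2" unfolding in_span_def b2_def by (intro exI[of _ "- j"] exI[of _ 1] exI[of _ 0]) auto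
  moreover have "in_span f g h b3" unfolding in_span_def b3_def by blast
  moreover have "in_span f b2 b3 f" unfolding in_span_def by (intro exI[of _ 1] exI[of _ 0]) auto
  moreover have "in_span f b2 b3 g" unfolding in_span_def b2_def by (intro exI[of _ "j"] exI[of _ 1] exI[of _ 0]) auto
  moreover have "in_span f b2 b3 h" unfolding in_span_def b2_def b3' by (intro exI[of _ "c"] exI[of _ d] exI[of _ 1]) auto
  ultimately have "adapted_basis p f g h m n l f b2 b3"
   unfolding adapted_basis_def using ord l \<open>n < l\<close> b2_def by auto
  thus ?thesis by blast
 qed
 have least: "?Q f g h" if an: "?A f" "?A g" "?A h" and ind: "germ_indep p f g h"
   and ord: "germ_order p f m" "germ_order p g n" "germ_order p h k" "m <= n" "m <= k" for f g h m n k proof -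
  obtain j where j: "!!k. germ_order p (%x. g x - j * f x) k ==> m < k" using germ_reduce[OF ord(1,2,4)] by blast
  obtain c where c: "!!k. germ_order p (%x. h x - c * f x) k ==> m < k" using germ_reduce[OF ord(1,3,5)] by blast
  obtain n' where n': "germ_order p (%x. g x - j * f x) n'" using germ_indep_order[OF an ind, of "- j" 1 0] by auto
  obtain k' where k': "germ_order p (%x. h x - c * f x) k'" using germ_indep_order[OF an ind, of "- c" 0 1] by auto
  show ?thesis proof (cases "n' <= k'")
   case True
   show ?thesis by (rule step[OF an ind ord(1) n' j[OF n'] k' True])
  next
   case False
   have "germ_indep p f h g" using ind germ_indep_perm by blast
   from step[OF an(1,3,2) this ord(1) k' c[OF k'] n'] False
   show ?thesis using adapted_basis_perm(2)[of p f g h] by auto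
  qed
 qed
 obtain m where m: "germ_order p f m" using germ_indep_order[OF an ind, of 1 0 0] by auto
 obtain n where n: "germ_order p g n" using germ_indep_order[OF an ind, of 0 1 0] by auto
 obtain k where k: "germ_order p h k" using germ_indep_order[OF an ind, of 0 0 1] by auto
 have i2: "germ_indep p g f h" and i3: "germ_indep p h f g" using ind germ_indep_perm by blast+
 consider "m <= n & m <= k" | "n <= m & n <= k" | "k <= m & k <= n" by linarith
 hence "?Q f g h" proof cases
  case 1
  thus ?thesis using least[OF an ind m n k] by simp
 next
  case 2
  hence "?Q g f h" using least[OF an(2,1,3) i2 n m k] by simp
  thus ?thesis using adapted_basis_perm(1)[of p f g h] by auto
 next
  case 3
  hence "?Q h f g" using least[OF an(3,1,2) i3 k m n] by simp
  thus ?thesis using adapted_basis_perm(2)[of p f g h] adapted_basis_perm(1)[of p f h g] by auto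
 qed
 thus ?thesis using that by auto
qed

lemma deriv_power_shift: "deriv (%x. (x - p) ^ n) x = of_nat n * (x - p) ^ (n - 1)" for p :: complex
 by (rule DERIV_imp_deriv) (auto intro!: derivative_eq_intros)

text \<open>The Euler operator \<open>(x - p) d/dx\<close> preserves the factor \<open>(x - p) ^ n\<close> and
 multiplies the leading coefficient by \<open>n\<close>, without a special case for \<open>n =
 0\<close>.\<close>

lemma theta_factor:
 assumes u: "u analytic_on {p}" and F: "germ_factor p n F u"
 shows "\<forall>\<^sub>F x in nhds p. (x - p) * deriv F x = (x - p) ^ n * (of_nat n * u x + (x - p) * deriv u x)"
 using deriv_germ(1)[OF F] eventually_analytic[OF u] proof eventually_elim
 case (elim x)
 have "deriv F x = of_nat n * (x - p) ^ (n - 1) * u x + (x - p) ^ n * deriv u x"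
  unfolding elim(1) by (subst deriv_mult_analytic(1)) (auto intro!: analytic_intros elim simp: deriv_power_shift)
 moreover have "of_nat n * (x - p) ^ n = (x - p) * (of_nat n * (x - p) ^ (n - 1))" by (cases n) auto
 moreover define q1 q2 where q: "q1 = (x - p) ^ n" "q2 = (x - p) ^ (n - 1)"
 ultimately show ?case unfolding q[symmetric] by algebra
qed

text \<open>The square of the Euler operator is \<open>(x - p)^2 F'' + (x - p) F'\<close>.\<close>

lemma theta_factor2:
 assumes u: "u analytic_on {p}" and F: "F analytic_on {p}" "germ_factor p n F u"
 obtains v w where "v analytic_on {p}" "w analytic_on {p}" "v p = of_nat n * u p" "w p = (of_nat n)^2 * u p"
  "\<forall>\<^sub>F x in nhds p. (x - p) * deriv F x = (x - p) ^ n * v x"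
  "\<forall>\<^sub>F x in nhds p. (x - p)^2 * deriv (deriv F) x + (x - p) * deriv F x = (x - p) ^ n * w x" proof -
 define v where "v = (%x. of_nat n * u x + (x - p) * deriv u x)"
 define w where "w = (%x. of_nat n * v x + (x - p) * deriv v x)"
 have v: "v analytic_on {p}" unfolding v_def by (intro analytic_intros u)
 have w: "w analytic_on {p}" unfolding w_def by (intro analytic_intros v)
 have 1: "\<forall>\<^sub>F x in nhds p. (x - p) * deriv F x = (x - p) ^ n * v x" unfolding v_def by (rule theta_factor[OF u F(2)])
 have 2: "\<forall>\<^sub>F x in nhds p. (x - p)^2 * deriv (deriv F) x + (x - p) * deriv F x = (x - p) ^ n * w x"
  using theta_factor[OF v 1] eventually_analytic[OF F(1)] proof eventually_elim
  case (elim x)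
  have "deriv (%x. (x - p) * deriv F x) x = deriv F x + (x - p) * deriv (deriv F) x"
   using elim(2) deriv_power_shift[of p 1 x] by (subst deriv_mult_analytic(1)) (auto intro!: analytic_intros)
  with elim(1) have "(x - p) * (deriv F x + (x - p) * deriv (deriv F) x) = (x - p) ^ n * w x" by (simp add: w_def)
  thus ?case by (simp add: distrib_left power2_eq_square ac_simps)
 qed
 show ?thesis by (rule that[OF v w _ _ 1 2]) (auto simp: v_def w_def power2_eq_square)
qed

lemma wronskian2_order: assumes u: "u1 analytic_on {p}" "u2 analytic_on {p}"
  and b: "germ_factor p n1 b1 u1" "germ_factor p n2 b2 u2"
 obtains V where "V analytic_on {p}" "V p = (of_nat n1 - of_nat n2) * (u1 p * u2 p)"
  "\<forall>\<^sub>F x in nhds p. (x - p) * wronskian2 b1 b2 x = (x - p) ^ (n1 + n2) * V x" proof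
 define V where "V = (%x. (of_nat n1 * u1 x + (x - p) * deriv u1 x) * u2 x - (of_nat n2 * u2 x + (x - p) * deriv u2 x) * u1 x)"
 show "V analytic_on {p}" unfolding V_def by (intro analytic_intros u)
 show "V p = (of_nat n1 - of_nat n2) * (u1 p * u2 p)" by (simp add: V_def algebra_simps)
 show "\<forall>\<^sub>F x in nhds p. (x - p) * wronskian2 b1 b2 x = (x - p) ^ (n1 + n2) * V x"
  using theta_factor[OF u(1) b(1)] theta_factor[OF u(2) b(2)] b proof eventually_elim
  case (elim x)
  have "(x - p) * wronskian2 b1 b2 x = ((x - p) * deriv b1 x) * b2 x - ((x - p) * deriv b2 x) * b1 x"
   unfolding wronskian2_def by algebra
  moreover define q1 q2 where q: "q1 = (x - p) ^ n1" "q2 = (x - p) ^ n2"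
  ultimately show ?case using elim unfolding V_def power_add q[symmetric] by algebra
 qed
qed

text \<open>In terms of the Euler operator the leading coefficient is a Vandermonde determinant of the
 orders.\<close>

lemma wronskian3_order: assumes u: "u1 analytic_on {p}" "u2 analytic_on {p}" "u3 analytic_on {p}"
  and an: "b1 analytic_on {p}" "b2 analytic_on {p}" "b3 analytic_on {p}"
  and b: "germ_factor p n1 b1 u1" "germ_factor p n2 b2 u2" "germ_factor p n3 b3 u3"
 obtains V where "V analytic_on {p}" "V p = (of_nat n2 - of_nat n1) * (of_nat n3 - of_nat n1) * (of_nat n3 - of_nat n2) * (u1 p * u2 p * u3 p)"
  "\<forall>\<^sub>F x in nhds p. (x - p) ^ 3 * wronskian3 b1 b2 b3 x = (x - p) ^ (n1 + n2 + n3) * V x" proof -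
 obtain v1 w1 where 1: "v1 analytic_on {p}" "w1 analytic_on {p}" "v1 p = of_nat n1 * u1 p" "w1 p = (of_nat n1)^2 * u1 p"
  "\<forall>\<^sub>F x in nhds p. (x - p) * deriv b1 x = (x - p) ^ n1 * v1 x"
  "\<forall>\<^sub>F x in nhds p. (x - p)^2 * deriv (deriv b1) x + (x - p) * deriv b1 x = (x - p) ^ n1 * w1 x"
  by (rule theta_factor2[OF u(1) an(1) b(1)])
 obtain v2 w2 where 2: "v2 analytic_on {p}" "w2 analytic_on {p}" "v2 p = of_nat n2 * u2 p" "w2 p = (of_nat n2)^2 * u2 p"
  "\<forall>\<^sub>F x in nhds p. (x - p) * deriv b2 x = (x - p) ^ n2 * v2 x"
  "\<forall>\<^sub>F x in nhds p. (x - p)^2 * deriv (deriv b2) x + (x - p) * deriv b2 x = (x - p) ^ n2 * w2 x"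
  by (rule theta_factor2[OF u(2) an(2) b(2)])
 obtain v3 w3 where 3: "v3 analytic_on {p}" "w3 analytic_on {p}" "v3 p = of_nat n3 * u3 p" "w3 p = (of_nat n3)^2 * u3 p"
  "\<forall>\<^sub>F x in nhds p. (x - p) * deriv b3 x = (x - p) ^ n3 * v3 x"
  "\<forall>\<^sub>F x in nhds p. (x - p)^2 * deriv (deriv b3) x + (x - p) * deriv b3 x = (x - p) ^ n3 * w3 x"
  by (rule theta_factor2[OF u(3) an(3) b(3)])
 define V where "V = (%x. u1 x * v2 x * w3 x + v1 x * w2 x * u3 x + w1 x * u2 x * v3 x
  - u1 x * w2 x * v3 x - v1 x * u2 x * w3 x - w1 x * v2 x * u3 x)"
 have "V analytic_on {p}" unfolding V_def by (intro analytic_intros u 1 2 3)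
 moreover have "V p = (of_nat n2 - of_nat n1) * (of_nat n3 - of_nat n1) * (of_nat n3 - of_nat n2) * (u1 p * u2 p * u3 p)"
  unfolding V_def 1 2 3 by algebra
 moreover have "\<forall>\<^sub>F x in nhds p. (x - p) ^ 3 * wronskian3 b1 b2 b3 x = (x - p) ^ (n1 + n2 + n3) * V x"
  using 1(5,6) 2(5,6) 3(5,6) b proof eventually_elim
  case (elim x)
  define q1 q2 q3 where q: "q1 = (x - p) ^ n1" "q2 = (x - p) ^ n2" "q3 = (x - p) ^ n3"
  show ?case using elim unfolding V_def wronskian3_eq power_add q[symmetric] by algebra
 qed
 ultimately show ?thesis by (rule that)
qed

lemma deriv_lincomb: assumes "b1 analytic_on {x}" "b2 analytic_on {x}" "b3 analytic_on {x}"
 shows "deriv (%x. a1 * b1 x + a2 * b2 x + a3 * b3 x) x = a1 * deriv b1 x + a2 * deriv b2 x + a3 * deriv b3 x" proof -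
 note d = assms[THEN analytic_has_derivative]
 show ?thesis by (rule DERIV_imp_deriv) (auto intro!: derivative_eq_intros d)
qed

lemma deriv2_lincomb: assumes "b1 analytic_on {x}" "b2 analytic_on {x}" "b3 analytic_on {x}"
 shows "deriv (deriv (%x. a1 * b1 x + a2 * b2 x + a3 * b3 x)) x = a1 * deriv (deriv b1) x + a2 * deriv (deriv b2) x + a3 * deriv (deriv b3) x"
proof -
 have "\<forall>\<^sub>F y in nhds x. deriv (%x. a1 * b1 x + a2 * b2 x + a3 * b3 x) y = a1 * deriv b1 y + a2 * deriv b2 y + a3 * deriv b3 y"
  using assms[THEN eventually_analytic] by eventually_elim (rule deriv_lincomb)
 from deriv_germ(2)[OF this] show ?thesis using assms by (simp add: deriv_lincomb analytic_deriv)
qed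

lemma wronskian2_lincomb: assumes "b1 analytic_on {x}" "b2 analytic_on {x}" "b3 analytic_on {x}"
 shows "wronskian2 (%x. a1 * b1 x + a2 * b2 x + a3 * b3 x) (%x. c1 * b1 x + c2 * b2 x + c3 * b3 x) x =
  (a1 * c2 - a2 * c1) * wronskian2 b1 b2 x + (a2 * c3 - a3 * c2) * wronskian2 b2 b3 x + (a1 * c3 - a3 * c1) * wronskian2 b1 b3 x"
 unfolding wronskian2_def deriv_lincomb[OF assms] by algebra

lemma wronskian3_lincomb: assumes "b1 analytic_on {x}" "b2 analytic_on {x}" "b3 analytic_on {x}"
 shows "wronskian3 (%x. a1 * b1 x + a2 * b2 x + a3 * b3 x) (%x. c1 * b1 x + c2 * b2 x + c3 * b3 x) (%x. e1 * b1 x + e2 * b2 x + e3 * b3 x) x =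
  (e3 * (a1 * c2 - a2 * c1) + a3 * (c1 * e2 - c2 * e1) - c3 * (a1 * e2 - a2 * e1)) * wronskian3 b1 b2 b3 x"
 unfolding wronskian3_eq deriv_lincomb[OF assms] deriv2_lincomb[OF assms] by algebra

lemma leading_factor: fixes p :: complex
 assumes u: "u1 analytic_on {p}" "u2 analytic_on {p}" "u3 analytic_on {p}" and n: "n1 < n2" "n1 < n3"
  and b: "germ_factor p n1 b1 u1" "germ_factor p n2 b2 u2" "germ_factor p n3 b3 u3"
 shows "EX F. F analytic_on {p} & F p = a1 * u1 p & (\<forall>\<^sub>F x in nhds p. a1 * b1 x + a2 * b2 x + a3 * b3 x = (x - p) ^ n1 * F x)"
proof (intro exI conjI)
 let ?F = "%x. a1 * u1 x + a2 * (x - p) ^ (n2 - n1) * u2 x + a3 * (x - p) ^ (n3 - n1) * u3 x"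
 show "?F analytic_on {p}" by (intro analytic_intros u)
 show "?F p = a1 * u1 p" using n by (simp add: power_0_left)
 show "\<forall>\<^sub>F x in nhds p. a1 * b1 x + a2 * b2 x + a3 * b3 x = (x - p) ^ n1 * ?F x" using b proof eventually_elim
  case (elim x)
  have "(x - p) ^ n2 = (x - p) ^ n1 * (x - p) ^ (n2 - n1)" "(x - p) ^ n3 = (x - p) ^ n1 * (x - p) ^ (n3 - n1)"
   using n by (simp_all flip: power_add)
  moreover define q1 q2 q3 r2 r3 where q: "q1 = (x - p) ^ n1" "q2 = (x - p) ^ n2" "q3 = (x - p) ^ n3" "r2 = (x - p) ^ (n2 - n1)" "r3 = (x - p) ^ (n3 - n1)"
  ultimately show ?case using elim unfolding q[symmetric] by algebra
 qed
qed

text \<open>The Wronskians of \<open>f, g, h\<close> are minors of the base change matrix times those of the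
 adapted basis. The minors for the two lowest orders are not all 0 because the matrix is invertible. The extra
 factors \<open>x - p\<close> keep the exponents natural numbers.\<close>

lemma adapted_expansion:
 assumes ad: "adapted_basis p f g h n1 n2 n3 b1 b2 b3" and an: "f analytic_on {p}" "g analytic_on {p}" "h analytic_on {p}"
 obtains F1 F2 F3 V12 V23 V31 Q where
  "F1 analytic_on {p}" "F2 analytic_on {p}" "F3 analytic_on {p}" "V12 analytic_on {p}" "V23 analytic_on {p}" "V31 analytic_on {p}" "Q analytic_on {p}"
  "germ_factor p n1 f F1" "germ_factor p n1 g F2" "germ_factor p n1 h F3"
  "\<forall>\<^sub>F x in nhds p. (x - p) * wronskian2 f g x = (x - p) ^ (n1 + n2) * V12 x"
  "\<forall>\<^sub>F x in nhds p. (x - p) * wronskian2 g h x = (x - p) ^ (n1 + n2) * V23 x"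
  "\<forall>\<^sub>F x in nhds p. (x - p) * wronskian2 h f x = (x - p) ^ (n1 + n2) * V31 x"
  "\<forall>\<^sub>F x in nhds p. (x - p) ^ 3 * wronskian3 f g h x = (x - p) ^ (n1 + n2 + n3) * Q x"
  "F1 p ~= 0 | F2 p ~= 0 | F3 p ~= 0" "V12 p ~= 0 | V23 p ~= 0 | V31 p ~= 0" "Q p ~= 0"
proof -
 have n: "n1 < n2" "n2 < n3" "n1 < n3" using ad unfolding adapted_basis_def by auto
 have anb: "b1 analytic_on {p}" "b2 analytic_on {p}" "b3 analytic_on {p}"
  using ad an unfolding adapted_basis_def by (auto intro: in_span_analytic)
 have go: "germ_order p b1 n1" "germ_order p b2 n2" "germ_order p b3 n3" using ad unfolding adapted_basis_def by auto
 obtain u1 where u1: "u1 analytic_on {p}" "u1 p ~= 0" "germ_factor p n1 b1 u1" using go(1) unfolding germ_order_def by blast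
 obtain u2 where u2: "u2 analytic_on {p}" "u2 p ~= 0" "germ_factor p n2 b2 u2" using go(2) unfolding germ_order_def by blast
 obtain u3 where u3: "u3 analytic_on {p}" "u3 p ~= 0" "germ_factor p n3 b3 u3" using go(3) unfolding germ_order_def by blast
 note u = u1(1) u2(1) u3(1) u1(2) u2(2) u3(2) and b = u1(3) u2(3) u3(3)
 have sp: "in_span b1 b2 b3 f" "in_span b1 b2 b3 g" "in_span b1 b2 b3 h"
  and sp': "in_span f g h b1" "in_span f g h b2" "in_span f g h b3" using ad unfolding adapted_basis_def by auto
 obtain a1 a2 a3 where fgh1: "f = (%x. a1 * b1 x + a2 * b2 x + a3 * b3 x)" using sp(1) unfolding in_span_def by blast
 obtain c1 c2 c3 where fgh2: "g = (%x. c1 * b1 x + c2 * b2 x + c3 * b3 x)" using sp(2) unfolding in_span_def by blast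
 obtain e1 e2 e3 where fgh3: "h = (%x. e1 * b1 x + e2 * b2 x + e3 * b3 x)" using sp(3) unfolding in_span_def by blast
 note fgh = fgh1 fgh2 fgh3
 define d where "d = e3 * (a1 * c2 - a2 * c1) + a3 * (c1 * e2 - c2 * e1) - c3 * (a1 * e2 - a2 * e1)"
 have W: "\<forall>\<^sub>F x in nhds p. wronskian3 f g h x = d * wronskian3 b1 b2 b3 x"
  using anb[THEN eventually_analytic] unfolding fgh d_def by eventually_elim (rule wronskian3_lincomb)
 obtain V where V: "V analytic_on {p}" "V p = (of_nat n2 - of_nat n1) * (of_nat n3 - of_nat n1) * (of_nat n3 - of_nat n2) * (u1 p * u2 p * u3 p)"
  "\<forall>\<^sub>F x in nhds p. (x - p) ^ 3 * wronskian3 b1 b2 b3 x = (x - p) ^ (n1 + n2 + n3) * V x"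
  by (rule wronskian3_order[OF u(1-3) anb b])
 have Vp: "V p ~= 0" unfolding V(2) using u(4-6) n by auto
 have d: "d ~= 0" proof
  assume "d = 0"
  have "EX d'. \<forall>\<^sub>F x in nhds p. wronskian3 b1 b2 b3 x = d' * wronskian3 f g h x"
  proof -
   obtain a1 a2 a3 where b1': "b1 = (%x. a1 * f x + a2 * g x + a3 * h x)" using sp'(1) unfolding in_span_def by blast
   obtain c1 c2 c3 where b2': "b2 = (%x. c1 * f x + c2 * g x + c3 * h x)" using sp'(2) unfolding in_span_def by blast
   obtain e1 e2 e3 where b3': "b3 = (%x. e1 * f x + e2 * g x + e3 * h x)" using sp'(3) unfolding in_span_def by blast
   show ?thesis unfolding b1' b2' b3'
    by (intro exI, use an[THEN eventually_analytic] in eventually_elim) (rule wronskian3_lincomb)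
  qed
  then obtain d' where "\<forall>\<^sub>F x in nhds p. wronskian3 b1 b2 b3 x = d' * wronskian3 f g h x" ..
  with W V(3) have "\<forall>\<^sub>F x in nhds p. x ~= p --> V x = 0" by eventually_elim (use \<open>d = 0\<close> in auto)
  hence "\<forall>\<^sub>F x in at p. V x = 0" by (simp add: eventually_at_filter)
  moreover have "(V \<longlongrightarrow> V p) (at p)" using analytic_at_imp_isCont[OF V(1)] by (simp add: isCont_def)
  ultimately have "((%x. 0) \<longlongrightarrow> V p) (at p)" by (rule Lim_transform_eventually[rotated])
  hence "V p = 0" by (simp add: tendsto_const_iff)
  with Vp show False by simp
 qed
 define Q where "Q = (%x. d * V x)"
 have Q: "Q analytic_on {p}" unfolding Q_def by (intro analytic_intros V)
 have WQ: "\<forall>\<^sub>F x in nhds p. (x - p) ^ 3 * wronskian3 f g h x = (x - p) ^ (n1 + n2 + n3) * Q x"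
  using W V(3) by eventually_elim (simp add: Q_def)
 note lf = leading_factor[OF u(1-3) n(1,3) b]
 obtain F1 where F1: "F1 analytic_on {p}" "F1 p = a1 * u1 p" "germ_factor p n1 f F1"
  unfolding fgh using lf[of a1 a2 a3] by blast
 obtain F2 where F2: "F2 analytic_on {p}" "F2 p = c1 * u1 p" "germ_factor p n1 g F2"
  unfolding fgh using lf[of c1 c2 c3] by blast
 obtain F3 where F3: "F3 analytic_on {p}" "F3 p = e1 * u1 p" "germ_factor p n1 h F3"
  unfolding fgh using lf[of e1 e2 e3] by blast
 obtain A12 where A12: "A12 analytic_on {p}" "A12 p = (of_nat n1 - of_nat n2) * (u1 p * u2 p)"
  "\<forall>\<^sub>F x in nhds p. (x - p) * wronskian2 b1 b2 x = (x - p) ^ (n1 + n2) * A12 x"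
  by (rule wronskian2_order[OF u(1,2) b(1,2)])
 obtain A23 where A23: "A23 analytic_on {p}" "A23 p = (of_nat n2 - of_nat n3) * (u2 p * u3 p)"
  "\<forall>\<^sub>F x in nhds p. (x - p) * wronskian2 b2 b3 x = (x - p) ^ (n2 + n3) * A23 x"
  by (rule wronskian2_order[OF u(2,3) b(2,3)])
 obtain A13 where A13: "A13 analytic_on {p}" "A13 p = (of_nat n1 - of_nat n3) * (u1 p * u3 p)"
  "\<forall>\<^sub>F x in nhds p. (x - p) * wronskian2 b1 b3 x = (x - p) ^ (n1 + n3) * A13 x"
  by (rule wronskian2_order[OF u(1,3) b(1,3)])
 have V2: "EX V. V analytic_on {p} & V p = (a1 * c2 - a2 * c1) * A12 p &
   (\<forall>\<^sub>F x in nhds p. (x - p) * wronskian2 (%x. a1 * b1 x + a2 * b2 x + a3 * b3 x) (%x. c1 * b1 x + c2 * b2 x + c3 * b3 x) x = (x - p) ^ (n1 + n2) * V x)"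
  for a1 a2 a3 c1 c2 c3 proof (intro exI conjI)
  let ?V = "%x. (a1 * c2 - a2 * c1) * A12 x + (a2 * c3 - a3 * c2) * (x - p) ^ (n3 - n1) * A23 x + (a1 * c3 - a3 * c1) * (x - p) ^ (n3 - n2) * A13 x"
  show "?V analytic_on {p}" by (intro analytic_intros A12 A23 A13)
  show "?V p = (a1 * c2 - a2 * c1) * A12 p" using n by (simp add: power_0_left)
  show "\<forall>\<^sub>F x in nhds p. (x - p) * wronskian2 (%x. a1 * b1 x + a2 * b2 x + a3 * b3 x) (%x. c1 * b1 x + c2 * b2 x + c3 * b3 x) x = (x - p) ^ (n1 + n2) * ?V x"
   using anb[THEN eventually_analytic] A12(3) A23(3) A13(3) proof eventually_elim
   case (elim x)
   have "(x - p) ^ (n2 + n3) = (x - p) ^ (n1 + n2) * (x - p) ^ (n3 - n1)" "(x - p) ^ (n1 + n3) = (x - p) ^ (n1 + n2) * (x - p) ^ (n3 - n2)"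
    using n by (simp_all add: ac_simps flip: power_add)
   moreover define q1 q2 q3 r2 r3 where q: "q1 = (x - p) ^ (n1 + n2)" "q2 = (x - p) ^ (n2 + n3)" "q3 = (x - p) ^ (n1 + n3)" "r2 = (x - p) ^ (n3 - n1)" "r3 = (x - p) ^ (n3 - n2)"
   ultimately show ?case using elim(4-6) unfolding wronskian2_lincomb[OF elim(1-3)] q[symmetric] by algebra
  qed
 qed
 obtain V12 where V12: "V12 analytic_on {p}" "V12 p = (a1 * c2 - a2 * c1) * A12 p" "\<forall>\<^sub>F x in nhds p. (x - p) * wronskian2 f g x = (x - p) ^ (n1 + n2) * V12 x"
  unfolding fgh using V2[of a1 c2 a2 c1 a3 c3] by blast
 obtain V23 where V23: "V23 analytic_on {p}" "V23 p = (c1 * e2 - c2 * e1) * A12 p" "\<forall>\<^sub>F x in nhds p. (x - p) * wronskian2 g h x = (x - p) ^ (n1 + n2) * V23 x"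
  unfolding fgh using V2[of c1 e2 c2 e1 c3 e3] by blast
 obtain V31 where V31: "V31 analytic_on {p}" "V31 p = (e1 * a2 - e2 * a1) * A12 p" "\<forall>\<^sub>F x in nhds p. (x - p) * wronskian2 h f x = (x - p) ^ (n1 + n2) * V31 x"
  unfolding fgh using V2[of e1 a2 e2 a1 e3 a3] by blast
 have A12p: "A12 p ~= 0" unfolding A12(2) using u(4,5) n by auto
 have "F1 p ~= 0 | F2 p ~= 0 | F3 p ~= 0" proof (rule ccontr)
  assume "~ ?thesis"
  hence "a1 = 0" "c1 = 0" "e1 = 0" using F1(2) F2(2) F3(2) u(4) by auto
  thus False using d by (simp add: d_def)
 qed
 moreover have "V12 p ~= 0 | V23 p ~= 0 | V31 p ~= 0" proof (rule ccontr)
  assume "~ ?thesis"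
  hence "a1 * c2 - a2 * c1 = 0" "c1 * e2 - c2 * e1 = 0" "e1 * a2 - e2 * a1 = 0" using V12(2) V23(2) V31(2) A12p by auto
  hence "d = 0" unfolding d_def by algebra
  thus False using d by simp
 qed
 moreover have "Q p ~= 0" using d Vp by (simp add: Q_def)
 ultimately show ?thesis by (rule that[OF F1(1) F2(1) F3(1) V12(1) V23(1) V31(1) Q F1(3) F2(3) F3(3) V12(3) V23(3) V31(3) WQ])
qed

lemma analytic_tendsto_at: "F analytic_on {p} ==> (F \<longlongrightarrow> F p) (at p)"
 using analytic_at_imp_isCont by (simp add: isCont_def)

lemma adapted_wronskian_nonzero:
 assumes ad: "adapted_basis p f g h n1 n2 n3 b1 b2 b3" and an: "f analytic_on {p}" "g analytic_on {p}" "h analytic_on {p}"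
 shows "\<forall>\<^sub>F x in at p. wronskian3 f g h x ~= 0" proof (rule adapted_expansion[OF assms])
 fix W
 assume W: "W analytic_on {p}" "W p ~= 0" "\<forall>\<^sub>F x in nhds p. (x - p) ^ 3 * wronskian3 f g h x = (x - p) ^ (n1 + n2 + n3) * W x"
 have "\<forall>\<^sub>F x in at p. W x ~= 0" by (rule tendsto_imp_eventually_ne[OF analytic_tendsto_at[OF W(1)] W(2)])
 moreover have "\<forall>\<^sub>F x in at p. (x - p) ^ 3 * wronskian3 f g h x = (x - p) ^ (n1 + n2 + n3) * W x"
  using W(3) by (simp add: eventually_at_filter eventually_mono)
 moreover have "\<forall>\<^sub>F x in at p. x ~= p" by (simp add: eventually_at_filter)
 ultimately show ?thesis proof eventually_elim
  case (elim x)
  have "(x - p) ^ (n1 + n2 + n3) * W x ~= 0" using elim by simp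
  thus ?case using elim(2) by auto
 qed
qed

text \<open>Insert the expansions: the powers of \<open>x - p\<close> contribute the logarithm, and the
 cofactors have positive limits.\<close>

lemma toda_local_asymptotics:
 assumes ad: "adapted_basis p f g h n1 n2 n3 b1 b2 b3" and an: "f analytic_on {p}" "g analytic_on {p}" "h analytic_on {p}"
  and l: "l > 0" "j > 0" and k: "k = 1 & m = real n2 - real n1 - 1 | k = 2 & m = real n3 - real n2 - 1"
 shows "EX L. ((%x. toda_local l j k f g h x - 2 * m * ln (cmod (x - p))) \<longlongrightarrow> L) (at p)"
proof (rule adapted_expansion[OF ad an])
 fix F1 F2 F3 V12 V23 V31 Q
 assume A: "F1 analytic_on {p}" "F2 analytic_on {p}" "F3 analytic_on {p}" "V12 analytic_on {p}" "V23 analytic_on {p}" "V31 analytic_on {p}" "Q analytic_on {p}"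
  and E: "germ_factor p n1 f F1" "germ_factor p n1 g F2" "germ_factor p n1 h F3"
  "\<forall>\<^sub>F x in nhds p. (x - p) * wronskian2 f g x = (x - p) ^ (n1 + n2) * V12 x"
  "\<forall>\<^sub>F x in nhds p. (x - p) * wronskian2 g h x = (x - p) ^ (n1 + n2) * V23 x"
  "\<forall>\<^sub>F x in nhds p. (x - p) * wronskian2 h f x = (x - p) ^ (n1 + n2) * V31 x"
  "\<forall>\<^sub>F x in nhds p. (x - p) ^ 3 * wronskian3 f g h x = (x - p) ^ (n1 + n2 + n3) * Q x"
  and nz: "F1 p ~= 0 | F2 p ~= 0 | F3 p ~= 0" "V12 p ~= 0 | V23 p ~= 0 | V31 p ~= 0" "Q p ~= 0"
 define N where "N = norm_sum l j F1 F2 F3"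
 define V where "V = (%x. l * j * (cmod (V12 x))^2 + j / l^2 * (cmod (V23 x))^2 + l / j^2 * (cmod (V31 x))^2)"
 note t = A[THEN analytic_tendsto_at]
 have Np: "N p > 0" unfolding N_def by (rule norm_sum_pos) (use l nz in auto)
 have Vp: "V p > 0" proof -
  have "0 <= l * j * (cmod (V12 p))^2" "0 <= j / l^2 * (cmod (V23 p))^2" "0 <= l / j^2 * (cmod (V31 p))^2" using l by auto
  moreover have "0 < l * j * (cmod (V12 p))^2 | 0 < j / l^2 * (cmod (V23 p))^2 | 0 < l / j^2 * (cmod (V31 p))^2"
   using l nz(2) by (auto intro!: mult_pos_pos)
  ultimately show ?thesis unfolding V_def by linarith
 qed
 have tN: "(N \<longlongrightarrow> N p) (at p)" unfolding N_def norm_sum_def by (intro tendsto_intros t)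
 have tV: "(V \<longlongrightarrow> V p) (at p)" unfolding V_def by (intro tendsto_intros t)
 have pos: "\<forall>\<^sub>F x in at p. N x > 0" "\<forall>\<^sub>F x in at p. V x > 0" "\<forall>\<^sub>F x in at p. Q x ~= 0"
  using order_tendstoD(1)[OF tN Np] order_tendstoD(1)[OF tV Vp] tendsto_imp_eventually_ne[OF t(7) nz(3)] by auto
 define T where "T = (%x. if k = 1 then ln 4 + ln (V x) - 2 * ln (N x) else ln 4 + ln (N x) + 2 * ln (cmod (Q x)) - 2 * ln (V x))"
 have "EX L. (T \<longlongrightarrow> L) (at p)" proof (cases "k = 1")
  case True
  have "((%x. ln 4 + ln (V x) - 2 * ln (N x)) \<longlongrightarrow> ln 4 + ln (V p) - 2 * ln (N p)) (at p)"
   by (intro tendsto_intros tN tV) (use Np Vp in auto)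
  thus ?thesis using True unfolding T_def by auto
 next
  case False
  have "((%x. ln 4 + ln (N x) + 2 * ln (cmod (Q x)) - 2 * ln (V x)) \<longlongrightarrow> ln 4 + ln (N p) + 2 * ln (cmod (Q p)) - 2 * ln (V p)) (at p)"
   by (intro tendsto_intros tN tV t) (use Np Vp nz in auto)
  thus ?thesis using False unfolding T_def by auto
 qed
 then obtain L where L: "(T \<longlongrightarrow> L) (at p)" ..
 have "\<forall>\<^sub>F x in nhds p. x ~= p --> N x > 0" "\<forall>\<^sub>F x in nhds p. x ~= p --> V x > 0" "\<forall>\<^sub>F x in nhds p. x ~= p --> Q x ~= 0"
  using pos unfolding eventually_at_filter by simp_all
 with E have "\<forall>\<^sub>F x in nhds p. x ~= p --> T x = toda_local l j k f g h x - 2 * m * ln (cmod (x - p))"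
 proof eventually_elim
  case (elim x)
  show ?case proof
   assume x: "x ~= p"
   define r where "r = cmod (x - p)"
   have r: "r > 0" using x by (simp add: r_def)
   have NV: "N x > 0" "V x > 0" "Q x ~= 0" using elim x by auto
   have n: "norm_sum l j f g h x = r ^ (2 * n1) * N x"
    unfolding norm_sum_def N_def elim(1-3) norm_mult norm_power r_def[symmetric]
    by (simp add: power_mult_distrib distrib_left ac_simps flip: power_mult)
   have "r^2 * wronskian_sum l j f g h x = l * j * (cmod ((x - p) * wronskian2 f g x))^2
     + j / l^2 * (cmod ((x - p) * wronskian2 g h x))^2 + l / j^2 * (cmod ((x - p) * wronskian2 h f x))^2"
    unfolding wronskian_sum_def norm_mult r_def by (simp add: power_mult_distrib distrib_left ac_simps)
   also have "... = r ^ (2 * (n1 + n2)) * V x"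
    unfolding V_def elim(4-6) norm_mult norm_power r_def[symmetric]
    by (simp add: power_mult_distrib distrib_left ac_simps flip: power_mult)
   finally have w: "r^2 * wronskian_sum l j f g h x = r ^ (2 * (n1 + n2)) * V x" .
   have W: "r ^ 3 * cmod (wronskian3 f g h x) = r ^ (n1 + n2 + n3) * cmod (Q x)"
    using arg_cong[OF elim(7), of cmod] by (simp add: norm_mult norm_power r_def)
   have "r ^ (2 * (n1 + n2)) * V x > 0" "r ^ (n1 + n2 + n3) * cmod (Q x) > 0" using r NV by auto
   hence wp: "wronskian_sum l j f g h x > 0" and Wp: "cmod (wronskian3 f g h x) > 0"
    using r unfolding w[symmetric] W[symmetric] by (auto simp: zero_less_mult_iff)
   have np: "norm_sum l j f g h x > 0" using n NV r by simp
   have ln_n: "ln (norm_sum l j f g h x) = 2 * real n1 * ln r + ln (N x)"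
    unfolding n using r NV by (simp add: ln_mult ln_realpow)
   have "ln (r^2 * wronskian_sum l j f g h x) = ln (r ^ (2 * (n1 + n2)) * V x)" using w by simp
   hence ln_w: "ln (wronskian_sum l j f g h x) = 2 * (real n1 * ln r) + 2 * (real n2 * ln r) - 2 * ln r + ln (V x)"
    using r NV wp by (simp add: ln_mult ln_realpow algebra_simps)
   have "ln (r ^ 3 * cmod (wronskian3 f g h x)) = ln (r ^ (n1 + n2 + n3) * cmod (Q x))" using W by simp
   hence ln_W: "ln (cmod (wronskian3 f g h x)) = real n1 * ln r + real n2 * ln r + real n3 * ln r - 3 * ln r + ln (cmod (Q x))"
    using r NV Wp by (simp add: ln_mult ln_realpow algebra_simps)
   have 1: "ln (4 * wronskian_sum l j f g h x / (norm_sum l j f g h x)^2) = ln 4 + ln (wronskian_sum l j f g h x) - 2 * ln (norm_sum l j f g h x)"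
    using np wp by (simp add: ln_mult ln_div ln_realpow)
   have 2: "ln (4 * norm_sum l j f g h x * (cmod (wronskian3 f g h x))^2 / (wronskian_sum l j f g h x)^2)
     = ln 4 + ln (norm_sum l j f g h x) + 2 * ln (cmod (wronskian3 f g h x)) - 2 * ln (wronskian_sum l j f g h x)"
    using np wp Wp by (simp add: ln_mult ln_div ln_realpow)
   show "T x = toda_local l j k f g h x - 2 * m * ln (cmod (x - p))" proof (cases "k = 1")
    case True
    hence m: "m = real n2 - real n1 - 1" using k by auto
    show ?thesis using True unfolding toda_local_def 1 2 ln_n ln_w ln_W T_def r_def[symmetric] m by (simp add: algebra_simps)
   next
    case False
    hence m: "m = real n3 - real n2 - 1" using k by auto
    show ?thesis using False unfolding toda_local_def 1 2 ln_n ln_w ln_W T_def r_def[symmetric] m by (simp add: algebra_simps)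
   qed
  qed
 qed
 hence "\<forall>\<^sub>F x in at p. T x = toda_local l j k f g h x - 2 * m * ln (cmod (x - p))" by (simp add: eventually_at_filter)
 with L show ?thesis by (intro exI[of _ L]) (rule Lim_transform_eventually)
qed

text \<open>For consecutive orders \<open>p\<close> is at most a common zero of the three functions, and
 dividing by it leaves a nonzero Wronskian.\<close>

lemma adapted_basis_regular:
 assumes ad: "adapted_basis p f g h n (n + 1) (n + 2) b1 b2 b3" and an: "f analytic_on {p}" "g analytic_on {p}" "h analytic_on {p}"
 obtains F1 F2 F3 where "F1 analytic_on {p}" "F2 analytic_on {p}" "F3 analytic_on {p}"
  "germ_factor p n f F1" "germ_factor p n g F2" "germ_factor p n h F3"
  "wronskian3 F1 F2 F3 p ~= 0" proof (rule adapted_expansion[OF ad an])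
 fix F1 F2 F3 W
 assume A: "F1 analytic_on {p}" "F2 analytic_on {p}" "F3 analytic_on {p}" "W analytic_on {p}"
  and E: "germ_factor p n f F1" "germ_factor p n g F2" "germ_factor p n h F3"
  "\<forall>\<^sub>F x in nhds p. (x - p) ^ 3 * wronskian3 f g h x = (x - p) ^ (n + (n + 1) + (n + 2)) * W x" and W: "W p ~= 0"
 have E': "\<forall>\<^sub>F y in nhds p. \<forall>\<^sub>F x in nhds y. f x = (x - p) ^ n * F1 x" "\<forall>\<^sub>F y in nhds p. \<forall>\<^sub>F x in nhds y. g x = (x - p) ^ n * F2 x"
  "\<forall>\<^sub>F y in nhds p. \<forall>\<^sub>F x in nhds y. h x = (x - p) ^ n * F3 x"
  using E by (simp_all add: eventually_eventually)
 have "\<forall>\<^sub>F x in nhds p. x ~= p --> wronskian3 F1 F2 F3 x = W x"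
  using E' E(4) A(1-3)[THEN eventually_analytic] proof eventually_elim
  case (elim x)
  have an: "(%x. (x - p) ^ n) analytic_on {x}" by (intro analytic_intros)
  have "wronskian3 f g h x = ((x - p) ^ n) ^ 3 * wronskian3 F1 F2 F3 x"
   unfolding wronskian3_germ[OF elim(1-3)] by (rule wronskian3_scale[OF an elim(5-7)])
  moreover have "(x - p) ^ (n + (n + 1) + (n + 2)) = (x - p) ^ 3 * ((x - p) ^ n) ^ 3"
   by (simp add: power_add power3_eq_cube power2_eq_square)
  ultimately have "((x - p) ^ 3 * ((x - p) ^ n) ^ 3) * wronskian3 F1 F2 F3 x = ((x - p) ^ 3 * ((x - p) ^ n) ^ 3) * W x"
   using elim(4) by (simp add: ac_simps)
  thus ?case by auto
 qed
 hence "\<forall>\<^sub>F x in at p. wronskian3 F1 F2 F3 x = W x" by (simp add: eventually_at_filter)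
 hence "\<forall>\<^sub>F x in at p. W x = wronskian3 F1 F2 F3 x" by eventually_elim simp
 with analytic_tendsto_at[OF A(4)] have "(wronskian3 F1 F2 F3 \<longlongrightarrow> W p) (at p)"
  by (rule Lim_transform_eventually)
 hence "wronskian3 F1 F2 F3 p = W p"
  by (rule tendsto_unique[OF _ analytic_tendsto_at[OF wronskian3_analytic[OF A(1-3)]], rotated]) simp
 with W have "wronskian3 F1 F2 F3 p ~= 0" by simp
 from A(1-3) E(1-3) this show ?thesis by (rule that)
qed

section \<open>Local exponents of the differential equation\<close>

lemma normalized_germ:
 assumes an: "f analytic_on {z}" "g analytic_on {z}" "h analytic_on {z}" and W: "wronskian3 f g h z ~= 0"
 obtains c where "c analytic_on {z}" "c z ~= 0" "\<forall>\<^sub>F x in nhds z. c x ^ 3 = wronskian3 f g h x"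
  "\<forall>u. u analytic_on {z} --> (\<forall>\<^sub>F x in nhds z. normalized f g h u z x = u x / c x)" proof -
 define c where "c = cube_root_at (wronskian3 f g h) z"
 obtain d where "d analytic_on {z}" "\<forall>\<^sub>F x in nhds z. d x ^ 3 = wronskian3 f g h x"
  using analytic_cube_root[OF wronskian3_analytic[OF an] W] by metis
 hence "EX c. c analytic_on {z} & (\<forall>\<^sub>F x in nhds z. c x ^ 3 = wronskian3 f g h x)" by blast
 from someI_ex[OF this] have c: "c analytic_on {z}" "\<forall>\<^sub>F x in nhds z. c x ^ 3 = wronskian3 f g h x"
  unfolding c_def cube_root_at_def by auto
 have cz: "c z ~= 0" using eventually_nhds_x_imp_x[OF c(2)] W by auto
 have "\<forall>\<^sub>F x in nhds z. normalized f g h u z x = u x / c x" if "u analytic_on {z}" for u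
 proof -
  have "(%x. u x / c x) analytic_on {z}" using that c cz by (intro analytic_intros) auto
  from eventually_analytic[OF this] show ?thesis by eventually_elim (simp add: normalized_def c_def)
 qed
 thus ?thesis using that[OF c(1) cz c(2)] by blast
qed

text \<open>The coefficients of the differential equation solve three linear equations. The determinant
 \<open>D\<close> of the solutions is 1, and the vanishing of its derivative \<open>E\<close> makes the
 equations compatible.\<close>

lemma cramer_unit_det: fixes y1 :: complex
 assumes D: "y1 * d2 * e3 + d1 * e2 * y3 + e1 * y2 * d3 - y1 * e2 * d3 - d1 * y2 * e3 - e1 * d2 * y3 = 1"
  and E: "y1 * d2 * t3 + d1 * t2 * y3 + t1 * y2 * d3 - y1 * t2 * d3 - d1 * y2 * t3 - t1 * d2 * y3 = 0"
 shows "\<exists>!(a, b). t1 + a * d1 + b * y1 = 0 & t2 + a * d2 + b * y2 = 0 & t3 + a * d3 + b * y3 = 0" proof (rule ex1I)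
 let ?a = "- (y1 * t2 * e3 + t1 * e2 * y3 + e1 * y2 * t3 - y1 * e2 * t3 - t1 * y2 * e3 - e1 * t2 * y3)"
 let ?b = "- (t1 * d2 * e3 + d1 * e2 * t3 + e1 * t2 * d3 - t1 * e2 * d3 - d1 * t2 * e3 - e1 * d2 * t3)"
 have "t1 + ?a * d1 + ?b * y1 = 0" "t2 + ?a * d2 + ?b * y2 = 0" "t3 + ?a * d3 + ?b * y3 = 0" using D E by algebra+
 thus "case (?a, ?b) of (a, b) => t1 + a * d1 + b * y1 = 0 & t2 + a * d2 + b * y2 = 0 & t3 + a * d3 + b * y3 = 0" by simp
 fix ab assume *: "case ab of (a, b) => t1 + a * d1 + b * y1 = 0 & t2 + a * d2 + b * y2 = 0 & t3 + a * d3 + b * y3 = 0"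
 obtain a b where ab: "ab = (a, b)" by (cases ab)
 have "t1 + a * d1 + b * y1 = 0" "t2 + a * d2 + b * y2 = 0" "t3 + a * d3 + b * y3 = 0" using * unfolding ab by auto
 hence "a = ?a" "b = ?b" using D by algebra+
 thus "ab = (?a, ?b)" using ab by simp
qed

lemma deriv_wronskian3: assumes "f analytic_on {x}" "g analytic_on {x}" "h analytic_on {x}"
 shows "deriv (wronskian3 f g h) x = f x * deriv g x * deriv (deriv (deriv h)) x + deriv f x * deriv (deriv (deriv g)) x * h x
   + deriv (deriv (deriv f)) x * g x * deriv h x
   - f x * deriv (deriv (deriv g)) x * deriv h x - deriv f x * g x * deriv (deriv (deriv h)) x - deriv (deriv (deriv f)) x * deriv g x * h x"
proof -
 note d = assms[THEN analytic_has_derivative] and d1 = assms[THEN analytic_deriv, THEN analytic_has_derivative]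
  and d2 = assms[THEN analytic_deriv, THEN analytic_deriv, THEN analytic_has_derivative]
 show ?thesis unfolding wronskian3_eq[abs_def]
  by (rule DERIV_imp_deriv) (auto intro!: derivative_eq_intros d d1 d2 simp: algebra_simps)
qed

text \<open>The quotients by the cube root have Wronskian 1, so the coefficients are uniquely determined and the
 defining description applies.\<close>

lemma ode_at_regular_point:
 assumes an: "f analytic_on {z}" "g analytic_on {z}" "h analytic_on {z}" and W: "wronskian3 f g h z ~= 0"
  and c: "c analytic_on {z}" "c z ~= 0" "\<forall>\<^sub>F x in nhds z. c x ^ 3 = wronskian3 f g h x"
   "\<forall>p. p analytic_on {z} --> (\<forall>\<^sub>F x in nhds z. normalized f g h p z x = p x / c x)"
  and p: "p \<in> {f, g, h}"
 shows "deriv (deriv (deriv (%x. p x / c x))) z + ode_Q2 f g h z * deriv (%x. p x / c x) z + ode_Q3 f g h z * (p z / c z) = 0"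
proof -
 define Y where "Y = (%p x. p x / c x :: complex)"
 have Y: "Y p analytic_on {z}" if "p analytic_on {z}" for p unfolding Y_def using that c by (intro analytic_intros) auto
 have cnz: "\<forall>\<^sub>F x in nhds z. c x ~= 0" by (rule analytic_eventually_nonzero[OF c(1) c(2)])
 hence cnz': "\<forall>\<^sub>F y in nhds z. \<forall>\<^sub>F x in nhds y. c x ~= 0" by (simp add: eventually_eventually)
 have W1: "\<forall>\<^sub>F x in nhds z. wronskian3 (Y f) (Y g) (Y h) x = 1"
  using cnz cnz' c(3) eventually_analytic[OF c(1)] an[THEN Y, THEN eventually_analytic] proof eventually_elim
  case (elim x)
  have e: "\<forall>\<^sub>F u in nhds x. p u = c u * Y p u" for p using elim(2) by eventually_elim (simp add: Y_def)
  have "c x ^ 3 * wronskian3 (Y f) (Y g) (Y h) x = wronskian3 f g h x"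
   unfolding wronskian3_germ[OF e[of f] e[of g] e[of h]] wronskian3_scale[OF elim(4) elim(5-7)] ..
  hence "c x ^ 3 * wronskian3 (Y f) (Y g) (Y h) x = c x ^ 3 * 1" using elim(3) by simp
  thus ?case using elim(1) unfolding mult_cancel_left by simp
 qed
 have W2: "deriv (wronskian3 (Y f) (Y g) (Y h)) z = 0" using deriv_germ(2)[OF W1] by simp
 note D = eventually_nhds_x_imp_x[OF W1, unfolded wronskian3_eq]
 note E = W2[unfolded deriv_wronskian3[OF Y[OF an(1)] Y[OF an(2)] Y[OF an(3)]]]
 from cramer_unit_det[OF D E] have ex: "\<exists>!(a, b). \<forall>p\<in>{f, g, h}. deriv (deriv (deriv (Y p))) z + a * deriv (Y p) z + b * Y p z = 0"
  by (simp add: case_prod_unfold)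
 have n: "normalized f g h p z z = Y p z & deriv (normalized f g h p z) z = deriv (Y p) z &
   (deriv ^^ 3) (normalized f g h p z) z = deriv (deriv (deriv (Y p))) z" if "p \<in> {f, g, h}" for p
 proof -
  have "p analytic_on {z}" using that an by auto
  from c(4)[rule_format, OF this] have 0: "\<forall>\<^sub>F x in nhds z. normalized f g h p z x = Y p x" unfolding Y_def .
  note 1 = deriv_germ(1)[OF 0]
  note 2 = deriv_germ(1)[OF 1]
  show ?thesis using 0[THEN eventually_nhds_x_imp_x] 1[THEN eventually_nhds_x_imp_x] deriv_germ(2)[OF 2]
   by (simp add: numeral_3_eq_3)
 qed
 have "ode_coeffs f g h z = (THE (a, b). \<forall>p\<in>{f, g, h}. deriv (deriv (deriv (Y p))) z + a * deriv (Y p) z + b * Y p z = 0)"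
  unfolding ode_coeffs_def using n by (intro arg_cong[where f = The]) (auto simp: fun_eq_iff)
 with theI'[OF ex] have "case ode_coeffs f g h z of (a, b) => \<forall>p\<in>{f, g, h}. deriv (deriv (deriv (Y p))) z + a * deriv (Y p) z + b * Y p z = 0"
  by simp
 thus ?thesis using p unfolding ode_Q2_def ode_Q3_def Y_def by (auto simp: case_prod_unfold)
qed

text \<open>\<open>L\<close> is the logarithmic derivative of the solution \<open>b / c\<close>, where
 \<open>c^3 = W\<close>. Unlike the solution, it is single valued near a zero of \<open>W\<close>.\<close>

lemma riccati_equation:
 assumes an: "f analytic_on {z}" "g analytic_on {z}" "h analytic_on {z}" and W: "wronskian3 f g h z ~= 0"
  and b: "in_span f g h b" "b z ~= 0"
  and L: "\<forall>\<^sub>F x in nhds z. L x = deriv b x / b x - deriv (wronskian3 f g h) x / (3 * wronskian3 f g h x)"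
 shows "deriv (deriv L) z + 3 * L z * deriv L z + L z ^ 3 + ode_Q2 f g h z * L z + ode_Q3 f g h z = 0" proof -
 obtain c where c: "c analytic_on {z}" "c z ~= 0" "\<forall>\<^sub>F x in nhds z. c x ^ 3 = wronskian3 f g h x"
  "\<forall>u. u analytic_on {z} --> (\<forall>\<^sub>F x in nhds z. normalized f g h u z x = u x / c x)"
  by (rule normalized_germ[OF an W])
 obtain a j q where b': "b = (%x. a * f x + j * g x + q * h x)" using b unfolding in_span_def by blast
 have anb: "b analytic_on {z}" by (rule in_span_analytic[OF b(1) an])
 define y where "y = (%x. b x / c x)"
 have y: "y analytic_on {z}" unfolding y_def using anb c by (intro analytic_intros) auto
 have yz: "y z ~= 0" using b c by (simp add: y_def)
 have Yan: "(%x. f x / c x) analytic_on {z}" "(%x. g x / c x) analytic_on {z}" "(%x. h x / c x) analytic_on {z}"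
  using an c by (intro analytic_intros; simp)+
 have ylin: "y = (%x. a * (f x / c x) + j * (g x / c x) + q * (h x / c x))"
  unfolding y_def b' by (auto simp: add_divide_distrib)
 have d1: "\<forall>\<^sub>F x in nhds z. deriv y x = a * deriv (%x. f x / c x) x + j * deriv (%x. g x / c x) x + q * deriv (%x. h x / c x) x"
  unfolding ylin using Yan[THEN eventually_analytic] by eventually_elim (rule deriv_lincomb)
 have d3: "deriv (deriv (deriv y)) z = a * deriv (deriv (deriv (%x. f x / c x))) z + j * deriv (deriv (deriv (%x. g x / c x))) z + q * deriv (deriv (deriv (%x. h x / c x))) z"
  using deriv_germ(2)[OF deriv_germ(1)[OF d1]] deriv2_lincomb[OF Yan[THEN analytic_deriv]] by simp
 note o = ode_at_regular_point[OF an W c]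
 have "deriv (deriv (deriv y)) z + ode_Q2 f g h z * deriv y z + ode_Q3 f g h z * y z = 0"
  using o[of f] o[of g] o[of h] unfolding d3 d1[THEN eventually_nhds_x_imp_x] unfolding ylin by simp algebra
 moreover have yL: "\<forall>\<^sub>F x in nhds z. deriv y x = y x * L x" proof -
  have "\<forall>\<^sub>F x in nhds z. b x ~= 0" by (rule analytic_eventually_nonzero[OF anb b(2)])
  moreover have "\<forall>\<^sub>F x in nhds z. c x ~= 0" by (rule analytic_eventually_nonzero[OF c(1) c(2)])
  ultimately show ?thesis using L eventually_analytic[OF anb] eventually_analytic[OF c(1)] c(3) deriv_germ(1)[OF c(3)]
  proof eventually_elim
   case (elim x)
   note db = analytic_has_derivative[OF elim(4)] and dc = analytic_has_derivative[OF elim(5)]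
   have W': "deriv (wronskian3 f g h) x = 3 * c x ^ 2 * deriv c x"
    using DERIV_imp_deriv[OF DERIV_power[OF dc, of 3]] elim(7) by simp
   have "deriv y x = (deriv b x * c x - b x * deriv c x) / (c x * c x)"
    unfolding y_def by (rule DERIV_imp_deriv) (rule DERIV_divide[OF db dc elim(2)])
   also have "... = y x * (deriv b x / b x - 3 * (c x)^2 * deriv c x / (3 * c x ^ 3))" unfolding y_def using elim(1,2)
    by (simp add: field_simps power2_eq_square power3_eq_cube)
   finally show ?case unfolding elim(3) W' elim(6)[symmetric] .
  qed
 qed
 moreover have anL: "L analytic_on {z}" proof -
  have "(%x. deriv b x / b x - deriv (wronskian3 f g h) x / (3 * wronskian3 f g h x)) analytic_on {z}"
   using anb b(2) W by (intro analytic_intros wronskian3_analytic an) auto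
  thus ?thesis using analytic_at_cong[OF L refl] by simp
 qed
 have y2: "deriv (deriv y) z = deriv y z * L z + y z * deriv L z"
  using deriv_germ(2)[OF yL] deriv_mult_analytic(1)[OF y anL] by simp
 have "deriv (deriv (deriv y)) z = deriv (deriv y) z * L z + 2 * deriv y z * deriv L z + y z * deriv (deriv L) z"
  using deriv_germ(2)[OF deriv_germ(1)[OF yL]] deriv_mult_analytic(2)[OF y anL] by simp
 ultimately have "y z * (deriv (deriv L) z + 3 * L z * deriv L z + L z ^ 3 + ode_Q2 f g h z * L z + ode_Q3 f g h z) = 0"
  using y2 eventually_nhds_x_imp_x[OF yL] by algebra
 thus ?thesis using yz by simp
qed

text \<open>Each of three solutions gives a linear equation for the two coefficients. This shows both that the
 coefficients converge and that the three exponents are roots of the same cubic.\<close>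

lemma solve_indicial: fixes D1 :: "'a => complex"
 assumes F: "F ~= bot" and D: "(D1 \<longlongrightarrow> d1) F" "(D2 \<longlongrightarrow> d2) F" "(D3 \<longlongrightarrow> d3) F"
  and A: "(A1 \<longlongrightarrow> j1) F" "(A2 \<longlongrightarrow> j2) F" "(A3 \<longlongrightarrow> j3) F" and ne: "j1 ~= j2"
  and eq: "\<forall>\<^sub>F x in F. D1 x + X x * A1 x + Z x = 0" "\<forall>\<^sub>F x in F. D2 x + X x * A2 x + Z x = 0" "\<forall>\<^sub>F x in F. D3 x + X x * A3 x + Z x = 0"
 obtains X0 Z0 where "(X \<longlongrightarrow> X0) F" "(Z \<longlongrightarrow> Z0) F" "d1 + X0 * j1 + Z0 = 0" "d2 + X0 * j2 + Z0 = 0" "d3 + X0 * j3 + Z0 = 0"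
proof -
 define X0 where "X0 = - (d1 - d2) / (j1 - j2)"
 have l: "((%x. - (D1 x - D2 x) / (A1 x - A2 x)) \<longlongrightarrow> X0) F"
  unfolding X0_def by (intro tendsto_intros D A) (use ne in auto)
 have "((%x. A1 x - A2 x) \<longlongrightarrow> j1 - j2) F" by (intro tendsto_intros A)
 hence "\<forall>\<^sub>F x in F. A1 x - A2 x ~= 0" by (rule tendsto_imp_eventually_ne) (use ne in auto)
 with eq(1,2) have "\<forall>\<^sub>F x in F. - (D1 x - D2 x) / (A1 x - A2 x) = X x" proof eventually_elim
  case (elim x)
  have "- (D1 x - D2 x) = X x * (A1 x - A2 x)" using elim(1,2) by algebra
  thus ?case using elim(3) by (simp only: nonzero_mult_div_cancel_right not_False_eq_True)
 qed
 with l have X: "(X \<longlongrightarrow> X0) F" by (rule Lim_transform_eventually)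
 define Z0 where "Z0 = - d1 - X0 * j1"
 have "((%x. - D1 x - X x * A1 x) \<longlongrightarrow> Z0) F" unfolding Z0_def by (intro tendsto_intros D A X)
 moreover have "\<forall>\<^sub>F x in F. - D1 x - X x * A1 x = Z x" using eq(1) by eventually_elim algebra
 ultimately have Z: "(Z \<longlongrightarrow> Z0) F" by (rule Lim_transform_eventually)
 have lim: "d + X0 * j + Z0 = 0" if *: "(D \<longlongrightarrow> d) F" "(A \<longlongrightarrow> j) F" "\<forall>\<^sub>F x in F. D x + X x * A x + Z x = 0" for D A d j
 proof -
  have "((%x. D x + X x * A x + Z x) \<longlongrightarrow> d + X0 * j + Z0) F" by (intro tendsto_intros *(1,2) X Z)
  hence "((%x. 0) \<longlongrightarrow> d + X0 * j + Z0) F" using *(3) by (rule Lim_transform_eventually)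
  thus ?thesis using F by (simp add: tendsto_const_iff)
 qed
 show ?thesis by (rule that[OF X Z lim[OF D(1) A(1) eq(1)] lim[OF D(2) A(2) eq(2)] lim[OF D(3) A(3) eq(3)]])
qed

lemma ordered_roots_cubic: fixes k1 k2 k3 :: real assumes P: "!!x. P x = x ^ 3 + a * x^2 + b * x + c" and k: "k1 < k2" "k2 < k3"
  and r: "P (of_real k1) = 0" "P (of_real k2) = 0" "P (of_real k3) = 0" shows "ordered_roots P = [k1, k2, k3]" proof -
 have fac: "P x = (x - of_real k1) * (x - of_real k2) * (x - of_real k3)" for x proof -
  define r1 r2 r3 where rr: "r1 = complex_of_real k1" "r2 = complex_of_real k2" "r3 = complex_of_real k3"
  have ne: "r1 - r2 ~= 0" "r2 - r3 ~= 0" "r1 - r3 ~= 0" using k unfolding rr by auto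
  have e: "r1 ^ 3 + a * r1^2 + b * r1 + c = 0" "r2 ^ 3 + a * r2^2 + b * r2 + c = 0" "r3 ^ 3 + a * r3^2 + b * r3 + c = 0"
   using r unfolding P rr by auto
  have "(r1 - r2) * (r1^2 + r1 * r2 + r2^2 + a * (r1 + r2) + b) = 0" using e by algebra
  hence e1: "r1^2 + r1 * r2 + r2^2 + a * (r1 + r2) + b = 0" using ne by simp
  have "(r2 - r3) * (r2^2 + r2 * r3 + r3^2 + a * (r2 + r3) + b) = 0" using e by algebra
  hence e2: "r2^2 + r2 * r3 + r3^2 + a * (r2 + r3) + b = 0" using ne by simp
  have "(r1 - r3) * (r1 + r2 + r3 + a) = 0" using e1 e2 by algebra
  hence e3: "r1 + r2 + r3 + a = 0" using ne by simp
  show ?thesis unfolding P rr[symmetric] using e e1 e3 by algebra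
 qed
 have S: "{x. P x = 0} = complex_of_real ` {k1, k2, k3}" unfolding fac by auto
 show ?thesis unfolding ordered_roots_def proof (rule the_equality)
  show "length [k1, k2, k3] = 3 & sorted_wrt (<) [k1, k2, k3] & {x. P x = 0} = complex_of_real ` set [k1, k2, k3]"
   using k S by auto
  fix j assume *: "length j = 3 & sorted_wrt (<) j & {x. P x = 0} = complex_of_real ` set j"
  hence "complex_of_real ` set j = complex_of_real ` {k1, k2, k3}" unfolding S by (elim conjE) (rule sym)
  hence "set j = set [k1, k2, k3]" by (simp only: inj_image_eq_iff[OF inj_of_real] list.set)
  moreover have "sorted_wrt (<) [k1, k2, k3]" using k by auto
  ultimately show "j = [k1, k2, k3]" using * by (intro strict_sorted_equal) auto
 qed
qed

lemma log_derivative_factor: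
 assumes u: "u analytic_on {p}" "u p ~= 0" and F: "germ_factor p n F u"
 shows "\<forall>\<^sub>F x in nhds p. x ~= p --> F x ~= 0 & deriv F x / F x = of_nat n / (x - p) + deriv u x / u x" proof -
 have "\<forall>\<^sub>F x in nhds p. u x ~= 0" by (rule analytic_eventually_nonzero[OF u(1) u(2)])
 thus ?thesis using F theta_factor[OF u(1) F] proof eventually_elim
  case (elim x)
  show ?case proof
   assume x: "x ~= p"
   hence nz: "F x ~= 0" using elim by simp
   have "(x - p) * deriv F x * u x = F x * (of_nat n * u x + (x - p) * deriv u x)"
    using elim(3) unfolding elim(2) by (metis mult.assoc mult.commute)
   hence "deriv F x / F x = of_nat n / (x - p) + deriv u x / u x" using nz x elim(1) by (simp add: field_simps)
   with nz show "F x ~= 0 & deriv F x / F x = of_nat n / (x - p) + deriv u x / u x" by blast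
  qed
 qed
qed

lemma double_pole_derivative: fixes p :: complex assumes "x ~= p"
 shows "((%y. - k / (y - p)^2) has_field_derivative 2 * k / (x - p) ^ 3) (at x)" proof -
 have "2 * k / t ^ 3 = (0 * t^2 - (- k) * (2 * t)) / (t^2 * t^2)" if "t ~= 0" for t
  using that by (simp add: field_simps power2_eq_square power3_eq_cube)
 hence *: "2 * k / (x - p) ^ 3 = (0 * (x - p)^2 - (- k) * (2 * (x - p))) / ((x - p)^2 * (x - p)^2)" using assms by simp
 show ?thesis unfolding * using assms by (intro DERIV_divide) (auto intro!: derivative_eq_intros)
qed

text \<open>The Wronskian has order \<open>S - 3\<close>, so \<open>b\<close> divided by its cube root has
 exponent \<open>k\<close>.\<close>

lemma log_derivative_expansion: assumes an: "f analytic_on {p}" "g analytic_on {p}" "h analytic_on {p}"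
  and Q: "Q analytic_on {p}" "Q p ~= 0" "\<forall>\<^sub>F x in nhds p. (x - p) ^ 3 * wronskian3 f g h x = (x - p) ^ S * Q x"
  and b: "germ_order p b n" and k: "k = of_nat n - (of_nat S - 3) / 3"
 obtains y where "y analytic_on {p}"
  "\<forall>\<^sub>F x in nhds p. x ~= p --> b x ~= 0 & wronskian3 f g h x ~= 0 &
    k / (x - p) + y x = deriv b x / b x - deriv (wronskian3 f g h) x / (3 * wronskian3 f g h x)"
proof -
 obtain u where u: "u analytic_on {p}" "u p ~= 0" "germ_factor p n b u" using b unfolding germ_order_def by blast
 define W where "W = wronskian3 f g h"
 have W: "W analytic_on {p}" unfolding W_def by (rule wronskian3_analytic[OF an])
 define y where "y = (%x. deriv u x / u x - deriv Q x / (3 * Q x))"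
 have y: "y analytic_on {p}" unfolding y_def using u Q by (intro analytic_intros) auto
 have ev: "\<forall>\<^sub>F x in nhds p. x ~= p --> b x ~= 0 & W x ~= 0 & k / (x - p) + y x = deriv b x / b x - deriv W x / (3 * W x)"
  using log_derivative_factor[OF u] log_derivative_factor[OF Q] eventually_analytic[OF W]
   analytic_eventually_nonzero[OF Q(1,2)] proof eventually_elim
  case (elim x)
  show ?case proof
   assume x: "x ~= p"
   have "deriv (%x. (x - p) ^ 3 * W x) x = 3 * (x - p)^2 * W x + (x - p) ^ 3 * deriv W x"
    by (subst deriv_mult_analytic(1)) (auto intro!: analytic_intros elim simp: deriv_power_shift)
   moreover have nz: "W x ~= 0" "b x ~= 0" using elim(1,2) x by (auto simp: W_def)
   ultimately have "of_nat S / (x - p) + deriv Q x / Q x = (3 * (x - p)^2 * W x + (x - p) ^ 3 * deriv W x) / ((x - p) ^ 3 * W x)"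
    using elim(2) x by (simp add: W_def)
   also have "... = 3 / (x - p) + deriv W x / W x" proof -
    have "(3 * t^2 * w + t ^ 3 * v) / (t ^ 3 * w) = 3 / t + v / w" if "t ~= 0" "w ~= 0" for t v w :: complex
     using that by (simp add: field_simps power2_eq_square power3_eq_cube)
    thus ?thesis using x nz by simp
   qed
   finally have "deriv W x / W x = of_nat S / (x - p) - 3 / (x - p) + deriv Q x / Q x" by (simp add: algebra_simps)
   hence dW: "deriv W x / (3 * W x) = (of_nat S / (x - p) - 3 / (x - p) + deriv Q x / Q x) / 3" by simp
   have db: "deriv b x / b x = of_nat n / (x - p) + deriv u x / u x" using elim(1) x by blast
   have "k / (x - p) + y x = deriv b x / b x - deriv W x / (3 * W x)" proof -
    have *: "(N - (S - 3) / 3) / t + (U - V / (3 * Y)) = N / t + U - (S / t - 3 / t + V / Y) / 3"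
     if "t ~= 0" "Y ~= 0" for N S U V Y t :: complex using that by (simp add: field_simps)
    have "k / (x - p) + y x = of_nat n / (x - p) + deriv u x / u x - (of_nat S / (x - p) - 3 / (x - p) + deriv Q x / Q x) / 3"
     unfolding y_def k by (rule *) (use x elim(4) in auto)
    thus ?thesis using db dW by simp
   qed
   with nz show "b x ~= 0 & W x ~= 0 & k / (x - p) + y x = deriv b x / b x - deriv W x / (3 * W x)" by blast
  qed
 qed
 from y this[unfolded W_def] show ?thesis by (rule that)
qed

text \<open>Multiply the Riccati equation by \<open>(x - p) ^ 3\<close> and insert \<open>L = k / (x - p) + j
 x\<close>.\<close>

lemma indicial_equation: assumes an: "f analytic_on {p}" "g analytic_on {p}" "h analytic_on {p}"
  and V: "V analytic_on {p}" "V p ~= 0" "\<forall>\<^sub>F x in nhds p. (x - p) ^ 3 * wronskian3 f g h x = (x - p) ^ S * V x"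
  and b: "in_span f g h b" "germ_order p b n" and k: "k = of_nat n - (of_nat S - 3) / 3"
 shows "EX D A. (D \<longlongrightarrow> k * (k - 1) * (k - 2)) (at p) & (A \<longlongrightarrow> k) (at p) &
  (\<forall>\<^sub>F x in at p. D x + ((x - p)^2 * ode_Q2 f g h x) * A x + (x - p) ^ 3 * ode_Q3 f g h x = 0)" proof -
 obtain j where j: "j analytic_on {p}" and ev:
  "\<forall>\<^sub>F x in nhds p. x ~= p --> b x ~= 0 & wronskian3 f g h x ~= 0 &
    k / (x - p) + j x = deriv b x / b x - deriv (wronskian3 f g h) x / (3 * wronskian3 f g h x)"
  by (rule log_derivative_expansion[OF an V b(2) k])
 define L where "L = (%x. k / (x - p) + j x)"
 define W where "W = wronskian3 f g h"
 have ev': "\<forall>\<^sub>F y in nhds p. \<forall>\<^sub>F x in nhds y. x ~= p --> b x ~= 0 & W x ~= 0 & L x = deriv b x / b x - deriv W x / (3 * W x)"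
  using ev unfolding W_def L_def by (simp add: eventually_eventually)
 define D where "D = (%x. 2 * k + (x - p) ^ 3 * deriv (deriv j) x + 3 * (k + (x - p) * j x) * (- k + (x - p)^2 * deriv j x) + (k + (x - p) * j x) ^ 3)"
 define A where "A = (%x. k + (x - p) * j x)"
 have "D analytic_on {p}" unfolding D_def by (intro analytic_intros j)
 moreover have "D p = k * (k - 1) * (k - 2)" unfolding D_def by (simp add: algebra_simps power3_eq_cube)
 ultimately have "(D \<longlongrightarrow> k * (k - 1) * (k - 2)) (at p)" using analytic_tendsto_at[of D p] by simp
 moreover have "A analytic_on {p}" unfolding A_def by (intro analytic_intros j)
 hence "(A \<longlongrightarrow> k) (at p)" using analytic_tendsto_at[of A p] by (simp add: A_def)
 moreover have "\<forall>\<^sub>F x in nhds p. x ~= p --> D x + ((x - p)^2 * ode_Q2 f g h x) * A x + (x - p) ^ 3 * ode_Q3 f g h x = 0"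
  using ev' an[THEN eventually_analytic] eventually_analytic[OF j] proof eventually_elim
  case (elim x)
  show ?case proof
   assume x: "x ~= p"
   have t: "x - p ~= 0" using x by simp
   have "\<forall>\<^sub>F y in nhds x. y ~= p" by (intro t1_space_nhds x)
   with elim(1) have e: "\<forall>\<^sub>F y in nhds x. L y = deriv b y / b y - deriv (wronskian3 f g h) y / (3 * wronskian3 f g h y)"
    by eventually_elim (auto simp: W_def)
   have nz: "b x ~= 0" "wronskian3 f g h x ~= 0" using eventually_nhds_x_imp_x[OF elim(1)] x by (auto simp: W_def)
   have d1: "deriv L y = - k / (y - p)^2 + deriv j y" if "y ~= p" "j analytic_on {y}" for y
    unfolding L_def using analytic_has_derivative[OF that(2)] that(1)
    by (intro DERIV_imp_deriv) (auto intro!: derivative_eq_intros simp: power2_eq_square)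
   have "\<forall>\<^sub>F y in nhds x. deriv L y = - k / (y - p)^2 + deriv j y"
    using \<open>\<forall>\<^sub>F y in nhds x. y ~= p\<close> eventually_analytic[OF elim(5)] by eventually_elim (rule d1)
   from deriv_germ(2)[OF this] have "deriv (deriv L) x = deriv (%y. - k / (y - p)^2 + deriv j y) x" .
   also have "... = 2 * k / (x - p) ^ 3 + deriv (deriv j) x"
    by (intro DERIV_imp_deriv DERIV_add double_pole_derivative x analytic_has_derivative[OF analytic_deriv[OF elim(5)]])
   finally have d2: "deriv (deriv L) x = 2 * k / (x - p) ^ 3 + deriv (deriv j) x" .
   define t where "t = x - p"
   have t0: "t ~= 0" using x by (simp add: t_def)
   have i1: "t ^ 3 * deriv (deriv L) x = 2 * k + t ^ 3 * deriv (deriv j) x"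
    unfolding d2 t_def[symmetric] using t0 by (simp add: distrib_left)
   have i2: "t^2 * deriv L x = - k + t^2 * deriv j x"
    unfolding d1[OF x elim(5)] t_def[symmetric] using t0 by (simp add: algebra_simps)
   have i3: "t * L x = A x" unfolding t_def[symmetric] A_def L_def using t0 by (simp add: distrib_left)
   note i = i1 i2 i3
   have r: "deriv (deriv L) x + 3 * L x * deriv L x + L x ^ 3 + ode_Q2 f g h x * L x + ode_Q3 f g h x = 0"
    by (rule riccati_equation[OF elim(2-4) nz(2) b(1) nz(1) e])
   have D': "D x = t ^ 3 * deriv (deriv L) x + 3 * (t * L x) * (t^2 * deriv L x) + (t * L x) ^ 3"
    unfolding i D_def t_def[symmetric] A_def by simp
   show "D x + ((x - p)^2 * ode_Q2 f g h x) * A x + (x - p) ^ 3 * ode_Q3 f g h x = 0"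
    unfolding D' i(3)[symmetric] t_def[symmetric] using r by algebra
  qed
 qed
 hence "\<forall>\<^sub>F x in at p. D x + ((x - p)^2 * ode_Q2 f g h x) * A x + (x - p) ^ 3 * ode_Q3 f g h x = 0"
  by (simp add: eventually_at_filter)
 ultimately show ?thesis by blast
qed

text \<open>The exponents are the orders minus a common number. If the coefficients have no poles, the indicial
 polynomial is \<open>x (x - 1) (x - 2)\<close>, which forces consecutive orders.\<close>

lemma local_exponents_adapted:
 assumes ad: "adapted_basis p f g h n1 n2 n3 b1 b2 b3" and an: "f analytic_on {p}" "g analytic_on {p}" "h analytic_on {p}"
 shows "sing_m f g h p 1 = real n2 - real n1 - 1" "sing_m f g h p 2 = real n3 - real n2 - 1"
  "~ singular_point f g h p ==> n2 = n1 + 1 & n3 = n1 + 2" proof -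
 obtain W where W: "W analytic_on {p}" "W p ~= 0" "\<forall>\<^sub>F x in nhds p. (x - p) ^ 3 * wronskian3 f g h x = (x - p) ^ (n1 + n2 + n3) * W x"
  by (rule adapted_expansion[OF ad an])
 define k where "k = (%n. real n - (real (n1 + n2 + n3) - 3) / 3)"
 have lt: "n1 < n2" "n2 < n3" using ad unfolding adapted_basis_def by auto
 have b: "in_span f g h b1" "in_span f g h b2" "in_span f g h b3" "germ_order p b1 n1" "germ_order p b2 n2" "germ_order p b3 n3"
  using ad unfolding adapted_basis_def by auto
 have k': "complex_of_real (k n) = of_nat n - (of_nat (n1 + n2 + n3) - 3) / 3" for n by (simp add: k_def)
 note I = indicial_equation[OF an W _ _ k']
 obtain D1 A1 where 1: "(D1 \<longlongrightarrow> of_real (k n1) * (of_real (k n1) - 1) * (of_real (k n1) - 2)) (at p)" "(A1 \<longlongrightarrow> of_real (k n1)) (at p)"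
  "\<forall>\<^sub>F x in at p. D1 x + ((x - p)^2 * ode_Q2 f g h x) * A1 x + (x - p) ^ 3 * ode_Q3 f g h x = 0"
  using I[OF b(1,4)] by blast
 obtain D2 A2 where 2: "(D2 \<longlongrightarrow> of_real (k n2) * (of_real (k n2) - 1) * (of_real (k n2) - 2)) (at p)" "(A2 \<longlongrightarrow> of_real (k n2)) (at p)"
  "\<forall>\<^sub>F x in at p. D2 x + ((x - p)^2 * ode_Q2 f g h x) * A2 x + (x - p) ^ 3 * ode_Q3 f g h x = 0"
  using I[OF b(2,5)] by blast
 obtain D3 A3 where 3: "(D3 \<longlongrightarrow> of_real (k n3) * (of_real (k n3) - 1) * (of_real (k n3) - 2)) (at p)" "(A3 \<longlongrightarrow> of_real (k n3)) (at p)"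
  "\<forall>\<^sub>F x in at p. D3 x + ((x - p)^2 * ode_Q2 f g h x) * A3 x + (x - p) ^ 3 * ode_Q3 f g h x = 0"
  using I[OF b(3,6)] by blast
 have "complex_of_real (k n1) ~= k n2" using lt by (simp add: k_def)
 from solve_indicial[OF _ 1(1) 2(1) 3(1) 1(2) 2(2) 3(2) this 1(3) 2(3) 3(3)]
 obtain X0 Z0 where XZ: "((%x. (x - p)^2 * ode_Q2 f g h x) \<longlongrightarrow> X0) (at p)" "((%x. (x - p) ^ 3 * ode_Q3 f g h x) \<longlongrightarrow> Z0) (at p)"
  "of_real (k n1) * (of_real (k n1) - 1) * (of_real (k n1) - 2) + X0 * of_real (k n1) + Z0 = 0" "of_real (k n2) * (of_real (k n2) - 1) * (of_real (k n2) - 2) + X0 * of_real (k n2) + Z0 = 0"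
  "of_real (k n3) * (of_real (k n3) - 1) * (of_real (k n3) - 2) + X0 * of_real (k n3) + Z0 = 0" by auto
 have kk: "k n1 < k n2" "k n2 < k n3" using lt by (auto simp: k_def)
 have LX: "Lim (at p) (%x. (x - p)^2 * ode_Q2 f g h x) = X0" and LZ: "Lim (at p) (%x. (x - p) ^ 3 * ode_Q3 f g h x) = Z0"
  using XZ(1,2) by (auto intro: tendsto_Lim)
 have le: "local_exponents f g h p = [k n1, k n2, k n3]"
  unfolding local_exponents_def LX LZ proof (rule ordered_roots_cubic[OF _ kk])
  show "x * (x - 1) * (x - 2) + X0 * x + Z0 = x ^ 3 + (- 3) * x^2 + (2 + X0) * x + Z0" for x by algebra
 qed (use XZ(3-5) in auto)
 show "sing_m f g h p 1 = real n2 - real n1 - 1" "sing_m f g h p 2 = real n3 - real n2 - 1"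
  unfolding sing_m_def le by (simp_all add: k_def numeral_2_eq_2)
 assume ns: "~ singular_point f g h p"
 have pole: "is_pole Q p" if "((%x. (x - p) ^ m * Q x) \<longlongrightarrow> c) (at p)" "c ~= 0" "m > 0" for Q m c proof -
  have "filterlim (%x. (x - p) ^ m) (at 0) (at p)" proof (rule filterlim_atI)
   have "((%x. (x - p) ^ m) \<longlongrightarrow> (p - p) ^ m) (at p)" by (intro tendsto_intros)
   thus "((%x. (x - p) ^ m) \<longlongrightarrow> 0) (at p)" using that by (simp add: power_0_left)
  next
   show "\<forall>\<^sub>F x in at p. (x - p) ^ m ~= 0" unfolding eventually_at_filter by (rule always_eventually) auto
  qed
  note inf = filterlim_divide_at_infinity[OF that(1) this that(2)]
  have "\<forall>\<^sub>F x in at p. (x - p) ^ m * Q x / (x - p) ^ m = Q x" by (simp add: eventually_at_filter)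
  from filterlim_cong[OF refl refl this] inf show ?thesis unfolding is_pole_def by blast
 qed
 have "X0 = 0" using pole[OF XZ(1)] ns unfolding singular_point_def by auto
 moreover have "Z0 = 0" using pole[OF XZ(2)] ns unfolding singular_point_def by auto
 ultimately have "complex_of_real (k n1 * (k n1 - 1) * (k n1 - 2)) = 0" "complex_of_real (k n2 * (k n2 - 1) * (k n2 - 2)) = 0"
  "complex_of_real (k n3 * (k n3 - 1) * (k n3 - 2)) = 0" using XZ(3-5) by simp_all
 hence "k n1 = 0 | k n1 = 1 | k n1 = 2" "k n2 = 0 | k n2 = 1 | k n2 = 2" "k n3 = 0 | k n3 = 1 | k n3 = 2"
  unfolding of_real_eq_0_iff by auto
 hence "k n1 = 0" "k n2 = 1" "k n3 = 2" using kk by linarith+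
 hence "real n2 - real n1 = 1" "real n3 - real n1 = 2" unfolding k_def by linarith+
 thus "n2 = n1 + 1 & n3 = n1 + 2" by linarith
qed

text \<open>Here \<open>d/dz\<close> is \<open>2 pi \<i>\<close> times the Euler operator in \<open>q\<close>.
 Hence the cubic is \<open>x^3\<close> plus lower terms from the coefficients, and \<open>k\<close> lacks the
 shift by 1 that occurs at other points.\<close>

lemma indicial_equation_cusp: assumes q: "q_expansion f G1" "q_expansion g G2" "q_expansion h G3"
  and V: "V analytic_on {0}" "V 0 ~= 0" "\<forall>\<^sub>F x in nhds 0. (x - 0) ^ 3 * wronskian3 G1 G2 G3 x = (x - 0) ^ S * V x"
  and b: "in_span G1 G2 G3 b" "germ_order 0 b n" and k: "k = of_nat n - of_nat S / 3"
 shows "EX D A. (D \<longlongrightarrow> (2 * of_real pi * \<i> * k) ^ 3) to_cusp & (A \<longlongrightarrow> 2 * of_real pi * \<i> * k) to_cusp &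
  (\<forall>\<^sub>F z in to_cusp. D z + ode_Q2 f g h z * A z + ode_Q3 f g h z = 0)" proof -
 have an: "G1 analytic_on {x}" "G2 analytic_on {x}" "G3 analytic_on {x}" if "x \<in> ball 0 1" for x
  using q that unfolding q_expansion_def analytic_at by (auto intro!: exI[of _ "ball 0 1"])
 have 0: "(0::complex) \<in> ball 0 1" by simp
 have k': "k + 1 = of_nat n - (of_nat S - 3) / 3" unfolding k by (simp add: field_simps)
 define W where "W = wronskian3 G1 G2 G3"
 obtain j where j: "j analytic_on {0}" and ev:
  "\<forall>\<^sub>F x in nhds 0. x ~= 0 --> b x ~= 0 & wronskian3 G1 G2 G3 x ~= 0 &
    (k + 1) / (x - 0) + j x = deriv b x / b x - deriv (wronskian3 G1 G2 G3) x / (3 * wronskian3 G1 G2 G3 x)"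
  by (rule log_derivative_expansion[OF an[OF 0] V b(2) k'])
 have ev': "\<forall>\<^sub>F y in nhds 0. \<forall>\<^sub>F x in nhds y. x ~= 0 --> b x ~= 0 & W x ~= 0 &
    (k + 1) / x + j x = deriv b x / b x - deriv W x / (3 * W x)" using ev unfolding W_def by (simp add: eventually_eventually)
 define c where "c = 2 * of_real pi * \<i>"
 have dn: "deriv nome = (%x. c * nome x)" "deriv (%x. c * nome x) = (%x. c * (c * nome x))"
  using deriv_nome DERIV_imp_deriv[OF DERIV_cmult[OF nome_has_field_derivative]] by (auto simp: c_def fun_eq_iff)
 have nan: "nome analytic_on {x}" for x using nome_holomorphic[of UNIV] by (metis analytic_at_two analytic_on_def analytic_on_open open_UNIV UNIV_I analytic_on_subset subset_UNIV)
 define m where "m = (%x. c * (k + x * j x))"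
 have man: "m analytic_on {x}" if "j analytic_on {x}" for x unfolding m_def using that by (intro analytic_intros)
 obtain a1 a2 a3 where b': "b = (%x. a1 * G1 x + a2 * G2 x + a3 * G3 x)" using b(1) unfolding in_span_def by blast
 define B where "B = (%z. a1 * f z + a2 * g z + a3 * h z)"
 have BG: "B z = b (nome z)" if "z \<in> HH" for z using q that unfolding B_def b' q_expansion_def by simp
 have span: "in_span f g h B" unfolding in_span_def B_def by blast
 have ban: "b analytic_on {x}" if "x \<in> ball 0 1" for x by (rule in_span_analytic[OF b(1) an[OF that]])
 have nbhd: "\<forall>\<^sub>F x in nhds z. x \<in> HH" if "z \<in> HH" for z by (rule eventually_nhds_in_open[OF open_HH that])
 have fG: "\<forall>\<^sub>F x in nhds z. f x = G1 (nome x)" "\<forall>\<^sub>F x in nhds z. g x = G2 (nome x)" "\<forall>\<^sub>F x in nhds z. h x = G3 (nome x)"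
  "\<forall>\<^sub>F x in nhds z. B x = b (nome x)" if "z \<in> HH" for z
  using nbhd[OF that] q BG unfolding q_expansion_def by (auto elim!: eventually_mono)
 have fan: "f analytic_on {z}" "g analytic_on {z}" "h analytic_on {z}" if "z \<in> HH" for z
  using analytic_compose_at[OF nan an(1)[OF nome_in_ball[OF that]]] analytic_compose_at[OF nan an(2)[OF nome_in_ball[OF that]]]
   analytic_compose_at[OF nan an(3)[OF nome_in_ball[OF that]]]
   analytic_at_cong[OF fG(1)[OF that] refl] analytic_at_cong[OF fG(2)[OF that] refl] analytic_at_cong[OF fG(3)[OF that] refl] by auto
 have WG: "wronskian3 f g h z = (c * nome z) ^ 3 * W (nome z)" if "z \<in> HH" for z
  unfolding wronskian3_germ[OF fG(1-3)[OF that]] wronskian3_compose[OF nan an[OF nome_in_ball[OF that]]] W_def dn ..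
 have Lz: "m (nome z) = deriv B z / B z - deriv (wronskian3 f g h) z / (3 * wronskian3 f g h z)"
  if z: "z \<in> HH" and "nome z ~= 0 --> b (nome z) ~= 0 & W (nome z) ~= 0 &
    (k + 1) / nome z + j (nome z) = deriv b (nome z) / b (nome z) - deriv W (nome z) / (3 * W (nome z))" for z proof -
  have E: "b (nome z) ~= 0" "W (nome z) ~= 0"
   "(k + 1) / nome z + j (nome z) = deriv b (nome z) / b (nome z) - deriv W (nome z) / (3 * W (nome z))" using that by auto
  have dB: "deriv B z = deriv b (nome z) * (c * nome z)"
   using deriv_germ(2)[OF fG(4)[OF z]] deriv_compose_analytic(1)[OF nan ban[OF nome_in_ball[OF z]]] by (simp add: dn)
  have "\<forall>\<^sub>F x in nhds z. wronskian3 f g h x = (c * nome x) ^ 3 * W (nome x)"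
   using nbhd[OF z] by eventually_elim (rule WG)
  from deriv_germ(2)[OF this] have "deriv (wronskian3 f g h) z = deriv (%x. (c * nome x) ^ 3 * W (nome x)) z" .
  also have "... = 3 * (c * nome z) ^ 2 * (c * (c * nome z)) * W (nome z) + (c * nome z) ^ 3 * (deriv W (nome z) * (c * nome z))"
  proof (rule DERIV_imp_deriv)
   have "W analytic_on {nome z}" unfolding W_def by (rule wronskian3_analytic[OF an[OF nome_in_ball[OF z]]])
   note d = DERIV_chain2[OF analytic_has_derivative[OF this] nome_has_field_derivative]
   show "((%x. (c * nome x) ^ 3 * W (nome x)) has_field_derivative
    3 * (c * nome z) ^ 2 * (c * (c * nome z)) * W (nome z) + (c * nome z) ^ 3 * (deriv W (nome z) * (c * nome z))) (at z)"
    by (rule derivative_eq_intros d nome_has_field_derivative refl)+ (simp add: c_def)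
  qed
  finally have "deriv B z / B z - deriv (wronskian3 f g h) z / (3 * wronskian3 f g h z) =
    deriv b (nome z) * (c * nome z) / b (nome z) - (3 * (c * nome z) ^ 2 * (c * (c * nome z)) * W (nome z) + (c * nome z) ^ 3 * (deriv W (nome z) * (c * nome z))) / (3 * ((c * nome z) ^ 3 * W (nome z)))"
   by (simp only: BG[OF z] WG[OF z] dB)
  also have "... = c * nome z * (deriv b (nome z) / b (nome z) - deriv W (nome z) / (3 * W (nome z))) - c" proof -
   have *: "b' * s / b0 - (3 * s ^ 2 * (c * s) * w + s ^ 3 * (w' * s)) / (3 * (s ^ 3 * w)) = s * (b' / b0 - w' / (3 * w)) - c"
    if "s ~= 0" "w ~= 0" "b0 ~= 0" for b' b0 s w w' :: complex
    using that by (simp add: field_simps power2_eq_square power3_eq_cube)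
   show ?thesis by (rule *) (use E in \<open>auto simp: c_def\<close>)
  qed
  also have "... = m (nome z)" unfolding E(3)[symmetric] m_def by (simp add: field_simps)
  finally show ?thesis by simp
 qed
 define D where "D = (%x. deriv (deriv m) x * (c * x)^2 + deriv m x * (c * (c * x)) + 3 * m x * (deriv m x * (c * x)) + m x ^ 3)"
 note m0 = man[OF j]
 have "D analytic_on {0}" unfolding D_def by (intro analytic_intros m0)
 moreover have "D 0 = (c * k) ^ 3" by (simp add: D_def m_def)
 ultimately have "((%z. D (nome z)) \<longlongrightarrow> (c * k) ^ 3) to_cusp"
  using filterlim_compose[OF analytic_tendsto_at nome_at_0, of D] by simp
 moreover have "((%z. m (nome z)) \<longlongrightarrow> c * k) to_cusp"
  using filterlim_compose[OF analytic_tendsto_at[OF m0] nome_at_0] by (simp add: m_def)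
 moreover have "\<forall>\<^sub>F z in to_cusp. D (nome z) + ode_Q2 f g h z * m (nome z) + ode_Q3 f g h z = 0" proof -
  have "filterlim nome (nhds 0) to_cusp" using nome_at_0 by (rule filterlim_mono) (auto simp: at_within_le_nhds)
  hence "\<forall>\<^sub>F z in to_cusp. \<forall>\<^sub>F x in nhds (nome z). x ~= 0 --> b x ~= 0 & W x ~= 0 &
    (k + 1) / x + j x = deriv b x / b x - deriv W x / (3 * W x)" "\<forall>\<^sub>F z in to_cusp. j analytic_on {nome z}"
   using eventually_compose_filterlim[OF ev'] eventually_compose_filterlim[OF eventually_analytic[OF j]] by blast+
  with eventually_to_cusp_HH show ?thesis proof eventually_elim
   case (elim z)
   have "\<forall>\<^sub>F x in nhds z. nome x ~= 0 --> b (nome x) ~= 0 & W (nome x) ~= 0 &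
     (k + 1) / nome x + j (nome x) = deriv b (nome x) / b (nome x) - deriv W (nome x) / (3 * W (nome x))"
    by (rule eventually_compose[OF nan elim(2)])
   with nbhd[OF elim(1)] have L: "\<forall>\<^sub>F x in nhds z. m (nome x) = deriv B x / B x - deriv (wronskian3 f g h) x / (3 * wronskian3 f g h x)"
    by eventually_elim (rule Lz)
   have nz: "b (nome z) ~= 0" "W (nome z) ~= 0" using eventually_nhds_x_imp_x[OF elim(2)] by auto
   hence nz': "B z ~= 0" "wronskian3 f g h z ~= 0" by (auto simp: BG[OF elim(1)] WG[OF elim(1)] c_def)
   note d = deriv_compose_analytic[OF nan man[OF elim(3)], unfolded dn]
   from riccati_equation[OF fan[OF elim(1)] nz'(2) span nz'(1) L]
   show ?case unfolding D_def d by (simp only: ac_simps)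
  qed
 qed
 ultimately show ?thesis unfolding c_def by blast
qed

lemma cusp_exponents_adapted: assumes ad: "adapted_basis 0 G1 G2 G3 n1 n2 n3 b1 b2 b3"
  and q: "q_expansion f G1" "q_expansion g G2" "q_expansion h G3"
 shows "cusp_m f g h 1 = real n2 - real n1" "cusp_m f g h 2 = real n3 - real n2" proof -
 have an: "G1 analytic_on {0}" "G2 analytic_on {0}" "G3 analytic_on {0}"
  using q unfolding q_expansion_def analytic_at by (auto intro!: exI[of _ "ball 0 1"])
 obtain W where W: "W analytic_on {0}" "W 0 ~= 0"
  "\<forall>\<^sub>F x in nhds 0. (x - 0) ^ 3 * wronskian3 G1 G2 G3 x = (x - 0) ^ (n1 + n2 + n3) * W x"
  by (rule adapted_expansion[OF ad an])
 define k where "k = (%n. real n - real (n1 + n2 + n3) / 3)"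
 define c where "c = 2 * of_real pi * \<i>"
 have c: "c ~= 0" by (simp add: c_def)
 have lt: "n1 < n2" "n2 < n3" using ad unfolding adapted_basis_def by auto
 have b: "in_span G1 G2 G3 b1" "in_span G1 G2 G3 b2" "in_span G1 G2 G3 b3" "germ_order 0 b1 n1" "germ_order 0 b2 n2" "germ_order 0 b3 n3"
  using ad unfolding adapted_basis_def by auto
 have k': "complex_of_real (k n) = of_nat n - of_nat (n1 + n2 + n3) / 3" for n by (simp add: k_def)
 note I = indicial_equation_cusp[OF q W _ _ k', folded c_def]
 obtain D1 A1 where 1: "(D1 \<longlongrightarrow> (c * of_real (k n1)) ^ 3) to_cusp" "(A1 \<longlongrightarrow> c * of_real (k n1)) to_cusp"
  "\<forall>\<^sub>F z in to_cusp. D1 z + ode_Q2 f g h z * A1 z + ode_Q3 f g h z = 0" using I[OF b(1,4)] by blast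
 obtain D2 A2 where 2: "(D2 \<longlongrightarrow> (c * of_real (k n2)) ^ 3) to_cusp" "(A2 \<longlongrightarrow> c * of_real (k n2)) to_cusp"
  "\<forall>\<^sub>F z in to_cusp. D2 z + ode_Q2 f g h z * A2 z + ode_Q3 f g h z = 0" using I[OF b(2,5)] by blast
 obtain D3 A3 where 3: "(D3 \<longlongrightarrow> (c * of_real (k n3)) ^ 3) to_cusp" "(A3 \<longlongrightarrow> c * of_real (k n3)) to_cusp"
  "\<forall>\<^sub>F z in to_cusp. D3 z + ode_Q2 f g h z * A3 z + ode_Q3 f g h z = 0" using I[OF b(3,6)] by blast
 have "c * complex_of_real (k n1) ~= c * k n2" using lt c by (simp add: k_def)
 from solve_indicial[OF to_cusp_neq_bot 1(1) 2(1) 3(1) 1(2) 2(2) 3(2) this 1(3) 2(3) 3(3)]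
 obtain X0 Z0 where XZ: "(ode_Q2 f g h \<longlongrightarrow> X0) to_cusp" "(ode_Q3 f g h \<longlongrightarrow> Z0) to_cusp"
  "(c * of_real (k n1)) ^ 3 + X0 * (c * of_real (k n1)) + Z0 = 0" "(c * of_real (k n2)) ^ 3 + X0 * (c * of_real (k n2)) + Z0 = 0"
  "(c * of_real (k n3)) ^ 3 + X0 * (c * of_real (k n3)) + Z0 = 0" by auto
 have kk: "k n1 < k n2" "k n2 < k n3" using lt by (auto simp: k_def)
 have root: "x ^ 3 + X0 / c ^ 2 * x + Z0 / c ^ 3 = 0" if "(c * x) ^ 3 + X0 * (c * x) + Z0 = 0" for x proof -
  have "x ^ 3 + X0 / c ^ 2 * x + Z0 / c ^ 3 = ((c * x) ^ 3 + X0 * (c * x) + Z0) / c ^ 3"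
   using c by (simp add: field_simps power2_eq_square power3_eq_cube)
  thus ?thesis using that by simp
 qed
 have LX: "Lim to_cusp (ode_Q2 f g h) = X0" and LZ: "Lim to_cusp (ode_Q3 f g h) = Z0"
  using XZ(1,2) to_cusp_neq_bot by (auto intro: tendsto_Lim)
 have le: "cusp_exponents f g h = [k n1, k n2, k n3]"
  unfolding cusp_exponents_def LX LZ c_def[symmetric] proof (rule ordered_roots_cubic[OF _ kk])
  show "x ^ 3 + X0 / c ^ 2 * x + Z0 / c ^ 3 = x ^ 3 + 0 * x^2 + (X0 / c ^ 2) * x + Z0 / c ^ 3" for x by simp
 qed (use XZ(3-5)[THEN root] in auto)
 show "cusp_m f g h 1 = real n2 - real n1" "cusp_m f g h 2 = real n3 - real n2"
  unfolding cusp_m_def le by (simp_all add: k_def numeral_2_eq_2)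
qed

section \<open>The Toda equations in a chart\<close>

text \<open>Duality: the dual of the dual curve is the original curve.\<close>

lemma wronskian2_of_wronskians: assumes "F1 analytic_on {x}" "F2 analytic_on {x}" "F3 analytic_on {x}"
 shows "wronskian2 (wronskian2 F1 F2) (wronskian2 F2 F3) x = - (F2 x * wronskian3 F1 F2 F3 x)" proof -
 have d: "deriv (wronskian2 P Q) x = deriv (deriv P) x * Q x - deriv (deriv Q) x * P x"
  if "P analytic_on {x}" "Q analytic_on {x}" for P Q
  using analytic_has_derivative[OF that(1)] analytic_has_derivative[OF that(2)]
   analytic_has_derivative[OF analytic_deriv[OF that(1)]] analytic_has_derivative[OF analytic_deriv[OF that(2)]]
  unfolding wronskian2_def[abs_def] by (intro DERIV_imp_deriv) (auto intro!: derivative_eq_intros)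
 show ?thesis unfolding wronskian2_def[of "wronskian2 F1 F2"] d[OF assms(1,2)] d[OF assms(2,3)]
  unfolding wronskian2_def wronskian3_eq by algebra
qed

lemma wronskian3_cyclic: "wronskian3 F2 F3 F1 x = wronskian3 F1 F2 F3 x" unfolding wronskian3_eq by algebra

text \<open>Apply \<open>laplacian_ln_sum_squares\<close> to the curve, to the curve of its 2 by 2 Wronskians,
 and to the single function \<open>W\<close>.\<close>

lemma toda_system_local:
 assumes U: "open U" and F: "F1 holomorphic_on U" "F2 holomorphic_on U" "F3 holomorphic_on U"
  and W: "!!w. w \<in> U ==> wronskian3 F1 F2 F3 w ~= 0" and l: "l > 0" "m > 0"
 shows "C2_on U (toda_local l m 1 F1 F2 F3)" "C2_on U (toda_local l m 2 F1 F2 F3)"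
  "!!w. w \<in> U ==> laplacian (toda_local l m 1 F1 F2 F3) w = exp (toda_local l m 2 F1 F2 F3 w) - 2 * exp (toda_local l m 1 F1 F2 F3 w)"
  "!!w. w \<in> U ==> laplacian (toda_local l m 2 F1 F2 F3) w = exp (toda_local l m 1 F1 F2 F3 w) - 2 * exp (toda_local l m 2 F1 F2 F3 w)"
proof -
 define N M E where "N = norm_sum l m F1 F2 F3" and "M = wronskian_sum l m F1 F2 F3" and "E = (%w. (cmod (wronskian3 F1 F2 F3 w))^2)"
 have an: "F1 analytic_on {w}" "F2 analytic_on {w}" "F3 analytic_on {w}" if "w \<in> U" for w
  using F U that by (auto simp: analytic_at)
 have hol2: "wronskian2 P Q holomorphic_on U" if "P holomorphic_on U" "Q holomorphic_on U" for P Q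
  unfolding wronskian2_def[abs_def] using that U by (intro holomorphic_intros) auto
 have Npos: "N w > 0" if "w \<in> U" for w unfolding N_def by (intro norm_sum_pos l wronskian3_nonzero_imp(1)[OF W[OF that]])
 have Mpos: "M w > 0" if "w \<in> U" for w unfolding M_def by (intro wronskian_sum_pos l wronskian3_nonzero_imp(2)[OF W[OF that]])
 have Epos: "E w > 0" if "w \<in> U" for w unfolding E_def using W[OF that] by simp
 define FF where "FF = (%i::nat. if i = 1 then F1 else if i = 2 then F2 else F3)"
 define VV where "VV = (%i::nat. if i = 1 then wronskian2 F1 F2 else if i = 2 then wronskian2 F2 F3 else wronskian2 F3 F1)"
 \<comment> \<open>the zero components turn \<open>ln |W|^2\<close> into an instance of the general formula\<close>
 define WW where "WW = (%i::nat. if i = 1 then wronskian3 F1 F2 F3 else (%w. 0))"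
 define c where "c = (%i::nat. if i = 1 then l^2 / m else if i = 2 then m^2 / l else 1 / (l * m))"
 define d where "d = (%i::nat. if i = 1 then l * m else if i = 2 then m / l^2 else l / m^2)"
 have N': "N = (%w. c 1 * (cmod (FF 1 w))^2 + c 2 * (cmod (FF 2 w))^2 + c 3 * (cmod (FF 3 w))^2)"
  by (auto simp: N_def norm_sum_def c_def FF_def)
 have M': "M = (%w. d 1 * (cmod (VV 1 w))^2 + d 2 * (cmod (VV 2 w))^2 + d 3 * (cmod (VV 3 w))^2)"
  by (auto simp: M_def wronskian_sum_def d_def VV_def)
 have E': "E = (%w. 1 * (cmod (WW 1 w))^2 + 1 * (cmod (WW 2 w))^2 + 1 * (cmod (WW 3 w))^2)" by (auto simp: E_def WW_def)
 have h1: "FF i holomorphic_on U" for i using F by (auto simp: FF_def)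
 have h2: "VV i holomorphic_on U" for i using F hol2 by (auto simp: VV_def)
 have h3: "WW i holomorphic_on U" for i unfolding WW_def wronskian3_eq[abs_def] using F U by (auto intro!: holomorphic_intros)
 have cc: "c 1 * c 2 = d 1" "c 2 * c 3 = d 2" "c 3 * c 1 = d 3" "d 1 * d 2 = c 2" "d 2 * d 3 = c 3" "d 3 * d 1 = c 1"
  using l by (auto simp: c_def d_def field_simps power2_eq_square)
 have LN: "C2_on U (%w. ln (N w))" "!!w. w \<in> U ==> laplacian (%w. ln (N w)) w = 4 * M w / (N w)^2" proof -
  show "C2_on U (%w. ln (N w))" unfolding N' by (rule laplacian_ln_sum_squares(1)[OF U]) (use h1 Npos N' in auto)
  fix w assume w: "w \<in> U"
  have "laplacian (%w. ln (N w)) w = 4 * (c 1 * c 2 * (cmod (wronskian2 (FF 1) (FF 2) w))^2 + c 2 * c 3 * (cmod (wronskian2 (FF 2) (FF 3) w))^2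
    + c 3 * c 1 * (cmod (wronskian2 (FF 3) (FF 1) w))^2) / (N w)^2" unfolding N'
   by (rule laplacian_ln_sum_squares(2)[OF U]) (use h1 Npos N' w in auto)
  also have "... = 4 * M w / (N w)^2" unfolding cc M' by (simp add: FF_def VV_def)
  finally show "laplacian (%w. ln (N w)) w = 4 * M w / (N w)^2" .
 qed
 have LM: "C2_on U (%w. ln (M w))" "!!w. w \<in> U ==> laplacian (%w. ln (M w)) w = 4 * N w * E w / (M w)^2" proof -
  show "C2_on U (%w. ln (M w))" unfolding M' by (rule laplacian_ln_sum_squares(1)[OF U]) (use h2 Mpos M' in auto)
  fix w assume w: "w \<in> U"
  have s: "cmod (wronskian2 (VV 1) (VV 2) w) = cmod (F2 w) * cmod (wronskian3 F1 F2 F3 w)"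
   "cmod (wronskian2 (VV 2) (VV 3) w) = cmod (F3 w) * cmod (wronskian3 F1 F2 F3 w)"
   "cmod (wronskian2 (VV 3) (VV 1) w) = cmod (F1 w) * cmod (wronskian3 F1 F2 F3 w)"
   using wronskian2_of_wronskians[OF an(1,2,3)[OF w]] wronskian2_of_wronskians[OF an(2,3,1)[OF w]] wronskian2_of_wronskians[OF an(3,1,2)[OF w]]
    wronskian3_cyclic[of F2 F3 F1 w] wronskian3_cyclic[of F1 F2 F3 w] by (auto simp: VV_def norm_mult)
  have "laplacian (%w. ln (M w)) w = 4 * (d 1 * d 2 * (cmod (wronskian2 (VV 1) (VV 2) w))^2 + d 2 * d 3 * (cmod (wronskian2 (VV 2) (VV 3) w))^2
    + d 3 * d 1 * (cmod (wronskian2 (VV 3) (VV 1) w))^2) / (M w)^2" unfolding M'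
   by (rule laplacian_ln_sum_squares(2)[OF U]) (use h2 Mpos M' w in auto)
  also have "... = 4 * N w * E w / (M w)^2" unfolding s cc E_def N' FF_def by (simp add: power_mult_distrib algebra_simps)
  finally show "laplacian (%w. ln (M w)) w = 4 * N w * E w / (M w)^2" .
 qed
 have LE: "C2_on U (%w. ln (E w))" "!!w. w \<in> U ==> laplacian (%w. ln (E w)) w = 0" proof -
  show "C2_on U (%w. ln (E w))" unfolding E' by (rule laplacian_ln_sum_squares(1)[OF U]) (use h3 Epos E' in auto)
  fix w assume "w \<in> U"
  thus "laplacian (%w. ln (E w)) w = 0" unfolding E'
   by (subst laplacian_ln_sum_squares(2)[OF U]) (use h3 Epos E' in \<open>auto simp: WW_def wronskian2_def\<close>)
 qed
 have C: "C2_on U (%w. ln 4 :: real)" "!!w. w \<in> U ==> laplacian (%w. ln 4 :: real) w = 0" proof -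
  have p: "partial1 (%w. a) = (%w. 0)" "partial2 (%w. a) = (%w. 0)" for a :: real
   by (auto simp: fun_eq_iff partial_eqI[OF has_derivative_const])
  show "C2_on U (%w. ln 4 :: real)" "!!w. w \<in> U ==> laplacian (%w. ln 4 :: real) w = 0"
   unfolding C2_on_def laplacian_def p by auto
 qed
 define v1 where "v1 = (%w. 1 * ln 4 + 1 * (1 * ln (M w) + (-2) * ln (N w)))"
 define v2 where "v2 = (%w. 1 * (1 * ln 4 + 1 * ln (E w)) + 1 * (1 * ln (N w) + (-2) * ln (M w)))"
 note A = C2_on_lincomb[OF U LM(1) LN(1), where a = 1 and b = "-2"] and B = C2_on_lincomb[OF U C(1) LE(1), where a = 1 and b = 1]
  and D = C2_on_lincomb[OF U LN(1) LM(1), where a = 1 and b = "-2"]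
 note V1 = C2_on_lincomb[OF U C(1) A(1), where a = 1 and b = 1, folded v1_def] and V2 = C2_on_lincomb[OF U B(1) D(1), where a = 1 and b = 1, folded v2_def]
 have t1: "toda_local l m 1 F1 F2 F3 = (%w. ln (4 * M w / (N w)^2))" and t2: "toda_local l m 2 F1 F2 F3 = (%w. ln (4 * N w * E w / (M w)^2))"
  unfolding toda_local_def N_def M_def E_def by auto
 have e1: "toda_local l m 1 F1 F2 F3 w = v1 w" "exp (toda_local l m 1 F1 F2 F3 w) = 4 * M w / (N w)^2"
  and e2: "toda_local l m 2 F1 F2 F3 w = v2 w" "exp (toda_local l m 2 F1 F2 F3 w) = 4 * N w * E w / (M w)^2" if "w \<in> U" for w
 proof -
  note pos = Npos[OF that] Mpos[OF that] Epos[OF that]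
  show "toda_local l m 1 F1 F2 F3 w = v1 w" unfolding t1 v1_def using pos by (simp add: ln_mult ln_div ln_realpow)
  show "toda_local l m 2 F1 F2 F3 w = v2 w" unfolding t2 v2_def using pos by (simp add: ln_mult ln_div ln_realpow)
  show "exp (toda_local l m 1 F1 F2 F3 w) = 4 * M w / (N w)^2" "exp (toda_local l m 2 F1 F2 F3 w) = 4 * N w * E w / (M w)^2"
   unfolding t1 t2 using pos by simp_all
 qed
 show "C2_on U (toda_local l m 1 F1 F2 F3)" "C2_on U (toda_local l m 2 F1 F2 F3)"
  by (rule C2_on_open_cong(1)[OF U e1(1) V1(1)], assumption) (rule C2_on_open_cong(1)[OF U e2(1) V2(1)], assumption)
 fix w assume w: "w \<in> U"
 have L1: "laplacian (toda_local l m 1 F1 F2 F3) w = laplacian v1 w" by (rule C2_on_open_cong(2)[OF U e1(1) V1(1) w])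
 have L2: "laplacian (toda_local l m 2 F1 F2 F3) w = laplacian v2 w" by (rule C2_on_open_cong(2)[OF U e2(1) V2(1) w])
 show "laplacian (toda_local l m 1 F1 F2 F3) w = exp (toda_local l m 2 F1 F2 F3 w) - 2 * exp (toda_local l m 1 F1 F2 F3 w)"
  unfolding L1 V1(2)[OF w] A(2)[OF w] C(2)[OF w] LM(2)[OF w] LN(2)[OF w] e1(2)[OF w] e2(2)[OF w] by simp
 show "laplacian (toda_local l m 2 F1 F2 F3) w = exp (toda_local l m 1 F1 F2 F3 w) - 2 * exp (toda_local l m 2 F1 F2 F3 w)"
  unfolding L2 V2(2)[OF w] B(2)[OF w] D(2)[OF w] C(2)[OF w] LM(2)[OF w] LN(2)[OF w] LE(2)[OF w] e1(2)[OF w] e2(2)[OF w] by simp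
qed

lemma modular_form_analytic: "modular_form k f ==> z \<in> HH ==> f analytic_on {z}"
 using modular_formD(1) open_HH by (auto simp: analytic_at)

lemma germ_indep_HH:
 assumes f: "modular_form k f" "modular_form k g" "modular_form k h" and ind: "lin_indep3 f g h" and p: "p \<in> HH"
 shows "germ_indep p f g h" unfolding germ_indep_def proof (intro allI impI)
 fix a b c assume "\<forall>\<^sub>F x in nhds p. a * f x + b * g x + c * h x = 0"
 moreover have "\<forall>\<^sub>F x in nhds p. x \<in> HH" by (rule eventually_nhds_in_open[OF open_HH p])
 ultimately have "\<forall>\<^sub>F x in nhds p. x \<in> HH & a * f x + b * g x + c * h x = 0" by eventually_elim simp
 then obtain S where S: "open S" "p \<in> S" "!!x. x \<in> S ==> x \<in> HH & a * f x + b * g x + c * h x = 0"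
  unfolding eventually_nhds by blast
 have "a * f z + b * g z + c * h z = 0" if "z \<in> HH" for z
  by (rule analytic_continuation_open[OF S(1) open_HH _ connected_HH, where g = "%_. 0"])
   (use S that f[THEN modular_formD(1)] in \<open>auto intro!: holomorphic_intros\<close>)
 thus "a = 0 & b = 0 & c = 0" using ind unfolding lin_indep3_def by blast
qed

lemma germ_indep_cusp:
 assumes q: "q_expansion f G1" "q_expansion g G2" "q_expansion h G3" and ind: "lin_indep3 f g h"
 shows "germ_indep 0 G1 G2 G3" unfolding germ_indep_def proof (intro allI impI)
 fix a b c assume "\<forall>\<^sub>F x in nhds 0. a * G1 x + b * G2 x + c * G3 x = 0"
 moreover have "\<forall>\<^sub>F x in nhds 0. x \<in> ball (0::complex) 1" by (rule eventually_nhds_in_open) auto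
 ultimately have "\<forall>\<^sub>F x in nhds 0. x \<in> ball 0 1 & a * G1 x + b * G2 x + c * G3 x = 0" by eventually_elim simp
 then obtain S where S: "open S" "0 \<in> S" "!!x. x \<in> S ==> x \<in> ball 0 1 & a * G1 x + b * G2 x + c * G3 x = 0"
  unfolding eventually_nhds by blast
 have hol: "G1 holomorphic_on ball 0 1" "G2 holomorphic_on ball 0 1" "G3 holomorphic_on ball 0 1" using q unfolding q_expansion_def by auto
 have "S \<subseteq> ball 0 1" using S(3) by blast
 have "a * G1 z + b * G2 z + c * G3 z = 0" if "z \<in> ball 0 1" for z
  by (rule analytic_continuation_open[OF S(1) open_ball _ connected_ball \<open>S \<subseteq> ball 0 1\<close>, where g = "%_. 0"])
   (use S(2,3) that hol in \<open>auto intro!: holomorphic_intros\<close>)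
 hence "a * f z + b * g z + c * h z = 0" if "z \<in> HH" for z using q nome_in_ball[OF that] that unfolding q_expansion_def by simp
 thus "a = 0 & b = 0 & c = 0" using ind unfolding lin_indep3_def by blast
qed

text \<open>Near a point where the equation is regular and \<open>w\<close> is locally invertible by
 \<open>q\<close>, divide the forms by their common zero and write them in the coordinate \<open>w\<close>. At
 any other \<open>z\<close> with the same value, a matrix moves \<open>z\<close> into the neighbourhood
 \<open>B\<close>, which changes the forms only by a common factor \<open>s\<close>.\<close>

lemma toda_chart:
 assumes f: "modular_form k f" "modular_form k g" "modular_form k h" and ind: "lin_indep3 f g h"
  and p: "p \<in> HH" "~ singular_point f g h p" "deriv modular_w p ~= 0"
 obtains U F1 F2 F3 where "open U" "modular_w p \<in> U" "F1 holomorphic_on U" "F2 holomorphic_on U" "F3 holomorphic_on U"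
  "!!w. w \<in> U ==> wronskian3 F1 F2 F3 w ~= 0"
  "!!z l j i. z \<in> HH ==> modular_w z \<in> U ==> deriv modular_w z ~= 0 ==> l > 0 ==> j > 0 ==>
    toda_u f g h l j i z = toda_local l j i F1 F2 F3 (modular_w z) + 2 * ln (cmod (deriv modular_w z))"
proof -
 have an: "f analytic_on {p}" "g analytic_on {p}" "h analytic_on {p}" using f p(1) by (auto intro: modular_form_analytic)
 obtain n1 n2 n3 b1 b2 b3 where ad: "adapted_basis p f g h n1 n2 n3 b1 b2 b3"
  by (rule adapted_basis_exists[OF an germ_indep_HH[OF f ind p(1)]])
 hence "n2 = n1 + 1 & n3 = n1 + 2" using local_exponents_adapted(3)[OF ad an p(2)] by simp
 with ad have ad': "adapted_basis p f g h n1 (n1 + 1) (n1 + 2) b1 b2 b3" by simp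
 obtain f' g' h' where F: "f' analytic_on {p}" "g' analytic_on {p}" "h' analytic_on {p}"
  "germ_factor p n1 f f'" "germ_factor p n1 g g'" "germ_factor p n1 h h'"
  "wronskian3 f' g' h' p ~= 0" by (rule adapted_basis_regular[OF ad' an])
 obtain r0 where r0: "r0 > 0" "inj_on modular_w (ball p r0)"
  using has_complex_derivative_locally_injective[OF modular_w_hol p(1) open_HH p(3)] by blast
 have "\<forall>\<^sub>F x in nhds p. x \<in> HH & x \<in> ball p r0 & wronskian3 f' g' h' x ~= 0 & f' analytic_on {x} & g' analytic_on {x} & h' analytic_on {x} &
   f x = (x - p) ^ n1 * f' x & g x = (x - p) ^ n1 * g' x & h x = (x - p) ^ n1 * h' x"
  using F(4-6) F(1-3)[THEN eventually_analytic] analytic_eventually_nonzero[OF wronskian3_analytic[OF F(1-3)] F(7)]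
   eventually_nhds_in_open[OF open_HH p(1)] eventually_nhds_in_open[OF open_ball centre_in_ball[THEN iffD2, OF r0(1)]]
  by eventually_elim simp
 then obtain B where B: "open B" "p \<in> B" "!!x. x \<in> B ==> x \<in> HH & x \<in> ball p r0 & wronskian3 f' g' h' x ~= 0 & f' analytic_on {x} & g' analytic_on {x} & h' analytic_on {x} &
   f x = (x - p) ^ n1 * f' x & g x = (x - p) ^ n1 * g' x & h x = (x - p) ^ n1 * h' x" unfolding eventually_nhds by blast
 have BHH: "B \<subseteq> HH" and Bball: "B \<subseteq> ball p r0" using B(3) by auto
 have wB: "modular_w holomorphic_on B" by (rule holomorphic_on_subset[OF modular_w_hol BHH])
 have inj: "inj_on modular_w B" by (rule inj_on_subset[OF r0(2) Bball])
 obtain q where q: "q holomorphic_on (modular_w ` B)" "!!z. z \<in> B ==> deriv modular_w z * deriv q (modular_w z) = 1" "!!z. z \<in> B ==> q (modular_w z) = z"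
  using holomorphic_has_inverse[OF wB B(1) inj] by metis
 define U where "U = modular_w ` B"
 have U: "open U" unfolding U_def by (rule modular_w_open[OF B(1) BHH])
 have hol: "F holomorphic_on B" if "!!x. x \<in> B ==> F analytic_on {x}" for F
  using that by (meson analytic_imp_holomorphic analytic_on_analytic_at)
 have comp: "(%w. F (q w)) holomorphic_on U" if "!!x. x \<in> B ==> F analytic_on {x}" for F
  using holomorphic_on_compose_gen[OF q(1) hol[OF that], unfolded o_def] q(3) unfolding U_def by fastforce
 define F1 F2 F3 where FF: "F1 = (%w. f' (q w))" "F2 = (%w. g' (q w))" "F3 = (%w. h' (q w))"
 have Fhol: "F1 holomorphic_on U" "F2 holomorphic_on U" "F3 holomorphic_on U" unfolding FF using B(3) by (auto intro!: comp)
 hence Fan: "F1 analytic_on {w}" "F2 analytic_on {w}" "F3 analytic_on {w}" if "w \<in> U" for w using U that by (auto simp: analytic_at)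
 have wan: "modular_w analytic_on {z}" if "z \<in> HH" for z using modular_w_hol open_HH that by (auto simp: analytic_at)
 have W: "wronskian3 F1 F2 F3 w ~= 0" if wU: "w \<in> U" for w proof -
  obtain x where x: "x \<in> B" "w = modular_w x" using wU unfolding U_def by blast
  have ev: "\<forall>\<^sub>F y in nhds x. y \<in> B" by (rule eventually_nhds_in_open[OF B(1) x(1)])
  have "wronskian3 f' g' h' x = wronskian3 (%y. F1 (modular_w y)) (%y. F2 (modular_w y)) (%y. F3 (modular_w y)) x"
   by (rule wronskian3_germ) (use ev q(3) in \<open>auto simp: FF elim!: eventually_mono\<close>)
  also have "... = deriv modular_w x ^ 3 * wronskian3 F1 F2 F3 w"
   unfolding x(2) by (rule wronskian3_compose) (use wan Fan x wU BHH in auto)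
  finally show ?thesis using B(3)[OF x(1)] by auto
 qed
 have cov: "toda_u f g h l j i z = toda_local l j i F1 F2 F3 (modular_w z) + 2 * ln (cmod (deriv modular_w z))"
  if z: "z \<in> HH" "modular_w z \<in> U" "deriv modular_w z ~= 0" and l: "l > 0" "j > 0" for z l j i
 proof -
  obtain x where x: "x \<in> B" "modular_w x = modular_w z" using z(2) unfolding U_def by auto
  have "SL2Z_equiv z x" using modular_w_inj[OF z(1) _ x(2)[symmetric]] BHH x(1) by auto
  then obtain a b c d where m: "a * d - b * c = 1" "x = mob a b c d z" unfolding SL2Z_equiv_alt by blast
  have nz: "cocycle c d y ~= 0" if "y \<in> HH" for y by (rule cocycle_nonzero[OF that unimodular_not_both_zero[OF m(1)]])
  have man: "mob a b c d analytic_on {z}"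
   unfolding mob_def[abs_def] using nz[OF z(1)] by (intro analytic_intros) (auto simp: cocycle_def intro!: analytic_intros)
  \<comment> \<open>the automorphy factor times the common zero of the forms at \<open>p\<close>\<close>
  define s where "s = (%y. inverse (cocycle c d y powi k) * (mob a b c d y - p) ^ n1)"
  have can: "(%y. cocycle c d y) analytic_on {z}" unfolding cocycle_def by (intro analytic_intros)
  have s: "s analytic_on {z}" unfolding s_def using nz[OF z(1)] by (intro analytic_intros can man) auto
  have nHH: "\<forall>\<^sub>F y in nhds z. y \<in> HH" by (rule eventually_nhds_in_open[OF open_HH z(1)])
  have snz: "\<forall>\<^sub>F y in at z. s y ~= 0" proof -
   have "\<forall>\<^sub>F y in nhds z. y ~= z --> y ~= mob d (-b) (-c) a p" proof (cases "z = mob d (-b) (-c) a p")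
    case False
    hence "\<forall>\<^sub>F y in nhds z. y ~= mob d (-b) (-c) a p" by (intro t1_space_nhds) auto
    thus ?thesis by eventually_elim simp
   qed auto
   with nHH have "\<forall>\<^sub>F y in nhds z. y ~= z --> s y ~= 0" proof eventually_elim
    case (elim y)
    have "mob a b c d y ~= p" if "y ~= z" using mob_inverse[OF m(1) elim(1)] elim(2) that by metis
    thus ?case using nz[OF elim(1)] by (auto simp: s_def)
   qed
   thus ?thesis by (simp add: eventually_at_filter)
  qed
  have mB: "\<forall>\<^sub>F y in nhds z. mob a b c d y \<in> B"
   by (rule eventually_compose[OF man]) (rule eventually_nhds_in_open[OF B(1)], use x m in simp)
  have eq: "\<forall>\<^sub>F y in nhds z. u y = s y * u' (q (modular_w y))"
   if "modular_form k u" "!!x. x \<in> B ==> u x = (x - p) ^ n1 * u' x" for u u' using mB nHH proof eventually_elim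
   case (elim y)
   have "cocycle c d y powi k * u y = u (mob a b c d y)" by (rule modular_formD(2)[OF that(1) m(1) elim(2), symmetric])
   also have "... = (mob a b c d y - p) ^ n1 * u' (mob a b c d y)" by (rule that(2)[OF elim(1)])
   also have "mob a b c d y = q (modular_w y)" using q(3)[OF elim(1)] modular_w_mob[OF m(1) elim(2)] by simp
   finally have "u y = inverse (cocycle c d y powi k) * ((q (modular_w y) - p) ^ n1 * u' (q (modular_w y)))"
    using nz[OF elim(2)] by (simp add: field_simps)
   thus ?case using q(3)[OF elim(1)] modular_w_mob[OF m(1) elim(2)] by (simp add: s_def ac_simps)
  qed
  show ?thesis by (rule toda_u_covariant[OF wan[OF z(1)] z(3) s snz Fan[OF z(2)] W[OF z(2)] _ _ _ l])
    (unfold FF, use B(3) in \<open>auto intro!: eq f\<close>)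
 qed
 have "modular_w p \<in> U" using B(2) unfolding U_def by blast
 from that[OF U this Fhol W cov] show ?thesis .
qed

lemma modular_w_analytic: "z \<in> HH ==> modular_w analytic_on {z}" using modular_w_hol open_HH by (auto simp: analytic_at)

lemma modular_w_preimage: obtains z where "z \<in> HH" "modular_w z = w" using modular_w_surj by (metis UNIV_I imageE)

section \<open>The potentials on the plane\<close>

locale modular_toda =
 fixes f g h :: "complex => complex" and k :: int and n :: nat and z :: "nat => complex" and l \<mu> :: real
 assumes forms: "modular_form k f" "modular_form k g" "modular_form k h"
  and indep: "lin_indep3 f g h"
  and reps: "singular_representatives f g h n z"
  and pos: "l > 0" "\<mu> > 0"
begin

definition P :: "complex set" where "P = {0, 1} \<union> (%j. modular_w (z j)) ` {1..n}"

abbreviation u where "u \<equiv> toda_u f g h l \<mu>"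
abbreviation v where "v \<equiv> toda_v f g h l \<mu>"

lemma finite_P: "finite P" by (simp add: P_def)

lemma open_compl_P: "open (- P)" using finite_P by (simp add: finite_imp_closed open_Compl)

lemma deriv_modular_w_nonzero: "p \<in> HH ==> modular_w p \<notin> P ==> deriv modular_w p ~= 0"
 using deriv_modular_w_zero[of p] by (auto simp: P_def)

lemma forms_analytic: "p \<in> HH ==> f analytic_on {p}" "p \<in> HH ==> g analytic_on {p}" "p \<in> HH ==> h analytic_on {p}"
 using forms by (auto intro: modular_form_analytic)

lemma adapted_basis_HH: assumes "p \<in> HH" obtains n1 n2 n3 b1 b2 b3 where "adapted_basis p f g h n1 n2 n3 b1 b2 b3"
 by (rule adapted_basis_exists[OF forms_analytic[OF assms] germ_indep_HH[OF forms indep assms]])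

lemma singular_image: assumes "p \<in> HH" "singular_point f g h p"
 shows "modular_w p \<in> P" proof -
 have "SL2Z_equiv p \<i> | SL2Z_equiv p rho | (\<exists>j\<in>{1..n}. SL2Z_equiv p (z j))"
  using reps assms unfolding singular_representatives_def by simp
 hence "modular_w p = 1 | modular_w p = 0 | (\<exists>j\<in>{1..n}. modular_w p = modular_w (z j))"
  using modular_w_invariant[OF assms(1)] modular_w_i modular_w_rho by metis
 thus ?thesis unfolding P_def by blast
qed

text \<open>The description of \<open>v\<close> by all preimages is consistent, and \<open>v\<close> is given
 locally by \<open>F1, F2, F3\<close>.\<close>

lemma toda_v_chart: assumes "w0 \<notin> P"
 obtains U F1 F2 F3 where "open U" "w0 \<in> U" "U \<subseteq> - P" "F1 holomorphic_on U" "F2 holomorphic_on U" "F3 holomorphic_on U"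
  "!!w. w \<in> U ==> wronskian3 F1 F2 F3 w ~= 0"
  "!!w i. w \<in> U ==> v i w = toda_local l \<mu> i F1 F2 F3 w"
  "!!p i. p \<in> HH ==> modular_w p \<in> U ==> toda_local l \<mu> i F1 F2 F3 (modular_w p) = u i p - 2 * ln (cmod (deriv modular_w p))"
proof -
 obtain p where p: "p \<in> HH" "modular_w p = w0" by (rule modular_w_preimage)
 have ns: "~ singular_point f g h p" using singular_image[OF p(1)] p(2) assms by auto
 have d: "deriv modular_w p ~= 0" using deriv_modular_w_nonzero[OF p(1)] p(2) assms by auto
 obtain U F1 F2 F3 where U: "open U" "modular_w p \<in> U" "F1 holomorphic_on U" "F2 holomorphic_on U" "F3 holomorphic_on U"
  "!!w. w \<in> U ==> wronskian3 F1 F2 F3 w ~= 0"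
  and chart: "!!z l \<mu> i. z \<in> HH ==> modular_w z \<in> U ==> deriv modular_w z ~= 0 ==> l > 0 ==> \<mu> > 0 ==>
    toda_u f g h l \<mu> i z = toda_local l \<mu> i F1 F2 F3 (modular_w z) + 2 * ln (cmod (deriv modular_w z))"
  using toda_chart[OF forms indep p(1) ns d] by metis
 have c: "toda_local l \<mu> i F1 F2 F3 (modular_w p) = u i p - 2 * ln (cmod (deriv modular_w p))"
  if "p \<in> HH" "modular_w p \<in> U \<inter> - P" for p i
  using chart[OF that(1) _ deriv_modular_w_nonzero[OF that(1)] pos, of i] that by simp
 have v: "v i w = toda_local l \<mu> i F1 F2 F3 w" if "w \<in> U \<inter> - P" for w i unfolding toda_v_def
 proof (rule the_equality)
  show "\<forall>z\<in>HH. modular_w z = w --> toda_local l \<mu> i F1 F2 F3 w = u i z - 2 * ln (cmod (deriv modular_w z))"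
   using c that by auto
  fix t assume t: "\<forall>z\<in>HH. modular_w z = w --> t = u i z - 2 * ln (cmod (deriv modular_w z))"
  obtain p where "p \<in> HH" "modular_w p = w" by (rule modular_w_preimage)
  thus "t = toda_local l \<mu> i F1 F2 F3 w" using t c[of p i] that by auto
 qed
 show ?thesis
  by (rule that[of "U \<inter> - P" F1 F2 F3]) (use U p assms open_compl_P c v in \<open>auto intro: holomorphic_on_subset\<close>)
qed

lemma toda_v_eq: assumes "p \<in> HH" "modular_w p \<notin> P"
 shows "v i (modular_w p) = u i p - 2 * ln (cmod (deriv modular_w p))"
proof (rule toda_v_chart[OF assms(2)])
 fix U F1 F2 F3
 assume U: "modular_w p \<in> U" and v: "!!w i. w \<in> U ==> v i w = toda_local l \<mu> i F1 F2 F3 w"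
  and c: "!!p i. p \<in> HH ==> modular_w p \<in> U ==> toda_local l \<mu> i F1 F2 F3 (modular_w p) = u i p - 2 * ln (cmod (deriv modular_w p))"
 show ?thesis using v[OF U] c[OF assms(1) U] by simp
qed

lemma toda_v_system: shows "C2_on (- P) (v 1)" "C2_on (- P) (v 2)"
  "!!w. w \<notin> P ==> laplacian (v 1) w = - (2 * exp (v 1 w) - exp (v 2 w))"
  "!!w. w \<notin> P ==> laplacian (v 2) w = - (2 * exp (v 2 w) - exp (v 1 w))" proof -
 have loc: "EX U. open U & w \<in> U & U \<subseteq> - P & C2_on U (v 1) & C2_on U (v 2) & laplacian (v 1) w = - (2 * exp (v 1 w) - exp (v 2 w)) &
   laplacian (v 2) w = - (2 * exp (v 2 w) - exp (v 1 w))" if w: "w \<in> - P" for w proof -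
  have "w \<notin> P" using w by simp
  thus ?thesis proof (rule toda_v_chart)
   fix U F1 F2 F3 assume U: "open U" "w \<in> U" "U \<subseteq> - P" "F1 holomorphic_on U" "F2 holomorphic_on U" "F3 holomorphic_on U"
    and W: "!!w. w \<in> U ==> wronskian3 F1 F2 F3 w ~= 0" and v: "!!w i. w \<in> U ==> v i w = toda_local l \<mu> i F1 F2 F3 w"
   have T: "C2_on U (toda_local l \<mu> 1 F1 F2 F3)" "C2_on U (toda_local l \<mu> 2 F1 F2 F3)"
    "laplacian (toda_local l \<mu> 1 F1 F2 F3) w = exp (toda_local l \<mu> 2 F1 F2 F3 w) - 2 * exp (toda_local l \<mu> 1 F1 F2 F3 w)"
    "laplacian (toda_local l \<mu> 2 F1 F2 F3) w = exp (toda_local l \<mu> 1 F1 F2 F3 w) - 2 * exp (toda_local l \<mu> 2 F1 F2 F3 w)"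
    by (rule toda_system_local[OF U(1,4-6) _ pos]; use U(2) W in simp)+
   have C: "C2_on U (v 1)" "C2_on U (v 2)" using C2_on_open_cong(1)[OF U(1) v T(1)] C2_on_open_cong(1)[OF U(1) v T(2)] by auto
   have L: "laplacian (v 1) w = laplacian (toda_local l \<mu> 1 F1 F2 F3) w" "laplacian (v 2) w = laplacian (toda_local l \<mu> 2 F1 F2 F3) w"
    using C2_on_open_cong(2)[OF U(1) v T(1) U(2)] C2_on_open_cong(2)[OF U(1) v T(2) U(2)] by auto
   show ?thesis by (rule exI[of _ U]) (use U C in \<open>simp del: One_nat_def add: L T(3,4) v[OF U(2)]\<close>)
  qed
 qed
 have C2: "C2_on (- P) p" if l: "!!w. w \<in> - P ==> EX U. open U & w \<in> U & U \<subseteq> - P & C2_on U p" for p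
  unfolding C2_on_def proof (intro conjI ballI)
  fix w assume w: "w \<in> - P"
  obtain U where "w \<in> U" "C2_on U p" using l[OF w] by blast
  thus "p differentiable at w" "partial1 p differentiable at w" "partial2 p differentiable at w" using C2_onD by blast+
 next
  have "isCont (partial1 (partial1 p)) w & isCont (partial2 (partial2 p)) w" if w: "w \<in> - P" for w
  proof -
   obtain U where "open U" "w \<in> U" "C2_on U p" using l[OF w] by blast
   thus ?thesis using C2_on_continuous(4,5)[of U p] by (simp add: continuous_on_eq_continuous_at)
  qed
  thus "continuous_on (- P) (partial1 (partial1 p))" "continuous_on (- P) (partial2 (partial2 p))"
   by (auto intro!: continuous_at_imp_continuous_on)
 qed
 show "C2_on (- P) (v 1)" by (rule C2) (use loc in blast)
 show "C2_on (- P) (v 2)" by (rule C2) (use loc in blast)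
 show "laplacian (v 1) w = - (2 * exp (v 1 w) - exp (v 2 w))" if "w \<notin> P" for w using loc[of w] that by auto
 show "laplacian (v 2) w = - (2 * exp (v 2 w) - exp (v 1 w))" if "w \<notin> P" for w using loc[of w] that by auto
qed

lemma toda_u_pole: assumes p: "p \<in> HH" and i: "i \<in> {1, 2}"
 shows "EX L. ((%x. u i x - 2 * sing_m f g h p i * ln (cmod (x - p))) \<longlongrightarrow> L) (at p)" "sing_m f g h p i >= 0"
proof -
 note an = forms_analytic[OF p]
 obtain n1 n2 n3 b1 b2 b3 where ad: "adapted_basis p f g h n1 n2 n3 b1 b2 b3" by (rule adapted_basis_HH[OF p])
 note m = local_exponents_adapted(1,2)[OF ad an]
 have "n1 < n2" "n2 < n3" using ad unfolding adapted_basis_def by auto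
 thus "sing_m f g h p i >= 0" using i m by auto
 have "i = 1 & sing_m f g h p i = real n2 - real n1 - 1 | i = 2 & sing_m f g h p i = real n3 - real n2 - 1"
  using i m by auto
 from toda_local_asymptotics[OF ad an pos this]
 obtain L where L: "((%x. toda_local l \<mu> i f g h x - 2 * sing_m f g h p i * ln (cmod (x - p))) \<longlongrightarrow> L) (at p)" ..
 have "\<forall>\<^sub>F x in at p. f analytic_on {x} & g analytic_on {x} & h analytic_on {x}"
  using an[THEN eventually_analytic] unfolding eventually_at_filter by eventually_elim auto
 with adapted_wronskian_nonzero[OF ad an]
 have "\<forall>\<^sub>F x in at p. toda_local l \<mu> i f g h x - 2 * sing_m f g h p i * ln (cmod (x - p)) = u i x - 2 * sing_m f g h p i * ln (cmod (x - p))"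
 proof eventually_elim
  case (elim x)
  have "u i x = toda_local l \<mu> i f g h x + 2 * ln (cmod (deriv (%x. x) x))"
   by (rule toda_u_covariant[where s = "%_. 1" and v = "%x. x"]) (use elim pos in \<open>auto intro: analytic_intros\<close>)
  thus ?case by simp
 qed
 with L have "((%x. u i x - 2 * sing_m f g h p i * ln (cmod (x - p))) \<longlongrightarrow> L) (at p)" by (rule Lim_transform_eventually)
 thus "EX L. ((%x. u i x - 2 * sing_m f g h p i * ln (cmod (x - p))) \<longlongrightarrow> L) (at p)" ..
qed

text \<open>With ramification \<open>e\<close>, \<open>ln |w - p|\<close> is \<open>e ln |x - a|\<close> and
 \<open>2 ln |w'|\<close> is \<open>2 (e - 1) ln |x - a|\<close>, up to convergent terms. The limit transfers to
 \<open>w\<close> because \<open>w\<close> is an open map.\<close>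

lemma toda_v_pole:
 assumes a: "a \<in> HH" and i: "i \<in> {1, 2}" and e: "e > 0" and r: "r > 0" "ball a r \<subseteq> HH"
  and G: "G holomorphic_on ball a r" "G a ~= 0" and eq: "!!x. x \<in> ball a r ==> modular_w x - modular_w a = (x - a) ^ e * G x"
  and j: "real e * j = 2 * sing_m f g h a i - 2 * (real e - 1)"
 shows "EX L. ((%w. v i w - j * ln (cmod (w - modular_w a))) \<longlongrightarrow> L) (at (modular_w a))" proof -
 define p where "p = modular_w a"
 define m where "m = sing_m f g h a i"
 obtain L where L: "((%x. u i x - 2 * m * ln (cmod (x - a))) \<longlongrightarrow> L) (at a)"
  using toda_u_pole(1)[OF a i] unfolding m_def by blast
 have Gan: "G analytic_on {a}" unfolding analytic_at using G r by (intro exI[of _ "ball a r"]) auto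
 define E where "E = (%x. of_nat e * G x + (x - a) * deriv G x)"
 have Ean: "E analytic_on {a}" unfolding E_def by (intro analytic_intros Gan)
 have E0: "E a ~= 0" using e G by (simp add: E_def)
 have nb: "\<forall>\<^sub>F x in nhds a. x \<in> ball a r" using r by (intro eventually_nhds_in_open) auto
 have fac: "\<forall>\<^sub>F x in nhds a. modular_w x - p = (x - a) ^ e * G x"
  using nb unfolding p_def by eventually_elim (rule eq)
 have wan: "\<forall>\<^sub>F x in nhds a. modular_w analytic_on {x}" by (rule eventually_analytic[OF modular_w_analytic[OF a]])
 have th: "\<forall>\<^sub>F x in nhds a. (x - a) * deriv modular_w x = (x - a) ^ e * E x"
  using theta_factor[OF Gan fac] wan proof eventually_elim
  case (elim x)
  have "deriv (%x. modular_w x - p) x = deriv modular_w x"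
   using analytic_has_derivative[OF elim(2)] by (intro DERIV_imp_deriv) (auto intro!: derivative_eq_intros)
  thus ?case using elim(1) unfolding E_def by simp
 qed
 have Pev: "\<forall>\<^sub>F x in nhds a. x ~= a --> modular_w x \<notin> P" proof -
  have "open (- (P - {p}))" by (intro open_Compl finite_imp_closed finite_Diff finite_P)
  hence "\<forall>\<^sub>F w in nhds p. w \<in> - (P - {p})" by (rule eventually_nhds_in_open) auto
  hence "\<forall>\<^sub>F x in nhds a. modular_w x \<in> - (P - {p})" unfolding p_def by (rule eventually_compose[OF modular_w_analytic[OF a]])
  with fac analytic_eventually_nonzero[OF Gan G(2)] show ?thesis proof eventually_elim
   case (elim x)
   show ?case proof
    assume "x ~= a"
    hence "modular_w x - p ~= 0" unfolding elim(1) using elim(2) by simp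
    thus "modular_w x \<notin> P" using elim(3) by auto
   qed
  qed
 qed
 define T where "T = (%x. (u i x - 2 * m * ln (cmod (x - a))) - 2 * ln (cmod (E x)) - j * ln (cmod (G x)))"
 define L' where "L' = L - 2 * ln (cmod (E a)) - j * ln (cmod (G a))"
 have T: "(T \<longlongrightarrow> L') (at a)" unfolding T_def L'_def
  by (intro tendsto_intros L analytic_tendsto_at Ean Gan) (use E0 G in auto)
 have key: "\<forall>\<^sub>F x in nhds a. x ~= a --> T x = v i (modular_w x) - j * ln (cmod (modular_w x - p))"
  using nb fac th Pev analytic_eventually_nonzero[OF Gan G(2)] analytic_eventually_nonzero[OF Ean E0] proof eventually_elim
  case (elim x)
  show ?case proof
   assume x: "x ~= a"
   have xH: "x \<in> HH" using elim(1) r by auto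
   have P: "modular_w x \<notin> P" using elim x by simp
   define s where "s = cmod (x - a)"
   have s: "s > 0" using x by (simp add: s_def)
   have "s * cmod (deriv modular_w x) = s ^ e * cmod (E x)" using arg_cong[OF elim(3), of cmod] by (simp add: norm_mult norm_power s_def)
   hence "ln (s * cmod (deriv modular_w x)) = ln (s ^ e * cmod (E x))" by simp
   hence d: "ln (cmod (deriv modular_w x)) = real e * ln s - ln s + ln (cmod (E x))"
    using s elim(6) deriv_modular_w_nonzero[OF xH P] by (simp add: ln_mult ln_realpow)
   have "cmod (modular_w x - p) = s ^ e * cmod (G x)" using elim(2) by (simp add: norm_mult norm_power s_def)
   hence w: "ln (cmod (modular_w x - p)) = real e * ln s + ln (cmod (G x))" using s elim(5) by (simp add: ln_mult ln_realpow)
   have "v i (modular_w x) - j * ln (cmod (modular_w x - p)) = u i x - 2 * (real e * ln s - ln s + ln (cmod (E x))) - j * (real e * ln s + ln (cmod (G x)))"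
    unfolding toda_v_eq[OF xH P] d w ..
   also have "... = u i x - (2 * real e - 2 + real e * j) * ln s - 2 * ln (cmod (E x)) - j * ln (cmod (G x))"
    by (simp add: algebra_simps)
   also have "2 * real e - 2 + real e * j = 2 * m" using j unfolding m_def by simp
   finally show "T x = v i (modular_w x) - j * ln (cmod (modular_w x - p))" unfolding T_def s_def by simp
  qed
 qed
 have "((%w. v i w - j * ln (cmod (w - p))) \<longlongrightarrow> L') (at p)" proof (rule tendstoI)
  fix q :: real assume "q > 0"
  hence "\<forall>\<^sub>F x in at a. dist (T x) L' < q" using T by (rule tendstoD[rotated])
  hence "\<forall>\<^sub>F x in nhds a. x ~= a --> dist (T x) L' < q" by (simp add: eventually_at_filter)
  with key nb have "\<forall>\<^sub>F x in nhds a. x \<in> ball a r & (x ~= a --> dist (v i (modular_w x) - j * ln (cmod (modular_w x - p))) L' < q)"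
   by eventually_elim auto
  then obtain B where B: "open B" "a \<in> B" "!!x. x \<in> B ==> x \<in> ball a r & (x ~= a --> dist (v i (modular_w x) - j * ln (cmod (modular_w x - p))) L' < q)"
   unfolding eventually_nhds by blast
  have "open (modular_w ` B)" by (rule modular_w_open[OF B(1)]) (use B(3) r in auto)
  hence "\<forall>\<^sub>F w in nhds p. w \<in> modular_w ` B" by (rule eventually_nhds_in_open) (use B(2) in \<open>auto simp: p_def\<close>)
  hence "\<forall>\<^sub>F w in nhds p. w ~= p --> dist (v i w - j * ln (cmod (w - p))) L' < q"
   by eventually_elim (use B(3) in \<open>auto simp: p_def\<close>)
  thus "\<forall>\<^sub>F w in at p. dist (v i w - j * ln (cmod (w - p))) L' < q" by (simp add: eventually_at_filter)
 qed
 thus ?thesis unfolding p_def by blast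
qed

text \<open>The coefficient of \<open>ln |w - p|\<close> in \<open>v i\<close>. The inverse recovers the
 representative \<open>z j\<close> from its image.\<close>

definition weight :: "nat => complex => real" where
 "weight i p = (if p = 1 then sing_m f g h \<i> i - 1 else if p = 0 then 2 * ((sing_m f g h rho i - 2) / 3)
   else 2 * sing_m f g h (z (inv_into {1..n} (%j. modular_w (z j)) p)) i)"

lemma reps_HH: "j \<in> {1..n} ==> z j \<in> HH" using reps unfolding singular_representatives_def by blast

lemma reps_inj: "inj_on (%j. modular_w (z j)) {1..n}" proof (rule inj_onI)
 fix i j assume ij: "i \<in> {1..n}" "j \<in> {1..n}" "modular_w (z i) = modular_w (z j)"
 hence "SL2Z_equiv (z i) (z j)" by (intro modular_w_inj reps_HH)
 thus "i = j" using reps ij unfolding singular_representatives_def by blast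
qed

lemma reps_not_elliptic: assumes "j \<in> {1..n}" shows "modular_w (z j) ~= 0" "modular_w (z j) ~= 1" proof -
 have "~ SL2Z_equiv (z j) \<i>" "~ SL2Z_equiv (z j) rho" using reps assms unfolding singular_representatives_def by auto
 thus "modular_w (z j) ~= 0" "modular_w (z j) ~= 1"
  using modular_w_inj[OF reps_HH[OF assms] rho_in_HH] modular_w_inj[OF reps_HH[OF assms] i_in_HH] modular_w_i modular_w_rho by auto
qed

lemma weight_rep: "j \<in> {1..n} ==> weight i (modular_w (z j)) = 2 * sing_m f g h (z j) i"
 using reps_not_elliptic[of j] inv_into_f_f[OF reps_inj, of j] by (simp add: weight_def)

lemma sum_P: "(\<Sum>p\<in>P. q p) = q 1 + q 0 + (\<Sum>j=1..n. q (modular_w (z j)))" for q :: "complex => real" proof -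
 have "(\<Sum>p\<in>P. q p) = (\<Sum>p\<in>{0, 1}. q p) + (\<Sum>p\<in>(%j. modular_w (z j)) ` {1..n}. q p)"
  unfolding P_def by (rule sum.union_disjoint) (use reps_not_elliptic in fastforce)+
 also have "(\<Sum>p\<in>(%j. modular_w (z j)) ` {1..n}. q p) = (\<Sum>j=1..n. q (modular_w (z j)))"
  by (subst sum.reindex[OF reps_inj]) (simp add: o_def)
 finally show ?thesis by simp
qed

text \<open>The bound \<open>- 2\<close> is what makes \<open>exp (v i)\<close> locally integrable; it holds
 because the numbers \<open>m\<close> are nonnegative.\<close>

lemma toda_v_weight: assumes i: "i \<in> {1, 2}" and p: "p \<in> P"
 shows "EX L. ((%w. v i w - weight i p * ln (cmod (w - p))) \<longlongrightarrow> L) (at p)" "weight i p > - 2" proof -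
 consider "p = 1" | "p = 0" | j where "j \<in> {1..n}" "p = modular_w (z j)" using p unfolding P_def by auto
 hence "(EX L. ((%w. v i w - weight i p * ln (cmod (w - p))) \<longlongrightarrow> L) (at p)) & weight i p > - 2"
 proof cases
  case 1
  obtain r G where G: "r > 0" "ball \<i> r \<subseteq> HH" "G holomorphic_on ball \<i> r" "G \<i> ~= 0"
   "!!x. x \<in> ball \<i> r ==> modular_w x - 1 = (x - \<i>) ^ 2 * G x" using modular_w_factor_i by metis
  have "EX L. ((%w. v i w - weight i p * ln (cmod (w - modular_w \<i>))) \<longlongrightarrow> L) (at (modular_w \<i>))"
   by (rule toda_v_pole[OF i_in_HH i _ G(1-4), of 2]) (use 1 G(5) in \<open>auto simp: modular_w_i weight_def\<close>)
  thus ?thesis using 1 toda_u_pole(2)[OF i_in_HH i] by (simp add: modular_w_i weight_def)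
 next
  case 2
  obtain r G where G: "r > 0" "ball rho r \<subseteq> HH" "G holomorphic_on ball rho r" "G rho ~= 0"
   "!!x. x \<in> ball rho r ==> modular_w x - 0 = (x - rho) ^ 3 * G x" using modular_w_factor_rho by metis
  have "EX L. ((%w. v i w - weight i p * ln (cmod (w - modular_w rho))) \<longlongrightarrow> L) (at (modular_w rho))"
   by (rule toda_v_pole[OF rho_in_HH i _ G(1-4), of 3]) (use 2 G(5) in \<open>auto simp: modular_w_rho weight_def\<close>)
  thus ?thesis using 2 toda_u_pole(2)[OF rho_in_HH i] by (simp add: modular_w_rho weight_def)
 next
  case 3
  note zj = reps_HH[OF 3(1)]
  have "deriv modular_w (z j) ~= 0" using deriv_modular_w_zero[OF zj] reps_not_elliptic[OF 3(1)] by auto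
  from modular_w_factor_regular[OF zj this]
  obtain r G where G: "r > 0" "ball (z j) r \<subseteq> HH" "G holomorphic_on ball (z j) r" "G (z j) ~= 0"
   "!!x. x \<in> ball (z j) r ==> modular_w x - modular_w (z j) = (x - z j) ^ 1 * G x" by metis
  have "EX L. ((%w. v i w - weight i p * ln (cmod (w - modular_w (z j)))) \<longlongrightarrow> L) (at (modular_w (z j)))"
   by (rule toda_v_pole[OF zj i _ G(1-5)]) (use 3 in \<open>auto simp: weight_rep\<close>)
  thus ?thesis using 3 toda_u_pole(2)[OF zj i] by (simp add: weight_rep)
 qed
 thus "EX L. ((%w. v i w - weight i p * ln (cmod (w - p))) \<longlongrightarrow> L) (at p)" "weight i p > - 2" by auto
qed

lemma exp_toda_v_bound: assumes i: "i \<in> {1, 2}" and p: "p \<in> P"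
 obtains C where "C > 0" "\<forall>\<^sub>F w in at p. exp (v i w) <= C * cmod (w - p) powr weight i p" proof -
 obtain L where L: "((%w. v i w - weight i p * ln (cmod (w - p))) \<longlongrightarrow> L) (at p)" using toda_v_weight(1)[OF assms] by blast
 have "\<forall>\<^sub>F w in at p. v i w - weight i p * ln (cmod (w - p)) < L + 1" by (rule order_tendstoD(2)[OF L]) simp
 moreover have "\<forall>\<^sub>F w in at p. w ~= p" by (simp add: eventually_at_filter)
 ultimately have "\<forall>\<^sub>F w in at p. exp (v i w) <= exp (L + 1) * cmod (w - p) powr weight i p" proof eventually_elim
  case (elim w)
  have "exp (v i w) <= exp (L + 1 + weight i p * ln (cmod (w - p)))" using elim by simp
  also have "... = exp (L + 1) * cmod (w - p) powr weight i p" using elim(2) by (simp add: exp_add powr_def)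
  finally show ?case .
 qed
 thus ?thesis by (rule that[rotated]) simp
qed

lemma nonlinearity_locally_integrable: assumes i: "i \<in> {1, 2}" "j \<in> {1, 2}"
 shows "locally_integrable (%w. 2 * exp (v i w) - exp (v j w))" proof (rule locally_integrable_isolated[OF finite_P])
 have "continuous_on (- P) (v 1)" "continuous_on (- P) (v 2)" using toda_v_system(1,2) by (auto intro: C2_on_continuous(1))
 hence "continuous_on (- P) (v m)" if "m \<in> {1, 2}" for m using that by auto
 thus "continuous_on (- P) (%w. 2 * exp (v i w) - exp (v j w))" using i by (intro continuous_intros)
 fix p assume p: "p \<in> P"
 obtain C1 where C1: "C1 > 0" "\<forall>\<^sub>F w in at p. exp (v i w) <= C1 * cmod (w - p) powr weight i p" by (rule exp_toda_v_bound[OF i(1) p])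
 obtain C2 where C2: "C2 > 0" "\<forall>\<^sub>F w in at p. exp (v j w) <= C2 * cmod (w - p) powr weight j p" by (rule exp_toda_v_bound[OF i(2) p])
 define a where "a = min (weight i p) (weight j p)"
 have "\<forall>\<^sub>F w in at p. w \<in> ball p 1 - {p}" by (rule eventually_at_in_open) auto
 with C1(2) C2(2) have "\<forall>\<^sub>F w in at p. \<bar>2 * exp (v i w) - exp (v j w)\<bar> <= (2 * C1 + C2) * cmod (w - p) powr a"
 proof eventually_elim
  case (elim w)
  define s where "s = cmod (w - p)"
  have s: "0 < s" "s <= 1" using elim(3) by (auto simp: s_def dist_norm norm_minus_commute)
  have "s powr weight i p <= s powr a" "s powr weight j p <= s powr a" using s by (auto simp: a_def intro!: powr_mono')
  hence "C1 * s powr weight i p <= C1 * s powr a" "C2 * s powr weight j p <= C2 * s powr a" using C1 C2 by simp_all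
  hence "exp (v i w) <= C1 * s powr a" "exp (v j w) <= C2 * s powr a" using elim(1,2) by (simp_all add: s_def)
  moreover have "exp (v i w) > 0" "exp (v j w) > 0" by simp_all
  ultimately have "abs (2 * exp (v i w) - exp (v j w)) <= 2 * (C1 * s powr a) + C2 * s powr a" by linarith
  thus ?case by (simp add: s_def algebra_simps)
 qed
 moreover have "a > - 2" using toda_v_weight(2)[OF i(1) p] toda_v_weight(2)[OF i(2) p] by (simp add: a_def)
 ultimately show "EX C a. a > - 2 & (\<forall>\<^sub>F w in at p. \<bar>2 * exp (v i w) - exp (v j w)\<bar> <= C * cmod (w - p) powr a)" by blast
qed

lemma toda_v_distribution: assumes "i = 1 & j = 2 | i = 2 & j = 1"
 shows "laplacian_plus_eq (v i) (%w. 2 * exp (v i w) - exp (v j w))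
  (%q. 4 * pi * ((sing_m f g h \<i> i - 1) / 2) * dirac 1 q + 4 * pi * ((sing_m f g h rho i - 2) / 3) * dirac 0 q
    + 4 * pi * (\<Sum>m = 1..n. sing_m f g h (z m) i * dirac (modular_w (z m)) q))" proof -
 have ij: "i \<in> {1, 2}" "j \<in> {1, 2}" using assms by auto
 have "C2_on (- P) (v i)" using assms toda_v_system(1,2) by auto
 moreover have "laplacian (v i) w = - (2 * exp (v i w) - exp (v j w))" if "w \<notin> P" for w
  using assms toda_v_system(3,4)[OF that] by auto
 ultimately have "laplacian_plus_eq (v i) (%w. 2 * exp (v i w) - exp (v j w)) (%q. 2 * pi * (\<Sum>p\<in>P. weight i p * q p))"
  by (intro laplacian_plus_eq_log_poles finite_P nonlinearity_locally_integrable ij toda_v_weight(1))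
 also have "(%q. 2 * pi * (\<Sum>p\<in>P. weight i p * q p)) = (%q. 4 * pi * ((sing_m f g h \<i> i - 1) / 2) * dirac 1 q
    + 4 * pi * ((sing_m f g h rho i - 2) / 3) * dirac 0 q
    + 4 * pi * (\<Sum>m = 1..n. sing_m f g h (z m) i * dirac (modular_w (z m)) q))" proof
  fix q :: "complex => real"
  have "(\<Sum>m=1..n. weight i (modular_w (z m)) * q (modular_w (z m))) = 2 * (\<Sum>m=1..n. sing_m f g h (z m) i * q (modular_w (z m)))"
   unfolding sum_distrib_left by (rule sum.cong) (auto simp: weight_rep)
  hence "2 * pi * (\<Sum>p\<in>P. weight i p * q p) = 2 * pi * (weight i 1 * q 1 + weight i 0 * q 0 + 2 * (\<Sum>m=1..n. sing_m f g h (z m) i * q (modular_w (z m))))"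
   unfolding sum_P by simp
  also have "... = 4 * pi * ((sing_m f g h \<i> i - 1) / 2) * q 1
    + 4 * pi * ((sing_m f g h rho i - 2) / 3) * q 0 + 4 * pi * (\<Sum>m = 1..n. sing_m f g h (z m) i * q (modular_w (z m)))"
   by (simp add: weight_def field_simps)
  finally show "2 * pi * (\<Sum>p\<in>P. weight i p * q p) = 4 * pi * ((sing_m f g h \<i> i - 1) / 2) * dirac 1 q
    + 4 * pi * ((sing_m f g h rho i - 2) / 3) * dirac 0 q
    + 4 * pi * (\<Sum>m = 1..n. sing_m f g h (z m) i * dirac (modular_w (z m)) q)" unfolding dirac_def .
 qed
 finally show ?thesis .
qed

text \<open>Write \<open>w = H q / q\<close>. The logarithms of \<open>|q|\<close> add up to \<open>2 (m -
 1)\<close> from the forms, 2 from \<open>dq/dz\<close> and 2 from \<open>dw/dz\<close>, that is \<open>2 (m +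
 1) ln |q|\<close>, and \<open>ln |q|\<close> is \<open>- ln |w|\<close> up to a convergent term.\<close>

lemma toda_v_cusp: assumes i: "i \<in> {1, 2}"
 shows "EX L. ((%d. v i (modular_w d) + 2 * (cusp_m f g h i + 1) * ln (cmod (modular_w d))) \<longlongrightarrow> L) to_cusp"
proof -
 obtain G1 G2 G3 where q: "q_expansion f G1" "q_expansion g G2" "q_expansion h G3" using forms[THEN modular_formD(3)] by blast
 have an: "G1 analytic_on {0}" "G2 analytic_on {0}" "G3 analytic_on {0}"
  using q unfolding q_expansion_def analytic_at by (auto intro!: exI[of _ "ball 0 1"])
 obtain n1 n2 n3 b1 b2 b3 where ad: "adapted_basis 0 G1 G2 G3 n1 n2 n3 b1 b2 b3"
  by (rule adapted_basis_exists[OF an germ_indep_cusp[OF q indep]])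
 define m where "m = cusp_m f g h i"
 have "i = 1 & m - 1 = real n2 - real n1 - 1 | i = 2 & m - 1 = real n3 - real n2 - 1"
  using i cusp_exponents_adapted[OF ad q] by (auto simp: m_def)
 from toda_local_asymptotics[OF ad an pos this]
 obtain L where L: "((%x. toda_local l \<mu> i G1 G2 G3 x - 2 * (m - 1) * ln (cmod (x - 0))) \<longlongrightarrow> L) (at 0)" ..
 obtain H where H: "H holomorphic_on ball 0 1" "H 0 ~= 0" "!!z. z \<in> HH ==> modular_w z = H (nome z) / nome z"
  using modular_w_cusp by metis
 have Han: "H analytic_on {0}" unfolding analytic_at using H by (intro exI[of _ "ball 0 1"]) auto
 \<comment> \<open>\<open>K q / q\<close> is \<open>q\<close> times the derivative of \<open>H q / q\<close>\<close>
 define K where "K = (%q. q * deriv H q - H q)"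
 have Kan: "K analytic_on {0}" unfolding K_def by (intro analytic_intros Han)
 have K0: "K 0 ~= 0" using H by (simp add: K_def)
 define T where "T = (%q. toda_local l \<mu> i G1 G2 G3 q - 2 * (m - 1) * ln (cmod (q - 0)) - 2 * ln (cmod (K q)) + 2 * (m + 1) * ln (cmod (H q)))"
 have "(T \<longlongrightarrow> L - 2 * ln (cmod (K 0)) + 2 * (m + 1) * ln (cmod (H 0))) (at 0)"
  unfolding T_def by (intro tendsto_intros L analytic_tendsto_at Han Kan) (use K0 H in auto)
 note TL = filterlim_compose[OF this nome_at_0]
 have nome0: "filterlim nome (nhds 0) to_cusp" using nome_at_0 by (rule filterlim_mono) (auto simp: at_within_le_nhds)
 obtain R where R: "!!p. p \<in> P ==> cmod p <= R" using finite_imp_bounded[OF finite_P] unfolding bounded_iff by blast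
 obtain Y where Y: "!!d. Im d > Y ==> cmod (modular_w d) > R" using modular_w_large[of R] by metis
 have nP: "\<forall>\<^sub>F d in to_cusp. modular_w d \<notin> P" unfolding eventually_to_cusp using R Y by (intro exI[of _ Y]) force
 have "\<forall>\<^sub>F q in at 0. wronskian3 G1 G2 G3 q ~= 0 & G1 analytic_on {q} & G2 analytic_on {q} & G3 analytic_on {q}"
 proof -
  have "\<forall>\<^sub>F q in at 0. G1 analytic_on {q} & G2 analytic_on {q} & G3 analytic_on {q}"
   using an[THEN eventually_analytic] unfolding eventually_at_filter by eventually_elim auto
  with adapted_wronskian_nonzero[OF ad an] show ?thesis by eventually_elim simp
 qed
 note W = eventually_compose_filterlim[OF this nome_at_0]
 have "\<forall>\<^sub>F d in to_cusp. T (nome d) + - 0 = v i (modular_w d) + 2 * (m + 1) * ln (cmod (modular_w d))"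
  using W nP eventually_to_cusp_HH
   eventually_compose_filterlim[OF analytic_eventually_nonzero[OF Han H(2)] nome0]
   eventually_compose_filterlim[OF analytic_eventually_nonzero[OF Kan K0] nome0]
   eventually_compose_filterlim[OF eventually_analytic[OF Han] nome0] proof eventually_elim
  case (elim d)
  define q where "q = nome d"
  have nan: "nome analytic_on {d}" using nome_holomorphic[of UNIV] by (auto simp: analytic_at)
  define c where "c = 2 * of_real pi * \<i>"
  have dn: "deriv nome d = c * q" by (simp add: deriv_nome c_def q_def)
  have nHH: "\<forall>\<^sub>F y in nhds d. y \<in> HH" by (rule eventually_nhds_in_open[OF open_HH elim(3)])
  have fG: "\<forall>\<^sub>F y in nhds d. a y = 1 * G (nome y)" if "q_expansion a G" for a G
   using nHH by eventually_elim (use that in \<open>auto simp: q_expansion_def\<close>)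
  have u: "u i d = toda_local l \<mu> i G1 G2 G3 q + 2 * ln (cmod (deriv nome d))"
   unfolding q_def by (rule toda_u_covariant[where s = "%_. 1" and v = nome])
    (use elim nan pos fG q in \<open>auto intro: analytic_intros simp: deriv_nome\<close>)
  have w: "modular_w d = H q / q" using H(3)[OF elim(3)] by (simp add: q_def)
  have "\<forall>\<^sub>F y in nhds d. modular_w y = H (nome y) / nome y" using nHH by eventually_elim (rule H(3))
  from deriv_germ(2)[OF this] have "deriv modular_w d = deriv (%y. H (nome y) / nome y) d" .
  also have "... = ((deriv H q * (c * q)) * q - H q * (c * q)) / (q * q)" unfolding q_def c_def
   by (intro DERIV_imp_deriv DERIV_divide DERIV_chain2[OF _ nome_has_field_derivative] nome_has_field_derivative nome_nonzero
     analytic_has_derivative elim(6))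
  also have "... = c * K q / q" unfolding K_def by (simp add: q_def field_simps)
  finally have dw: "deriv modular_w d = c * K q / q" .
  have q0: "cmod q > 0" "cmod c > 0" by (simp_all add: q_def c_def)
  have nz: "cmod (K q) > 0" "cmod (H q) > 0" using elim(4,5) by (simp_all add: q_def)
  have 1: "ln (cmod (deriv nome d)) = ln (cmod c) + ln (cmod q)" unfolding dn norm_mult using q0 by (simp add: ln_mult)
  have 2: "ln (cmod (deriv modular_w d)) = ln (cmod c) + ln (cmod (K q)) - ln (cmod q)"
   unfolding dw norm_mult norm_divide using q0 nz by (simp add: ln_mult ln_div)
  have 3: "ln (cmod (modular_w d)) = ln (cmod (H q)) - ln (cmod q)" unfolding w norm_divide using q0 nz by (simp add: ln_div)
  show ?case unfolding toda_v_eq[OF elim(3,2)] u 1 2 3 T_def q_def[symmetric] by (simp add: algebra_simps)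
 qed
 hence "\<forall>\<^sub>F d in to_cusp. T (nome d) = v i (modular_w d) + 2 * (m + 1) * ln (cmod (modular_w d))" by simp
 with TL show ?thesis unfolding m_def by (intro exI) (rule Lim_transform_eventually)
qed

lemma toda_v_infinity: assumes i: "i \<in> {1, 2}"
 shows "(%w. v i w - (- 2 * (cusp_m f g h i + 1) * ln (cmod w))) \<in> O[at_infinity](%_. 1)" proof -
 define D where "D = (%w. v i w + 2 * (cusp_m f g h i + 1) * ln (cmod w))"
 obtain L where L: "((%p. D (modular_w p)) \<longlongrightarrow> L) to_cusp" using toda_v_cusp[OF i] unfolding D_def by blast
 hence "\<forall>\<^sub>F p in to_cusp. dist (D (modular_w p)) L < 1" by (rule tendstoD) simp
 then obtain Y where Y: "!!p. Im p > Y ==> dist (D (modular_w p)) L < 1" unfolding eventually_to_cusp by blast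
 obtain B where B: "!!p. p \<in> HH ==> cmod (modular_w p) > B ==> EX p'. SL2Z_equiv p p' & p' \<in> HH & Im p' > Y"
  using modular_w_large_imp_near_cusp[of Y] by metis
 have "abs (D w) <= abs L + 1" if w: "cmod w > B" for w proof -
  obtain p where p: "p \<in> HH" "modular_w p = w" by (rule modular_w_preimage)
  obtain p' where p': "SL2Z_equiv p p'" "Im p' > Y" using B[OF p(1)] w p(2) by auto
  have w': "modular_w p' = w" using modular_w_invariant[OF p(1) p'(1)] p(2) by simp
  hence "abs (D w - L) < 1" using Y[OF p'(2)] w' by (simp add: dist_real_def)
  thus ?thesis by linarith
 qed
 hence "\<forall>\<^sub>F w in at_infinity. norm (D w) <= (abs L + 1) * norm (1::real)"
  unfolding eventually_at_infinity by (intro exI[of _ "B + 1"]) auto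
 hence "D \<in> O[at_infinity](%_. 1)" by (rule bigoI)
 moreover have "(%w. v i w - (- 2 * (cusp_m f g h i + 1) * ln (cmod w))) = D"
  unfolding D_def by (intro ext) (simp add: algebra_simps)
 ultimately show ?thesis by simp
qed

end

theorem theorem4p6:
  fixes f g h :: "complex \<Rightarrow> complex" and k :: int and n :: nat and z :: "nat \<Rightarrow> complex"
  assumes "modular_form k f" and "modular_form k g" and "modular_form k h"
    and "lin_indep3 f g h"
    and "singular_representatives f g h n z"
  shows "\<forall>l \<mu> :: real. l > 0 \<longrightarrow> \<mu> > 0 \<longrightarrow>
    (\<forall>i\<in>{1, 2}. \<forall>\<zeta>\<in>upper_half_plane.
        modular_w \<zeta> \<notin> {0, 1} \<union> (\<lambda>j. modular_w (z j)) ` {1..n} \<longrightarrow>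
        toda_v f g h l \<mu> i (modular_w \<zeta>) =
          toda_u f g h l \<mu> i \<zeta> - 2 * ln (cmod (deriv modular_w \<zeta>))) \<and>
    laplacian_plus_eq (toda_v f g h l \<mu> 1)
      (\<lambda>w. 2 * exp (toda_v f g h l \<mu> 1 w) - exp (toda_v f g h l \<mu> 2 w))
      (\<lambda>\<phi>. 4 * pi * ((sing_m f g h \<i> 1 - 1) / 2) * dirac 1 \<phi>
         + 4 * pi * ((sing_m f g h rho 1 - 2) / 3) * dirac 0 \<phi>
         + 4 * pi * (\<Sum>j = 1..n. sing_m f g h (z j) 1 * dirac (modular_w (z j)) \<phi>)) \<and>
    laplacian_plus_eq (toda_v f g h l \<mu> 2)
      (\<lambda>w. 2 * exp (toda_v f g h l \<mu> 2 w) - exp (toda_v f g h l \<mu> 1 w))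
      (\<lambda>\<phi>. 4 * pi * ((sing_m f g h \<i> 2 - 1) / 2) * dirac 1 \<phi>
         + 4 * pi * ((sing_m f g h rho 2 - 2) / 3) * dirac 0 \<phi>
         + 4 * pi * (\<Sum>j = 1..n. sing_m f g h (z j) 2 * dirac (modular_w (z j)) \<phi>)) \<and>
    (\<forall>i\<in>{1, 2}. (\<lambda>w. toda_v f g h l \<mu> i w
        - (- 2 * (cusp_m f g h i + 1) * ln (cmod w))) \<in> O[at_infinity](\<lambda>_. 1))" proof (intro allI impI, goal_cases)
 case (1 l \<mu>)
 then interpret modular_toda f g h k n z l \<mu> by (intro modular_toda.intro assms)
 show ?case
 proof (intro conjI ballI impI)
  fix i \<zeta> assume "\<zeta> \<in> HH" "modular_w \<zeta> \<notin> {0, 1} \<union> (\<lambda>j. modular_w (z j)) ` {1..n}"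
  thus "v i (modular_w \<zeta>) = u i \<zeta> - 2 * ln (cmod (deriv modular_w \<zeta>))" unfolding P_def[symmetric] by (rule toda_v_eq)
 qed (rule toda_v_distribution toda_v_infinity; simp)+
qed

end
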